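(* Let $\varepsilon = 1 + \beta i$, with $\beta$ a non-zero real number, and let $Q$ be a non-trivial divisible subgroup of $(\mathbb{R},+)$ of finite rank. Let \[ G = \exp(\varepsilon \mathbb{R} + Q). \] Assume the Schanuel Conjecture for raising to powers in $K$ (SC$_K$) for $K = \mathbb{Q}(\beta i)$. Then: \begin{enumerate} \item For every tuple $c \subset \mathbb{C}^*$, there exists a tuple $c' \subset \mathbb{C}^*$ extending $c$, such that $c'$ is strong with respect to the predimension function $(\delta_G)_{c'}$. If $c \subset G$, then we can find such a $c'$ also contained in $G$. \item The structure $(\mathbb{C}^*,G)$ has the EC-property. Therefore, for every tuple $c \subset G$, strong with respect to $(\delta_G)_c$, the structure $(\mathbb{C}^*,G)_{X_0}$ is a model of the theory $T_{X_0}$, where $X_0 = \operatorname{span}(c)$ with the structure induced from $(\mathbb{C}^*,G)$. \end{enumerate}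
   Context: Setting: the multiplicative group $\mathbb{G}_m$ (over $k_0=\mathbb{Q}$), written multiplicatively, with $A=\mathbb{C}^*$. $\operatorname{lin.d.}$ denotes multiplicative (i.e. $\mathbb{Z}$-linear) rank modulo torsion, and $\operatorname{span}(Y)$ is the set of elements of $\mathbb{C}^*$ some nonzero power of which lies in the subgroup generated by $Y$ (i.e. the preimage of the $\mathbb{Q}$-span of the image of $Y$ in $\mathbb{C}^*/\operatorname{Tor}(\mathbb{C}^* )$). The language $L$ has an $n$-ary predicate for each subvariety of $(\mathbb{G}_m)^n$ defined over $k_0$, plus a unary predicate for $G$. Predimension: for finite-dimensional $\operatorname{span}$-closed $X$, $\delta_G(X) = 2\operatorname{tr.d.}(X) - \operatorname{lin.d.}(X\cap G)$; its localisation at a $\operatorname{span}$-closed $Y$ is $\delta_G(X/Y) = 2\operatorname{tr.d.}(X/Y) - \operatorname{lin.d.}((X\cdot Y)\cap G / Y\cap G)$, and $(\delta_G)_c$ denotes localisation at $\operatorname{span}(c)$. A set $Y$ is strong (for a predimension $\delta$) if $\delta(X/\operatorname{span}(Y)) \ge 0$ for every finite-dimensional $\operatorname{span}$-closed $X$. SC$_K$ (for a subfield $K\subseteq\mathbb{C}$ of finite transcendence degree): for every tuple $x\subset\mathbb{C}$, $\operatorname{lin.d.}_K(x) + \operatorname{tr.d.}(\exp(x)) - \operatorname{lin.d.}_{\mathbb{Q}}(x) \ge -\operatorname{tr.d.}(K)$ (a consequence of Schanuel's conjecture). An irreducible subvariety $W\subseteq(\mathbb{C}^* )^n$ is rotund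 if for every $k\times n$ integer matrix $M$ of rank $k$, the image of $W$ under $y\mapsto y^M$ has dimension at least $k/2$. The structure $(A,G)$ has the EC-property if for every even $n\ge 1$ and every rotund subvariety $W\subseteq A^n$ of dimension $n/2$, $W\cap G^n$ is Zariski dense in $W$. $T_{X_0}$ (a theory of green points): given a finite-dimensional $\operatorname{span}$-closed substructure $X_0$, the complete theory in $L$ expanded by constants for $X_0$ whose models are exactly the structures $(K^*,G')$, $K$ an algebraically closed field of characteristic $0$ and $G'$ a divisible subgroup, in which the constants give a strong embedding of $X_0$ and which have the EC-property. *)

theory Defs
  imports
    Complex_Main
    "HOL-Library.Poly_Mapping"
    "HOL-Library.Extended_Nat"
    "HOL-Library.FuncSet"
    "HOL-Library.Sublist"
    "HOL-Computational_Algebra.Fundamental_Theorem_Algebra"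
    "Jordan_Normal_Form.DL_Rank"
begin

section \<open>Independence and rank\<close>

text \<open>
  The cardinality of a maximal independent subset of \<open>X\<close>. In all uses below \<open>I\<close> is the
  independence predicate of a matroid, so the choice does not matter, and \<open>X\<close> has finite rank.
\<close>

definition indep_rank :: "('a set \<Rightarrow> bool) \<Rightarrow> 'a set \<Rightarrow> nat" where
  "indep_rank I X = card (SOME B. B \<subseteq> X \<and> I B \<and> (\<forall>x\<in>X - B. \<not> I (insert x B)))"

text \<open>Linear independence with coefficients in a subset \<open>F\<close> of the ambient field.\<close>

definition lin_indep :: "'k::field set \<Rightarrow> 'k set \<Rightarrow> bool" where
  "lin_indep F B \<longleftrightarrow>
     (\<forall>S u. finite S \<and> S \<subseteq> B \<and> (\<forall>b\<in>S. u b \<in> F) \<and> (\<Sum>b\<in>S. u b * b) = 0 \<longrightarrow> (\<forall>b\<in>S. u b = 0))"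

definition lin_dim :: "'k::field set \<Rightarrow> 'k set \<Rightarrow> nat" where
  "lin_dim F X = indep_rank (lin_indep F) X"

definition add_subgroup :: "real set \<Rightarrow> bool" where
  "add_subgroup H \<longleftrightarrow> 0 \<in> H \<and> (\<forall>x\<in>H. \<forall>y\<in>H. x - y \<in> H)"

definition add_divisible :: "real set \<Rightarrow> bool" where
  "add_divisible H \<longleftrightarrow> (\<forall>x\<in>H. \<forall>m::nat. m > 0 \<longrightarrow> (\<exists>y\<in>H. of_nat m * y = x))"

definition finite_rank :: "real set \<Rightarrow> bool" where
  "finite_rank H \<longleftrightarrow> (\<exists>N. \<forall>B. B \<subseteq> H \<and> finite B \<and> lin_indep \<int> B \<longrightarrow> card B \<le> N)"


section \<open>Polynomials and transcendence degree\<close>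

text \<open>
  Polynomials in variables from \<open>'v\<close>: a monomial is a finitely supported exponent vector, a
  polynomial a finitely supported coefficient function on monomials. The argument \<open>h\<close> maps the
  coefficients into the field in which the polynomial is evaluated.
\<close>

type_synonym ('v, 'c) mpoly = "('v \<Rightarrow>\<^sub>0 nat) \<Rightarrow>\<^sub>0 'c"

definition mpoly_eval :: "('c::zero \<Rightarrow> 'k::field) \<Rightarrow> ('v, 'c) mpoly \<Rightarrow> ('v \<Rightarrow> 'k) \<Rightarrow> 'k" where
  "mpoly_eval h p x =
     (\<Sum>m\<in>Poly_Mapping.keys p. h (Poly_Mapping.lookup p m) *
        (\<Prod>i\<in>Poly_Mapping.keys m. x i ^ Poly_Mapping.lookup m i))"

definition mpoly_vars :: "('v, 'c::zero) mpoly \<Rightarrow> 'v set" where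
  "mpoly_vars p = (\<Union>m\<in>Poly_Mapping.keys p. Poly_Mapping.keys m)"

definition is_subfield :: "'k::field set \<Rightarrow> bool" where
  "is_subfield F \<longleftrightarrow> 0 \<in> F \<and> 1 \<in> F \<and>
     (\<forall>x\<in>F. \<forall>y\<in>F. x - y \<in> F \<and> x * y \<in> F) \<and> (\<forall>x\<in>F. inverse x \<in> F)"

definition gen_field :: "'k::field set \<Rightarrow> 'k set" where
  "gen_field X = \<Inter>{F. is_subfield F \<and> X \<subseteq> F}"

text \<open>The elements of \<open>S\<close> serve as their own names for the variables.\<close>

definition alg_indep :: "'k::field set \<Rightarrow> 'k set \<Rightarrow> bool" where
  "alg_indep F S \<longleftrightarrow>
     (\<forall>p :: ('k, 'k) mpoly. range (Poly_Mapping.lookup p) \<subseteq> F \<and> mpoly_vars p \<subseteq> S \<and>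
        mpoly_eval id p id = 0 \<longrightarrow> p = 0)"

definition trdeg_over :: "'k::field set \<Rightarrow> 'k set \<Rightarrow> nat" where
  "trdeg_over X Y = indep_rank (alg_indep (gen_field Y)) (gen_field (X \<union> Y))"

abbreviation trdeg :: "'k::field set \<Rightarrow> nat" where
  "trdeg X \<equiv> trdeg_over X {}"


section \<open>Schanuel's conjecture for raising to powers\<close>

definition SC :: "complex set \<Rightarrow> bool" where
  "SC K \<longleftrightarrow> (\<forall>x :: complex list.
     int (lin_dim K (set x)) + int (trdeg (exp ` set x)) - int (lin_dim \<rat> (set x))
       \<ge> - int (trdeg K))"


section \<open>The multiplicative group\<close>

definition mult_group :: "'k::field set" where
  "mult_group = UNIV - {0}"

definition mult_subgroup :: "'k::field set \<Rightarrow> bool" where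
  "mult_subgroup H \<longleftrightarrow> H \<subseteq> mult_group \<and> 1 \<in> H \<and> (\<forall>x\<in>H. \<forall>y\<in>H. x / y \<in> H)"

definition mult_divisible :: "'k::field set \<Rightarrow> bool" where
  "mult_divisible H \<longleftrightarrow> (\<forall>x\<in>H. \<forall>m::nat. m > 0 \<longrightarrow> (\<exists>y\<in>H. y ^ m = x))"

definition mgen :: "'k::field set \<Rightarrow> 'k set" where
  "mgen Y = {\<Prod>y\<in>S. y powi e y | S e. finite S \<and> S \<subseteq> Y}"

definition mspan :: "'k::field set \<Rightarrow> 'k set" where
  "mspan Y = {x \<in> mult_group. \<exists>m::int. m \<noteq> 0 \<and> x powi m \<in> mgen Y}"

definition mspan_closed :: "'k::field set \<Rightarrow> bool" where
  "mspan_closed X \<longleftrightarrow> X \<subseteq> mult_group \<and> mspan X = X"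

definition mfinite_dim :: "'k::field set \<Rightarrow> bool" where
  "mfinite_dim X \<longleftrightarrow> (\<exists>S. finite S \<and> S \<subseteq> X \<and> X \<subseteq> mspan S)"

text \<open>Working modulo \<open>mspan Y\<close> rather than \<open>mgen Y\<close> kills torsion.\<close>

definition mult_indep :: "'k::field set \<Rightarrow> 'k set \<Rightarrow> bool" where
  "mult_indep Y B \<longleftrightarrow>
     (\<forall>S (e :: 'k \<Rightarrow> int). finite S \<and> S \<subseteq> B \<and> (\<Prod>b\<in>S. b powi e b) \<in> mspan Y \<longrightarrow> (\<forall>b\<in>S. e b = 0))"

definition mult_rank_over :: "'k::field set \<Rightarrow> 'k set \<Rightarrow> nat" where
  "mult_rank_over X Y = indep_rank (mult_indep Y) X"


section \<open>Predimensions\<close>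

text \<open>
  A predimension is represented by its relative form \<open>d X Y\<close>, standing for the value at \<open>X\<close>
  over the span-closed set \<open>Y\<close>.
\<close>

definition delta :: "'k::field set \<Rightarrow> 'k set \<Rightarrow> 'k set \<Rightarrow> int" where
  "delta G X Y = 2 * int (trdeg_over X Y)
     - int (mult_rank_over ({x * y | x y. x \<in> X \<and> y \<in> Y} \<inter> G) (Y \<inter> G))"

definition localise :: "('k::field set \<Rightarrow> 'k set \<Rightarrow> int) \<Rightarrow> 'k set \<Rightarrow> 'k set \<Rightarrow> 'k set \<Rightarrow> int" where
  "localise d C X Y = d X (mspan (Y \<union> C))"

definition strong :: "('k::field set \<Rightarrow> 'k set \<Rightarrow> int) \<Rightarrow> 'k set \<Rightarrow> bool" where
  "strong d Y \<longleftrightarrow> (\<forall>X. mspan_closed X \<and> mfinite_dim X \<longrightarrow> d X (mspan Y) \<ge> 0)"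


section \<open>Subvarieties of the torus\<close>

text \<open>Points of an \<open>n\<close>-fold product are extensional functions on \<open>{..<n}\<close>.\<close>

definition tuples :: "nat \<Rightarrow> 'k set \<Rightarrow> (nat \<Rightarrow> 'k) set" where
  "tuples n H = {..<n} \<rightarrow>\<^sub>E H"

definition zariski_closed :: "nat \<Rightarrow> (nat \<Rightarrow> 'k::field) set \<Rightarrow> bool" where
  "zariski_closed n V \<longleftrightarrow> (\<exists>P :: (nat, 'k) mpoly set. (\<forall>p\<in>P. mpoly_vars p \<subseteq> {..<n}) \<and>
     V = {x \<in> tuples n mult_group. \<forall>p\<in>P. mpoly_eval id p x = 0})"

definition zariski_closure :: "nat \<Rightarrow> (nat \<Rightarrow> 'k::field) set \<Rightarrow> (nat \<Rightarrow> 'k) set" where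
  "zariski_closure n S = \<Inter>{V. zariski_closed n V \<and> S \<subseteq> V}"

definition irreducible_subvariety :: "nat \<Rightarrow> (nat \<Rightarrow> 'k::field) set \<Rightarrow> bool" where
  "irreducible_subvariety n V \<longleftrightarrow> zariski_closed n V \<and> V \<noteq> {} \<and>
     (\<forall>V1 V2. zariski_closed n V1 \<and> zariski_closed n V2 \<and> V = V1 \<union> V2 \<longrightarrow> V = V1 \<or> V = V2)"

text \<open>The dimension of a constructible set is the Krull dimension of its Zariski closure.\<close>

definition variety_dim :: "nat \<Rightarrow> (nat \<Rightarrow> 'k::field) set \<Rightarrow> enat" where
  "variety_dim n S = (SUP d \<in> {d :: nat. \<exists>Z :: nat \<Rightarrow> (nat \<Rightarrow> 'k) set.
      (\<forall>i\<le>d. irreducible_subvariety n (Z i) \<and> Z i \<subseteq> zariski_closure n S) \<and>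
      (\<forall>i<d. Z i \<subset> Z (Suc i))}. enat d)"

definition matrix_power :: "int mat \<Rightarrow> (nat \<Rightarrow> 'k::field) \<Rightarrow> (nat \<Rightarrow> 'k)" where
  "matrix_power M y = (\<lambda>i\<in>{..<dim_row M}. \<Prod>j<dim_col M. y j powi (M $$ (i, j)))"

definition rotund :: "nat \<Rightarrow> (nat \<Rightarrow> 'k::field) set \<Rightarrow> bool" where
  "rotund n W \<longleftrightarrow> irreducible_subvariety n W \<and>
     (\<forall>k. \<forall>M \<in> carrier_mat k n. vec_space.rank k (map_mat rat_of_int M) = k \<longrightarrow>
        2 * variety_dim k (matrix_power M ` W) \<ge> enat k)"

definition EC_property :: "'k::field set \<Rightarrow> bool" where
  "EC_property G \<longleftrightarrow> (\<forall>n W. n \<ge> 1 \<and> even n \<and> rotund n W \<and> 2 * variety_dim n W = enat n \<longrightarrow>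
     W \<subseteq> zariski_closure n (W \<inter> tuples n G))"


section \<open>The first-order language and the theories of green points\<close>

text \<open>
  A subvariety of the \<open>n\<close>-dimensional torus over the rationals is named by a finite list of defining
  equations in the variables \<open>{..<n}\<close>; several names may denote the same subvariety. The arity is
  the length of the argument list. Constants are drawn from \<open>'c\<close>.
\<close>

datatype 'c green_term = Var nat | Const 'c

datatype 'c green_fm =
    Eq "'c green_term" "'c green_term"
  | InVariety "(nat, rat) mpoly list" "'c green_term list"
  | Green "'c green_term"
  | Neg "'c green_fm"
  | Conj "'c green_fm" "'c green_fm"
  | Forall nat "'c green_fm"

text \<open>
  Satisfaction in the structure on the multiplicative group of \<open>'k\<close> with green subgroup \<open>G\<close>,
  constants interpreted by \<open>f\<close> and variables by \<open>e\<close>.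
\<close>

primrec term_val :: "('c \<Rightarrow> 'k) \<Rightarrow> (nat \<Rightarrow> 'k) \<Rightarrow> 'c green_term \<Rightarrow> 'k" where
  "term_val f e (Var i) = e i"
| "term_val f e (Const c) = f c"

primrec sat :: "'k::field_char_0 set \<Rightarrow> ('c \<Rightarrow> 'k) \<Rightarrow> (nat \<Rightarrow> 'k) \<Rightarrow> 'c green_fm \<Rightarrow> bool" where
  "sat G f e (Eq s t) \<longleftrightarrow> term_val f e s = term_val f e t"
| "sat G f e (InVariety ps ts) \<longleftrightarrow>
     (\<forall>p\<in>set ps. mpoly_eval of_rat p (\<lambda>i. term_val f e (ts ! i)) = 0)"
| "sat G f e (Green t) \<longleftrightarrow> term_val f e t \<in> G"
| "sat G f e (Neg \<phi>) \<longleftrightarrow> \<not> sat G f e \<phi>"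
| "sat G f e (Conj \<phi> \<psi>) \<longleftrightarrow> sat G f e \<phi> \<and> sat G f e \<psi>"
| "sat G f e (Forall i \<phi>) \<longleftrightarrow> (\<forall>a\<in>mult_group. sat G f (e(i := a)) \<phi>)"

primrec term_ok :: "'c set \<Rightarrow> nat set \<Rightarrow> 'c green_term \<Rightarrow> bool" where
  "term_ok C V (Var i) \<longleftrightarrow> i \<in> V"
| "term_ok C V (Const c) \<longleftrightarrow> c \<in> C"

text \<open>Well-formed formulas with constants in \<open>C\<close> and free variables in \<open>V\<close>.\<close>

primrec fm_ok :: "'c set \<Rightarrow> nat set \<Rightarrow> 'c green_fm \<Rightarrow> bool" where
  "fm_ok C V (Eq s t) \<longleftrightarrow> term_ok C V s \<and> term_ok C V t"
| "fm_ok C V (InVariety ps ts) \<longleftrightarrow>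
     (\<forall>p\<in>set ps. mpoly_vars p \<subseteq> {..<length ts}) \<and> (\<forall>t\<in>set ts. term_ok C V t)"
| "fm_ok C V (Green t) \<longleftrightarrow> term_ok C V t"
| "fm_ok C V (Neg \<phi>) \<longleftrightarrow> fm_ok C V \<phi>"
| "fm_ok C V (Conj \<phi> \<psi>) \<longleftrightarrow> fm_ok C V \<phi> \<and> fm_ok C V \<psi>"
| "fm_ok C V (Forall i \<phi>) \<longleftrightarrow> fm_ok C (insert i V) \<phi>"

abbreviation sentence :: "'c set \<Rightarrow> 'c green_fm \<Rightarrow> bool" where
  "sentence C \<phi> \<equiv> fm_ok C {} \<phi>"

text \<open>
  \<open>X0\<close> with green part \<open>G0\<close> is embedded by \<open>f\<close> in the structure on the multiplicative group
  of \<open>'k\<close> with green subgroup \<open>G\<close>: \<open>f\<close> is injective and preserves and reflects all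
  predicates of the language.
\<close>

definition L_embedding ::
  "'c::field_char_0 set \<Rightarrow> 'c set \<Rightarrow> 'k::field_char_0 set \<Rightarrow> ('c \<Rightarrow> 'k) \<Rightarrow> bool" where
  "L_embedding X0 G0 G f \<longleftrightarrow> f ` X0 \<subseteq> mult_group \<and> inj_on f X0 \<and>
     (\<forall>x\<in>X0. f x \<in> G \<longleftrightarrow> x \<in> G0) \<and>
     (\<forall>n (p :: (nat, rat) mpoly). mpoly_vars p \<subseteq> {..<n} \<longrightarrow>
        (\<forall>x\<in>tuples n X0. mpoly_eval of_rat p (\<lambda>i. f (x i)) = 0 \<longleftrightarrow> mpoly_eval of_rat p x = 0))"

text \<open>
  The structures that are, by definition, exactly the models of the theory of green points over
  \<open>(X0, G0)\<close>. The field is the type \<open>'k\<close>.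
\<close>

definition green_model ::
  "'c::field_char_0 set \<Rightarrow> 'c set \<Rightarrow> 'k::{alg_closed_field, field_char_0} set \<Rightarrow> ('c \<Rightarrow> 'k) \<Rightarrow> bool" where
  "green_model X0 G0 G f \<longleftrightarrow>
     mult_subgroup G \<and> mult_divisible G \<and>
     L_embedding X0 G0 G f \<and> strong (delta G) (f ` X0) \<and>
     EC_property G"

text \<open>
  The theory itself, as the set of sentences true in all these structures. It suffices to let the
  field range over copies of the complex numbers: the class is elementary in a countable language,
  so each of its members is elementarily equivalent to one of cardinality the continuum.
\<close>

definition green_theory :: "complex set \<Rightarrow> complex set \<Rightarrow> complex green_fm set" where
  "green_theory X0 G0 = {\<phi>. sentence X0 \<phi> \<and>
     (\<forall>(G :: complex set) f. green_model X0 G0 G f \<longrightarrow> (\<forall>e. sat G f e \<phi>))}"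

definition satisfies_theory ::
  "'k::field_char_0 set \<Rightarrow> ('c \<Rightarrow> 'k) \<Rightarrow> 'c green_fm set \<Rightarrow> bool" where
  "satisfies_theory G f T \<longleftrightarrow> (\<forall>\<phi>\<in>T. \<forall>e. sat G f e \<phi>)"

end

theory Submission
  imports Defs "HOL-Analysis.Continuum_Not_Denumerable"
begin

text \<open>
  Transcendence degree is handled through derivations: \<open>a\<close> is algebraic over the field generated by
  \<open>S\<close> iff every derivation killing \<open>S\<close> kills \<open>a\<close>.

  Part 1. For multiplicatively independent green \<open>g = exp (\<epsilon> t + q)\<close>, apply the conjecture to the
  logarithms of \<open>g\<close> together with their complex conjugates. All of these lie in the space over
  \<open>\<rat>(\<beta>i)\<close> spanned by the \<open>t\<close> and a basis of \<open>Q\<close>, which has about half as many dimensions as there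
  are rationally independent logarithms. This bounds \<open>card g - 2 tr.d. g\<close>, and a tuple extending
  \<open>c\<close> that minimises the predimension is strong.

  Part 2. Let \<open>W\<close> be rotund and \<open>w\<close> a point of \<open>W\<close>, generic over a countable conjugation-closed set
  \<open>K\<close> of coefficients and algebraically free from its conjugate over \<open>K\<close>. By a form of Ax's theorem
  the logarithmic derivatives of \<open>w\<close> satisfy no nontrivial linear relation with real coefficients.
  Hence, in real coordinates \<open>t\<close> with \<open>x = exp (\<epsilon> t + q)\<close>, a triangular system of equations for
  \<open>W\<close> at \<open>w\<close> is a submersion, uniformly for all real \<open>q\<close> near those of \<open>w\<close>. Choosing \<open>q\<close> in the
  dense group \<open>Q\<close> and solving by Newton iteration gives green points of \<open>W\<close> arbitrarily close to \<open>w\<close>.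
\<close>

section \<open>Pregeometries\<close>

text \<open>Conjugates double the number of logarithms while the span over the field generated by
  \<beta>i barely grows: for m real parts independent modulo Q the conjecture reads 2m - (m + r)
  \<le> 2 tr.d. + 1, with r a bound on the rank of Q. The factor 2 of the predimension matches
  exactly this. The obstacle in the second half is that Ax's theorem wants coefficients that are
  constants of the derivations involved, whereas the coefficients met here are arbitrary reals. A
  relation for \<open>w\<close> with real coefficients passes to the products
  \<open>w i * cnj (w i)\<close>, and a shortest relation among these has coefficients algebraic
  over the products, hence constant for every derivation over \<open>K\<close> that kills the
  products. Rotundity enters once for \<open>w\<close> and once for its conjugate: two ranks of at
  least n/2 leave n products no room for dependence. A countable \<open>K\<close> keeps generic
  points available inside the complex numbers. Membership in \<open>W\<close> is traded for a
  triangular system because the gradients of such a system are visibly independent.\<close>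

locale pregeometry =
  fixes cl :: "'a set \<Rightarrow> 'a set"
  assumes cl_ext: "A \<subseteq> cl A"
    and cl_mono: "A \<subseteq> B \<Longrightarrow> cl A \<subseteq> cl B"
    and cl_idem: "cl (cl A) \<subseteq> cl A"
    and cl_exchange: "y \<in> cl (insert x A) \<Longrightarrow> y \<notin> cl A \<Longrightarrow> x \<in> cl (insert y A)"
begin

definition indep :: "'a set \<Rightarrow> bool" where
  "indep B \<longleftrightarrow> (\<forall>b\<in>B. b \<notin> cl (B - {b}))"

lemma indep_subset: "indep B \<Longrightarrow> A \<subseteq> B \<Longrightarrow> indep A"
  unfolding indep_def by (meson Diff_mono cl_mono order_refl subsetD)

lemma cl_leI: "A \<subseteq> cl B \<Longrightarrow> cl A \<subseteq> cl B"
  using cl_mono[of A "cl B"] cl_idem[of B] by blast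

lemma indep_insert:
  assumes "indep B" "x \<notin> cl B"
  shows "indep (insert x B)"
  unfolding indep_def
proof
  fix b assume b: "b \<in> insert x B"
  have xB: "x \<notin> B" using assms(2) cl_ext[of B] by blast
  show "b \<notin> cl (insert x B - {b})"
  proof (cases "b = x")
    case True
    then show ?thesis using assms(2) xB by simp
  next
    case False
    then have bB: "b \<in> B" using b by simp
    have eq: "insert x B - {b} = insert x (B - {b})" using False by auto
    show ?thesis
    proof
      assume "b \<in> cl (insert x B - {b})"
      then have "x \<in> cl (insert b (B - {b}))"
        using cl_exchange[of b x "B - {b}"] assms(1) bB unfolding eq indep_def by blast
      then show False using assms(2) bB by (simp add: insert_absorb)
    qed
  qed
qed

text \<open>Elements of \<open>B\<close> outside \<open>S\<close> are traded one at a time for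
  elements of \<open>S\<close>. Each trade keeps the size and the independence of \<open>B\<close>
  and lowers \<open>card (S - B)\<close>; once \<open>B\<close> lies inside \<open>S\<close> the
  bound is clear.\<close>

lemma steinitz_finite:
  assumes "finite S" "finite B" "indep B" "B \<subseteq> cl S"
  shows "card B \<le> card S"
  using assms(2-)
proof (induction "card (S - B)" arbitrary: B rule: less_induct)
  case less
  show ?case
  proof (cases "B \<subseteq> S")
    case True
    then show ?thesis using assms(1) card_mono by blast
  next
    case False
    then obtain b where b: "b \<in> B" "b \<notin> S" by blast
    let ?B = "B - {b}"
    have nb: "b \<notin> cl ?B" using less.prems(2) b(1) unfolding indep_def by simp
    have "\<not> S \<subseteq> cl ?B"
    proof
      assume "S \<subseteq> cl ?B"
      then have "cl S \<subseteq> cl ?B" by (rule cl_leI)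
      then show False using nb b(1) less.prems(3) by (meson subsetD)
    qed
    then obtain s where s: "s \<in> S" "s \<notin> cl ?B" by (meson subsetI)
    then have sB: "s \<notin> B" using cl_ext[of ?B] b by (metis Diff_iff singletonD subsetD)
    have "indep (insert s ?B)"
      using s(2) less.prems(2) indep_subset[of B ?B] indep_insert[of ?B s] by blast
    moreover have "insert s ?B \<subseteq> cl S" using less.prems(3) s(1) cl_ext[of S] by auto
    moreover have "card (S - insert s ?B) < card (S - B)"
      using assms(1) s(1) sB b by (intro psubset_card_mono) auto
    ultimately have "card (insert s ?B) \<le> card S"
      using less.hyps less.prems(1) by blast
    then show ?thesis using less.prems(1) b sB by (simp add: card_Suc_Diff1)
  qed
qed

lemma steinitz:
  assumes "finite S" "indep B" "B \<subseteq> cl S"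
  shows "finite B \<and> card B \<le> card S"
proof -
  have "finite B"
  proof (rule ccontr)
    assume "infinite B"
    then obtain T where T: "T \<subseteq> B" "finite T" "card T = Suc (card S)"
      using infinite_arbitrarily_large by blast
    then show False
      using steinitz_finite[OF assms(1) T(2)] indep_subset[OF assms(2) T(1)] assms(3) by auto
  qed
  then show ?thesis using steinitz_finite assms by blast
qed

text \<open>Steinitz bounds the size of every independent subset of \<open>X\<close>, so one of
  greatest size exists; any point outside its closure could still be added.\<close>

lemma extend_to_basis:
  assumes "finite S" "X \<subseteq> cl S" "B0 \<subseteq> X" "indep B0"
  obtains B where "B0 \<subseteq> B" "B \<subseteq> X" "finite B" "indep B" "X \<subseteq> cl B"
proof -
  let ?P = "\<lambda>B. B0 \<subseteq> B \<and> B \<subseteq> X \<and> indep B"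
  have bd: "finite B \<and> card B \<le> card S" if "?P B" for B
    using steinitz[OF assms(1), of B] assms(2) that by auto
  have "?P B0" using assms by simp
  moreover have "\<forall>B. ?P B \<longrightarrow> card B < Suc (card S)" using bd by (simp add: less_Suc_eq_le)
  ultimately have "\<exists>B. ?P B \<and> (\<forall>C. ?P C \<longrightarrow> card C \<le> card B)"
    by (rule ex_has_greatest_nat[of ?P B0 card "Suc (card S)"])
  then obtain B where B: "?P B" "\<And>C. ?P C \<Longrightarrow> card C \<le> card B" by (elim exE conjE) simp
  have fin: "finite B" using bd B(1) by simp
  have "X \<subseteq> cl B"
  proof
    fix x assume x: "x \<in> X"
    show "x \<in> cl B"
    proof (rule ccontr)
      assume n: "x \<notin> cl B"
      then have "?P (insert x B)" using indep_insert B(1) x by auto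
      then have "card (insert x B) \<le> card B" using B(2) by blast
      moreover have "x \<notin> B" using n cl_ext[of B] by blast
      ultimately show False using fin by simp
    qed
  qed
  then show ?thesis using that B(1) fin by blast
qed

lemma indep_empty: "indep {}"
  unfolding indep_def by simp

definition rk :: "'a set \<Rightarrow> nat" where
  "rk X = indep_rank indep X"

text \<open>Ties the arbitrary choice inside \<open>indep_rank\<close> to a basis of the
  pregeometry. \<open>I\<close> is compared with \<open>indep\<close> on finite sets only, which is
  the form in which algebraic independence will be available; heredity of \<open>I\<close> then
  excludes an infinite choice.\<close>

lemma indep_rank_eq:
  assumes I: "\<And>B. finite B \<Longrightarrow> B \<subseteq> X \<Longrightarrow> I B \<longleftrightarrow> indep B"
    and down: "\<And>A B. I B \<Longrightarrow> A \<subseteq> B \<Longrightarrow> I A"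
    and B: "B \<subseteq> X" "finite B" "indep B" "X \<subseteq> cl B"
  shows "indep_rank I X = card B"
proof -
  let ?P = "\<lambda>B. B \<subseteq> X \<and> I B \<and> (\<forall>x\<in>X - B. \<not> I (insert x B))"
  have "?P B"
  proof (intro conjI ballI)
    show "I B" using I B by blast
    fix x assume x: "x \<in> X - B"
    have "\<not> indep (insert x B)"
      unfolding indep_def using x B(4) by (metis DiffD1 DiffD2 Diff_insert_absorb insertI1 subsetD)
    then show "\<not> I (insert x B)" using I[of "insert x B"] x B by simp
  qed (rule B)
  then have P: "?P (SOME B. ?P B)" by (rule someI)
  define C where "C = (SOME B. ?P B)"
  have C: "C \<subseteq> X" "I C" "\<And>x. x \<in> X - C \<Longrightarrow> \<not> I (insert x C)" using P unfolding C_def by auto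
  have finC: "finite C"
  proof (rule ccontr)
    assume "infinite C"
    then obtain T where T: "T \<subseteq> C" "finite T" "card T = Suc (card B)"
      using infinite_arbitrarily_large by blast
    then have "indep T" using I[of T] down[OF C(2)] C(1) by blast
    then show False
      using steinitz_finite[OF B(2) T(2)] T C(1) B(4) by auto
  qed
  then have indC: "indep C" using I C by blast
  have "X \<subseteq> cl C"
  proof
    fix x assume x: "x \<in> X"
    show "x \<in> cl C"
    proof (rule ccontr)
      assume n: "x \<notin> cl C"
      then have "indep (insert x C)" using indep_insert indC by blast
      then have "I (insert x C)" using I[of "insert x C"] x C(1) finC by simp
      then show False using C(3)[of x] x n cl_ext[of C] by blast
    qed
  qed
  then have "card B \<le> card C" using steinitz_finite[OF finC B(2,3)] B(1) by auto
  moreover have "card C \<le> card B" using steinitz_finite[OF B(2) finC indC] C(1) B(4) by auto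
  ultimately show ?thesis unfolding indep_rank_def C_def by simp
qed

lemma rk_eq: "B \<subseteq> X \<Longrightarrow> finite B \<Longrightarrow> indep B \<Longrightarrow> X \<subseteq> cl B \<Longrightarrow> rk X = card B"
  unfolding rk_def by (rule indep_rank_eq) (auto intro: indep_subset)

lemma rk_basis:
  assumes "finite S" "X \<subseteq> cl S"
  obtains B where "B \<subseteq> X" "finite B" "indep B" "X \<subseteq> cl B" "card B = rk X"
  using extend_to_basis[OF assms, of "{}"] indep_empty rk_eq by (metis empty_subsetI)

lemma rk_le_card: "finite S \<Longrightarrow> X \<subseteq> cl S \<Longrightarrow> rk X \<le> card S"
  by (metis rk_basis steinitz order_trans)

lemma indep_le_rk:
  assumes "finite S" "X \<subseteq> cl S" "indep B" "B \<subseteq> X"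
  shows "finite B \<and> card B \<le> rk X"
  using rk_basis[OF assms(1,2)] steinitz assms(3,4) by (metis order_trans)

lemma rk_mono:
  assumes "finite S" "X \<subseteq> cl S" "Y \<subseteq> cl X"
  shows "rk Y \<le> rk X"
proof -
  obtain B where "B \<subseteq> X" "finite B" "indep B" "X \<subseteq> cl B" "card B = rk X"
    using rk_basis[OF assms(1,2)] .
  then show ?thesis using rk_le_card[of B Y] cl_leI[of X B] assms(3) by auto
qed

text \<open>A dependent spanning set could be shortened by one element and would still have to
  accommodate \<open>B\<close>.\<close>

lemma indep_if_spanning:
  assumes fin: "finite S" and "indep B" "B \<subseteq> cl S" "card S \<le> card B"
  shows "indep S"
proof (rule ccontr)
  assume "\<not> indep S"
  then obtain s where s: "s \<in> S" "s \<in> cl (S - {s})" unfolding indep_def by blast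
  have "S \<subseteq> cl (S - {s})" using s cl_ext[of "S - {s}"] by blast
  then have "B \<subseteq> cl (S - {s})" using cl_leI[of S "S - {s}"] assms(3) by blast
  then have "card B \<le> card (S - {s})" using steinitz[of "S - {s}" B] fin assms(2) by simp
  then have "card B \<le> card S - 1" using s(1) by simp
  moreover have "card S > 0" using s(1) fin card_gt_0_iff by blast
  ultimately show False using assms(4) by linarith
qed

end


section \<open>Dual numbers and derivations\<close>

text \<open>Numbers x + y e with e squared equal to 0. A map d is a derivation exactly when x
  \<mapsto> x + d(x) e is a ring homomorphism, so extending derivations becomes enlarging
  subrings.\<close>

datatype 'a dual = Dual (re: 'a) (eps: 'a)

instantiation dual :: (comm_ring_1) comm_ring_1
begin
definition "0 = Dual 0 0"
definition "1 = Dual 1 0"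
definition "x + y = Dual (re x + re y) (eps x + eps y)"
definition "x - y = Dual (re x - re y) (eps x - eps y)"
definition "- x = Dual (- re x) (- eps x)"
definition "x * y = Dual (re x * re y) (re x * eps y + eps x * re y)"
instance
  by standard (auto simp: zero_dual_def one_dual_def plus_dual_def minus_dual_def uminus_dual_def
      times_dual_def algebra_simps)
end

lemma dual_simps [simp]:
  "re 0 = 0" "eps 0 = 0" "re 1 = 1" "eps 1 = 0"
  "re (x + y) = re x + re y" "eps (x + y) = eps x + eps y"
  "re (x - y) = re x - re y" "eps (x - y) = eps x - eps y"
  "re (- x) = - re x" "eps (- x) = - eps x"
  "re (x * y) = re x * re y" "eps (x * y) = re x * eps y + eps x * re y"
  by (simp_all add: zero_dual_def one_dual_def plus_dual_def minus_dual_def uminus_dual_def times_dual_def)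

lemma dual_eq_iff: "x = y \<longleftrightarrow> re x = re y \<and> eps x = eps y"
  by (cases x; cases y) simp

lemma re_power [simp]: "re (x ^ k) = re x ^ k"
  by (induction k) auto

lemma map_poly_re_coeff [simp]: "coeff (map_poly re P) i = re (coeff P i)"
  by (simp add: coeff_map_poly)

lemma map_poly_eps_coeff [simp]: "coeff (map_poly eps P) i = eps (coeff P i)"
  by (simp add: coeff_map_poly)

lemma degree_map_poly_le_re: "degree (map_poly re P) \<le> degree P"
  by (rule degree_le) (simp add: coeff_eq_0)

lemma re_poly: "re (poly P z) = poly (map_poly re P) (re z)"
  by (induction P) (auto simp: map_poly_pCons)

text \<open>First-order Taylor expansion: one term differentiates the coefficients, the other the
  argument.\<close>

lemma eps_poly:
  "eps (poly P z) = poly (map_poly eps P) (re z) + poly (pderiv (map_poly re P)) (re z) * eps z"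
  by (induction P) (auto simp: map_poly_pCons pderiv_pCons re_poly algebra_simps)

section \<open>Subrings, subfields and polynomials with coefficients in them\<close>

definition coeffs_in :: "'a::zero poly \<Rightarrow> 'a set \<Rightarrow> bool" where
  "coeffs_in p F \<longleftrightarrow> (\<forall>i. coeff p i \<in> F)"

definition is_subring :: "'a::comm_ring_1 set \<Rightarrow> bool" where
  "is_subring R \<longleftrightarrow> 1 \<in> R \<and> (\<forall>x\<in>R. \<forall>y\<in>R. x - y \<in> R \<and> x * y \<in> R)"

lemma is_subringD:
  assumes "is_subring R"
  shows "0 \<in> R" "1 \<in> R" "x \<in> R \<Longrightarrow> y \<in> R \<Longrightarrow> x - y \<in> R" "x \<in> R \<Longrightarrow> - x \<in> R"
    "x \<in> R \<Longrightarrow> y \<in> R \<Longrightarrow> x + y \<in> R" "x \<in> R \<Longrightarrow> y \<in> R \<Longrightarrow> x * y \<in> R"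
proof -
  show z: "0 \<in> R" using assms unfolding is_subring_def by (metis diff_self)
  show "1 \<in> R" "x \<in> R \<Longrightarrow> y \<in> R \<Longrightarrow> x - y \<in> R" "x \<in> R \<Longrightarrow> y \<in> R \<Longrightarrow> x * y \<in> R" for x y
    using assms unfolding is_subring_def by auto
  show m: "x \<in> R \<Longrightarrow> - x \<in> R" for x
    using assms z unfolding is_subring_def by (metis diff_0)
  show "x \<in> R \<Longrightarrow> y \<in> R \<Longrightarrow> x + y \<in> R" for x y
    using assms m unfolding is_subring_def by (metis diff_minus_eq_add)
qed

lemma is_subring_sum:
  "is_subring R \<Longrightarrow> (\<And>i. i \<in> A \<Longrightarrow> f i \<in> R) \<Longrightarrow> sum f A \<in> R"
  by (induction A rule: infinite_finite_induct) (auto simp: is_subringD)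

lemma is_subring_prod:
  "is_subring R \<Longrightarrow> (\<And>i. i \<in> A \<Longrightarrow> f i \<in> R) \<Longrightarrow> prod f A \<in> R"
  by (induction A rule: infinite_finite_induct) (auto simp: is_subringD)

lemma is_subring_power: "is_subring R \<Longrightarrow> x \<in> R \<Longrightarrow> x ^ k \<in> R"
  by (induction k) (auto simp: is_subringD)

lemma is_subring_of_nat: "is_subring R \<Longrightarrow> of_nat k \<in> R"
  by (induction k) (auto simp: is_subringD)

lemma is_subring_of_int: "is_subring R \<Longrightarrow> of_int k \<in> R"
  by (cases k) (auto simp: is_subring_of_nat is_subringD(4) simp del: of_nat_Suc)

lemma coeffs_in_ring:
  assumes R: "is_subring R"
  shows "coeffs_in 0 R" "coeffs_in 1 R"
    "coeffs_in p R \<Longrightarrow> coeffs_in q R \<Longrightarrow> coeffs_in (p + q) R"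
    "coeffs_in p R \<Longrightarrow> coeffs_in q R \<Longrightarrow> coeffs_in (p - q) R"
    "coeffs_in p R \<Longrightarrow> coeffs_in q R \<Longrightarrow> coeffs_in (p * q) R"
    "c \<in> R \<Longrightarrow> coeffs_in p R \<Longrightarrow> coeffs_in (Polynomial.smult c p) R"
    "c \<in> R \<Longrightarrow> coeffs_in (monom c k) R"
    "c \<in> R \<Longrightarrow> coeffs_in [:c:] R"
  using is_subringD[OF R]
  by (auto simp: coeffs_in_def coeff_mult coeff_pCons split: nat.split intro!: is_subring_sum[OF R])

lemma coeffs_in_pderiv:
  fixes p :: "'a::idom poly"
  assumes R: "is_subring R" and p: "coeffs_in p R"
  shows "coeffs_in (pderiv p) R"
  unfolding coeffs_in_def coeff_pderiv
  using p is_subringD(6)[OF R] is_subring_of_nat[OF R] unfolding coeffs_in_def by blast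

lemma poly_in_subring:
  assumes "is_subring R" "coeffs_in p R" "x \<in> R"
  shows "poly p x \<in> R"
  unfolding poly_altdef using assms
  by (intro is_subring_sum is_subringD(6) is_subring_power) (auto simp: coeffs_in_def)

lemma is_subring_poly_image:
  assumes R: "is_subring R"
  shows "is_subring {poly P z | P. coeffs_in P R}"
  unfolding is_subring_def
proof (intro conjI ballI)
  show "1 \<in> {poly P z | P. coeffs_in P R}"
    using coeffs_in_ring(2)[OF R] poly_1 by (metis (mono_tags, lifting) mem_Collect_eq)
next
  fix x y assume "x \<in> {poly P z | P. coeffs_in P R}" "y \<in> {poly P z | P. coeffs_in P R}"
  then obtain P Q where "x = poly P z" "y = poly Q z" "coeffs_in P R" "coeffs_in Q R" by blast
  then show "x - y \<in> {poly P z | P. coeffs_in P R}" "x * y \<in> {poly P z | P. coeffs_in P R}"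
    using coeffs_in_ring(4,5)[OF R, of P Q] poly_diff[of P Q z] poly_mult[of P Q z]
    by (metis (mono_tags, lifting) mem_Collect_eq)+
qed

lemma is_subfield_subring: "is_subfield F \<Longrightarrow> is_subring F"
  unfolding is_subfield_def is_subring_def by blast

lemma is_subfield_inverse: "is_subfield F \<Longrightarrow> x \<in> F \<Longrightarrow> inverse x \<in> F"
  unfolding is_subfield_def by blast

lemma is_subfield_divide: "is_subfield F \<Longrightarrow> x \<in> F \<Longrightarrow> y \<in> F \<Longrightarrow> x / y \<in> F"
  unfolding is_subfield_def divide_inverse by blast

lemma is_subfield_gen: "is_subfield (gen_field X)"
  unfolding gen_field_def is_subfield_def by blast

lemma gen_field_ext: "X \<subseteq> gen_field X"
  unfolding gen_field_def by blast

lemma gen_field_least: "is_subfield F \<Longrightarrow> X \<subseteq> F \<Longrightarrow> gen_field X \<subseteq> F"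
  unfolding gen_field_def by blast

lemma gen_field_mono: "X \<subseteq> Y \<Longrightarrow> gen_field X \<subseteq> gen_field Y"
  unfolding gen_field_def by blast

definition Der :: "'k::field set \<Rightarrow> ('k \<Rightarrow> 'k) set" where
  "Der S = {d. (\<forall>x y. d (x + y) = d x + d y) \<and> (\<forall>x y. d (x * y) = x * d y + d x * y) \<and> (\<forall>s\<in>S. d s = 0)}"

text \<open>Relative algebraic closure in characteristic 0, see \<open>dcl_iff_alg_over\<close>. In
  this form, closure under field operations and the exchange property are linear algebra on
  derivations, without resultants or symmetric functions.\<close>

definition dcl :: "'k::field set \<Rightarrow> 'k set" where
  "dcl S = {a. \<forall>d\<in>Der S. d a = 0}"

definition alg_over :: "'k::field set \<Rightarrow> 'k \<Rightarrow> bool" where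
  "alg_over F a \<longleftrightarrow> (\<exists>p. p \<noteq> 0 \<and> coeffs_in p F \<and> poly p a = 0)"

text \<open>Graphs of derivations on a subring, as subrings of the dual numbers.\<close>

definition der_graph :: "'k::field dual set \<Rightarrow> bool" where
  "der_graph g \<longleftrightarrow> is_subring g \<and> (\<forall>z\<in>g. re z = 0 \<longrightarrow> eps z = 0)"

lemma der_graph_eqI: "der_graph g \<Longrightarrow> x \<in> g \<Longrightarrow> y \<in> g \<Longrightarrow> re x = re y \<Longrightarrow> x = y"
  unfolding der_graph_def
  by (metis dual_simps(7,8) dual_eq_iff eq_iff_diff_eq_0 is_subringD(3))

lemma der_graph_adjoin:
  assumes "der_graph g" "\<And>P. coeffs_in P g \<Longrightarrow> re (poly P z) = 0 \<Longrightarrow> eps (poly P z) = 0"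
  shows "der_graph {poly P z | P. coeffs_in P g}"
  using assms is_subring_poly_image unfolding der_graph_def by blast

lemma subset_poly_image: "is_subring g \<Longrightarrow> g \<subseteq> {poly P z | P. coeffs_in P g}"
proof
  fix x assume "is_subring g" "x \<in> g"
  then have "coeffs_in [:x:] g" "poly [:x:] z = x" by (auto intro: coeffs_in_ring)
  then show "x \<in> {poly P z | P. coeffs_in P g}" by (metis (mono_tags, lifting) mem_Collect_eq)
qed

lemma mem_poly_image: "is_subring g \<Longrightarrow> z \<in> {poly P z | P. coeffs_in P g}"
proof -
  assume "is_subring g"
  then have "coeffs_in [:0, 1:] g" "poly [:0, 1:] z = z"
    by (auto simp: coeffs_in_def coeff_pCons is_subringD split: nat.split)
  then show ?thesis by (metis (mono_tags, lifting) mem_Collect_eq)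
qed

lemma der_graph_localise:
  fixes g :: "'k::field dual set"
  assumes g: "der_graph g" and u: "u \<in> g" "re u \<noteq> 0"
  shows "der_graph {z. \<exists>k. z * u ^ k \<in> g}"
proof -
  have R: "is_subring g" using g unfolding der_graph_def by blast
  have cl: "x * u ^ (k + l) \<in> g" if "x * u ^ k \<in> g" for x k l
    using that is_subring_power[OF R u(1), of l] is_subringD(6)[OF R] by (simp add: power_add mult.assoc[symmetric])
  show ?thesis unfolding der_graph_def is_subring_def
  proof (intro conjI ballI impI)
    show "1 \<in> {z. \<exists>k. z * u ^ k \<in> g}" using is_subringD(2)[OF R] by (auto intro: exI[of _ 0])
  next
    fix x y assume "x \<in> {z. \<exists>k. z * u ^ k \<in> g}" "y \<in> {z. \<exists>k. z * u ^ k \<in> g}"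
    then obtain k l where kl: "x * u ^ k \<in> g" "y * u ^ l \<in> g" by blast
    have "(x - y) * u ^ (k + l) \<in> g"
      using is_subringD(3)[OF R cl[OF kl(1), of l] cl[OF kl(2), of k]]
      by (simp add: left_diff_distrib add.commute)
    moreover have "(x * y) * u ^ (k + l) \<in> g"
      using is_subringD(6)[OF R kl] by (simp add: power_add mult_ac)
    ultimately show "x - y \<in> {z. \<exists>k. z * u ^ k \<in> g}" "x * y \<in> {z. \<exists>k. z * u ^ k \<in> g}" by blast+
  next
    fix z assume "z \<in> {z. \<exists>k. z * u ^ k \<in> g}" "re z = 0"
    then obtain k where k: "z * u ^ k \<in> g" "re (z * u ^ k) = 0" by auto
    then have "eps (z * u ^ k) = 0" using g unfolding der_graph_def by blast
    then show "eps z = 0" using \<open>re z = 0\<close> u(2) by simp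
  qed
qed

lemma poly_dual_const_zero:
  assumes "der_graph g" "coeffs_in P g" "map_poly re P = 0"
  shows "P = 0"
proof (rule poly_eqI)
  fix i
  have "re (coeff P i) = 0" using assms(3) map_poly_re_coeff[of P i] by simp
  then show "coeff P i = coeff 0 i"
    using assms(1,2) unfolding der_graph_def coeffs_in_def by (simp add: dual_eq_iff)
qed

text \<open>With a monic divisor, division with remainder needs no inverses; it is applied over
  subrings of the dual numbers, which have zero divisors.\<close>

lemma monic_reduce:
  fixes M :: "'a::comm_ring_1 poly"
  assumes R: "is_subring R" and M: "coeffs_in M R" "lead_coeff M = 1"
  shows "coeffs_in P R \<Longrightarrow> \<exists>r q. coeffs_in r R \<and> coeffs_in q R \<and> P = q * M + r \<and> (r = 0 \<or> degree r < degree M)"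
proof (induction "degree P" arbitrary: P rule: less_induct)
  case less
  show ?case
  proof (cases "P = 0 \<or> degree P < degree M")
    case True
    then show ?thesis using less.prems coeffs_in_ring(1)[OF R]
      by (intro exI[of _ P] exI[of _ 0]) auto
  next
    case False
    let ?m = "monom (lead_coeff P) (degree P - degree M)"
    let ?Q = "P - ?m * M"
    have m: "coeffs_in ?m R" using less.prems by (intro coeffs_in_ring[OF R]) (auto simp: coeffs_in_def)
    then have Q: "coeffs_in ?Q R" using less.prems M coeffs_in_ring[OF R] by blast
    have dle: "degree ?Q \<le> degree P"
    proof (intro degree_diff_le order.refl)
      have "degree (?m * M) \<le> degree ?m + degree M" by (rule degree_mult_le)
      also have "\<dots> \<le> (degree P - degree M) + degree M" by (intro add_right_mono degree_monom_le)
      finally show "degree (?m * M) \<le> degree P" using False by simp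
    qed
    have c0: "coeff ?Q (degree P) = 0"
      using False M(2) by (simp add: coeff_monom_mult)
    have "?Q = 0 \<or> degree ?Q < degree P"
      using dle c0 by (metis le_neq_implies_less leading_coeff_0_iff)
    then show ?thesis
    proof
      assume "?Q = 0"
      then show ?thesis using m coeffs_in_ring(1)[OF R] by (intro exI[of _ 0] exI[of _ ?m]) auto
    next
      assume "degree ?Q < degree P"
      from less.hyps[OF this Q] obtain r q where rq: "coeffs_in r R" "coeffs_in q R"
        "?Q = q * M + r" "r = 0 \<or> degree r < degree M" by blast
      then have "P = (q + ?m) * M + r" by (simp add: algebra_simps)
      then show ?thesis using rq m coeffs_in_ring(3)[OF R] by blast
    qed
  qed
qed

section \<open>Minimal polynomials\<close>

lemma min_poly_exists:
  assumes F: "is_subfield F" and a: "alg_over F a"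
  obtains m where "coeffs_in m F" "lead_coeff m = 1" "poly m a = 0"
    "\<And>p. coeffs_in p F \<Longrightarrow> poly p a = 0 \<Longrightarrow> p \<noteq> 0 \<Longrightarrow> degree m \<le> degree p"
proof -
  let ?P = "\<lambda>p. p \<noteq> 0 \<and> coeffs_in p F \<and> poly p a = 0"
  obtain p where p: "?P p" "\<And>q. ?P q \<Longrightarrow> degree p \<le> degree q"
    using a ex_has_least_nat[of ?P _ degree] unfolding alg_over_def by blast
  let ?m = "Polynomial.smult (inverse (lead_coeff p)) p"
  have R: "is_subring F" using F by (rule is_subfield_subring)
  have "lead_coeff p \<in> F" using p(1) by (simp add: coeffs_in_def)
  then have "coeffs_in ?m F" using coeffs_in_ring(6)[OF R] p(1) is_subfield_inverse[OF F] by blast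
  moreover have "lead_coeff ?m = 1" "degree ?m = degree p" using p(1) by auto
  ultimately show ?thesis using that[of ?m] p by auto
qed

text \<open>Separability in characteristic 0: the derivative is a nonzero polynomial of smaller
  degree, so minimality forbids it to vanish at \<open>a\<close>.\<close>

lemma min_poly_deriv_nonzero:
  fixes a :: "'k::field_char_0"
  assumes F: "is_subfield F" and m: "lead_coeff m = 1" "coeffs_in m F" "poly m a = 0"
    and least: "\<And>p. coeffs_in p F \<Longrightarrow> poly p a = 0 \<Longrightarrow> p \<noteq> 0 \<Longrightarrow> degree m \<le> degree p"
  shows "poly (pderiv m) a \<noteq> 0"
proof
  assume z: "poly (pderiv m) a = 0"
  have "degree m \<noteq> 0"
  proof
    assume "degree m = 0"
    then have "m = [:1:]" using m(1) by (metis degree_0_id)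
    then show False using m(3) by simp
  qed
  then have nz: "pderiv m \<noteq> 0" by (simp add: pderiv_eq_0_iff)
  then have "degree m \<le> degree (pderiv m)"
    using least[OF _ z nz] coeffs_in_pderiv[OF is_subfield_subring[OF F] m(2)] by blast
  then show False using \<open>degree m \<noteq> 0\<close> by (simp add: degree_pderiv)
qed

section \<open>Calculus of derivations and of logarithmic derivatives\<close>

lemma Der_0: "d \<in> Der S \<Longrightarrow> d 0 = 0"
  unfolding Der_def by (metis (mono_tags, lifting) add_cancel_right_left mem_Collect_eq)

lemma Der_add: "d \<in> Der S \<Longrightarrow> d (x + y) = d x + d y"
  and Der_mult: "d \<in> Der S \<Longrightarrow> d (x * y) = x * d y + d x * y"
  and Der_zero: "d \<in> Der S \<Longrightarrow> s \<in> S \<Longrightarrow> d s = 0"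
  unfolding Der_def by auto

lemma Der_1: "d \<in> Der S \<Longrightarrow> d 1 = 0"
  using Der_mult[of d S 1 1] by (metis add_cancel_right_left mult_1 mult_1_right)

lemma Der_minus: "d \<in> Der S \<Longrightarrow> d (- x) = - d x"
  by (metis Der_0 Der_add add.right_inverse add_eq_0_iff)

lemma Der_diff: "d \<in> Der S \<Longrightarrow> d (x - y) = d x - d y"
  using Der_add[of d S x "- y"] Der_minus[of d S y] by simp

lemma Der_inverse: "d \<in> Der S \<Longrightarrow> d (inverse x) = - d x / x\<^sup>2"
proof (cases "x = 0")
  case False
  assume d: "d \<in> Der S"
  have "0 = x * d (inverse x) + d x * inverse x"
    using Der_mult[OF d, of x "inverse x"] Der_1[OF d] False by simp
  then have "x * d (inverse x) = - (d x * inverse x)" by (simp add: eq_neg_iff_add_eq_0)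
  then have "d (inverse x) = - (d x * inverse x) / x" using False by (simp add: field_simps)
  then show ?thesis using False by (simp add: field_simps power2_eq_square)
qed (simp add: Der_0)

lemma Der_divide:
  assumes "d \<in> Der S" "y \<noteq> 0"
  shows "d (x / y) = (d x * y - x * d y) / y\<^sup>2"
proof -
  have "d (x / y) = x * (- d y / y\<^sup>2) + d x * inverse y"
    unfolding divide_inverse[of x] Der_mult[OF assms(1)] Der_inverse[OF assms(1)] ..
  also have "\<dots> = (d x * y - x * d y) / y\<^sup>2"
    using assms(2) by (simp add: field_simps power2_eq_square)
  finally show ?thesis .
qed

lemma Der_sum: "d \<in> Der S \<Longrightarrow> d (sum f A) = (\<Sum>i\<in>A. d (f i))"
  by (induction A rule: infinite_finite_induct) (auto simp: Der_0 Der_add)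

lemma Der_prod:
  assumes "finite A" "d \<in> Der S"
  shows "d (prod f A) = (\<Sum>i\<in>A. d (f i) * prod f (A - {i}))"
  using assms
proof (induction A rule: finite_induct)
  case empty then show ?case by (simp add: Der_1)
next
  case (insert a A)
  have "(\<Sum>i\<in>A. d (f i) * prod f (insert a A - {i})) = (\<Sum>i\<in>A. f a * (d (f i) * prod f (A - {i})))"
  proof (rule sum.cong[OF refl])
    fix i assume "i \<in> A"
    then have "insert a A - {i} = insert a (A - {i})" using insert.hyps(2) by auto
    then show "d (f i) * prod f (insert a A - {i}) = f a * (d (f i) * prod f (A - {i}))"
      using insert.hyps by simp
  qed
  then show ?case using insert by (simp add: Der_mult sum_distrib_left)
qed

lemma Der_ln_mult:
  assumes "d \<in> Der S" "x \<noteq> 0" "y \<noteq> 0"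
  shows "d (x * y) / (x * y) = d x / x + d y / y"
  using assms(2,3) by (simp add: Der_mult[OF assms(1)] add_divide_distrib)

lemma Der_ln_power:
  assumes "d \<in> Der S" "x \<noteq> 0"
  shows "d (x ^ k) / x ^ k = of_nat k * (d x / x)"
proof (induction k)
  case (Suc k)
  have "d (x * x ^ k) / (x * x ^ k) = d x / x + d (x ^ k) / x ^ k"
    by (rule Der_ln_mult) (use assms in auto)
  then show ?case by (simp only: Suc power_Suc of_nat_Suc distrib_right mult_1)
qed (simp add: Der_1[OF assms(1)])

lemma Der_powi:
  assumes "d \<in> Der S" "x \<noteq> 0"
  shows "d (x powi k) / x powi k = of_int k * (d x / x)"
proof (cases "k \<ge> 0")
  case True
  then obtain m where "k = int m" using nonneg_eq_int by blast
  then show ?thesis using Der_ln_power[OF assms, of m] by (simp only: power_int_of_nat of_int_of_nat_eq)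
next
  case False
  define y where "y = x ^ nat (- k)"
  have y: "y \<noteq> 0" "x powi k = inverse y" using assms(2) False by (auto simp: y_def power_int_def power_inverse)
  have "d (y * inverse y) / (y * inverse y) = d y / y + d (inverse y) / inverse y"
    by (rule Der_ln_mult[OF assms(1)]) (use y in auto)
  then have "d (inverse y) / inverse y = - (d y / y)"
    using y(1) Der_1[OF assms(1)] by (simp add: eq_neg_iff_add_eq_0 add.commute del: divide_inverse)
  also have "\<dots> = - (of_nat (nat (- k)) * (d x / x))" unfolding y_def Der_ln_power[OF assms] ..
  also have "\<dots> = of_int k * (d x / x)" using False by simp
  finally show ?thesis unfolding y(2) .
qed

lemma Der_ln_prod_powi:
  assumes "d \<in> Der S" "finite A" "\<And>i. i \<in> A \<Longrightarrow> f i \<noteq> 0"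
  shows "d (\<Prod>i\<in>A. f i powi e i) / (\<Prod>i\<in>A. f i powi e i) = (\<Sum>i\<in>A. of_int (e i) * (d (f i) / f i))"
  using assms(2,3)
proof (induction A rule: finite_induct)
  case (insert a A)
  let ?u = "f a powi e a" and ?w = "\<Prod>i\<in>A. f i powi e i"
  have nz: "?u \<noteq> 0" "?w \<noteq> 0" using insert by auto
  have "d (?u * ?w) / (?u * ?w) = d ?u / ?u + d ?w / ?w"
    by (rule Der_ln_mult[OF assms(1) nz])
  then show ?case using insert by (simp add: Der_powi[OF assms(1)])
qed (simp add: Der_1[OF assms(1)])

lemma Der_poly:
  assumes "d \<in> Der S"
  shows "d (poly p x) = poly (map_poly d p) x + poly (pderiv p) x * d x"
proof (induction p)
  case (pCons a p)
  then show ?case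
    using Der_0[OF assms]
    by (simp add: map_poly_pCons pderiv_pCons Der_add[OF assms] Der_mult[OF assms] algebra_simps)
qed (simp add: Der_0[OF assms])

lemma map_poly_Der_zero:
  "d \<in> Der S \<Longrightarrow> (\<And>i. d (coeff p i) = 0) \<Longrightarrow> map_poly d p = 0"
  by (rule poly_eqI) (simp add: coeff_map_poly Der_0)

section \<open>The closure operator defined by derivations\<close>

lemma is_subfield_dcl: "is_subfield (dcl S)"
  unfolding is_subfield_def dcl_def
  by (auto simp: Der_0 Der_1 Der_diff Der_mult Der_inverse)

lemma dcl_ext: "S \<subseteq> dcl S"
  unfolding dcl_def by (auto simp: Der_zero)

lemma Der_antimono: "S \<subseteq> T \<Longrightarrow> Der T \<subseteq> Der S"
  unfolding Der_def by auto

lemma dcl_mono: "S \<subseteq> T \<Longrightarrow> dcl S \<subseteq> dcl T"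
  unfolding dcl_def using Der_antimono by blast

lemma Der_dcl: "Der (dcl S) = Der S"
proof
  show "Der (dcl S) \<subseteq> Der S" using Der_antimono dcl_ext by blast
  show "Der S \<subseteq> Der (dcl S)" unfolding Der_def dcl_def by auto
qed

lemma Der_between: "S \<subseteq> T \<Longrightarrow> T \<subseteq> dcl S \<Longrightarrow> Der T = Der S"
  using Der_antimono Der_dcl by (metis subset_antisym)

lemma dcl_between: "S \<subseteq> T \<Longrightarrow> T \<subseteq> dcl S \<Longrightarrow> dcl T = dcl S"
  using Der_between[of S T] by (simp add: dcl_def)

lemma gen_field_subset_dcl: "gen_field S \<subseteq> dcl S"
  by (rule gen_field_least[OF is_subfield_dcl dcl_ext])

lemma dcl_gen_field: "dcl (gen_field S) = dcl S"
  by (rule dcl_between[OF gen_field_ext gen_field_subset_dcl])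

text \<open>Differentiating m(a) = 0 for the minimal polynomial m gives m'(a) d(a) = 0, because
  \<open>d\<close> kills the coefficients, and m'(a) is nonzero.\<close>

lemma alg_over_dcl:
  fixes a :: "'k::field_char_0"
  assumes "alg_over (gen_field S) a"
  shows "a \<in> dcl S"
proof -
  obtain m where m: "coeffs_in m (gen_field S)" "lead_coeff m = 1" "poly m a = 0"
    "\<And>p. coeffs_in p (gen_field S) \<Longrightarrow> poly p a = 0 \<Longrightarrow> p \<noteq> 0 \<Longrightarrow> degree m \<le> degree p"
    using min_poly_exists[OF is_subfield_gen assms] by metis
  have nz: "poly (pderiv m) a \<noteq> 0" by (rule min_poly_deriv_nonzero[OF is_subfield_gen m(2,1,3,4)])
  show ?thesis unfolding dcl_def
  proof safe
    fix d assume d: "d \<in> Der S"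
    have "map_poly d m = 0"
      using m(1) gen_field_subset_dcl[of S] d unfolding dcl_def coeffs_in_def
      by (intro map_poly_Der_zero[OF d]) blast
    then have "poly (pderiv m) a * d a = 0" using Der_poly[OF d, of m a] m(3) Der_0[OF d] by simp
    then show "d a = 0" using nz by simp
  qed
qed

text \<open>By maximality it suffices to adjoin some \<open>Dual a y\<close> without spoiling the
  graph property. The first components of \<open>g\<close> form a field; if \<open>a\<close> is
  transcendental over it, the slope 0 does no harm, and if \<open>a\<close> is algebraic, the slope
  is dictated by the minimal polynomial.\<close>

lemma der_graph_maximal_total:
  fixes g :: "'k::field_char_0 dual set"
  assumes g: "der_graph g" and max: "\<And>h. der_graph h \<Longrightarrow> g \<subseteq> h \<Longrightarrow> h = g"
  shows "\<exists>y. Dual a y \<in> g"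
proof -
  have R: "is_subring g" using g unfolding der_graph_def by blast
  let ?F = "re ` g"
  have inv: "\<exists>z\<in>g. re z = inverse (re u)" if u: "u \<in> g" "re u \<noteq> 0" for u
  proof -
    have "{z. \<exists>k. z * u ^ k \<in> g} = g"
      by (intro max der_graph_localise[OF g u]) (auto intro: exI[of _ 0])
    moreover have "Dual (inverse (re u)) (- eps u / (re u)\<^sup>2) * u ^ 1 = 1"
      using u(2) by (simp add: dual_eq_iff power2_eq_square field_simps)
    then have "Dual (inverse (re u)) (- eps u / (re u)\<^sup>2) \<in> {z. \<exists>k. z * u ^ k \<in> g}"
      using is_subringD(2)[OF R] by (metis (mono_tags, lifting) mem_Collect_eq)
    ultimately show ?thesis by (metis dual.sel(1))
  qed
  have F: "is_subfield ?F" unfolding is_subfield_def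
  proof (intro conjI ballI)
    show "0 \<in> ?F" using is_subringD(1)[OF R] dual_simps(1) by (metis imageI)
    show "1 \<in> ?F" using is_subringD(2)[OF R] dual_simps(3) by (metis imageI)
    fix x y assume "x \<in> ?F" "y \<in> ?F"
    then obtain u v where "u \<in> g" "v \<in> g" "x = re u" "y = re v" by blast
    then show "x - y \<in> ?F" "x * y \<in> ?F"
      using is_subringD(3,6)[OF R, of u v] dual_simps(7,11) by (metis imageI)+
  next
    fix x assume "x \<in> ?F"
    then obtain u where u: "u \<in> g" "x = re u" by blast
    show "inverse x \<in> ?F"
    proof (cases "x = 0")
      case False then show ?thesis using inv[OF u(1)] u(2) by (metis imageI)
    qed (use \<open>x \<in> ?F\<close> in simp)
  qed
  have lift: "\<exists>P. coeffs_in P g \<and> map_poly re P = p" if p: "coeffs_in p ?F" for p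
  proof -
    have "\<forall>i. \<exists>z\<in>g. re z = coeff p i" using p unfolding coeffs_in_def by (metis imageE)
    then obtain f where f: "\<And>i. f i \<in> g" "\<And>i. re (f i) = coeff p i" by metis
    define P where "P = (\<Sum>i\<le>degree p. monom (f i) i)"
    have c: "coeff P i = (if i \<le> degree p then f i else 0)" for i
      unfolding P_def by (simp add: coeff_sum if_distrib cong: if_cong)
    have "coeffs_in P g" unfolding coeffs_in_def c using f(1) is_subringD(1)[OF R] by simp
    moreover have "map_poly re P = p"
      by (rule poly_eqI) (auto simp: c f(2) coeff_eq_0)
    ultimately show ?thesis by blast
  qed
  have ok: "\<exists>y. \<forall>P. coeffs_in P g \<longrightarrow> re (poly P (Dual a y)) = 0 \<longrightarrow> eps (poly P (Dual a y)) = 0"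
  proof (cases "alg_over ?F a")
    case False
    have "eps (poly P (Dual a 0)) = 0" if P: "coeffs_in P g" "re (poly P (Dual a 0)) = 0" for P
    proof -
      have "coeffs_in (map_poly re P) ?F" using P(1) unfolding coeffs_in_def by auto
      then have "map_poly re P = 0" using False P(2) unfolding alg_over_def re_poly by auto
      then have "P = 0" using poly_dual_const_zero g P(1) by blast
      then show ?thesis by simp
    qed
    then show ?thesis by blast
  next
    case True
    obtain m where m: "coeffs_in m ?F" "lead_coeff m = 1" "poly m a = 0"
      "\<And>p. coeffs_in p ?F \<Longrightarrow> poly p a = 0 \<Longrightarrow> p \<noteq> 0 \<Longrightarrow> degree m \<le> degree p"
      using min_poly_exists[OF F True] by metis
    have nz: "poly (pderiv m) a \<noteq> 0" by (rule min_poly_deriv_nonzero[OF F m(2,1,3,4)])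
    obtain M where M: "coeffs_in M g" "map_poly re M = m" using lift[OF m(1)] by blast
    have deg: "degree M = degree m"
    proof (rule antisym)
      show "degree m \<le> degree M" unfolding M(2)[symmetric] by (rule degree_map_poly_le_re)
      show "degree M \<le> degree m"
      proof (rule degree_le, safe)
        fix i assume "degree m < i"
        then have "re (coeff M i) = 0" using map_poly_re_coeff[of M i] M(2) by (simp add: coeff_eq_0)
        then show "coeff M i = 0"
          using M(1) g unfolding der_graph_def coeffs_in_def by (simp add: dual_eq_iff)
      qed
    qed
    have lM: "lead_coeff M = 1"
      using M(1) m(2) map_poly_re_coeff[of M "degree m"] M(2) is_subringD(2)[OF R] deg
      by (intro der_graph_eqI[OF g]) (auto simp: coeffs_in_def)
    \<comment> \<open>The only slope for which the lifted minimal polynomial \<open>M\<close>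
      vanishes at \<open>Dual a y\<close>: solve \<open>eps_poly\<close> for it. Every other
      polynomial over \<open>g\<close> can then be reduced modulo \<open>M\<close>.\<close>
    define y where "y = - poly (map_poly eps M) a / poly (pderiv m) a"
    have pM: "poly M (Dual a y) = 0"
      using nz m(3) unfolding dual_eq_iff re_poly eps_poly M(2) by (simp add: y_def)
    have "eps (poly P (Dual a y)) = 0" if P: "coeffs_in P g" "re (poly P (Dual a y)) = 0" for P
    proof -
      obtain r q where rq: "coeffs_in r g" "P = q * M + r" "r = 0 \<or> degree r < degree M"
        using monic_reduce[OF R M(1) lM P(1)] by blast
      have eq: "poly P (Dual a y) = poly r (Dual a y)" using rq(2) pM by simp
      have "coeffs_in (map_poly re r) ?F" using rq(1) unfolding coeffs_in_def by auto
      moreover have "poly (map_poly re r) a = 0" using P(2) unfolding eq re_poly by simp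
      ultimately have "map_poly re r = 0 \<or> degree m \<le> degree (map_poly re r)" using m(4) by blast
      moreover have "degree (map_poly re r) \<le> degree r" by (rule degree_map_poly_le_re)
      ultimately have "map_poly re r = 0" using rq(3) deg by auto
      then have "r = 0" using poly_dual_const_zero g rq(1) by blast
      then show ?thesis unfolding eq by simp
    qed
    then show ?thesis by blast
  qed
  then obtain y where y: "\<And>P. coeffs_in P g \<Longrightarrow> re (poly P (Dual a y)) = 0 \<Longrightarrow> eps (poly P (Dual a y)) = 0"
    by blast
  have "{poly P (Dual a y) | P. coeffs_in P g} = g"
    by (rule max[OF der_graph_adjoin[OF g y] subset_poly_image[OF R]])
  then show ?thesis using mem_poly_image[OF R, of "Dual a y"] by blast
qed

text \<open>Zorn's lemma on the graphs containing \<open>g\<close>; a maximal one is total and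
  single-valued, hence the graph of a derivation of the whole field.\<close>

lemma der_graph_extend:
  fixes g :: "'k::field_char_0 dual set"
  assumes g: "der_graph g"
  obtains d where "d \<in> Der {}" "\<And>z. z \<in> g \<Longrightarrow> d (re z) = eps z"
proof -
  let ?A = "{h. der_graph h \<and> g \<subseteq> h}"
  have "\<exists>M\<in>?A. \<forall>X\<in>?A. M \<subseteq> X \<longrightarrow> X = M"
  proof (rule subset_Zorn_nonempty)
    show "?A \<noteq> {}" using g by blast
    fix C assume C: "C \<noteq> {}" "subset.chain ?A C"
    have "der_graph (\<Union>C)" unfolding der_graph_def is_subring_def
    proof (intro conjI ballI impI)
      obtain h where "h \<in> C" using C(1) by blast
      moreover from this have "is_subring h"
        using C(2) unfolding subset.chain_def der_graph_def by blast
      ultimately show "1 \<in> \<Union>C" using is_subringD(2)[of h] by blast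
    next
      fix x y assume "x \<in> \<Union>C" "y \<in> \<Union>C"
      then obtain h where h: "h \<in> C" "x \<in> h" "y \<in> h"
        using C(2) unfolding subset.chain_def by blast
      then have "is_subring h" using C(2) unfolding subset.chain_def der_graph_def by blast
      then show "x - y \<in> \<Union>C" "x * y \<in> \<Union>C" using h is_subringD(3,6) by blast+
    next
      fix z assume "z \<in> \<Union>C" "re z = 0"
      then obtain h where h: "h \<in> C" "z \<in> h" by blast
    then have "der_graph h" using C(2) unfolding subset.chain_def by blast
    then show "eps z = 0" using h \<open>re z = 0\<close> unfolding der_graph_def by blast
    qed
    moreover obtain h where "h \<in> C" using C(1) by blast
    moreover have "g \<subseteq> h" using C(2) \<open>h \<in> C\<close> unfolding subset.chain_def by blast
    ultimately show "\<Union>C \<in> ?A" by blast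
  qed
  then obtain M where M0: "M \<in> ?A" "\<forall>X\<in>?A. M \<subseteq> X \<longrightarrow> X = M" by (rule bexE)
  have M: "der_graph M" "g \<subseteq> M" using M0(1) by simp_all
  have M3: "h = M" if "der_graph h" "M \<subseteq> h" for h using M0(2) M(2) that by simp
  have R: "is_subring M" using M(1) unfolding der_graph_def by blast
  have tot: "\<exists>y. Dual a y \<in> M" for a by (rule der_graph_maximal_total[OF M(1) M3])
  define d where "d a = (SOME y. Dual a y \<in> M)" for a
  have d: "Dual a (d a) \<in> M" for a unfolding d_def by (rule someI_ex[OF tot])
  have u: "d (re z) = eps z" if "z \<in> M" for z
    using der_graph_eqI[OF M(1) d[of "re z"] that] by (simp add: dual_eq_iff)
  have "d (x + y) = d x + d y" "d (x * y) = x * d y + d x * y" for x y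
    using u[OF is_subringD(5)[OF R d[of x] d[of y]]] u[OF is_subringD(6)[OF R d[of x] d[of y]]]
    by simp_all
  then have "d \<in> Der {}" by (simp add: Der_def)
  then show ?thesis by (rule that) (rule u[OF subsetD[OF M(2)]])
qed

text \<open>Start from the zero derivation on \<open>gen_field S\<close>, adjoin
  \<open>Dual x 1\<close>, which is harmless because \<open>x\<close> satisfies no equation, and
  extend to the whole field.\<close>

lemma Der_transcendental:
  fixes x :: "'k::field_char_0"
  assumes "\<not> alg_over (gen_field S) x"
  obtains d where "d \<in> Der S" "d x = 1"
proof -
  let ?F = "gen_field S"
  have RF: "is_subring ?F" by (rule is_subfield_subring[OF is_subfield_gen])
  let ?h = "(\<lambda>a. Dual a 0) ` ?F"
  have sh: "is_subring ?h" unfolding is_subring_def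
  proof (intro conjI ballI)
    show "1 \<in> ?h" unfolding one_dual_def by (rule imageI[OF is_subringD(2)[OF RF]])
    fix x y assume "x \<in> ?h" "y \<in> ?h"
    then obtain a b where ab: "a \<in> ?F" "b \<in> ?F" "x = Dual a 0" "y = Dual b 0" by (elim imageE)
    then have "x - y = Dual (a - b) 0" "x * y = Dual (a * b) 0" by (auto simp: dual_eq_iff)
    then show "x - y \<in> ?h" "x * y \<in> ?h" using is_subringD(3,6)[OF RF ab(1,2)] by simp_all
  qed
  have h: "der_graph ?h" using sh unfolding der_graph_def by auto
  let ?g = "{poly P (Dual x 1) | P. coeffs_in P ?h}"
  have g: "der_graph ?g"
  proof (rule der_graph_adjoin[OF h])
    fix P assume P: "coeffs_in P ?h" "re (poly P (Dual x 1)) = 0"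
    have "coeffs_in (map_poly re P) ?F" using P(1) unfolding coeffs_in_def
      by (metis (no_types, lifting) dual.sel(1) imageE map_poly_re_coeff)
    then have "map_poly re P = 0" using assms P(2) unfolding alg_over_def re_poly by auto
    then have "P = 0" using poly_dual_const_zero h P(1) by blast
    then show "eps (poly P (Dual x 1)) = 0" by simp
  qed
  obtain d where d: "d \<in> Der {}" "\<And>z. z \<in> ?g \<Longrightarrow> d (re z) = eps z"
    using der_graph_extend[OF g] by blast
  have "d s = 0" if "s \<in> S" for s
  proof -
    have "Dual s 0 \<in> ?h" using that gen_field_ext[of S] by (intro imageI) blast
    then have "Dual s 0 \<in> ?g" by (rule subsetD[OF subset_poly_image[OF sh]])
    from d(2)[OF this] show ?thesis by simp
  qed
  then have "d \<in> Der S" using d(1) by (simp add: Der_def)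
  moreover have "d x = 1" using d(2)[OF mem_poly_image[OF sh, of "Dual x 1"]] by simp
  ultimately show ?thesis by (rule that)
qed

lemma dcl_iff_alg_over: "a \<in> dcl S \<longleftrightarrow> alg_over (gen_field S) (a::'k::field_char_0)"
proof
  assume a: "a \<in> dcl S"
  show "alg_over (gen_field S) a"
  proof (rule ccontr)
    assume "\<not> alg_over (gen_field S) a"
    then obtain d where d: "d \<in> Der S" "d a = 1" by (rule Der_transcendental)
    have "d a = 0" using a d(1) by (simp add: dcl_def)
    then show False using d(2) by simp
  qed
qed (rule alg_over_dcl)

section \<open>Derivations as a vector space; rank and dual derivations\<close>

lemma Der_lin_comb: "d \<in> Der S \<Longrightarrow> e \<in> Der S \<Longrightarrow> (\<lambda>x. d x + c * e x) \<in> Der S"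
  unfolding Der_def by (auto simp: algebra_simps)

lemma Der_sum_lin: "(\<And>i. i \<in> A \<Longrightarrow> d i \<in> Der S) \<Longrightarrow> (\<lambda>x. \<Sum>i\<in>A. c i * d i x) \<in> Der S"
proof (induction A rule: infinite_finite_induct)
  case (insert a A)
  then show ?case
    using Der_lin_comb[of "\<lambda>x. \<Sum>i\<in>A. c i * d i x" S "d a" "c a"] by (simp add: add.commute)
qed (auto simp: Der_def)

text \<open>Exchange: let \<open>e\<close> kill \<open>Y\<close> and \<open>A\<close> but not
  \<open>y\<close>, so that \<open>e x\<close> is nonzero as well. If \<open>d\<close> kills
  \<open>Y\<close>, \<open>A\<close> and \<open>y\<close>, subtract the multiple of \<open>e\<close>
  that makes the value at \<open>x\<close> zero; the difference must kill \<open>y\<close>, which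
  forces that multiple, hence \<open>d x\<close>, to be 0.\<close>

interpretation dcl: pregeometry "\<lambda>A. dcl (Y \<union> A)" for Y :: "'k::field set"
proof
  fix A B :: "'k set" and x y
  show "A \<subseteq> dcl (Y \<union> A)" using dcl_ext by blast
  show "A \<subseteq> B \<Longrightarrow> dcl (Y \<union> A) \<subseteq> dcl (Y \<union> B)" by (rule dcl_mono) blast
  show "dcl (Y \<union> dcl (Y \<union> A)) \<subseteq> dcl (Y \<union> A)"
    using dcl_ext[of "Y \<union> A"] by (subst dcl_between[of "Y \<union> A"]) auto
  assume y: "y \<in> dcl (Y \<union> insert x A)" "y \<notin> dcl (Y \<union> A)"
  then obtain e where e: "e \<in> Der (Y \<union> A)" "e y \<noteq> 0" unfolding dcl_def by blast
  have kill: "d y = 0" if "d \<in> Der (Y \<union> A)" "d x = 0" for d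
    using y(1) that unfolding dcl_def Der_def by auto
  have ex: "e x \<noteq> 0" using kill e by blast
  show "x \<in> dcl (Y \<union> insert y A)" unfolding dcl_def
  proof safe
    fix d assume d: "d \<in> Der (Y \<union> insert y A)"
    then have "d \<in> Der (Y \<union> A)" "d y = 0" unfolding Der_def by auto
    then have "(\<lambda>z. d z + (- d x / e x) * e z) \<in> Der (Y \<union> A)" using e Der_lin_comb by blast
    then have "d y + (- d x / e x) * e y = 0" by (rule kill) (use ex in simp)
    then show "d x = 0" using \<open>d y = 0\<close> e ex by simp
  qed
qed

abbreviation dindep :: "'k::field set \<Rightarrow> 'k set \<Rightarrow> bool" where
  "dindep Y B \<equiv> pregeometry.indep (\<lambda>A. dcl (Y \<union> A)) B"

abbreviation drk :: "'k::field set \<Rightarrow> 'k set \<Rightarrow> nat" where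
  "drk Y X \<equiv> pregeometry.rk (\<lambda>A. dcl (Y \<union> A)) X"

text \<open>The partial derivative along \<open>b\<close>: a derivation that kills the rest of
  \<open>B\<close> but not \<open>b\<close>, rescaled.\<close>

lemma dindep_dual:
  assumes "dindep Y B" "b \<in> B"
  obtains d where "d \<in> Der Y" "d b = 1" "\<forall>c\<in>B. c \<noteq> b \<longrightarrow> d c = 0"
proof -
  have "b \<notin> dcl (Y \<union> (B - {b}))" using assms unfolding dcl.indep_def by blast
  then obtain e where e: "e \<in> Der (Y \<union> (B - {b}))" "e b \<noteq> 0"
    by (auto simp: dcl_def)
  let ?d = "\<lambda>x. 0 + inverse (e b) * e x"
  have "?d \<in> Der Y"
    by (rule Der_lin_comb) (use e in \<open>auto simp: Der_def\<close>)
  then show ?thesis using that[of ?d] e by (auto simp: Der_def)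
qed

lemma dindep_prescribe:
  assumes "dindep Y B" "finite B"
  obtains d where "d \<in> Der Y" "\<forall>b\<in>B. d b = f b"
proof -
  have "\<forall>b\<in>B. \<exists>d. d \<in> Der Y \<and> d b = 1 \<and> (\<forall>c\<in>B. c \<noteq> b \<longrightarrow> d c = 0)"
    using dindep_dual[OF assms(1)] by metis
  then obtain D where D: "\<And>b. b \<in> B \<Longrightarrow> D b \<in> Der Y \<and> D b b = 1 \<and> (\<forall>c\<in>B. c \<noteq> b \<longrightarrow> D b c = 0)"
    by metis
  have "(\<Sum>i\<in>B. f i * D i b) = f b" if b: "b \<in> B" for b
  proof -
    have "(\<Sum>i\<in>B. f i * D i b) = (\<Sum>i\<in>B. if i = b then f i else 0)"
      by (rule sum.cong) (use D b in auto)
    then show ?thesis using assms(2) b by simp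
  qed
  then show ?thesis using that Der_sum_lin[of B D Y f] D by blast
qed

section \<open>Polynomial functions\<close>

text \<open>Functions instead of formal polynomials, so that evaluation and induction are immediate.
  \<open>K\<close> is any set and generates the coefficient ring; the constant 1 has its own rule
  because \<open>K\<close> need not contain it.\<close>

inductive_set polyfun :: "'k::field set \<Rightarrow> 'v set \<Rightarrow> (('v \<Rightarrow> 'k) \<Rightarrow> 'k) set"
  for K :: "'k set" and V :: "'v set" where
  polyfun_1: "(\<lambda>x. 1) \<in> polyfun K V"
| polyfun_const: "c \<in> K \<Longrightarrow> (\<lambda>x. c) \<in> polyfun K V"
| polyfun_var: "i \<in> V \<Longrightarrow> (\<lambda>x. x i) \<in> polyfun K V"
| polyfun_diff: "f \<in> polyfun K V \<Longrightarrow> g \<in> polyfun K V \<Longrightarrow> (\<lambda>x. f x - g x) \<in> polyfun K V"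
| polyfun_mult: "f \<in> polyfun K V \<Longrightarrow> g \<in> polyfun K V \<Longrightarrow> (\<lambda>x. f x * g x) \<in> polyfun K V"

lemma polyfun_0: "(\<lambda>x. 0) \<in> polyfun K V"
  using polyfun_diff[OF polyfun_1 polyfun_1] by simp

lemma polyfun_uminus: "f \<in> polyfun K V \<Longrightarrow> (\<lambda>x. - f x) \<in> polyfun K V"
  using polyfun_diff[OF polyfun_0, of f K V] by simp

lemma polyfun_add: "f \<in> polyfun K V \<Longrightarrow> g \<in> polyfun K V \<Longrightarrow> (\<lambda>x. f x + g x) \<in> polyfun K V"
  using polyfun_diff[OF _ polyfun_uminus, of f K V g] by simp

lemma polyfun_sum: "(\<And>i. i \<in> A \<Longrightarrow> f i \<in> polyfun K V) \<Longrightarrow> (\<lambda>x. \<Sum>i\<in>A. f i x) \<in> polyfun K V"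
  by (induction A rule: infinite_finite_induct) (auto simp: polyfun_0 intro!: polyfun_add)

lemma polyfun_prod: "(\<And>i. i \<in> A \<Longrightarrow> f i \<in> polyfun K V) \<Longrightarrow> (\<lambda>x. \<Prod>i\<in>A. f i x) \<in> polyfun K V"
  by (induction A rule: infinite_finite_induct) (auto simp: polyfun_1 intro!: polyfun_mult)

lemma polyfun_power: "f \<in> polyfun K V \<Longrightarrow> (\<lambda>x. f x ^ k) \<in> polyfun K V"
  by (induction k) (auto simp: polyfun_1 intro!: polyfun_mult)

lemma polyfun_of_nat: "(\<lambda>x. of_nat k) \<in> polyfun K V"
  by (induction k) (auto simp: polyfun_0 polyfun_1 intro!: polyfun_add)

lemma polyfun_mono:
  assumes "f \<in> polyfun K V" "K \<subseteq> K'" "V \<subseteq> V'"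
  shows "f \<in> polyfun K' V'"
  using assms(1) by induction (use assms(2,3) in \<open>auto intro: polyfun.intros\<close>)

lemma polyfun_cong:
  assumes "f \<in> polyfun K V" "\<And>i. i \<in> V \<Longrightarrow> x i = y i"
  shows "f x = f y"
  using assms(1) by induction (use assms(2) in auto)

lemma polyfun_value_in:
  assumes "f \<in> polyfun K V" "is_subring R" "K \<subseteq> R" "\<And>i. i \<in> V \<Longrightarrow> x i \<in> R"
  shows "f x \<in> R"
  using assms(1) by induction (use assms(2-) is_subringD[OF assms(2)] in auto)

text \<open>A polynomial in one further variable whose coefficients are polynomial functions of the
  others. The degree bound is uniform in the point, whereas the true degree may drop at special
  points.\<close>

definition poly_family :: "'k::field set \<Rightarrow> 'v set \<Rightarrow> nat \<Rightarrow> (('v \<Rightarrow> 'k) \<Rightarrow> 'k poly) \<Rightarrow> bool" where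
  "poly_family K V d p \<longleftrightarrow> (\<forall>i. (\<lambda>x. coeff (p x) i) \<in> polyfun K V) \<and> (\<forall>x. degree (p x) \<le> d)"

lemma polyfun_decompose:
  assumes "f \<in> polyfun K (insert s V)"
  shows "\<exists>p d. poly_family K V d p \<and> (\<forall>x. f x = poly (p x) (x s))"
  using assms
proof induction
  case polyfun_1
  have "poly_family K V 0 (\<lambda>x. 1)"
    unfolding poly_family_def by (auto simp: polyfun.polyfun_1 polyfun_0 coeff_pCons split: nat.split)
  then show ?case by (intro exI[of _ "\<lambda>x. 1"] exI[of _ 0]) auto
next
  case (polyfun_const c)
  then have "poly_family K V 0 (\<lambda>x. [:c:])"
    unfolding poly_family_def
    by (auto simp: polyfun_0 coeff_pCons polyfun.polyfun_const split: nat.split)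
  then show ?case by (intro exI[of _ "\<lambda>x. [:c:]"] exI[of _ 0]) auto
next
  case (polyfun_var i)
  show ?case
  proof (cases "i = s")
    case True
    have "poly_family K V 1 (\<lambda>x. [:0, 1:])"
      unfolding poly_family_def
      by (auto simp: polyfun_0 polyfun.polyfun_1 coeff_pCons split: nat.split)
    then show ?thesis using True by (intro exI[of _ "\<lambda>x. [:0, 1:]"] exI[of _ 1]) auto
  next
    case False
    then have "i \<in> V" using polyfun_var by simp
    then have "(\<lambda>x. coeff [:x i:] j) \<in> polyfun K V" for j
      by (cases j) (auto simp: polyfun_0 polyfun.polyfun_var)
    then have "poly_family K V 0 (\<lambda>x. [:x i:])"
      unfolding poly_family_def by simp
    then show ?thesis by (intro exI[of _ "\<lambda>x. [:x i:]"] exI[of _ 0]) auto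
  qed
next
  case (polyfun_diff f g)
  then obtain p d q e where pq: "poly_family K V d p" "\<And>x. f x = poly (p x) (x s)"
    "poly_family K V e q" "\<And>x. g x = poly (q x) (x s)" by blast
  have "poly_family K V (max d e) (\<lambda>x. p x - q x)"
    using pq(1,3) unfolding poly_family_def
    by (auto intro!: polyfun.polyfun_diff degree_diff_le intro: max.coboundedI1 max.coboundedI2)
  then show ?case using pq by (intro exI[of _ "\<lambda>x. p x - q x"] exI) auto
next
  case (polyfun_mult f g)
  then obtain p d q e where pq: "poly_family K V d p" "\<And>x. f x = poly (p x) (x s)"
    "poly_family K V e q" "\<And>x. g x = poly (q x) (x s)" by blast
  have "poly_family K V (d + e) (\<lambda>x. p x * q x)"
    unfolding poly_family_def
  proof (intro conjI allI)
    fix i show "(\<lambda>x. coeff (p x * q x) i) \<in> polyfun K V"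
      unfolding coeff_mult using pq(1,3) unfolding poly_family_def
      by (intro polyfun_sum polyfun.polyfun_mult) auto
  next
    fix x show "degree (p x * q x) \<le> d + e"
      using degree_mult_le[of "p x" "q x"] pq(1,3) unfolding poly_family_def
      by (meson add_mono order_trans)
  qed
  then show ?case using pq by (intro exI[of _ "\<lambda>x. p x * q x"] exI) auto
qed

lemma poly_family_eval:
  assumes "poly_family K V d p" "V \<subseteq> V'" "s \<in> V'"
  shows "(\<lambda>x. poly (p x) (x s)) \<in> polyfun K V'"
proof -
  have "poly (p x) (x s) = (\<Sum>i\<le>d. coeff (p x) i * x s ^ i)" for x
  proof -
    have "(\<Sum>i\<le>d. coeff (p x) i * x s ^ i) = (\<Sum>i\<le>degree (p x). coeff (p x) i * x s ^ i)"
      using assms(1) unfolding poly_family_def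
      by (intro sum.mono_neutral_right) (auto simp: coeff_eq_0)
    then show ?thesis by (simp add: poly_altdef)
  qed
  moreover have "(\<lambda>x. \<Sum>i\<le>d. coeff (p x) i * x s ^ i) \<in> polyfun K V'"
    using assms unfolding poly_family_def
    by (intro polyfun_sum polyfun_mult polyfun_power polyfun_var)
       (auto intro: polyfun_mono[where K = K and V = V])
  ultimately show ?thesis by simp
qed

lemma gen_field_fraction:
  assumes "a \<in> gen_field (K \<union> x ` V)"
  shows "\<exists>f g. f \<in> polyfun K V \<and> g \<in> polyfun K V \<and> g x \<noteq> 0 \<and> a = f x / g x"
proof -
  let ?F = "{f x / g x | f g. f \<in> polyfun K V \<and> g \<in> polyfun K V \<and> g x \<noteq> 0}"
  have I: "f x / g x \<in> ?F" if "f \<in> polyfun K V" "g \<in> polyfun K V" "g x \<noteq> 0" for f g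
    using that by blast
  have "is_subfield ?F" unfolding is_subfield_def
  proof (intro conjI ballI)
    show "0 \<in> ?F" using I[OF polyfun_0 polyfun_1] by simp
    show "1 \<in> ?F" using I[OF polyfun_1 polyfun_1] by simp
    fix a b assume "a \<in> ?F" "b \<in> ?F"
    then obtain f g h k where fg: "f \<in> polyfun K V" "g \<in> polyfun K V" "g x \<noteq> 0" "a = f x / g x"
      "h \<in> polyfun K V" "k \<in> polyfun K V" "k x \<noteq> 0" "b = h x / k x" by blast
    have "a - b = (f x * k x - h x * g x) / (g x * k x)"
      unfolding fg(4,8) by (subst diff_frac_eq) (use fg in auto)
    then show "a - b \<in> ?F"
      using I[OF polyfun_diff[OF polyfun_mult[OF fg(1,6)] polyfun_mult[OF fg(5,2)]] polyfun_mult[OF fg(2,6)]] fg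
      by simp
    have "a * b = (f x * h x) / (g x * k x)" using fg by simp
    then show "a * b \<in> ?F"
      using I[OF polyfun_mult[OF fg(1,5)] polyfun_mult[OF fg(2,6)]] fg by simp
  next
    fix a assume a: "a \<in> ?F"
    then obtain f g where fg: "f \<in> polyfun K V" "g \<in> polyfun K V" "g x \<noteq> 0" "a = f x / g x" by blast
    show "inverse a \<in> ?F"
    proof (cases "f x = 0")
      case True then show ?thesis using a fg by simp
    next
      case False
      have "inverse a = g x / f x" using fg(4) by simp
      then show ?thesis using I[OF fg(2,1) False] by simp
    qed
  qed
  moreover have "K \<union> x ` V \<subseteq> ?F"
  proof
    fix a assume "a \<in> K \<union> x ` V"
    then have "\<exists>f\<in>polyfun K V. f x = a"
    proof
      assume "a \<in> K" then show ?thesis using polyfun_const[of a K V] by (intro bexI) auto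
    next
      assume "a \<in> x ` V"
      then obtain i where "i \<in> V" "a = x i" by blast
      then show ?thesis using polyfun_var[of i V K] by (intro bexI) auto
    qed
    then obtain f where f: "f \<in> polyfun K V" "f x = a" by blast
    then show "a \<in> ?F" using I[OF f(1) polyfun_1] by simp
  qed
  ultimately have "gen_field (K \<union> x ` V) \<subseteq> ?F" by (rule gen_field_least)
  then show ?thesis using assms by blast
qed

lemma polyfun_value_gen_field:
  assumes "f \<in> polyfun K V"
  shows "f x \<in> gen_field (K \<union> x ` V)"
  by (rule polyfun_value_in[OF assms is_subfield_subring[OF is_subfield_gen]])
     (use gen_field_ext[of "K \<union> x ` V"] in auto)

text \<open>An algebraic relation at one point \<open>x\<close> is spread out to a family defined at
  all points, so that it can be specialised elsewhere.\<close>

lemma alg_over_poly_family: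
  fixes x :: "'v \<Rightarrow> 'k::field"
  assumes "alg_over (gen_field (K \<union> x ` V)) a"
  shows "\<exists>p d. poly_family K V d p \<and> p x \<noteq> 0 \<and> poly (p x) a = 0"
proof -
  obtain q where q: "q \<noteq> 0" "coeffs_in q (gen_field (K \<union> x ` V))" "poly q a = 0"
    using assms unfolding alg_over_def by blast
  have "\<forall>i. \<exists>f g. f \<in> polyfun K V \<and> g \<in> polyfun K V \<and> g x \<noteq> 0 \<and> coeff q i = f x / g x"
    using q(2) gen_field_fraction unfolding coeffs_in_def by blast
  then obtain f g where fg: "\<And>i. f i \<in> polyfun K V" "\<And>i. g i \<in> polyfun K V" "\<And>i. g i x \<noteq> 0"
    "\<And>i. coeff q i = f i x / g i x" by metis
  let ?d = "degree q"
  \<comment> \<open>The coefficient quotients multiplied by the product of all denominators; leaving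
    out factor \<open>i\<close> clears the i-th one.\<close>
  define p where "p y = (\<Sum>i\<le>?d. monom (f i y * (\<Prod>j\<in>{..?d} - {i}. g j y)) i)" for y
  have c: "coeff (p y) i = (if i \<le> ?d then f i y * (\<Prod>j\<in>{..?d} - {i}. g j y) else 0)" for y i
    unfolding p_def by (simp add: coeff_sum if_distrib cong: if_cong)
  have "poly_family K V ?d p" unfolding poly_family_def
  proof (intro conjI allI)
    fix i show "(\<lambda>y. coeff (p y) i) \<in> polyfun K V"
      unfolding c by (cases "i \<le> ?d") (auto intro!: polyfun_0 polyfun_mult polyfun_prod fg)
  next
    fix y show "degree (p y) \<le> ?d" by (rule degree_le) (simp add: c)
  qed
  moreover have px: "p x = Polynomial.smult (\<Prod>j\<le>?d. g j x) q"
  proof (rule poly_eqI)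
    fix i show "coeff (p x) i = coeff (Polynomial.smult (\<Prod>j\<le>?d. g j x) q) i"
    proof (cases "i \<le> ?d")
      case True
      then have "(\<Prod>j\<le>?d. g j x) = g i x * (\<Prod>j\<in>{..?d} - {i}. g j x)"
        by (simp add: prod.remove)
      then show ?thesis using True fg(3)[of i] by (simp add: c fg(4))
    qed (simp add: c coeff_eq_0)
  qed
  moreover have "(\<Prod>j\<le>?d. g j x) \<noteq> 0" using fg(3) by simp
  ultimately show ?thesis using q by (intro exI[of _ p] exI[of _ ?d]) simp
qed


section \<open>Multivariate polynomials\<close>

definition monval :: "('v \<Rightarrow>\<^sub>0 nat) \<Rightarrow> ('v \<Rightarrow> 'k::field) \<Rightarrow> 'k" where
  "monval m x = (\<Prod>i\<in>Poly_Mapping.keys m. x i ^ Poly_Mapping.lookup m i)"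

lemma monval_superset:
  assumes "finite A" "Poly_Mapping.keys m \<subseteq> A"
  shows "monval m x = (\<Prod>i\<in>A. x i ^ Poly_Mapping.lookup m i)"
  unfolding monval_def using assms by (intro prod.mono_neutral_left) (auto simp: in_keys_iff)

lemma monval_add: "monval (m + m') x = monval m x * monval m' x"
proof -
  let ?A = "Poly_Mapping.keys m \<union> Poly_Mapping.keys m'"
  have "Poly_Mapping.keys (m + m') \<subseteq> ?A" by (rule keys_add)
  then show ?thesis
    by (simp add: monval_superset[of ?A] lookup_add power_add prod.distrib)
qed

lemma monval_times: "monval m (\<lambda>i. x i * y i) = monval m x * monval m y"
  unfolding monval_def by (simp add: power_mult_distrib prod.distrib)

definition ev :: "('v, 'k::field) mpoly \<Rightarrow> ('v \<Rightarrow> 'k) \<Rightarrow> 'k" where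
  "ev p = mpoly_eval id p"

lemma ev_superset:
  assumes "finite A" "Poly_Mapping.keys p \<subseteq> A"
  shows "ev p x = (\<Sum>m\<in>A. Poly_Mapping.lookup p m * monval m x)"
  unfolding ev_def mpoly_eval_def monval_def[symmetric] id_apply using assms
  by (intro sum.mono_neutral_left) (auto simp: in_keys_iff)

lemma ev_add: "ev (p + q) x = ev p x + ev q x"
proof -
  let ?A = "Poly_Mapping.keys p \<union> Poly_Mapping.keys q"
  have "Poly_Mapping.keys (p + q) \<subseteq> ?A" by (rule keys_add)
  then show ?thesis
    by (simp add: ev_superset[of ?A] lookup_add sum.distrib distrib_right)
qed

lemma ev_0 [simp]: "ev 0 x = 0"
  unfolding ev_def mpoly_eval_def by simp

lemma ev_sum: "ev (\<Sum>i\<in>A. p i) x = (\<Sum>i\<in>A. ev (p i) x)"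
  by (induction A rule: infinite_finite_induct) (auto simp: ev_add)

lemma ev_single: "ev (Poly_Mapping.single m c) x = c * monval m x"
  unfolding ev_def mpoly_eval_def monval_def[symmetric] by simp

lemma mpoly_expand:
  "p = (\<Sum>m\<in>Poly_Mapping.keys p. Poly_Mapping.single m (Poly_Mapping.lookup p m))"
proof (rule poly_mapping_eqI)
  fix k
  have "Poly_Mapping.lookup (\<Sum>m\<in>Poly_Mapping.keys p. Poly_Mapping.single m (Poly_Mapping.lookup p m)) k
      = (\<Sum>m\<in>Poly_Mapping.keys p. if m = k then Poly_Mapping.lookup p k else 0)"
    unfolding lookup_sum by (rule sum.cong) (auto simp: lookup_single when_def)
  then show "Poly_Mapping.lookup p k =
      Poly_Mapping.lookup (\<Sum>m\<in>Poly_Mapping.keys p. Poly_Mapping.single m (Poly_Mapping.lookup p m)) k"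
    by (simp add: in_keys_iff)
qed

lemma mpoly_mult_expand:
  fixes p q :: "('v, 'k::field) mpoly"
  shows "p * q = (\<Sum>m\<in>Poly_Mapping.keys p. \<Sum>m'\<in>Poly_Mapping.keys q.
      Poly_Mapping.single (m + m') (Poly_Mapping.lookup p m * Poly_Mapping.lookup q m'))"
  by (rule trans[OF arg_cong2[of _ _ _ _ "(*)", OF mpoly_expand[of p] mpoly_expand[of q]]])
     (simp only: sum_product mult_single)

lemma ev_mult:
  fixes p q :: "('v, 'k::field) mpoly"
  shows "ev (p * q) x = ev p x * ev q x"
proof -
  have "p * q = (\<Sum>m\<in>Poly_Mapping.keys p. \<Sum>m'\<in>Poly_Mapping.keys q.
      Poly_Mapping.single (m + m') (Poly_Mapping.lookup p m * Poly_Mapping.lookup q m'))"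
    by (rule mpoly_mult_expand)
  then have "ev (p * q) x = (\<Sum>m\<in>Poly_Mapping.keys p. \<Sum>m'\<in>Poly_Mapping.keys q.
      (Poly_Mapping.lookup p m * monval m x) * (Poly_Mapping.lookup q m' * monval m' x))"
    by (simp add: ev_sum ev_single monval_add mult_ac)
  also have "\<dots> = ev p x * ev q x"
    unfolding sum_product[symmetric] by (simp add: ev_def mpoly_eval_def monval_def)
  finally show ?thesis .
qed

definition mpoly_over :: "'k::zero set \<Rightarrow> 'v set \<Rightarrow> ('v, 'k) mpoly \<Rightarrow> bool" where
  "mpoly_over K V p \<longleftrightarrow> range (Poly_Mapping.lookup p) \<subseteq> K \<and> mpoly_vars p \<subseteq> V"

lemma mpoly_over_sum:
  fixes p :: "'i \<Rightarrow> ('v, 'k::field) mpoly"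
  assumes "is_subring K" "\<And>i. i \<in> A \<Longrightarrow> mpoly_over K V (p i)"
  shows "mpoly_over K V (\<Sum>i\<in>A. p i)"
proof -
  have "Poly_Mapping.lookup (\<Sum>i\<in>A. p i) m \<in> K" for m
    unfolding lookup_sum using assms by (intro is_subring_sum) (auto simp: mpoly_over_def)
  moreover have "Poly_Mapping.keys m \<subseteq> V" if "m \<in> Poly_Mapping.keys (\<Sum>i\<in>A. p i)" for m
  proof -
    have "(\<Sum>i\<in>A. Poly_Mapping.lookup (p i) m) \<noteq> 0" using that by (simp add: in_keys_iff lookup_sum)
    then obtain i where "i \<in> A" "Poly_Mapping.lookup (p i) m \<noteq> 0"
      by (rule sum.not_neutral_contains_not_neutral)
    then have "m \<in> Poly_Mapping.keys (p i)" "mpoly_vars (p i) \<subseteq> V"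
      using assms(2)[of i] by (auto simp: mpoly_over_def in_keys_iff)
    then show ?thesis unfolding mpoly_vars_def by blast
  qed
  ultimately show ?thesis unfolding mpoly_over_def mpoly_vars_def by blast
qed

lemma mpoly_over_single:
  "is_subring K \<Longrightarrow> c \<in> K \<Longrightarrow> Poly_Mapping.keys m \<subseteq> V \<Longrightarrow> mpoly_over K V (Poly_Mapping.single m c)"
  unfolding mpoly_over_def mpoly_vars_def
  by (auto simp: lookup_single when_def is_subringD(1) split: if_splits)

lemma mpoly_over_mult:
  fixes p q :: "('v, 'k::field) mpoly"
  assumes K: "is_subring K" and p: "mpoly_over K V p" and q: "mpoly_over K V q"
  shows "mpoly_over K V (p * q)"
proof -
  have "p * q = (\<Sum>m\<in>Poly_Mapping.keys p. \<Sum>m'\<in>Poly_Mapping.keys q.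
      Poly_Mapping.single (m + m') (Poly_Mapping.lookup p m * Poly_Mapping.lookup q m'))"
    by (rule mpoly_mult_expand)
  moreover have "mpoly_over K V (\<Sum>m\<in>Poly_Mapping.keys p. \<Sum>m'\<in>Poly_Mapping.keys q.
      Poly_Mapping.single (m + m') (Poly_Mapping.lookup p m * Poly_Mapping.lookup q m'))"
  proof (rule mpoly_over_sum[OF K], rule mpoly_over_sum[OF K], rule mpoly_over_single[OF K])
    fix m m' assume "m \<in> Poly_Mapping.keys p" "m' \<in> Poly_Mapping.keys q"
    then have "Poly_Mapping.keys m \<subseteq> V" "Poly_Mapping.keys m' \<subseteq> V"
      using p q unfolding mpoly_over_def mpoly_vars_def by (simp_all add: UN_subset_iff)
    then show "Poly_Mapping.keys (m + m') \<subseteq> V" using keys_add[of m m'] by blast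
    have "Poly_Mapping.lookup p m \<in> K" "Poly_Mapping.lookup q m' \<in> K"
      using p q unfolding mpoly_over_def by (simp_all add: image_subset_iff)
    then show "Poly_Mapping.lookup p m * Poly_Mapping.lookup q m' \<in> K" by (rule is_subringD(6)[OF K])
  qed
  ultimately show ?thesis by simp
qed

lemma polyfun_imp_mpoly:
  assumes "f \<in> polyfun K V" "is_subring R" "K \<subseteq> R"
  shows "\<exists>p. mpoly_over R V p \<and> f = ev p"
  using assms(1)
proof induction
  case polyfun_1
  have "mpoly_over R V (Poly_Mapping.single 0 1)"
    using assms(2) by (intro mpoly_over_single) (auto simp: is_subringD)
  then show ?case by (intro exI[of _ "Poly_Mapping.single 0 1"] conjI)
    (auto simp: ev_single monval_def fun_eq_iff simp del: single_one)
next
  case (polyfun_const c)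
  then have "mpoly_over R V (Poly_Mapping.single 0 c)"
    using assms(2,3) by (intro mpoly_over_single) auto
  then show ?case by (intro exI[of _ "Poly_Mapping.single 0 c"] conjI)
    (auto simp: ev_single monval_def fun_eq_iff)
next
  case (polyfun_var i)
  have "mpoly_over R V (Poly_Mapping.single (Poly_Mapping.single i 1) 1)"
    using assms(2) polyfun_var by (intro mpoly_over_single) (auto simp: is_subringD)
  then show ?case by (intro exI[of _ "Poly_Mapping.single (Poly_Mapping.single i 1) 1"] conjI)
    (auto simp: ev_single monval_def fun_eq_iff)
next
  case (polyfun_diff f g)
  then obtain p q where pq: "mpoly_over R V p" "f = ev p" "mpoly_over R V q" "g = ev q"
    by blast
  let ?m = "Poly_Mapping.single 0 (- 1)"
  have m: "mpoly_over R V ?m" using assms(2) by (intro mpoly_over_single) (auto simp: is_subringD)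
  let ?h = "\<lambda>b. if b then p else ?m * q"
  have "mpoly_over R V (\<Sum>b\<in>UNIV. ?h b)"
    by (rule mpoly_over_sum[OF assms(2)]) (use pq m mpoly_over_mult[OF assms(2)] in auto)
  moreover have "ev (\<Sum>b\<in>UNIV. ?h b) x = f x - g x" for x
    using pq by (simp add: UNIV_bool ev_add ev_mult ev_single monval_def)
  ultimately show ?case by (intro exI conjI ext) (assumption, simp)
next
  case (polyfun_mult f g)
  then obtain p q where pq: "mpoly_over R V p" "f = ev p" "mpoly_over R V q" "g = ev q"
    by blast
  then show ?case using mpoly_over_mult[OF assms(2) pq(1,3)]
    by (intro exI[of _ "p * q"]) (auto simp: ev_mult fun_eq_iff)
qed

lemma ev_polyfun:
  assumes "range (Poly_Mapping.lookup p) \<subseteq> K" "mpoly_vars p \<subseteq> V"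
  shows "ev p \<in> polyfun K V"
proof -
  have "(\<lambda>x. \<Sum>m\<in>Poly_Mapping.keys p. id (Poly_Mapping.lookup p m) *
      (\<Prod>i\<in>Poly_Mapping.keys m. x i ^ Poly_Mapping.lookup m i)) \<in> polyfun K V"
    using assms by (intro polyfun_sum polyfun_mult polyfun_prod polyfun_power polyfun_var polyfun_const)
      (auto simp: mpoly_vars_def)
  then show ?thesis unfolding ev_def mpoly_eval_def .
qed

text \<open>Artin's argument: distinct monomials are distinct characters of a monoid.\<close>

lemma monval_independent:
  fixes c :: "('v \<Rightarrow>\<^sub>0 nat) \<Rightarrow> 'k::field_char_0"
  assumes "finite A" "\<And>x. (\<Sum>m\<in>A. c m * monval m x) = 0" "m \<in> A"
  shows "c m = 0"
  using assms
proof (induction A arbitrary: c m rule: finite_induct)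
  case (insert m0 A)
  have A: "c m1 = 0" if m1: "m1 \<in> A" for m1
  proof -
    have "m1 \<noteq> m0" using m1 insert.hyps by auto
    then obtain i where i: "Poly_Mapping.lookup m1 i \<noteq> Poly_Mapping.lookup m0 i"
      using poly_mapping_eqI[of m1 m0] by auto
    \<comment> \<open>The value 2 in a single coordinate turns each monomial into a power of 2 and
      so separates \<open>m1\<close> from \<open>m0\<close> in characteristic 0. Scaling the
      argument by \<open>y\<close> and subtracting a multiple of the original relation eliminates
      \<open>m0\<close>.\<close>
    define y where "y j = (if j = i then 2 else 1 :: 'k)" for j
    have y: "monval m' y = 2 ^ Poly_Mapping.lookup m' i" for m'
    proof -
      have "monval m' y = (\<Prod>j\<in>insert i (Poly_Mapping.keys m'). y j ^ Poly_Mapping.lookup m' j)"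
        by (rule monval_superset) auto
      also have "\<dots> = (\<Prod>j\<in>{i}. y j ^ Poly_Mapping.lookup m' j)"
        by (rule prod.mono_neutral_right) (auto simp: y_def)
      finally show ?thesis by (simp add: y_def)
    qed
    have ne: "monval m1 y - monval m0 y \<noteq> 0"
    proof
      assume "monval m1 y - monval m0 y = 0"
      then have "(of_nat (2 ^ Poly_Mapping.lookup m1 i) :: 'k) = of_nat (2 ^ Poly_Mapping.lookup m0 i)"
        unfolding y by simp
      then have "(2::nat) ^ Poly_Mapping.lookup m1 i = 2 ^ Poly_Mapping.lookup m0 i"
        unfolding of_nat_eq_iff .
      then show False using i by simp
    qed
    have "(\<Sum>m\<in>A. (c m * (monval m y - monval m0 y)) * monval m x) = 0" for x
    proof -
      have e1: "(\<Sum>m\<in>insert m0 A. c m * monval m (\<lambda>j. y j * x j)) = 0" by (rule insert.prems(1))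
      have e2: "monval m0 y * (\<Sum>m\<in>insert m0 A. c m * monval m x) = 0" using insert.prems(1) by simp
      have "(\<Sum>m\<in>A. (c m * (monval m y - monval m0 y)) * monval m x)
          = (\<Sum>m\<in>A. c m * monval m (\<lambda>j. y j * x j)) - monval m0 y * (\<Sum>m\<in>A. c m * monval m x)"
        unfolding sum_distrib_left sum_subtractf[symmetric]
        by (rule sum.cong) (auto simp: monval_times algebra_simps)
      also have "\<dots> = (\<Sum>m\<in>insert m0 A. c m * monval m (\<lambda>j. y j * x j))
          - monval m0 y * (\<Sum>m\<in>insert m0 A. c m * monval m x)"
        using insert.hyps by (simp add: monval_times algebra_simps)
      finally show ?thesis using e1 e2 by simp
    qed
    then have "c m1 * (monval m1 y - monval m0 y) = 0"
      by (rule insert.IH[of "\<lambda>m. c m * (monval m y - monval m0 y)" m1, OF _ m1])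
    then show ?thesis using ne by simp
  qed
  have "(\<Sum>m\<in>insert m0 A. c m * monval m (\<lambda>_. 1)) = 0" by (rule insert.prems(1))
  then have "c m0 = 0" using insert.hyps A by (simp add: monval_def)
  then show ?case using A insert.prems(2) by auto
qed simp

lemma mpoly_eq_0_if_eval_0:
  fixes p :: "('v, 'k::field_char_0) mpoly"
  assumes "\<And>x. ev p x = 0"
  shows "p = 0"
proof (rule poly_mapping_eqI)
  fix m
  have "Poly_Mapping.lookup p m = 0" if "m \<in> Poly_Mapping.keys p"
    using assms that
    by (intro monval_independent[of "Poly_Mapping.keys p" "Poly_Mapping.lookup p" m])
       (auto simp: ev_superset[of "Poly_Mapping.keys p" p])
  then show "Poly_Mapping.lookup p m = Poly_Mapping.lookup 0 m" by (auto simp: in_keys_iff)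
qed

section \<open>Algebraic independence and transcendence degree\<close>

lemma poly_family_vanish:
  fixes x :: "'v \<Rightarrow> 'k::field_char_0"
  assumes p: "poly_family K V d p" and x: "x s \<notin> dcl (K \<union> x ` V)" and "poly (p x) (x s) = 0"
  shows "p x = 0"
proof (rule ccontr)
  assume "p x \<noteq> 0"
  moreover have "coeffs_in (p x) (gen_field (K \<union> x ` V))"
    unfolding coeffs_in_def using p polyfun_value_gen_field unfolding poly_family_def by blast
  ultimately have "alg_over (gen_field (K \<union> x ` V)) (x s)"
    using assms(3) unfolding alg_over_def by blast
  then show False using x dcl_iff_alg_over by blast
qed

text \<open>Expanded in its last variable, \<open>f\<close> has coefficients that vanish at the
  given point because that variable is transcendental over the others; induction makes them vanish
  identically.\<close>

lemma dindep_polyfun_zero: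
  fixes B :: "'k::field_char_0 set"
  assumes "finite B" "dindep Y B" "f \<in> polyfun (gen_field Y) B" "f id = 0"
  shows "f x = 0"
  using assms
proof (induction B arbitrary: f x rule: finite_induct)
  case empty
  then show ?case using polyfun_cong[of f "gen_field Y" "{}" x id] by (auto simp: id_def)
next
  case (insert s B)
  obtain p d where p: "poly_family (gen_field Y) B d p" "\<And>x. f x = poly (p x) (x s)"
    using polyfun_decompose[OF insert.prems(2)] by blast
  have "s \<notin> dcl (Y \<union> (insert s B - {s}))" using insert.prems(1) unfolding dcl.indep_def by blast
  then have "s \<notin> dcl (Y \<union> B)" using insert.hyps by simp
  moreover have "gen_field Y \<union> B \<subseteq> dcl (Y \<union> B)"
    using gen_field_subset_dcl[of Y] dcl_mono[of Y "Y \<union> B"] dcl_ext[of "Y \<union> B"] by blast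
  then have "dcl (gen_field Y \<union> B) \<subseteq> dcl (Y \<union> B)"
    using dcl_between[of "Y \<union> B" "gen_field Y \<union> B"] gen_field_ext[of Y] by auto
  ultimately have "id s \<notin> dcl (gen_field Y \<union> id ` B)" by auto
  then have "p id = 0"
    by (rule poly_family_vanish[OF p(1)]) (use p(2)[of id] insert.prems(3) in \<open>simp add: id_def\<close>)
  then have "coeff (p x) i = 0" for i x
    using insert.IH[of "\<lambda>x. coeff (p x) i" x] p(1) dcl.indep_subset[OF insert.prems(1), of B]
    unfolding poly_family_def by (auto simp: id_def)
  then have "p x = 0" for x by (simp add: poly_eqI)
  then show ?case unfolding p(2) by simp
qed

lemma alg_indep_iff_dindep:
  fixes B :: "'k::field_char_0 set"
  assumes fin: "finite B"
  shows "alg_indep (gen_field Y) B \<longleftrightarrow> dindep Y B"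
proof
  assume d: "dindep Y B"
  show "alg_indep (gen_field Y) B" unfolding alg_indep_def
  proof (intro allI impI)
    fix p :: "('k, 'k) mpoly"
    assume p: "range (Poly_Mapping.lookup p) \<subseteq> gen_field Y \<and> mpoly_vars p \<subseteq> B \<and> mpoly_eval id p id = 0"
    then have "ev p \<in> polyfun (gen_field Y) B" using ev_polyfun by blast
    then have "ev p x = 0" for x using dindep_polyfun_zero[OF fin d, of "ev p" x] p by (simp add: ev_def)
    then show "p = 0" by (rule mpoly_eq_0_if_eval_0)
  qed
next
  assume a: "alg_indep (gen_field Y) B"
  show "dindep Y B" unfolding dcl.indep_def
  proof safe
    fix s assume s: "s \<in> B" "s \<in> dcl (Y \<union> (B - {s}))"
    have "Y \<union> (B - {s}) \<subseteq> gen_field Y \<union> id ` (B - {s})" using gen_field_ext[of Y] by auto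
    then have "s \<in> dcl (gen_field Y \<union> id ` (B - {s}))" using s(2) dcl_mono by blast
    then have "alg_over (gen_field (gen_field Y \<union> id ` (B - {s}))) s" by (simp add: dcl_iff_alg_over)
    then obtain p d where p: "poly_family (gen_field Y) (B - {s}) d p" "p id \<noteq> 0" "poly (p id) s = 0"
      using alg_over_poly_family by blast
    have "(\<lambda>x. poly (p x) (x s)) \<in> polyfun (gen_field Y) B"
      by (rule poly_family_eval[OF p(1)]) (use s in auto)
    then obtain q where q: "mpoly_over (gen_field Y) B q" "(\<lambda>x. poly (p x) (x s)) = ev q"
      using polyfun_imp_mpoly[OF _ is_subfield_subring[OF is_subfield_gen] order_refl] by blast
    have "ev q id = 0" using q(2) p(3) by (metis id_apply)
    then have "q = 0" using a q(1) unfolding alg_indep_def mpoly_over_def ev_def by blast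
    then have z: "poly (p x) (x s) = 0" for x using q(2) by (metis ev_0)
    \<comment> \<open>Variable \<open>s\<close> does not occur in the coefficients, so it may be
      moved to any value \<open>t\<close> while the polynomial stays \<open>p id\<close>, which
      therefore has every element as a root.\<close>
    have "poly (p id) t = 0" for t
    proof -
      have "coeff (p (id(s := t))) i = coeff (p id) i" for i
        using p(1) polyfun_cong[of "\<lambda>x. coeff (p x) i" "gen_field Y" "B - {s}" "id(s := t)" id]
        unfolding poly_family_def by auto
      then have "p (id(s := t)) = p id" by (rule poly_eqI)
      then show ?thesis using z[of "id(s := t)"] by simp
    qed
    then have "p id = 0" using poly_all_0_iff_0 by blast
    then show False using p(2) by simp
  qed
qed

lemma alg_indep_subset: "alg_indep F B \<Longrightarrow> A \<subseteq> B \<Longrightarrow> alg_indep F A"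
  unfolding alg_indep_def by (meson order_trans)

text \<open>Passage from the choice-based degree of the predimension to the rank of the pregeometry.
  A basis of \<open>X\<close> over \<open>Y\<close> is also one of the field generated by
  both.\<close>

lemma trdeg_over_eq_drk:
  fixes X Y :: "'k::field_char_0 set"
  assumes "finite S" "X \<subseteq> dcl (Y \<union> S)"
  shows "trdeg_over X Y = drk Y X"
proof -
  obtain B where B: "B \<subseteq> X" "finite B" "dindep Y B" "X \<subseteq> dcl (Y \<union> B)" "card B = drk Y X"
    using dcl.rk_basis[OF assms] .
  have "X \<union> Y \<subseteq> dcl (Y \<union> B)" using B(4) dcl_ext[of "Y \<union> B"] by blast
  then have "gen_field (X \<union> Y) \<subseteq> dcl (Y \<union> B)" by (rule gen_field_least[OF is_subfield_dcl])
  moreover have "B \<subseteq> gen_field (X \<union> Y)" using B(1) gen_field_ext[of "X \<union> Y"] by blast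
  ultimately have "indep_rank (alg_indep (gen_field Y)) (gen_field (X \<union> Y)) = card B"
    using B by (intro dcl.indep_rank_eq[where Y = Y]) (auto simp: alg_indep_iff_dindep intro: alg_indep_subset)
  then show ?thesis unfolding trdeg_over_def B(5) .
qed

section \<open>Linear spans over a subfield\<close>

definition fspan :: "'k::field set \<Rightarrow> 'k set \<Rightarrow> 'k set" where
  "fspan F S = {\<Sum>b\<in>T. u b * b | T u. finite T \<and> T \<subseteq> S \<and> (\<forall>b\<in>T. u b \<in> F)}"

definition fsubspace :: "'k::field set \<Rightarrow> 'k set \<Rightarrow> bool" where
  "fsubspace F U \<longleftrightarrow> 0 \<in> U \<and> (\<forall>x\<in>U. \<forall>y\<in>U. x + y \<in> U) \<and> (\<forall>a\<in>F. \<forall>x\<in>U. a * x \<in> U)"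

lemma fsubspace_sum:
  assumes "fsubspace F U" "\<And>i. i \<in> A \<Longrightarrow> u i \<in> F" "\<And>i. i \<in> A \<Longrightarrow> x i \<in> U"
  shows "(\<Sum>i\<in>A. u i * x i) \<in> U"
  using assms(2,3) by (induction A rule: infinite_finite_induct) (use assms(1) in \<open>auto simp: fsubspace_def\<close>)

lemma fspan_least: "fsubspace F U \<Longrightarrow> S \<subseteq> U \<Longrightarrow> fspan F S \<subseteq> U"
proof
  fix x assume U: "fsubspace F U" "S \<subseteq> U" and "x \<in> fspan F S"
  then obtain T u where T: "finite T" "T \<subseteq> S" "\<forall>b\<in>T. u b \<in> F" "x = (\<Sum>b\<in>T. u b * b)"
    unfolding fspan_def by blast
  show "x \<in> U" unfolding T(4) by (rule fsubspace_sum[OF U(1)]) (use T U(2) in auto)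
qed

lemma fspanI: "finite T \<Longrightarrow> T \<subseteq> S \<Longrightarrow> (\<And>b. b \<in> T \<Longrightarrow> u b \<in> F) \<Longrightarrow> (\<Sum>b\<in>T. u b * b) \<in> fspan F S"
  unfolding fspan_def by blast

lemma fspan_fsubspace:
  assumes F: "is_subfield F"
  shows "fsubspace F (fspan F S)"
proof -
  note R = is_subfield_subring[OF F]
  show ?thesis unfolding fsubspace_def
  proof (intro conjI ballI)
    show "0 \<in> fspan F S" using fspanI[of "{}" S "\<lambda>_. 0" F] by simp
  next
    fix x y assume "x \<in> fspan F S" "y \<in> fspan F S"
    then obtain T u T' u' where T: "finite T" "T \<subseteq> S" "\<forall>b\<in>T. u b \<in> F" "x = (\<Sum>b\<in>T. u b * b)"
      and T': "finite T'" "T' \<subseteq> S" "\<forall>b\<in>T'. u' b \<in> F" "y = (\<Sum>b\<in>T'. u' b * b)"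
      unfolding fspan_def by blast
    let ?v = "\<lambda>b. (if b \<in> T then u b else 0) + (if b \<in> T' then u' b else 0)"
    have "x = (\<Sum>b\<in>T \<union> T'. (if b \<in> T then u b else 0) * b)"
      unfolding T(4) using T(1) T'(1) by (intro sum.mono_neutral_cong_left) auto
    moreover have "y = (\<Sum>b\<in>T \<union> T'. (if b \<in> T' then u' b else 0) * b)"
      unfolding T'(4) using T(1) T'(1) by (intro sum.mono_neutral_cong_left) auto
    ultimately have "x + y = (\<Sum>b\<in>T \<union> T'. ?v b * b)" by (simp add: sum.distrib distrib_right)
    moreover have "(\<Sum>b\<in>T \<union> T'. ?v b * b) \<in> fspan F S"
      by (rule fspanI) (use T T' in \<open>auto intro!: is_subringD[OF R]\<close>)
    ultimately show "x + y \<in> fspan F S" by simp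
  next
    fix a x assume a: "a \<in> F" and "x \<in> fspan F S"
    then obtain T u where T: "finite T" "T \<subseteq> S" "\<forall>b\<in>T. u b \<in> F" "x = (\<Sum>b\<in>T. u b * b)"
      unfolding fspan_def by blast
    have "a * x = (\<Sum>b\<in>T. (a * u b) * b)" unfolding T(4) by (simp add: sum_distrib_left mult.assoc)
    moreover have "(\<Sum>b\<in>T. (a * u b) * b) \<in> fspan F S"
      by (rule fspanI) (use T a in \<open>auto intro!: is_subringD[OF R]\<close>)
    ultimately show "a * x \<in> fspan F S" by simp
  qed
qed

lemma fspan_ext: "is_subfield F \<Longrightarrow> S \<subseteq> fspan F S"
proof
  fix x assume "is_subfield F" "x \<in> S"
  then show "x \<in> fspan F S" using fspanI[of "{x}" S "\<lambda>_. 1" F] by (simp add: is_subfield_def)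
qed

lemma fspan_insert:
  assumes F: "is_subfield F" and y: "y \<in> fspan F (insert x A)"
  obtains a z where "a \<in> F" "z \<in> fspan F A" "y = a * x + z"
proof -
  note R = is_subfield_subring[OF F]
  let ?U = "{a * x + z | a z. a \<in> F \<and> z \<in> fspan F A}"
  have S: "fsubspace F (fspan F A)" by (rule fspan_fsubspace[OF F])
  have "fsubspace F ?U" unfolding fsubspace_def
  proof (intro conjI ballI)
    show "0 \<in> ?U" using is_subringD(1)[OF R] S unfolding fsubspace_def by force
  next
    fix p q assume "p \<in> ?U" "q \<in> ?U"
    then obtain a z b w where e: "a \<in> F" "z \<in> fspan F A" "p = a * x + z" "b \<in> F" "w \<in> fspan F A" "q = b * x + w"
      by blast
    then have "p + q = (a + b) * x + (z + w)" by (simp add: algebra_simps)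
    moreover have "a + b \<in> F" "z + w \<in> fspan F A"
      using e is_subringD(5)[OF R] S unfolding fsubspace_def by blast+
    ultimately show "p + q \<in> ?U" by blast
  next
    fix c p assume "c \<in> F" "p \<in> ?U"
    then obtain a z where e: "a \<in> F" "z \<in> fspan F A" "p = a * x + z" by blast
    then have "c * p = (c * a) * x + c * z" by (simp add: algebra_simps)
    moreover have "c * a \<in> F" "c * z \<in> fspan F A"
      using e \<open>c \<in> F\<close> is_subringD(6)[OF R] S unfolding fsubspace_def by blast+
    ultimately show "c * p \<in> ?U" by blast
  qed
  moreover have "insert x A \<subseteq> ?U"
  proof
    fix y assume "y \<in> insert x A"
    then show "y \<in> ?U"
    proof
      assume "y = x"
      moreover have "x = 1 * x + 0" by simp
      ultimately show ?thesis using is_subringD(2)[OF R] S unfolding fsubspace_def by blast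
    next
      assume "y \<in> A"
      then have "y \<in> fspan F A" using fspan_ext[OF F, of A] by blast
      moreover have "y = 0 * x + y" by simp
      ultimately show ?thesis using is_subringD(1)[OF R] by blast
    qed
  qed
  ultimately have "fspan F (insert x A) \<subseteq> ?U" by (rule fspan_least)
  then have "y \<in> ?U" using y by (rule subsetD)
  then show ?thesis using that by (elim CollectE exE conjE) simp
qed

lemma fspan_mono: "A \<subseteq> B \<Longrightarrow> fspan F A \<subseteq> fspan F B"
  unfolding fspan_def by blast

lemma fspan_pregeometry:
  assumes F: "is_subfield F"
  shows "pregeometry (fspan F)"
proof
  fix A B :: "'a set" and x y
  show "A \<subseteq> fspan F A" by (rule fspan_ext[OF F])
  show "A \<subseteq> B \<Longrightarrow> fspan F A \<subseteq> fspan F B" by (rule fspan_mono)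
  show "fspan F (fspan F A) \<subseteq> fspan F A" by (rule fspan_least[OF fspan_fsubspace[OF F] order_refl])
  assume y: "y \<in> fspan F (insert x A)" "y \<notin> fspan F A"
  obtain a z where az: "a \<in> F" "z \<in> fspan F A" "y = a * x + z" using fspan_insert[OF F y(1)] .
  have a0: "a \<noteq> 0" using az y(2) by auto
  have S: "fsubspace F (fspan F (insert y A))" by (rule fspan_fsubspace[OF F])
  have "x = inverse a * y + (- inverse a) * z" using az(3) a0 by (simp add: field_simps)
  moreover have "inverse a \<in> F" "- inverse a \<in> F"
    using az(1) is_subfield_inverse[OF F] is_subringD(4)[OF is_subfield_subring[OF F]] by blast+
  moreover have "y \<in> fspan F (insert y A)" "z \<in> fspan F (insert y A)"
    using fspan_ext[OF F, of "insert y A"] fspan_mono[of A "insert y A" F] az(2) by blast+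
  ultimately show "x \<in> fspan F (insert y A)" using S unfolding fsubspace_def by metis
qed

lemma lin_indep_iff:
  assumes F: "is_subfield F"
  shows "lin_indep F B \<longleftrightarrow> pregeometry.indep (fspan F) B"
proof -
  interpret pregeometry "fspan F" by (rule fspan_pregeometry[OF F])
  note R = is_subfield_subring[OF F]
  show ?thesis
  proof
    assume L: "lin_indep F B"
    show "indep B" unfolding indep_def
    proof (intro ballI notI)
      fix b assume b: "b \<in> B" "b \<in> fspan F (B - {b})"
      then obtain T u where T: "finite T" "T \<subseteq> B - {b}" "\<forall>c\<in>T. u c \<in> F" "b = (\<Sum>c\<in>T. u c * c)"
        unfolding fspan_def by blast
      let ?u = "u(b := - 1)"
      have bT: "b \<notin> T" using T(2) by blast
      have "(\<Sum>c\<in>T. ?u c * c) = (\<Sum>c\<in>T. u c * c)" by (rule sum.cong) (use bT in auto)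
      then have "(\<Sum>c\<in>insert b T. ?u c * c) = 0" using T(1,4) bT by simp
      moreover have "\<forall>c\<in>insert b T. ?u c \<in> F" using T(3) is_subringD(2,4)[OF R] by auto
      moreover have "insert b T \<subseteq> B" using T(2) b(1) by blast
      ultimately have "?u b = 0"
        using L[unfolded lin_indep_def, THEN spec, THEN spec, THEN mp, of "insert b T" ?u] T(1) by simp
      then show False by simp
    qed
  next
    assume I: "indep B"
    show "lin_indep F B" unfolding lin_indep_def
    proof (intro allI impI ballI, rule ccontr)
      fix S u b
      assume H: "finite S \<and> S \<subseteq> B \<and> (\<forall>b\<in>S. u b \<in> F) \<and> (\<Sum>b\<in>S. u b * b) = 0" and b: "b \<in> S" "u b \<noteq> 0"
      have "u b * b + (\<Sum>c\<in>S - {b}. u c * c) = 0" using H b(1) sum.remove[of S b "\<lambda>b. u b * b"] by simp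
      then have "u b * b = - (\<Sum>c\<in>S - {b}. u c * c)" by (simp add: eq_neg_iff_add_eq_0)
      then have "b = (- inverse (u b)) * (\<Sum>c\<in>S - {b}. u c * c)"
        using b(2) by (simp add: field_simps)
      then have "b = (\<Sum>c\<in>S - {b}. (- inverse (u b) * u c) * c)"
        by (simp only: sum_distrib_left mult.assoc)
      moreover have "(\<Sum>c\<in>S - {b}. (- inverse (u b) * u c) * c) \<in> fspan F (B - {b})"
      proof (rule fspanI)
        fix c assume c: "c \<in> S - {b}"
        then have "u b \<in> F" "u c \<in> F" using H b(1) by auto
        then show "- inverse (u b) * u c \<in> F"
          by (intro is_subringD(4,6)[OF R] is_subfield_inverse[OF F])
      qed (use H in auto)
      ultimately have "b \<in> fspan F (B - {b})" by simp
      then show False using I H b(1) unfolding indep_def by blast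
    qed
  qed
qed

text \<open>Adjoining \<open>a\<close> multiplies the spanning set by the powers of \<open>a\<close>
  below the degree of its minimal polynomial, since higher powers reduce modulo it. That
  \<open>X\<close> stays in the generated field later shows that the ring is algebraic over
  \<open>F\<close>.\<close>

lemma finite_ring_extension:
  fixes V :: "'k::field set"
  assumes F: "is_subfield F" and "finite V" "\<And>a. a \<in> V \<Longrightarrow> alg_over F a"
  shows "\<exists>X. finite X \<and> is_subring (fspan F X) \<and> F \<union> V \<subseteq> fspan F X \<and> X \<subseteq> gen_field (F \<union> V)"
  using assms(2,3)
proof (induction V rule: finite_induct)
  case empty
  have "fspan F {1} = F"
  proof
    show "fspan F {1} \<subseteq> F"
      by (rule fspan_least) (use is_subringD[OF is_subfield_subring[OF F]] in \<open>auto simp: fsubspace_def\<close>)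
    show "F \<subseteq> fspan F {1}" using fspanI[of "{1}" "{1}" "\<lambda>_. _" F] by auto
  qed
  moreover have "1 \<in> gen_field (F \<union> {})" by (rule is_subringD(2)[OF is_subfield_subring[OF is_subfield_gen]])
  ultimately show ?case using is_subfield_subring[OF F] by (intro exI[of _ "{1}"]) auto
next
  case (insert a V)
  then obtain X where X: "finite X" "is_subring (fspan F X)" "F \<union> V \<subseteq> fspan F X"
    "X \<subseteq> gen_field (F \<union> V)" by auto
  obtain m where m: "coeffs_in m F" "lead_coeff m = 1" "poly m a = 0"
    using min_poly_exists[OF F insert.prems[of a]] by auto
  let ?U = "fspan F X" and ?X = "(\<lambda>(x, i). x * a ^ i) ` (X \<times> {..<degree m})"
  let ?P = "{poly p a | p. coeffs_in p ?U}"
  have mU: "coeffs_in m ?U" using m(1) X(3) unfolding coeffs_in_def by blast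
  have S: "fsubspace F ?U" by (rule fspan_fsubspace[OF F])
  have SX: "fsubspace F (fspan F ?X)" by (rule fspan_fsubspace[OF F])
  have rP: "is_subring ?P" by (rule is_subring_poly_image[OF X(2)])
  have UP: "?U \<subseteq> ?P" by (rule subset_poly_image[OF X(2)])
  have aP: "a \<in> ?P" by (rule mem_poly_image[OF X(2)])
  have "fspan F ?X = ?P"
  proof
    show "fspan F ?X \<subseteq> ?P"
    proof (rule fspan_least)
      show "fsubspace F ?P" unfolding fsubspace_def
        using is_subringD(1,5,6)[OF rP] UP X(3) by (meson Un_subset_iff subsetD)
      show "?X \<subseteq> ?P"
      proof
        fix z assume "z \<in> ?X"
        then obtain x i where x: "x \<in> X" "z = x * a ^ i" by auto
        then have "x \<in> ?P" using fspan_ext[OF F, of X] UP by (meson subsetD)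
        then show "z \<in> ?P" unfolding x(2) by (rule is_subringD(6)[OF rP _ is_subring_power[OF rP aP]])
      qed
    qed
    show "?P \<subseteq> fspan F ?X"
    proof
      fix z assume "z \<in> ?P"
      then obtain p where p: "coeffs_in p ?U" "z = poly p a" by (elim CollectE exE conjE) simp
      obtain r q where rq: "coeffs_in r ?U" "p = q * m + r" "r = 0 \<or> degree r < degree m"
        using monic_reduce[OF X(2) mU m(2) p(1)] by blast
      have xa: "y * a ^ i \<in> fspan F ?X" if "y \<in> ?U" "i < degree m" for y i
      proof -
        have "fsubspace F {y. y * a ^ i \<in> fspan F ?X}"
          using SX unfolding fsubspace_def by (auto simp: distrib_right mult.assoc)
        moreover have "X \<subseteq> {y. y * a ^ i \<in> fspan F ?X}"
          using fspan_ext[OF F, of ?X] that(2) by auto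
        ultimately have "?U \<subseteq> {y. y * a ^ i \<in> fspan F ?X}" by (rule fspan_least)
        then show ?thesis using that(1) by blast
      qed
      have "poly r a \<in> fspan F ?X"
      proof (cases "r = 0")
        case True then show ?thesis using SX by (simp add: fsubspace_def)
      next
        case False
        then have d: "degree r < degree m" using rq(3) by simp
        have "(\<Sum>i\<le>degree r. 1 * (coeff r i * a ^ i)) \<in> fspan F ?X"
          by (rule fsubspace_sum[OF SX])
             (use d rq(1) xa is_subringD(2)[OF is_subfield_subring[OF F]] in \<open>auto simp: coeffs_in_def\<close>)
        then show ?thesis by (simp add: poly_altdef)
      qed
      then show "z \<in> fspan F ?X" using p(2) rq(2) m(3) by simp
    qed
  qed
  moreover have "F \<union> insert a V \<subseteq> ?P" using aP UP X(3) by auto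
  moreover have "?X \<subseteq> gen_field (F \<union> insert a V)"
  proof
    fix z assume "z \<in> ?X"
    then obtain x i where x: "x \<in> X" "z = x * a ^ i" by auto
    note RG = is_subfield_subring[OF is_subfield_gen[of "F \<union> insert a V"]]
    have "gen_field (F \<union> V) \<subseteq> gen_field (F \<union> insert a V)" by (rule gen_field_mono) blast
    then have "x \<in> gen_field (F \<union> insert a V)" using x(1) X(4) by (meson subsetD)
    moreover have "a \<in> gen_field (F \<union> insert a V)" using gen_field_ext[of "F \<union> insert a V"] by auto
    ultimately show "z \<in> gen_field (F \<union> insert a V)"
      unfolding x(2) by (intro is_subringD(6)[OF RG] is_subring_power[OF RG])
  qed
  ultimately show ?case using rP X(1) by (intro exI[of _ ?X]) auto
qed

text \<open>Multiplication by \<open>y\<close> is injective on a finite-dimensional space, hence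
  surjective: the multiples of a basis are again a basis, and 1 is a combination of them.\<close>

lemma finite_ring_inverse:
  assumes F: "is_subfield F" and X: "finite X" "is_subring (fspan F X)" and y: "y \<in> fspan F X" "y \<noteq> 0"
  shows "inverse y \<in> fspan F X"
proof -
  interpret pregeometry "fspan F" by (rule fspan_pregeometry[OF F])
  let ?U = "fspan F X"
  obtain B where B: "B \<subseteq> ?U" "finite B" "indep B" "?U \<subseteq> fspan F B" "card B = rk ?U"
    using rk_basis[OF X(1) order_refl] .
  have iy: "inverse y * (y * x) = x" for x using y(2) by (simp add: mult.assoc[symmetric])
  have sc: "x \<in> fspan F S" if x: "y * x \<in> fspan F ((*) y ` S)" for x S
  proof -
    have S: "fsubspace F (fspan F S)" by (rule fspan_fsubspace[OF F])
    have "fsubspace F {z. inverse y * z \<in> fspan F S}" unfolding fsubspace_def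
    proof (intro conjI ballI CollectI)
      show "inverse y * 0 \<in> fspan F S" using S by (simp add: fsubspace_def)
      fix p q assume "p \<in> {z. inverse y * z \<in> fspan F S}" "q \<in> {z. inverse y * z \<in> fspan F S}"
      then have "inverse y * p + inverse y * q \<in> fspan F S" using S by (simp add: fsubspace_def)
      then show "inverse y * (p + q) \<in> fspan F S" by (simp only: distrib_left)
    next
      fix a p assume "a \<in> F" "p \<in> {z. inverse y * z \<in> fspan F S}"
      then have "a * (inverse y * p) \<in> fspan F S" using S by (simp add: fsubspace_def)
      then show "inverse y * (a * p) \<in> fspan F S" by (simp only: mult.left_commute)
    qed
    moreover have "(*) y ` S \<subseteq> {z. inverse y * z \<in> fspan F S}"
      using fspan_ext[OF F, of S] by (auto simp: iy)
    ultimately have "fspan F ((*) y ` S) \<subseteq> {z. inverse y * z \<in> fspan F S}" by (rule fspan_least)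
    then have "inverse y * (y * x) \<in> fspan F S" using x by blast
    then show ?thesis unfolding iy .
  qed
  have inj: "inj_on ((*) y) B" using y(2) by (auto simp: inj_on_def)
  have yB: "indep ((*) y ` B)" unfolding indep_def
  proof (intro ballI notI)
    fix z assume "z \<in> (*) y ` B" and z: "z \<in> fspan F ((*) y ` B - {z})"
    then obtain b where b: "b \<in> B" "z = y * b" by blast
    have "(*) y ` B - {z} = (*) y ` (B - {b})" unfolding b(2) using y(2) by auto
    then have "y * b \<in> fspan F ((*) y ` (B - {b}))" using z b(2) by simp
    then have "b \<in> fspan F (B - {b})" by (rule sc)
    then show False using B(3) b(1) unfolding indep_def by simp
  qed
  have yU: "(*) y ` B \<subseteq> ?U" using B(1) y(1) is_subringD(6)[OF X(2)] by auto
  have "1 \<in> fspan F ((*) y ` B)"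
  proof (rule ccontr)
    assume n: "1 \<notin> fspan F ((*) y ` B)"
    then have "indep (insert 1 ((*) y ` B))" by (rule indep_insert[OF yB])
    moreover have "insert 1 ((*) y ` B) \<subseteq> fspan F B" using yU is_subringD(2)[OF X(2)] B(4) by auto
    ultimately have "card (insert 1 ((*) y ` B)) \<le> card B" using steinitz[OF B(2)] by blast
    moreover have "1 \<notin> (*) y ` B" using n fspan_ext[OF F, of "(*) y ` B"] by blast
    ultimately show False using B(2) inj by (simp add: card_image)
  qed
  then have "y * inverse y \<in> fspan F ((*) y ` B)" using y(2) by simp
  then have "inverse y \<in> fspan F B" by (rule sc)
  then show ?thesis using cl_leI[OF B(1)] by blast
qed


section \<open>Logarithmic derivatives and norms\<close>

lemma det_mat_expand:
  "det (mat s s (\<lambda>(i, j). A i j)) = (\<Sum>p | p permutes {0..<s}. signof p * (\<Prod>i<s. A i (p i)))"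
proof -
  have "(\<Prod>i = 0..<s. mat s s (\<lambda>(i, j). A i j) $$ (i, p i)) = (\<Prod>i<s. A i (p i))"
    if "p permutes {0..<s}" for p
  proof (rule prod.cong)
    fix i assume "i \<in> {..<s}"
    moreover from this have "p i < s" using permutes_in_image[OF that, of i] by simp
    ultimately show "mat s s (\<lambda>(i, j). A i j) $$ (i, p i) = A i (p i)" by simp
  qed (simp add: atLeast0LessThan)
  then show ?thesis by (subst det_def'[of _ s]) (auto intro!: sum.cong)
qed

text \<open>Any permutation other than the identity moves some index besides \<open>k\<close> and
  meets a zero entry there.\<close>

lemma det_replaced_row:
  fixes N :: "nat \<Rightarrow> 'k::field"
  assumes "k < s"
  shows "det (mat s s (\<lambda>(i, j). if i = k then N j else if i = j then 1 else 0)) = N k"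
proof -
  let ?E = "\<lambda>i j. if i = k then N j else if i = j then 1 else 0"
  have "signof p * (\<Prod>i<s. ?E i (p i)) = 0" if p: "p permutes {0..<s}" "p \<noteq> id" for p
  proof -
    obtain a where a: "p a \<noteq> a" using p(2) by (auto simp: fun_eq_iff)
    have "p (p a) \<noteq> p a" using a p(1) by (metis permutes_def)
    then obtain b where b: "b \<noteq> k" "p b \<noteq> b" using a by (cases "a = k") auto
    then have "b < s" using p(1) unfolding permutes_def by (metis atLeastLessThan_iff zero_le)
    moreover have "?E b (p b) = 0" using b by auto
    ultimately have "(\<Prod>i<s. ?E i (p i)) = 0" by (intro prod_zero bexI[of _ b]) simp_all
    then show ?thesis by simp
  qed
  then have "(\<Sum>p | p permutes {0..<s}. signof p * (\<Prod>i<s. ?E i (p i)))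
      = (\<Sum>p\<in>{id}. signof p * (\<Prod>i<s. ?E i (p i)))"
    by (intro sum.mono_neutral_right) (auto simp: permutes_id finite_permutations)
  also have "\<dots> = (\<Prod>i<s. ?E i (id i))" by simp
  also have "\<dots> = (\<Prod>i<s. if i = k then N k else 1)" by (rule prod.cong) auto
  also have "\<dots> = N k" using assms by simp
  finally show ?thesis unfolding det_mat_expand .
qed

lemma Der_signof: "d \<in> Der S \<Longrightarrow> d (signof p * x) = signof p * d x"
  by (simp add: sign_def Der_minus)

text \<open>Liouville's formula for dA = N A. The Leibniz rule differentiates one row at a time;
  replacing row \<open>k\<close> of A by row \<open>k\<close> of N A amounts to multiplying A by the
  identity matrix with row \<open>k\<close> replaced, whose determinant is
  \<open>N k k\<close>.\<close>

lemma Der_det: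
  fixes A N :: "nat \<Rightarrow> nat \<Rightarrow> 'k::field"
  assumes d: "d \<in> Der S" and DA: "\<And>i j. i < s \<Longrightarrow> j < s \<Longrightarrow> d (A i j) = (\<Sum>l<s. N i l * A l j)"
  shows "d (det (mat s s (\<lambda>(i, j). A i j))) = (\<Sum>k<s. N k k) * det (mat s s (\<lambda>(i, j). A i j))"
proof -
  let ?M = "mat s s (\<lambda>(i, j). A i j)"
  have "d (det ?M) = (\<Sum>p | p permutes {0..<s}. \<Sum>k<s. signof p * (d (A k (p k)) * (\<Prod>i\<in>{..<s} - {k}. A i (p i))))"
    unfolding det_mat_expand by (simp add: Der_sum[OF d] Der_signof[OF d] Der_prod[OF _ d] sum_distrib_left)
  also have "\<dots> = (\<Sum>k<s. \<Sum>p | p permutes {0..<s}. signof p * (d (A k (p k)) * (\<Prod>i\<in>{..<s} - {k}. A i (p i))))"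
    by (rule sum.swap)
  also have "\<dots> = (\<Sum>k<s. N k k * det ?M)"
  proof (rule sum.cong[OF refl])
    fix k assume "k \<in> {..<s}"
    then have k: "k < s" by simp
    let ?B = "\<lambda>i j. if i = k then (\<Sum>l<s. N k l * A l j) else A i j"
    let ?E = "mat s s (\<lambda>(i, j). if i = k then N k j else if i = j then 1 else 0)"
    have "(\<Sum>p | p permutes {0..<s}. signof p * (d (A k (p k)) * (\<Prod>i\<in>{..<s} - {k}. A i (p i))))
        = det (mat s s (\<lambda>(i, j). ?B i j))"
      unfolding det_mat_expand
    proof (rule sum.cong[OF refl])
      fix p assume "p \<in> {p. p permutes {0..<s}}"
      then have p: "p permutes {0..<s}" by simp
      have "p k < s" using permutes_in_image[OF p, of k] k by simp
      then have "d (A k (p k)) = ?B k (p k)" using DA[OF k] by simp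
      moreover have "(\<Prod>i\<in>{..<s} - {k}. A i (p i)) = (\<Prod>i\<in>{..<s} - {k}. ?B i (p i))"
        by (rule prod.cong) auto
      ultimately have "d (A k (p k)) * (\<Prod>i\<in>{..<s} - {k}. A i (p i)) = (\<Prod>i<s. ?B i (p i))"
        using k by (simp add: prod.remove[of "{..<s}" k "\<lambda>i. ?B i (p i)"])
      then show "signof p * (d (A k (p k)) * (\<Prod>i\<in>{..<s} - {k}. A i (p i))) = signof p * (\<Prod>i<s. ?B i (p i))"
        by simp
    qed
    also have "mat s s (\<lambda>(i, j). ?B i j) = ?E * ?M"
    proof (rule eq_matI)
      fix i j assume "i < dim_row (?E * ?M)" "j < dim_col (?E * ?M)"
      then have ij: "i < s" "j < s" by auto
      have "(?E * ?M) $$ (i, j) = (\<Sum>l<s. (if i = k then N k l else if i = l then 1 else 0) * A l j)"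
        using ij by (simp add: scalar_prod_def atLeast0LessThan)
      also have "\<dots> = ?B i j"
      proof (cases "i = k")
        case False
        then have "(\<Sum>l<s. (if i = k then N k l else if i = l then 1 else 0) * A l j) = (\<Sum>l<s. if l = i then A l j else 0)"
          by (intro sum.cong) auto
        then show ?thesis using False ij by simp
      qed simp
      finally show "mat s s (\<lambda>(i, j). ?B i j) $$ (i, j) = (?E * ?M) $$ (i, j)" using ij by simp
    qed auto
    also have "det (?E * ?M) = det ?E * det ?M" by (rule det_mult[of _ s]) auto
    also have "det ?E = N k k" by (rule det_replaced_row[OF k])
    finally show "(\<Sum>p | p permutes {0..<s}. signof p * (d (A k (p k)) * (\<Prod>i\<in>{..<s} - {k}. A i (p i)))) = N k k * det ?M" .
  qed
  finally show ?thesis by (simp add: sum_distrib_right)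
qed

text \<open>Conjugation leaves the trace unchanged: the left side is the trace of A G A' with A'
  inverse to A.\<close>

lemma trace_commutator:
  fixes A G A' :: "nat \<Rightarrow> nat \<Rightarrow> 'k::field"
  assumes inv: "\<And>i j. i < s \<Longrightarrow> j < s \<Longrightarrow> (\<Sum>l<s. A' i l * A l j) = (if i = j then 1 else 0)"
  shows "(\<Sum>k<s. \<Sum>l<s. \<Sum>m<s. A k l * G l m * A' m k) = (\<Sum>k<s. G k k)"
proof -
  have "(\<Sum>k<s. \<Sum>l<s. \<Sum>m<s. A k l * G l m * A' m k) = (\<Sum>l<s. \<Sum>k<s. \<Sum>m<s. A k l * G l m * A' m k)"
    by (rule sum.swap)
  also have "\<dots> = (\<Sum>l<s. \<Sum>m<s. \<Sum>k<s. A k l * G l m * A' m k)"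
    by (rule sum.cong[OF refl]) (rule sum.swap)
  also have "\<dots> = (\<Sum>l<s. \<Sum>m<s. G l m * (if m = l then 1 else 0))"
  proof (rule sum.cong[OF refl], rule sum.cong[OF refl])
    fix l m assume lm: "l \<in> {..<s}" "m \<in> {..<s}"
    have "(\<Sum>k<s. A k l * G l m * A' m k) = G l m * (\<Sum>k<s. A' m k * A k l)"
      unfolding sum_distrib_left by (rule sum.cong) (simp_all add: mult_ac)
    then show "(\<Sum>k<s. A k l * G l m * A' m k) = G l m * (if m = l then 1 else 0)"
      using inv[of m l] lm by simp
  qed
  also have "\<dots> = (\<Sum>l<s. G l l)" by (rule sum.cong[OF refl]) (simp add: if_distrib cong: if_cong)
  finally show ?thesis .
qed

text \<open>A finite field extension of \<open>M\<close> inside the ambient field, with basis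
  \<open>b\<close>, both fields stable under \<open>D\<close>. The basis is indexed by numbers
  because matrices are.\<close>

locale finite_diff_extension =
  fixes M :: "'k::field_char_0 set" and U :: "'k set" and b :: "nat \<Rightarrow> 'k" and s :: nat
    and D :: "'k \<Rightarrow> 'k" and S :: "'k set"
  assumes M: "is_subfield M" and U: "is_subfield U"
    and D: "D \<in> Der S"
    and DU: "\<And>u. u \<in> U \<Longrightarrow> D u \<in> U"
    and bU: "\<And>i. i < s \<Longrightarrow> b i \<in> U"
    and spans: "\<And>u. u \<in> U \<Longrightarrow> \<exists>c. (\<forall>i<s. c i \<in> M) \<and> u = (\<Sum>i<s. c i * b i)"
    and unique: "\<And>c i. (\<And>i. i < s \<Longrightarrow> c i \<in> M) \<Longrightarrow> (\<Sum>i<s. c i * b i) = 0 \<Longrightarrow> i < s \<Longrightarrow> c i = 0"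
    and DM: "\<And>u. u \<in> M \<Longrightarrow> D u \<in> M"
begin

text \<open>\<open>A\<close> is the coordinate matrix of the family \<open>f\<close>. For
  \<open>f i = v * b i\<close> it is the matrix of multiplication by \<open>v\<close>, with norm and
  trace of \<open>v\<close> as determinant and trace.\<close>

definition represents :: "(nat \<Rightarrow> 'k) \<Rightarrow> (nat \<Rightarrow> nat \<Rightarrow> 'k) \<Rightarrow> bool" where
  "represents f A \<longleftrightarrow> (\<forall>i<s. \<forall>j<s. A i j \<in> M) \<and> (\<forall>i<s. f i = (\<Sum>l<s. A i l * b l))"

lemma represents_ex:
  assumes "\<And>i. i < s \<Longrightarrow> f i \<in> U"
  shows "\<exists>A. represents f A"
proof -
  have "\<forall>i. \<exists>c. i < s \<longrightarrow> (\<forall>l<s. c l \<in> M) \<and> f i = (\<Sum>l<s. c l * b l)"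
    using spans assms by blast
  then obtain A where "\<forall>i. i < s \<longrightarrow> (\<forall>l<s. A i l \<in> M) \<and> f i = (\<Sum>l<s. A i l * b l)"
    by metis
  then show ?thesis unfolding represents_def by blast
qed

lemma represents_unique:
  assumes "represents f A" "represents f B" "i < s" "j < s"
  shows "A i j = B i j"
proof -
  note R = is_subfield_subring[OF M]
  have "(\<Sum>l<s. (A i l - B i l) * b l) = 0"
    using assms unfolding represents_def by (simp add: left_diff_distrib sum_subtractf)
  moreover have "A i l - B i l \<in> M" if "l < s" for l
    using assms that is_subringD(3)[OF R] unfolding represents_def by simp
  ultimately have "A i j - B i j = 0" using unique[of "\<lambda>l. A i l - B i l" j] assms(4) by blast
  then show ?thesis by simp
qed

lemma represents_compose:
  assumes "represents f A" "represents (\<lambda>i. v * b i) B"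
  shows "represents (\<lambda>i. v * f i) (\<lambda>i j. \<Sum>l<s. A i l * B l j)"
  unfolding represents_def
proof (intro conjI allI impI)
  fix i j assume "i < s" "j < s"
  then show "(\<Sum>l<s. A i l * B l j) \<in> M"
    using assms is_subringD(6)[OF is_subfield_subring[OF M]] unfolding represents_def
    by (intro is_subring_sum[OF is_subfield_subring[OF M]]) simp
next
  fix i assume i: "i < s"
  have "v * f i = (\<Sum>l<s. A i l * (v * b l))"
    using assms(1) i unfolding represents_def by (simp add: sum_distrib_left mult.left_commute)
  also have "\<dots> = (\<Sum>l<s. A i l * (\<Sum>j<s. B l j * b j))"
    using assms(2) unfolding represents_def by (intro sum.cong) auto
  also have "\<dots> = (\<Sum>l<s. \<Sum>j<s. A i l * B l j * b j)" by (simp add: sum_distrib_left mult.assoc)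
  also have "\<dots> = (\<Sum>j<s. (\<Sum>l<s. A i l * B l j) * b j)"
    unfolding sum_distrib_right by (rule sum.swap)
  finally show "v * f i = (\<Sum>j<s. (\<Sum>l<s. A i l * B l j) * b j)" .
qed

lemma represents_lin:
  assumes "represents f A" "represents g B" "a \<in> M" "c \<in> M"
  shows "represents (\<lambda>i. a * f i + c * g i) (\<lambda>i j. a * A i j + c * B i j)"
  using assms is_subringD(5,6)[OF is_subfield_subring[OF M]] unfolding represents_def
  by (auto simp: sum.distrib sum_distrib_left distrib_right mult.assoc)

lemma represents_id: "represents b (\<lambda>i j. if i = j then 1 else 0)"
  unfolding represents_def using is_subringD(1,2)[OF is_subfield_subring[OF M]]
  by (auto simp: if_distrib[of "\<lambda>x. x * _"] cong: if_cong)

text \<open>The logarithmic derivative of the norm is the trace of the logarithmic derivative. With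
  G the matrix of \<open>D\<close> on the basis, expanding D(v b) in two ways gives DA + AG = HA +
  GA; hence DA = N A with N = H + G - A G A', and the traces of G and A G A' cancel.\<close>

lemma norm_trace:
  assumes v: "v \<in> U" "v \<noteq> 0"
    and A: "represents (\<lambda>i. v * b i) A" and H: "represents (\<lambda>i. (D v / v) * b i) H"
  shows "det (mat s s (\<lambda>(i, j). A i j)) \<in> M" "det (mat s s (\<lambda>(i, j). A i j)) \<noteq> 0"
    "D (det (mat s s (\<lambda>(i, j). A i j))) / det (mat s s (\<lambda>(i, j). A i j)) = (\<Sum>k<s. H k k)"
proof -
  note RM = is_subfield_subring[OF M] and RU = is_subfield_subring[OF U]
  let ?A = "mat s s (\<lambda>(i, j). A i j)"
  have AM: "A i j \<in> M" if "i < s" "j < s" for i j using A that unfolding represents_def by blast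
  show "det ?A \<in> M" unfolding det_mat_expand
  proof (intro is_subring_sum[OF RM] is_subringD(6)[OF RM] is_subring_of_int[OF RM] is_subring_prod[OF RM])
    fix p i assume "p \<in> {p. p permutes {0..<s}}" "i \<in> {..<s}"
    then show "A i (p i) \<in> M" using permutes_in_image[of p "{0..<s}" i] by (intro AM) auto
  qed
  obtain A' where A': "represents (\<lambda>i. inverse v * b i) A'"
    using represents_ex[of "\<lambda>i. inverse v * b i"] bU v is_subringD(6)[OF RU] is_subfield_inverse[OF U]
    by blast
  obtain G where G: "represents (\<lambda>i. D (b i)) G"
    using represents_ex[of "\<lambda>i. D (b i)"] bU DU by blast
  have canc: "v * (inverse v * x) = x" "inverse v * (v * x) = x" for x
    using v(2) by (simp_all add: mult.assoc[symmetric])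
  have inv: "(\<Sum>l<s. A' i l * A l j) = (if i = j then 1 else 0)"
    "(\<Sum>l<s. A i l * A' l j) = (if i = j then 1 else 0)" if "i < s" "j < s" for i j
    using represents_unique[OF represents_compose[OF A' A, unfolded canc] represents_id that]
      represents_unique[OF represents_compose[OF A A', unfolded canc] represents_id that] by auto
  let ?A' = "mat s s (\<lambda>(i, j). A' i j)"
  have "?A * ?A' = 1\<^sub>m s"
    by (rule eq_matI) (auto simp: scalar_prod_def atLeast0LessThan inv(2))
  moreover have "det (?A * ?A') = det ?A * det ?A'" by (rule det_mult[of _ s]) auto
  ultimately have "det ?A * det ?A' = 1" by simp
  then show nz: "det ?A \<noteq> 0" by auto
  have HA: "represents (\<lambda>i. v * ((D v / v) * b i)) (\<lambda>i j. \<Sum>l<s. H i l * A l j)"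
    by (rule represents_compose[OF H A])
  have GA: "represents (\<lambda>i. v * D (b i)) (\<lambda>i j. \<Sum>l<s. G i l * A l j)"
    by (rule represents_compose[OF G A])
  have "represents (\<lambda>i. D (v * b i)) (\<lambda>i j. D (A i j) + (\<Sum>l<s. A i l * G l j))"
    unfolding represents_def
  proof (intro conjI allI impI)
    fix i j assume ij: "i < s" "j < s"
    have "(\<Sum>l<s. A i l * G l j) \<in> M"
      by (rule is_subring_sum[OF RM])
         (use ij AM G is_subringD(6)[OF RM] in \<open>auto simp: represents_def\<close>)
    then show "D (A i j) + (\<Sum>l<s. A i l * G l j) \<in> M" using DM AM ij is_subringD(5)[OF RM] by blast
  next
    fix i assume i: "i < s"
    have e: "D (b l) = (\<Sum>j<s. G l j * b j)" if "l < s" for l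
      using G that unfolding represents_def by blast
    have "D (v * b i) = D (\<Sum>l<s. A i l * b l)" using A i unfolding represents_def by metis
    also have "\<dots> = (\<Sum>l<s. A i l * D (b l)) + (\<Sum>l<s. D (A i l) * b l)"
      by (simp add: Der_sum[OF D] Der_mult[OF D] sum.distrib)
    also have "(\<Sum>l<s. A i l * D (b l)) = (\<Sum>l<s. \<Sum>j<s. A i l * G l j * b j)"
      by (rule sum.cong[OF refl]) (simp add: e sum_distrib_left mult.assoc)
    also have "\<dots> = (\<Sum>j<s. (\<Sum>l<s. A i l * G l j) * b j)"
      unfolding sum_distrib_right by (rule sum.swap)
    finally show "D (v * b i) = (\<Sum>j<s. (D (A i j) + (\<Sum>l<s. A i l * G l j)) * b j)"
      by (simp add: distrib_right sum.distrib)
  qed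
  moreover have "represents (\<lambda>i. D (v * b i)) (\<lambda>i j. (\<Sum>l<s. H i l * A l j) + (\<Sum>l<s. G i l * A l j))"
  proof -
    have "D (v * b i) = 1 * (v * ((D v / v) * b i)) + 1 * (v * D (b i))" for i
      using v(2) by (simp add: Der_mult[OF D] add.commute)
    then show ?thesis using represents_lin[OF HA GA, of 1 1] is_subringD(2)[OF RM] by simp
  qed
  ultimately have "D (A i j) + (\<Sum>l<s. A i l * G l j) = (\<Sum>l<s. H i l * A l j) + (\<Sum>l<s. G i l * A l j)"
    if "i < s" "j < s" for i j using represents_unique that by blast
  then have DA: "D (A i j) = (\<Sum>l<s. H i l * A l j) + (\<Sum>l<s. G i l * A l j) - (\<Sum>l<s. A i l * G l j)"
    if "i < s" "j < s" for i j using that by (simp add: eq_diff_eq)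
  define N where "N i l = H i l + G i l - (\<Sum>m<s. \<Sum>n<s. A i m * G m n * A' n l)" for i l
  have "D (A i j) = (\<Sum>l<s. N i l * A l j)" if ij: "i < s" "j < s" for i j
  proof -
    have "(\<Sum>l<s. (\<Sum>m<s. \<Sum>n<s. A i m * G m n * A' n l) * A l j)
        = (\<Sum>l<s. \<Sum>m<s. \<Sum>n<s. A i m * G m n * (A' n l * A l j))"
      by (simp add: sum_distrib_right mult.assoc)
    also have "\<dots> = (\<Sum>m<s. \<Sum>l<s. \<Sum>n<s. A i m * G m n * (A' n l * A l j))" by (rule sum.swap)
    also have "\<dots> = (\<Sum>m<s. \<Sum>n<s. \<Sum>l<s. A i m * G m n * (A' n l * A l j))"
      by (rule sum.cong[OF refl]) (rule sum.swap)
    also have "\<dots> = (\<Sum>m<s. \<Sum>n<s. A i m * G m n * (if n = j then 1 else 0))"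
      by (intro sum.cong refl) (simp add: sum_distrib_left[symmetric] inv(1) ij)
    also have "\<dots> = (\<Sum>m<s. A i m * G m j)"
      using ij by (intro sum.cong refl) (simp add: if_distrib cong: if_cong)
    finally have "(\<Sum>l<s. (\<Sum>m<s. \<Sum>n<s. A i m * G m n * A' n l) * A l j) = (\<Sum>m<s. A i m * G m j)" .
    then show ?thesis unfolding DA[OF ij] N_def
      by (simp add: left_diff_distrib distrib_right sum_subtractf sum.distrib)
  qed
  then have "D (det ?A) = (\<Sum>k<s. N k k) * det ?A" by (rule Der_det[OF D])
  moreover have "(\<Sum>k<s. N k k) = (\<Sum>k<s. H k k)"
  proof -
    have "(\<Sum>k<s. \<Sum>m<s. \<Sum>n<s. A k m * G m n * A' n k) = (\<Sum>k<s. G k k)"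
      by (rule trace_commutator) (rule inv(1))
    then show ?thesis unfolding N_def by (simp add: sum.distrib sum_subtractf)
  qed
  ultimately show "D (det ?A) / det ?A = (\<Sum>k<s. H k k)" using nz by simp
qed

end

section \<open>Residues of logarithmic derivatives at 0\<close>

lemma rational_function_value:
  assumes F: "is_subfield F" and a: "a \<in> gen_field (F \<union> {t})"
  shows "\<exists>p q. coeffs_in p F \<and> coeffs_in q F \<and> poly q t \<noteq> 0 \<and> a = poly p t / poly q t"
proof -
  \<comment> \<open>A single variable, named by the unit value, specialises the many-variable
    functions to ordinary polynomials in \<open>t\<close>.\<close>
  have u: "\<exists>p. coeffs_in p F \<and> f (\<lambda>_. t) = poly p t" if f: "f \<in> polyfun F {()}" for f
  proof -
    obtain p d where p: "poly_family F {} d p" "\<And>x. f x = poly (p x) (x ())"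
      using polyfun_decompose[OF f] by blast
    have "coeffs_in (p (\<lambda>_. t)) F" unfolding coeffs_in_def
    proof
      fix i
      have "(\<lambda>x. coeff (p x) i) \<in> polyfun F {}" using p(1) unfolding poly_family_def by blast
      then show "coeff (p (\<lambda>_. t)) i \<in> F"
        by (rule polyfun_value_in[OF _ is_subfield_subring[OF F] order_refl]) simp
    qed
    then show ?thesis using p(2) by (intro exI[of _ "p (\<lambda>_. t)"]) simp
  qed
  have "a \<in> gen_field (F \<union> (\<lambda>_. t) ` {()})" using a by simp
  then obtain f g where fg: "f \<in> polyfun F {()}" "g \<in> polyfun F {()}" "g (\<lambda>_. t) \<noteq> 0" "a = f (\<lambda>_. t) / g (\<lambda>_. t)"
    using gen_field_fraction by blast
  obtain p q where "coeffs_in p F" "f (\<lambda>_. t) = poly p t" "coeffs_in q F" "g (\<lambda>_. t) = poly q t"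
    using u[OF fg(1)] u[OF fg(2)] by blast
  then show ?thesis using fg(3,4) by (intro exI[of _ p] exI[of _ q]) simp
qed

lemma poly_factor_X:
  fixes p :: "'k::field poly"
  assumes "p \<noteq> 0" "coeffs_in p F"
  shows "\<exists>k p'. coeffs_in p' F \<and> coeff p' 0 \<noteq> 0 \<and> (\<forall>x. poly p x = x ^ k * poly p' x)"
  using assms
proof (induction p)
  case (pCons a p)
  show ?case
  proof (cases "a = 0")
    case True
    then have "p \<noteq> 0" using pCons.hyps by simp
    moreover have "coeffs_in p F" unfolding coeffs_in_def
    proof
      fix i
      have "coeff (pCons a p) (Suc i) \<in> F" using pCons.prems(2) unfolding coeffs_in_def by blast
      then show "coeff p i \<in> F" by simp
    qed
    ultimately obtain k p' where "coeffs_in p' F" "coeff p' 0 \<noteq> 0" "\<forall>x. poly p x = x ^ k * poly p' x"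
      using pCons.IH by blast
    then show ?thesis using True by (intro exI[of _ "Suc k"] exI[of _ p']) (simp add: mult.assoc)
  next
    case False
    then show ?thesis using pCons.prems by (intro exI[of _ "0::nat"] exI[of _ "pCons a p"]) simp
  qed
qed simp

text \<open>The integer is the order of \<open>N\<close> at t = 0. Once the powers of t are split
  off, numerator and denominator do not vanish at 0, so the remaining part of the logarithmic
  derivative has no pole there.\<close>

lemma log_derivative_residue:
  assumes F: "is_subfield F" and D: "D \<in> Der F" and Dt: "D t = 1" and t: "t \<noteq> 0"
    and N: "N \<in> gen_field (F \<union> {t})" "N \<noteq> 0"
  shows "\<exists>a f g. coeffs_in f F \<and> coeffs_in g F \<and> coeff g 0 \<noteq> 0 \<and> poly g t \<noteq> 0 \<and>
    D N / N = of_int a / t + poly f t / poly g t"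
proof -
  note R = is_subfield_subring[OF F]
  obtain p q where pq: "coeffs_in p F" "coeffs_in q F" "poly q t \<noteq> 0" "N = poly p t / poly q t"
    using rational_function_value[OF F N(1)] by blast
  have p0: "poly p t \<noteq> 0" using pq N(2) by auto
  obtain k p' where p': "coeffs_in p' F" "coeff p' 0 \<noteq> 0" "\<forall>x. poly p x = x ^ k * poly p' x"
    using poly_factor_X[OF _ pq(1)] p0 by force
  obtain l q' where q': "coeffs_in q' F" "coeff q' 0 \<noteq> 0" "\<forall>x. poly q x = x ^ l * poly q' x"
    using poly_factor_X[OF _ pq(2)] pq(3) by force
  have nz: "poly p' t \<noteq> 0" "poly q' t \<noteq> 0" using p0 pq(3) p'(3) q'(3) by auto
  have dp: "D (poly r t) = poly (pderiv r) t" if "coeffs_in r F" for r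
  proof -
    have "map_poly D r = 0"
      by (rule map_poly_Der_zero[OF D]) (use that D in \<open>auto simp: coeffs_in_def Der_def\<close>)
    then show ?thesis using Der_poly[OF D, of r t] Dt by simp
  qed
  have dl: "D (t ^ k * poly r t) / (t ^ k * poly r t) = of_nat k / t + poly (pderiv r) t / poly r t"
    if "coeffs_in r F" "poly r t \<noteq> 0" for r k
    using Der_ln_mult[OF D _ that(2), of "t ^ k"] t Der_ln_power[OF D t, of k] dp[OF that(1)] Dt by simp
  have "D N / N = D (poly p t) / poly p t - D (poly q t) / poly q t"
  proof -
    have "N \<noteq> 0" "poly p t = N * poly q t" using pq N(2) by auto
    then have "D (poly p t) / poly p t = D N / N + D (poly q t) / poly q t"
      using Der_ln_mult[OF D _ pq(3), of N] by simp
    then show ?thesis by simp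
  qed
  also have "\<dots> = of_int (int k - int l) / t +
      (poly (pderiv p') t / poly p' t - poly (pderiv q') t / poly q' t)"
    unfolding p'(3)[THEN spec] q'(3)[THEN spec] dl[OF p'(1) nz(1)] dl[OF q'(1) nz(2)]
    by (simp add: diff_divide_distrib)
  also have "poly (pderiv p') t / poly p' t - poly (pderiv q') t / poly q' t
      = poly (pderiv p' * q' - pderiv q' * p') t / poly (p' * q') t"
    using nz by (simp add: diff_frac_eq)
  finally show ?thesis
    using p'(1,2) q'(1,2) nz coeffs_in_ring(4,5)[OF R] coeffs_in_pderiv[OF R]
    by (intro exI[of _ "int k - int l"] exI[of _ "pderiv p' * q' - pderiv q' * p'"] exI[of _ "p' * q'"])
       (simp add: coeff_mult)
qed

lemma (in finite_diff_extension) represents_sum: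
  assumes "finite I" "\<And>i. i \<in> I \<Longrightarrow> represents (f i) (A i)" "\<And>i. i \<in> I \<Longrightarrow> c i \<in> M"
  shows "represents (\<lambda>k. \<Sum>i\<in>I. c i * f i k) (\<lambda>k l. \<Sum>i\<in>I. c i * A i k l)"
  using assms
proof (induction I rule: finite_induct)
  case empty
  then show ?case unfolding represents_def using is_subringD(1)[OF is_subfield_subring[OF M]] by simp
next
  case (insert i I)
  have "represents (\<lambda>k. 1 * (\<Sum>i\<in>I. c i * f i k) + c i * f i k) (\<lambda>k l. 1 * (\<Sum>i\<in>I. c i * A i k l) + c i * A i k l)"
    by (rule represents_lin) (use insert is_subringD(2)[OF is_subfield_subring[OF M]] in auto)
  then show ?case using insert.hyps by (simp add: add.commute)
qed

lemma Der_gen_field: "Der (gen_field S) = Der S"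
  by (rule Der_between[OF gen_field_ext gen_field_subset_dcl])

lemma gen_field_subfield: "is_subfield F \<Longrightarrow> gen_field F = F"
  using gen_field_least[of F F] gen_field_ext[of F] by blast

text \<open>Since \<open>t\<close> is transcendental over \<open>F\<close>, the relation is an
  identity of rational functions; after clearing denominators it may be evaluated at 0, where only
  the residues survive.\<close>

lemma residue_relation:
  fixes c :: "'i \<Rightarrow> 'k::field_char_0"
  assumes F: "is_subfield F" and t: "t \<notin> dcl F" and fin: "finite I" and c: "\<And>i. i \<in> I \<Longrightarrow> c i \<in> F"
    and fg: "\<And>i. i \<in> I \<Longrightarrow> coeffs_in (f i) F \<and> coeffs_in (g i) F \<and> coeff (g i) 0 \<noteq> 0 \<and> poly (g i) t \<noteq> 0"
    and rel: "(\<Sum>i\<in>I. c i * (of_int (a i) / t + poly (f i) t / poly (g i) t)) = 0"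
  shows "(\<Sum>i\<in>I. of_int (a i) * c i) = 0"
proof -
  note R = is_subfield_subring[OF F]
  have t0: "t \<noteq> 0" using t dcl_ext[of F] is_subringD(1)[OF R] by blast
  \<comment> \<open>The i-th summand multiplied by t and by the product of all
    \<open>g k\<close>.\<close>
  let ?h = "\<lambda>i. [:of_int (a i):] * (\<Prod>k\<in>I. g k) + [:0, 1:] * f i * (\<Prod>k\<in>I - {i}. g k)"
  define P where "P = (\<Sum>i\<in>I. [:c i:] * ?h i)"
  have pr: "is_subring {p. coeffs_in p F}"
    unfolding is_subring_def using coeffs_in_ring[OF R] by simp
  have X: "coeffs_in [:0, 1:] F" unfolding coeffs_in_def using is_subringD(1,2)[OF R]
    by (auto simp: coeff_pCons split: nat.split)
  have "P \<in> {p. coeffs_in p F}" unfolding P_def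
    by (intro is_subring_sum[OF pr] is_subringD(5,6)[OF pr] is_subring_prod[OF pr])
       (use c fg X coeffs_in_ring(8)[OF R] is_subring_of_int[OF R] in auto)
  moreover have "poly P t = 0"
  proof -
    have G: "(\<Prod>k\<in>I. poly (g k) t) = poly (g i) t * (\<Prod>k\<in>I - {i}. poly (g k) t)" if "i \<in> I" for i
      using fin that by (simp add: prod.remove)
    have "poly P t = (\<Sum>i\<in>I. (t * (\<Prod>k\<in>I. poly (g k) t)) * (c i * (of_int (a i) / t + poly (f i) t / poly (g i) t)))"
      unfolding P_def poly_sum
    proof (rule sum.cong[OF refl])
      fix i assume i: "i \<in> I"
      have "poly (g i) t \<noteq> 0" using fg i by blast
      then show "poly ([:c i:] * ?h i) t = (t * (\<Prod>k\<in>I. poly (g k) t)) * (c i * (of_int (a i) / t + poly (f i) t / poly (g i) t))"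
        using t0 by (simp add: poly_prod G[OF i] field_simps)
    qed
    also have "\<dots> = (t * (\<Prod>k\<in>I. poly (g k) t)) * (\<Sum>i\<in>I. c i * (of_int (a i) / t + poly (f i) t / poly (g i) t))"
      by (simp add: sum_distrib_left)
    finally show ?thesis using rel by simp
  qed
  moreover have "\<not> alg_over F t" using t dcl_iff_alg_over[of t F] gen_field_subfield[OF F] by simp
  ultimately have "P = 0" unfolding alg_over_def by blast
  then have "poly P 0 = 0" by simp
  moreover have "poly P 0 = (\<Sum>i\<in>I. of_int (a i) * c i) * (\<Prod>k\<in>I. poly (g k) 0)"
    unfolding P_def poly_sum sum_distrib_right by (rule sum.cong[OF refl]) (simp add: poly_prod)
  moreover have "(\<Prod>k\<in>I. poly (g k) 0) \<noteq> 0" using fin fg by (simp add: poly_0_coeff_0)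
  ultimately show ?thesis by simp
qed

lemma enumerate_basis:
  assumes M: "is_subfield M" and X: "finite X"
  shows "\<exists>b s. (\<forall>i<s. b i \<in> fspan M X) \<and>
    (\<forall>u\<in>fspan M X. \<exists>c. (\<forall>i<s. c i \<in> M) \<and> u = (\<Sum>i<s. c i * b i)) \<and>
    (\<forall>c. (\<forall>i<s. c i \<in> M) \<longrightarrow> (\<Sum>i<s. c i * b i) = 0 \<longrightarrow> (\<forall>i<(s::nat). c i = 0))"
proof -
  interpret pregeometry "fspan M" by (rule fspan_pregeometry[OF M])
  obtain B where B: "B \<subseteq> fspan M X" "finite B" "indep B" "fspan M X \<subseteq> fspan M B" "card B = rk (fspan M X)"
    using rk_basis[OF X order_refl] .
  define s where "s = card B"
  obtain b where b0: "bij_betw b {0..<s} B" using ex_bij_betw_nat_finite[OF B(2)] unfolding s_def by blast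
  then have b: "bij_betw b {..<s} B" by (simp add: atLeast0LessThan)
  have bB: "b i \<in> B" if "i < s" for i using b that by (auto simp: bij_betw_def)
  have inj: "inj_on b {..<s}" using b by (simp add: bij_betw_def)
  have re: "(\<Sum>x\<in>B. f x) = (\<Sum>i<s. f (b i))" for f :: "'a \<Rightarrow> 'a"
    using sum.reindex_bij_betw[OF b, of f] by simp
  show ?thesis
  proof (rule exI[of _ b], rule exI[of _ s], intro conjI ballI allI impI)
    show "b i \<in> fspan M X" if "i < s" for i using bB[OF that] B(1) by blast
  next
    fix u assume "u \<in> fspan M X"
    then have "u \<in> fspan M B" using B(4) by blast
    then obtain T w where T: "finite T" "T \<subseteq> B" "\<forall>x\<in>T. w x \<in> M" "u = (\<Sum>x\<in>T. w x * x)"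
      unfolding fspan_def by blast
    let ?c = "\<lambda>x. if x \<in> T then w x else 0"
    have "u = (\<Sum>x\<in>B. ?c x * x)"
      unfolding T(4) using T(2) B(2) by (intro sum.mono_neutral_cong_left) auto
    then have "u = (\<Sum>i<s. ?c (b i) * b i)" using re[of "\<lambda>x. ?c x * x"] by simp
    moreover have "\<forall>i<s. ?c (b i) \<in> M" using T(3) is_subringD(1)[OF is_subfield_subring[OF M]] by simp
    ultimately show "\<exists>c. (\<forall>i<s. c i \<in> M) \<and> u = (\<Sum>i<s. c i * b i)"
      by (intro exI[of _ "\<lambda>i. ?c (b i)"]) simp
  next
    fix c i assume c: "\<forall>i<s. c i \<in> M" "(\<Sum>i<s. c i * b i) = 0" and i: "i < s"
    define w where "w x = c (the_inv_into {..<s} b x)" for x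
    have w: "w (b i) = c i" if "i < s" for i
      unfolding w_def using the_inv_into_f_f[OF inj, of i] that by simp
    have "(\<Sum>x\<in>B. w x * x) = (\<Sum>i<s. w (b i) * b i)" by (rule re)
    also have "\<dots> = (\<Sum>i<s. c i * b i)" by (rule sum.cong) (simp_all add: w)
    finally have "(\<Sum>x\<in>B. w x * x) = 0" using c(2) by simp
    moreover have "\<forall>x\<in>B. w x \<in> M"
    proof
      fix x assume "x \<in> B"
      then obtain k where "k < s" "x = b k" using b by (auto simp: bij_betw_def)
      then show "w x \<in> M" using w[of k] c(1) by simp
    qed
    ultimately have P: "finite B \<and> B \<subseteq> B \<and> (\<forall>x\<in>B. w x \<in> M) \<and> (\<Sum>x\<in>B. w x * x) = 0"
      using B(2) by (intro conjI order_refl)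
    have L: "lin_indep M B" unfolding lin_indep_iff[OF M] by (rule B(3))
    have "\<forall>x\<in>B. w x = 0"
      by (rule mp[OF L[unfolded lin_indep_def, THEN spec, of B, THEN spec, of w] P])
    then have "w (b i) = 0" using bB[OF i] by (rule bspec)
    then show "c i = 0" unfolding w[OF i] .
  qed
qed

text \<open>The differential form of Ax's theorem for raising to powers. If some \<open>t = v j\<close> were
  transcendental over the constants, take the trace down to \<open>F(t)\<close>: logarithmic derivatives become
  logarithmic derivatives of norms, and comparing residues at \<open>t = 0\<close> gives an integral relation
  between the \<open>c i\<close> in which the coefficient of \<open>c j\<close> is the degree of the extension.\<close>

theorem log_derivatives_independent:
  fixes c v :: "'i \<Rightarrow> 'k::field_char_0"
  assumes fin: "finite I" and nz: "\<And>i. i \<in> I \<Longrightarrow> v i \<noteq> 0" and c: "\<And>i. i \<in> I \<Longrightarrow> c i \<in> dcl S"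
    and rel: "\<And>d. d \<in> Der S \<Longrightarrow> (\<Sum>i\<in>I. c i * (d (v i) / v i)) = 0"
    and ind: "\<And>e :: 'i \<Rightarrow> int. (\<Sum>i\<in>I. of_int (e i) * c i) = 0 \<Longrightarrow> \<forall>i\<in>I. e i = 0"
    and j: "j \<in> I" and d1: "d1 \<in> Der S"
  shows "d1 (v j) = 0"
proof (rule ccontr)
  assume dj: "d1 (v j) \<noteq> 0"
  define t where "t = v j"
  define S' where "S' = dcl S"
  have DS: "Der S' = Der S" unfolding S'_def by (rule Der_dcl)
  have tS: "t \<notin> dcl S'" using dj d1 DS unfolding t_def dcl_def by auto
  have "dindep S' {t}" unfolding dcl.indep_def using tS by simp
  moreover have "v ` I \<subseteq> dcl (S' \<union> v ` I)" using dcl_ext[of "S' \<union> v ` I"] by blast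
  moreover have "{t} \<subseteq> v ` I" unfolding t_def using j by blast
  ultimately obtain B where B: "{t} \<subseteq> B" "B \<subseteq> v ` I" "finite B" "dindep S' B" "v ` I \<subseteq> dcl (S' \<union> B)"
    using dcl.extend_to_basis[OF finite_imageI[OF fin], where Y = S'] by metis
  \<comment> \<open>All of the transcendence basis except \<open>t\<close> joins the constants, so
    only one variable is left and the \<open>v i\<close> are algebraic over \<open>M\<close>, the
    rational functions in it.\<close>
  define F where "F = gen_field (S' \<union> (B - {t}))"
  define M where "M = gen_field (F \<union> {t})"
  have F: "is_subfield F" and M: "is_subfield M" unfolding F_def M_def by (rule is_subfield_gen)+
  note RM = is_subfield_subring[OF M]
  have FM: "F \<subseteq> M" "t \<in> M" unfolding M_def using gen_field_ext[of "F \<union> {t}"] by auto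
  have SF: "S' \<subseteq> F" "B - {t} \<subseteq> F" unfolding F_def using gen_field_ext[of "S' \<union> (B - {t})"] by auto
  have tF: "t \<notin> dcl F"
    using B(1,4) unfolding F_def dcl_gen_field dcl.indep_def by blast
  have t0: "t \<noteq> 0" using nz[OF j] unfolding t_def .
  have tB: "t \<in> B" using B(1) by simp
  \<comment> \<open>\<open>D\<close> is differentiation with respect to \<open>t\<close> over
    \<open>F\<close>.\<close>
  obtain D where D0: "D \<in> Der S'" "D t = 1" "\<forall>x\<in>B. x \<noteq> t \<longrightarrow> D x = 0"
    using dindep_dual[OF B(4) tB] .
  have "D \<in> Der (S' \<union> (B - {t}))" using D0 unfolding Der_def by auto
  then have D: "D \<in> Der F" unfolding F_def Der_gen_field .
  have DM: "D u \<in> M" if "u \<in> M" for u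
  proof -
    have "is_subfield {u \<in> M. D u \<in> M}" unfolding is_subfield_def
    proof (intro conjI ballI)
      show "0 \<in> {u \<in> M. D u \<in> M}" "1 \<in> {u \<in> M. D u \<in> M}"
        using is_subringD(1,2)[OF RM] Der_0[OF D] Der_1[OF D] by simp_all
      fix x y assume xy: "x \<in> {u \<in> M. D u \<in> M}" "y \<in> {u \<in> M. D u \<in> M}"
      then show "x - y \<in> {u \<in> M. D u \<in> M}" "x * y \<in> {u \<in> M. D u \<in> M}"
        using is_subringD(3,5,6)[OF RM] by (simp_all add: Der_diff[OF D] Der_mult[OF D])
    next
      fix x assume x: "x \<in> {u \<in> M. D u \<in> M}"
      then show "inverse x \<in> {u \<in> M. D u \<in> M}"
        using is_subfield_inverse[OF M] is_subfield_divide[OF M] is_subringD(4)[OF RM] is_subring_power[OF RM]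
        by (simp add: Der_inverse[OF D])
    qed
    moreover have "F \<union> {t} \<subseteq> {u \<in> M. D u \<in> M}"
      using FM D0(2) is_subringD(1,2)[OF RM] D unfolding Der_def by auto
    ultimately have "M \<subseteq> {u \<in> M. D u \<in> M}" using gen_field_least unfolding M_def by blast
    then show ?thesis using that by blast
  qed
  have SB: "S' \<union> B \<subseteq> M" using FM SF by blast
  have algM: "alg_over M x" if "x \<in> dcl M" for x
    using that dcl_iff_alg_over[of x M] gen_field_subfield[OF M] by simp
  have vM: "v ` I \<subseteq> dcl M" using B(5) dcl_mono[OF SB] by blast
  obtain X where X: "finite X" "is_subring (fspan M X)" "M \<union> v ` I \<subseteq> fspan M X" "X \<subseteq> gen_field (M \<union> v ` I)"
    using finite_ring_extension[OF M finite_imageI[OF fin], of v] algM vM by blast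
  define U where "U = fspan M X"
  have U: "is_subfield U" unfolding is_subfield_def
  proof (intro conjI ballI)
    show "0 \<in> U" "1 \<in> U" using is_subringD(1,2)[OF X(2)] unfolding U_def .
    show "x - y \<in> U" "x * y \<in> U" if "x \<in> U" "y \<in> U" for x y
      using is_subringD(3,6)[OF X(2)] that unfolding U_def by blast+
    fix x assume x: "x \<in> U"
    then show "inverse x \<in> U"
      using finite_ring_inverse[OF M X(1,2), of x] unfolding U_def by (cases "x = 0") auto
  qed
  note RU = is_subfield_subring[OF U]
  have MU: "M \<subseteq> U" "v ` I \<subseteq> U" using X(3) unfolding U_def by blast+
  have "gen_field (M \<union> v ` I) \<subseteq> dcl M"
    by (rule gen_field_least[OF is_subfield_dcl]) (use vM dcl_ext[of M] in blast)
  moreover have "fsubspace M (dcl M)"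
    unfolding fsubspace_def using is_subringD(1,5,6)[OF is_subfield_subring[OF is_subfield_dcl[of M]]] dcl_ext[of M]
    by blast
  ultimately have UM: "U \<subseteq> dcl M" unfolding U_def using X(4) fspan_least by (metis order_trans)
  \<comment> \<open>Implicit differentiation: the minimal polynomial expresses \<open>D u\<close>
    through \<open>u\<close> and elements of \<open>M\<close>.\<close>
  have DU: "D u \<in> U" if u: "u \<in> U" for u
  proof -
    obtain m where m: "coeffs_in m M" "lead_coeff m = 1" "poly m u = 0"
      "\<And>p. coeffs_in p M \<Longrightarrow> poly p u = 0 \<Longrightarrow> p \<noteq> 0 \<Longrightarrow> degree m \<le> degree p"
      using min_poly_exists[OF M algM] u UM by blast
    have nz': "poly (pderiv m) u \<noteq> 0" by (rule min_poly_deriv_nonzero[OF M m(2,1,3,4)])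
    have "poly (map_poly D m) u + poly (pderiv m) u * D u = 0"
      using Der_poly[OF D, of m u] m(3) Der_0[OF D] by simp
    then have "D u = - poly (map_poly D m) u / poly (pderiv m) u"
      using nz' by (simp add: field_simps eq_neg_iff_add_eq_0)
    moreover have "coeffs_in (map_poly D m) U" "coeffs_in (pderiv m) U"
      using m(1) DM MU(1) coeffs_in_pderiv[OF RM m(1)] unfolding coeffs_in_def
      by (auto simp: coeff_map_poly Der_0[OF D])
    ultimately show ?thesis
      using poly_in_subring[OF RU _ u] is_subringD(4)[OF RU] is_subfield_divide[OF U] by simp
  qed
  have "\<exists>b s. (\<forall>i<(s::nat). b i \<in> U) \<and> (\<forall>u\<in>U. \<exists>c. (\<forall>i<s. c i \<in> M) \<and> u = (\<Sum>i<s. c i * b i)) \<and>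
      (\<forall>c. (\<forall>i<s. c i \<in> M) \<longrightarrow> (\<Sum>i<s. c i * b i) = 0 \<longrightarrow> (\<forall>i<s. c i = 0))"
    unfolding U_def by (rule enumerate_basis[OF M X(1)])
  then obtain b :: "nat \<Rightarrow> 'k" and s where b0: "\<forall>i<s. b i \<in> U"
    "\<forall>u\<in>U. \<exists>c. (\<forall>i<s. c i \<in> M) \<and> u = (\<Sum>i<s. c i * b i)"
    "\<forall>c. (\<forall>i<s. c i \<in> M) \<longrightarrow> (\<Sum>i<s. c i * b i) = 0 \<longrightarrow> (\<forall>i<s. c i = 0)"
    by (elim exE conjE)
  have b: "\<And>i. i < s \<Longrightarrow> b i \<in> U" "\<And>u. u \<in> U \<Longrightarrow> \<exists>c. (\<forall>i<s. c i \<in> M) \<and> u = (\<Sum>i<s. c i * b i)"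
    "\<And>c i. (\<And>i. i < s \<Longrightarrow> c i \<in> M) \<Longrightarrow> (\<Sum>i<s. c i * b i) = 0 \<Longrightarrow> i < s \<Longrightarrow> c i = 0"
    using b0(1) b0(2) b0(3)[THEN spec] by simp_all
  interpret E: finite_diff_extension M U b s D F
    by unfold_locales (fact M, fact U, fact D, fact DU, fact b(1), fact b(2), fact b(3), fact DM)
  have s0: "s \<noteq> 0"
  proof
    assume "s = 0"
    then have "(1::'k) = 0" using b(2)[of 1] is_subringD(2)[OF RU] by simp
    then show False by simp
  qed
  let ?h = "\<lambda>i. D (v i) / v i"
  have vU: "v i \<in> U" if "i \<in> I" for i using MU(2) that by blast
  have hU: "?h i \<in> U" if "i \<in> I" for i using vU[OF that] DU is_subfield_divide[OF U] by blast
  have "\<forall>i\<in>I. \<exists>A. E.represents (\<lambda>k. v i * b k) A"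
    using vU b(1) is_subringD(6)[OF RU] by (intro ballI E.represents_ex) blast
  then obtain A where A: "\<And>i. i \<in> I \<Longrightarrow> E.represents (\<lambda>k. v i * b k) (A i)" by metis
  have "\<forall>i\<in>I. \<exists>A. E.represents (\<lambda>k. ?h i * b k) A"
    using hU b(1) is_subringD(6)[OF RU] by (intro ballI E.represents_ex) blast
  then obtain H where H: "\<And>i. i \<in> I \<Longrightarrow> E.represents (\<lambda>k. ?h i * b k) (H i)" by metis
  have cF: "c i \<in> F" if "i \<in> I" for i using c[OF that] SF(1) unfolding S'_def by blast
  have cM: "c i \<in> M" if "i \<in> I" for i using cF[OF that] FM(1) by blast
  have "D \<in> Der S" using D0(1) DS by simp
  then have r0: "(\<Sum>i\<in>I. c i * ?h i) = 0" by (rule rel)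
  have "E.represents (\<lambda>k. \<Sum>i\<in>I. c i * (?h i * b k)) (\<lambda>k l. \<Sum>i\<in>I. c i * H i k l)"
    using E.represents_sum[OF fin H cM] .
  moreover have "(\<Sum>i\<in>I. c i * (?h i * b k)) = 0" for k
  proof -
    have "(\<Sum>i\<in>I. c i * (?h i * b k)) = (\<Sum>i\<in>I. c i * ?h i) * b k"
      by (simp only: sum_distrib_right mult.assoc)
    then show ?thesis using r0 by simp
  qed
  moreover have "E.represents (\<lambda>k. 0) (\<lambda>k l. 0)"
    unfolding E.represents_def using is_subringD(1)[OF RM] by simp
  ultimately have H0: "(\<Sum>i\<in>I. c i * H i k l) = 0" if "k < s" "l < s" for k l
    using E.represents_unique[of "\<lambda>k. 0" "\<lambda>k l. \<Sum>i\<in>I. c i * H i k l" "\<lambda>k l. 0" k l] that by simp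
  have tr: "(\<Sum>i\<in>I. c i * (\<Sum>k<s. H i k k)) = 0"
  proof -
    have "(\<Sum>i\<in>I. c i * (\<Sum>k<s. H i k k)) = (\<Sum>k<s. \<Sum>i\<in>I. c i * H i k k)"
      unfolding sum_distrib_left by (rule sum.swap)
    also have "\<dots> = 0" using H0 by simp
    finally show ?thesis .
  qed
  define Q where "Q i a f g \<longleftrightarrow> coeffs_in f F \<and> coeffs_in g F \<and> coeff g 0 \<noteq> 0 \<and> poly g t \<noteq> 0 \<and>
      (\<Sum>k<s. H i k k) = of_int a / t + poly f t / poly g t \<and> (i = j \<longrightarrow> a = int s)" for i a f g
  have "\<exists>a f g. Q i a f g" if i: "i \<in> I" for i
  proof (cases "i = j")
    case True
    \<comment> \<open>The logarithmic derivative of \<open>t\<close> itself is 1/t, a scalar in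
      \<open>M\<close>; its trace is s/t, so its residue is the degree \<open>s\<close>, which is
      not 0.\<close>
    have "E.represents (\<lambda>k. ?h i * b k) (\<lambda>k l. if k = l then inverse t else 0)"
    proof -
      have "?h i = inverse t" using True D0(2) unfolding t_def by (simp add: divide_inverse)
      then show ?thesis
        unfolding E.represents_def using is_subfield_inverse[OF M FM(2)] is_subringD(1)[OF RM]
        by (auto simp: if_distrib[of "\<lambda>x. x * _"] cong: if_cong)
    qed
    then have "H i k k = inverse t" if "k < s" for k
      using E.represents_unique[OF H[OF i], of "\<lambda>k l. if k = l then inverse t else 0" k k] that by simp
    then have "(\<Sum>k<s. H i k k) = of_int (int s) / t + poly 0 t / poly 1 t" by (simp add: divide_inverse)
    moreover have "coeffs_in 0 F" "coeffs_in 1 F"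
      using coeffs_in_ring(1,2)[OF is_subfield_subring[OF F]] by blast+
    ultimately show ?thesis unfolding Q_def by (intro exI[of _ "int s"] exI[of _ "0::'k poly"] exI[of _ "1::'k poly"]) simp
  next
    case False
    define N where "N = det (mat s s (\<lambda>(k, l). A i k l))"
    have N: "N \<in> M" "N \<noteq> 0" "D N / N = (\<Sum>k<s. H i k k)"
      using E.norm_trace[OF vU[OF i] nz[OF i] A[OF i] H[OF i]] unfolding N_def by auto
    show ?thesis unfolding Q_def
      using log_derivative_residue[OF F D D0(2) t0 N(1)[unfolded M_def] N(2)] N(3) False by auto
  qed
  then obtain a f g where "\<And>i. i \<in> I \<Longrightarrow> Q i (a i) (f i) (g i)" by metis
  note fg = this[unfolded Q_def]
  have "(\<Sum>i\<in>I. of_int (a i) * c i) = 0"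
  proof (rule residue_relation[OF F tF fin cF])
    show "(\<Sum>i\<in>I. c i * (of_int (a i) / t + poly (f i) t / poly (g i) t)) = 0"
      using tr fg by simp
  qed (use fg in auto)
  then have "a j = 0" using ind j by blast
  then show False using fg[OF j] s0 by simp
qed

section \<open>Products of independent rotund tuples\<close>

definition int_indep_rows :: "nat set \<Rightarrow> nat set \<Rightarrow> (nat \<Rightarrow> nat \<Rightarrow> int) \<Rightarrow> bool" where
  "int_indep_rows L I q \<longleftrightarrow> (\<forall>r. (\<forall>j\<in>I. (\<Sum>l\<in>L. r l * q l j) = 0) \<longrightarrow> (\<forall>l\<in>L. r l = 0))"

definition monomial :: "nat set \<Rightarrow> (nat \<Rightarrow> 'k::field) \<Rightarrow> (nat \<Rightarrow> int) \<Rightarrow> 'k" where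
  "monomial I v e = (\<Prod>j\<in>I. v j powi e j)"

text \<open>Rotundity read off at one point over \<open>K\<close>: independent rows of exponents
  give monomials whose rank is at least half their number.\<close>

definition rotund_tuple :: "'k::field set \<Rightarrow> nat set \<Rightarrow> (nat \<Rightarrow> 'k) \<Rightarrow> bool" where
  "rotund_tuple K I v \<longleftrightarrow>
     (\<forall>L q. finite L \<and> int_indep_rows L I q \<longrightarrow> card L \<le> 2 * drk K ((\<lambda>l. monomial I v (q l)) ` L))"

text \<open>The new tuple consists of monomials in the old one whose exponent rows are orthogonal to
  nothing new: independent rows in the new variables pull back to independent rows in the old,
  because \<open>m j0\<close> is nonzero.\<close>

lemma rotund_tuple_reduce:
  assumes I: "finite I" "j0 \<in> I" and nz: "\<And>i. i \<in> I \<Longrightarrow> v i \<noteq> 0" and m: "m j0 \<noteq> (0::int)"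
    and R: "rotund_tuple K I v"
  shows "rotund_tuple K (I - {j0}) (\<lambda>j. v j powi m j0 * v j0 powi (- m j))"
  unfolding rotund_tuple_def
proof (intro allI impI)
  fix L :: "nat set" and q' :: "nat \<Rightarrow> nat \<Rightarrow> int"
  let ?I = "I - {j0}" and ?a = "\<lambda>j. v j powi m j0 * v j0 powi (- m j)"
  assume L: "finite L \<and> int_indep_rows L ?I q'"
  \<comment> \<open>The exponents of the old variables after substitution; \<open>v j0\<close>
    collects a contribution from every factor.\<close>
  define q where "q l i = (if i = j0 then - (\<Sum>j\<in>?I. q' l j * m j) else q' l i * m j0)" for l i
  have "int_indep_rows L I q" unfolding int_indep_rows_def
  proof (intro allI impI)
    fix r assume r: "\<forall>j\<in>I. (\<Sum>l\<in>L. r l * q l j) = 0"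
    have "(\<Sum>l\<in>L. r l * q' l j) = 0" if j: "j \<in> ?I" for j
    proof -
      have "(\<Sum>l\<in>L. r l * q' l j) * m j0 = (\<Sum>l\<in>L. r l * q l j)"
        unfolding sum_distrib_right by (rule sum.cong) (use j in \<open>simp_all add: q_def\<close>)
      then show ?thesis using r j m by simp
    qed
    then show "\<forall>l\<in>L. r l = 0" using L unfolding int_indep_rows_def by simp
  qed
  then have "card L \<le> 2 * drk K ((\<lambda>l. monomial I v (q l)) ` L)"
    using R L unfolding rotund_tuple_def by simp
  moreover have "monomial ?I ?a (q' l) = monomial I v (q l)" for l
  proof -
    have v0: "v j0 \<noteq> 0" using nz I(2) by simp
    have "monomial ?I ?a (q' l) = (\<Prod>j\<in>?I. v j powi q l j) * (\<Prod>j\<in>?I. v j0 powi (- (q' l j * m j)))"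
      unfolding monomial_def prod.distrib[symmetric]
      by (rule prod.cong) (auto simp: q_def power_int_mult_distrib power_int_mult[symmetric] mult_ac)
    also have "(\<Prod>j\<in>?I. v j0 powi (- (q' l j * m j))) = v j0 powi q l j0"
    proof -
      have "(\<Prod>j\<in>A. v j0 powi f j) = v j0 powi (\<Sum>j\<in>A. f j)" if "finite A" for A and f :: "nat \<Rightarrow> int"
        using that by (induction A rule: finite_induct) (simp_all add: power_int_add v0)
      then show ?thesis using I(1) by (simp add: q_def sum_negf)
    qed
    also have "(\<Prod>j\<in>?I. v j powi q l j) * v j0 powi q l j0 = monomial I v (q l)"
      unfolding monomial_def using prod.remove[OF I, of "\<lambda>j. v j powi q l j"] by simp
    finally show ?thesis .
  qed
  ultimately show "card L \<le> 2 * drk K ((\<lambda>l. monomial ?I ?a (q' l)) ` L)" by simp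
qed

lemma rotund_tuple_rank:
  assumes "finite I" "rotund_tuple K I v"
  shows "card I \<le> 2 * drk K (v ` I)"
proof -
  let ?q = "\<lambda>l j. if l = j then 1 else (0::int)"
  have s: "(\<Sum>l\<in>I. r l * ?q l j) = r j" if "j \<in> I" for r :: "nat \<Rightarrow> int" and j
  proof -
    have "(\<Sum>l\<in>I. r l * ?q l j) = (\<Sum>l\<in>I. if l = j then r j else 0)" by (rule sum.cong) auto
    then show ?thesis using assms(1) that by simp
  qed
  then have "int_indep_rows I I ?q" unfolding int_indep_rows_def by simp
  moreover have "monomial I v (?q l) = v l" if "l \<in> I" for l
  proof -
    have "monomial I v (?q l) = (\<Prod>j\<in>I. if j = l then v l else 1)"
      unfolding monomial_def by (rule prod.cong) auto
    then show ?thesis using assms(1) that by simp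
  qed
  then have "(\<lambda>l. monomial I v (?q l)) ` I = v ` I" by (intro image_cong) auto
  ultimately show ?thesis using assms unfolding rotund_tuple_def by metis
qed

lemma Der_commutator:
  assumes "d \<in> Der K" "e \<in> Der K"
  shows "(\<lambda>z. d (e z) - e (d z)) \<in> Der K"
proof -
  have "d (e (x * y)) - e (d (x * y)) = x * (d (e y) - e (d y)) + (d (e x) - e (d x)) * y" for x y
    unfolding Der_mult[OF assms(1)] Der_mult[OF assms(2)] Der_add[OF assms(1)] Der_add[OF assms(2)]
    by (simp add: Der_mult[OF assms(1)] Der_mult[OF assms(2)] algebra_simps)
  moreover have "d (e (x + y)) - e (d (x + y)) = (d (e x) - e (d x)) + (d (e y) - e (d y))" for x y
    by (simp add: Der_add[OF assms(1)] Der_add[OF assms(2)])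
  moreover have "d (e s) - e (d s) = 0" if "s \<in> K" for s
    using Der_zero[OF assms(1) that] Der_zero[OF assms(2) that] Der_0[OF assms(1)] Der_0[OF assms(2)] by simp
  ultimately show ?thesis by (simp add: Der_def)
qed

lemma Der_eq_if_log_eq: "x \<noteq> 0 \<Longrightarrow> d x / x = e x / x \<Longrightarrow> d x = (e x :: 'k::field)"
  by simp

text \<open>The relation space \<open>N\<close> of the products \<open>v i * w i\<close> is stable under derivations that kill the
  products, so a relation of minimal support has coefficients algebraic over them. If these
  coefficients are linearly dependent over the rationals, the problem reduces to fewer monomials;
  otherwise the products already generate everything algebraically, and a rank count applies.\<close>

theorem rotund_products_independent:
  fixes v w :: "nat \<Rightarrow> 'k::field_char_0"
  assumes "finite I" "\<And>i. i \<in> I \<Longrightarrow> v i \<noteq> 0" "\<And>i. i \<in> I \<Longrightarrow> w i \<noteq> 0"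
    and "\<And>d. d \<in> Der K \<Longrightarrow> \<exists>d'\<in>Der K. \<forall>i\<in>I. d' (v i) = d (v i) \<and> d' (w i) = 0"
    and "rotund_tuple K I v" "rotund_tuple K I w"
    and "\<And>d. d \<in> Der K \<Longrightarrow> (\<Sum>i\<in>I. c i * (d (v i * w i) / (v i * w i))) = 0"
    and "i \<in> I"
  shows "c i = 0"
  using assms
proof (induction "card I" arbitrary: I v w c i rule: less_induct)
  case less
  note fin = less.prems(1) and vnz = less.prems(2) and wnz = less.prems(3) and Ind = less.prems(4)
    and Rv = less.prems(5) and Rw = less.prems(6)
  define x where "x j = v j * w j" for j
  have xnz: "x j \<noteq> 0" if "j \<in> I" for j using vnz wnz that by (simp add: x_def)
  have lx: "d (x j) / x j = d (v j) / v j + d (w j) / w j" if "d \<in> Der K" "j \<in> I" for d j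
    unfolding x_def by (rule Der_ln_mult) (use that vnz wnz in auto)
  define N where "N = {c. \<forall>d\<in>Der K. (\<Sum>j\<in>I. c j * (d (x j) / x j)) = 0}"
  \<comment> \<open>An integral relation \<open>m\<close> between the coefficients removes the index
    \<open>j0\<close>: pass to the monomials with exponents \<open>m j0\<close> at \<open>j\<close>
    and \<open>- m j\<close> at \<open>j0\<close>, which still satisfy all hypotheses, and use the
    induction on \<open>card I\<close>.\<close>
  have dep: "\<forall>j\<in>I. c j = 0" if c: "c \<in> N" and m: "(\<Sum>j\<in>I. of_int (m j) * c j) = 0" "j0 \<in> I" "m j0 \<noteq> (0::int)"
    for c m j0
  proof -
    let ?I = "I - {j0}" and ?a = "\<lambda>j. v j powi m j0 * v j0 powi (- m j)"
      and ?b = "\<lambda>j. w j powi m j0 * w j0 powi (- m j)"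
    have anz: "?a j \<noteq> 0" "?b j \<noteq> 0" if "j \<in> ?I" for j using vnz wnz m(2) that by auto
    have la: "d (u j powi m j0 * u j0 powi (- m j)) / (u j powi m j0 * u j0 powi (- m j))
        = of_int (m j0) * (d (u j) / u j) - of_int (m j) * (d (u j0) / u j0)"
      if d: "d \<in> Der K" and u: "u j \<noteq> 0" "u j0 \<noteq> 0" for d u j
    proof -
      have "d (u j powi m j0 * u j0 powi (- m j)) / (u j powi m j0 * u j0 powi (- m j))
          = d (u j powi m j0) / u j powi m j0 + d (u j0 powi (- m j)) / u j0 powi (- m j)"
        by (rule Der_ln_mult[OF d]) (use u in auto)
      then show ?thesis using Der_powi[OF d u(1)] Der_powi[OF d u(2), of "- m j"] by simp
    qed
    have nzI: "v j \<noteq> 0" "w j \<noteq> 0" if "j \<in> I" for j using vnz wnz that by auto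
    have "c j / of_int (m j0) = 0" if j: "j \<in> ?I" for j
    proof (rule less.hyps[of ?I ?a ?b "\<lambda>j. c j / of_int (m j0)"])
      show "card ?I < card I" by (rule card_Diff1_less[OF fin m(2)])
      show "finite ?I" using fin by simp
      show "\<And>j. j \<in> ?I \<Longrightarrow> ?a j \<noteq> 0" "\<And>j. j \<in> ?I \<Longrightarrow> ?b j \<noteq> 0" using anz by auto
      show "rotund_tuple K ?I ?a" by (rule rotund_tuple_reduce[where m = m and v = v, OF fin m(2) vnz m(3) Rv])
      show "rotund_tuple K ?I ?b" by (rule rotund_tuple_reduce[where m = m and v = w, OF fin m(2) wnz m(3) Rw])
      show "j \<in> ?I" by (rule j)
    next
      fix d assume d: "d \<in> Der K"
      then obtain d' where d': "d' \<in> Der K" "\<forall>i\<in>I. d' (v i) = d (v i) \<and> d' (w i) = 0" using Ind by blast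
      have "d' (?a j) = d (?a j) \<and> d' (?b j) = 0" if "j \<in> ?I" for j
      proof -
        have jI: "j \<in> I" using that by simp
        have "d' (?a j) / ?a j = d (?a j) / ?a j"
          using la[OF d'(1), of v j] la[OF d, of v j] nzI(1)[OF jI] nzI(1)[OF m(2)] d'(2) jI m(2) by simp
        moreover have "d' (?b j) / ?b j = 0"
          using la[OF d'(1), of w j] nzI(2)[OF jI] nzI(2)[OF m(2)] d'(2) jI m(2) by simp
        ultimately show ?thesis
          using Der_eq_if_log_eq[OF anz(1)[OF that], of d' d]
            Der_eq_if_log_eq[OF anz(2)[OF that], of d' "\<lambda>_. 0"] by (metis div_0)
      qed
      then show "\<exists>d'\<in>Der K. \<forall>i\<in>?I. d' (?a i) = d (?a i) \<and> d' (?b i) = 0" using d'(1) by blast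
    next
      fix d assume d: "d \<in> Der K"
      let ?y = "\<lambda>j. d (x j) / x j"
      have m0: "of_int (m j0) \<noteq> (0::'k)" using m(3) by simp
      have t: "d (?a j * ?b j) / (?a j * ?b j) = of_int (m j0) * ?y j - of_int (m j) * ?y j0"
        if j: "j \<in> ?I" for j
      proof -
        have jI: "j \<in> I" using j by simp
        have "d (?a j * ?b j) / (?a j * ?b j) = d (?a j) / ?a j + d (?b j) / ?b j"
          by (rule Der_ln_mult[OF d anz[OF j]])
        then show ?thesis
          unfolding la[OF d nzI(1)[OF jI] nzI(1)[OF m(2)]] la[OF d nzI(2)[OF jI] nzI(2)[OF m(2)]]
            lx[OF d jI] lx[OF d m(2)] by (simp add: algebra_simps)
      qed
      \<comment> \<open>The terms at \<open>j0\<close> recombine, since the sum of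
        \<open>m j * c j\<close> over the other indices equals \<open>- m j0 * c j0\<close>: the
        reduced relation is the original one.\<close>
      have "(\<Sum>j\<in>?I. c j / of_int (m j0) * (d (?a j * ?b j) / (?a j * ?b j)))
          = (\<Sum>j\<in>?I. c j * ?y j - (of_int (m j) * c j) * (?y j0 / of_int (m j0)))"
      proof (rule sum.cong[OF refl])
        fix j assume j: "j \<in> ?I"
        show "c j / of_int (m j0) * (d (?a j * ?b j) / (?a j * ?b j))
            = c j * ?y j - (of_int (m j) * c j) * (?y j0 / of_int (m j0))"
          unfolding t[OF j] using m0 by (simp add: right_diff_distrib mult_ac)
      qed
      also have "\<dots> = (\<Sum>j\<in>?I. c j * ?y j) - (\<Sum>j\<in>?I. of_int (m j) * c j) * (?y j0 / of_int (m j0))"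
        by (simp only: sum_subtractf sum_distrib_right)
      also have "(\<Sum>j\<in>?I. of_int (m j) * c j) = - (of_int (m j0) * c j0)"
        using m(1) sum.remove[OF fin m(2), of "\<lambda>j. of_int (m j) * c j"] by (simp add: eq_neg_iff_add_eq_0 add.commute)
      also have "(\<Sum>j\<in>?I. c j * ?y j) - - (of_int (m j0) * c j0) * (?y j0 / of_int (m j0)) = (\<Sum>j\<in>I. c j * ?y j)"
        using m0 sum.remove[OF fin m(2), of "\<lambda>j. c j * ?y j"] by simp
      also have "\<dots> = 0" using c d unfolding N_def by simp
      finally show "(\<Sum>j\<in>?I. c j / of_int (m j0) * (d (?a j * ?b j) / (?a j * ?b j))) = 0" .
    qed
    then have z: "c j = 0" if "j \<in> ?I" for j using that m(3) by simp
    then have "of_int (m j0) * c j0 = 0"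
      using m(1) sum.remove[OF fin m(2), of "\<lambda>j. of_int (m j) * c j"] by simp
    then show ?thesis using z m(3) by auto
  qed
  have "\<forall>j\<in>I. c j = 0" if "c \<in> N" for c
  proof (rule ccontr)
    let ?supp = "\<lambda>c. {j \<in> I. c j \<noteq> (0::'k)}"
    let ?P = "\<lambda>c. c \<in> N \<and> ?supp c \<noteq> {}"
    assume "\<not> (\<forall>j\<in>I. c j = 0)"
    then have "?P c" using that by blast
    then obtain c1 where c1: "?P c1" "\<And>c. ?P c \<Longrightarrow> card (?supp c1) \<le> card (?supp c)"
      using ex_has_least_nat[of ?P c "\<lambda>c. card (?supp c)"] by blast
    then obtain i0 where i0: "i0 \<in> I" "c1 i0 \<noteq> 0" by blast
    \<comment> \<open>With one coefficient equal to 1, any derivation annihilates it and so shrinks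
      the support.\<close>
    define c2 where "c2 j = c1 j / c1 i0" for j
    have c2N: "c2 \<in> N" unfolding N_def
    proof (intro CollectI ballI)
      fix d assume d: "d \<in> Der K"
      have "(\<Sum>j\<in>I. c2 j * (d (x j) / x j)) = (\<Sum>j\<in>I. c1 j * (d (x j) / x j)) / c1 i0"
        unfolding sum_divide_distrib by (rule sum.cong) (simp_all add: c2_def)
      then show "(\<Sum>j\<in>I. c2 j * (d (x j) / x j)) = 0" using c1(1) d unfolding N_def by simp
    qed
    have c2i: "c2 i0 = 1" using i0 by (simp add: c2_def)
    let ?S = "K \<union> x ` I"
    have SK: "d \<in> Der K" if "d \<in> Der ?S" for d using that Der_antimono[of K ?S] by blast
    have c2S: "c2 j \<in> dcl ?S" if j: "j \<in> I" for j
      unfolding dcl_def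
    proof (intro CollectI ballI)
      fix d assume d: "d \<in> Der ?S"
      have dx: "d (x j) = 0" if "j \<in> I" for j using Der_zero[OF d] that by blast
      \<comment> \<open>Apply \<open>d\<close>, which kills the products, to the relation for
        \<open>e\<close>. The part where \<open>d\<close> meets the logarithmic derivatives is the
        relation for the commutator of \<open>d\<close> and \<open>e\<close>, which is again a
        derivation over \<open>K\<close>, so it vanishes and the part with the differentiated
        coefficients remains.\<close>
      have "(\<lambda>j. d (c2 j)) \<in> N" unfolding N_def
      proof (intro CollectI ballI)
        fix e assume e: "e \<in> Der K"
        let ?f = "\<lambda>z. d (e z) - e (d z)"
        have f: "?f \<in> Der K" by (rule Der_commutator[OF SK[OF d] e])
        have "0 = d (\<Sum>j\<in>I. c2 j * (e (x j) / x j))"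
          using c2N e Der_0[OF d] unfolding N_def by simp
        also have "\<dots> = (\<Sum>j\<in>I. c2 j * (?f (x j) / x j) + d (c2 j) * (e (x j) / x j))"
          unfolding Der_sum[OF d]
        proof (rule sum.cong[OF refl])
          fix j assume j: "j \<in> I"
          have "d (e (x j) / x j) = ?f (x j) / x j"
            using Der_divide[OF d xnz[OF j], of "e (x j)"] dx[OF j] Der_0[OF e] xnz[OF j]
            by (simp add: power2_eq_square)
          then show "d (c2 j * (e (x j) / x j)) = c2 j * (?f (x j) / x j) + d (c2 j) * (e (x j) / x j)"
            by (simp only: Der_mult[OF d])
        qed
        also have "\<dots> = (\<Sum>j\<in>I. c2 j * (?f (x j) / x j)) + (\<Sum>j\<in>I. d (c2 j) * (e (x j) / x j))"
          by (rule sum.distrib)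
        also have "(\<Sum>j\<in>I. c2 j * (?f (x j) / x j)) = 0" using bspec[OF c2N[unfolded N_def, THEN CollectD] f] .
        finally show "(\<Sum>j\<in>I. d (c2 j) * (e (x j) / x j)) = 0" by simp
      qed
      moreover have "card (?supp (\<lambda>j. d (c2 j))) < card (?supp c1)"
      proof (rule psubset_card_mono)
        show "finite (?supp c1)" using fin by simp
        have "d (c2 j) = 0" if "c1 j = 0" for j using that Der_0[OF d] by (simp add: c2_def)
        moreover have "d (c2 i0) = 0" using c2i Der_1[OF d] by simp
        ultimately show "?supp (\<lambda>j. d (c2 j)) \<subset> ?supp c1" using i0 by blast
      qed
      ultimately have "?supp (\<lambda>j. d (c2 j)) = {}" using c1(2)[of "\<lambda>j. d (c2 j)"] by (meson leD)
      then show "d (c2 j) = 0" using j by simp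
    qed
    have indep: "\<forall>j\<in>I. m j = 0" if "(\<Sum>j\<in>I. of_int (m j) * c2 j) = 0" for m :: "nat \<Rightarrow> int"
    proof (rule ccontr)
      assume "\<not> (\<forall>j\<in>I. m j = 0)"
      then obtain j0 where "j0 \<in> I" "m j0 \<noteq> 0" by blast
      then have "c2 i0 = 0" using dep[OF c2N that] i0(1) by blast
      then show False using c2i by simp
    qed
    \<comment> \<open>A derivation can be modified to kill every \<open>w i\<close> without changing
      its values on the \<open>v i\<close>. The relation for the products thus becomes one for the
      \<open>v i\<close> alone, and over the field where the products are constant Ax's theorem
      applies.\<close>
    have kv: "d (v j) = 0" if d: "d \<in> Der ?S" and j: "j \<in> I" for d j
    proof (rule log_derivatives_independent[OF fin vnz c2S _ indep j d])
      fix e assume "e \<in> Der ?S"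
      then have e: "e \<in> Der K" by (rule SK)
      obtain e' where e': "e' \<in> Der K" "\<forall>i\<in>I. e' (v i) = e (v i) \<and> e' (w i) = 0" using Ind[OF e] by blast
      have "(\<Sum>i\<in>I. c2 i * (e (v i) / v i)) = (\<Sum>i\<in>I. c2 i * (e' (x i) / x i))"
        by (rule sum.cong[OF refl]) (use e' lx in simp)
      then show "(\<Sum>i\<in>I. c2 i * (e (v i) / v i)) = 0" using c2N e'(1) unfolding N_def by simp
    qed
    have kw: "d (w j) = 0" if d: "d \<in> Der ?S" and j: "j \<in> I" for d j
    proof -
      have "d (x j) = 0" using Der_zero[OF d] j by blast
      then have "v j * d (w j) = 0" unfolding x_def Der_mult[OF d] using kv[OF d j] by simp
      then show ?thesis using vnz[OF j] by simp
    qed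
    have sp: "v ` I \<subseteq> dcl ?S" "w ` I \<subseteq> dcl ?S" using kv kw unfolding dcl_def by auto
    have fx: "finite (x ` I)" using fin by simp
    obtain A where A: "A \<subseteq> v ` I" "finite A" "dindep K A" "v ` I \<subseteq> dcl (K \<union> A)" "card A = drk K (v ` I)"
      using dcl.rk_basis[OF fx sp(1)] .
    obtain B where B: "B \<subseteq> w ` I" "finite B" "dindep K B" "w ` I \<subseteq> dcl (K \<union> B)" "card B = drk K (w ` I)"
      using dcl.rk_basis[OF fx sp(2)] .
    have Ind2: "\<exists>e\<in>Der K. \<forall>i\<in>I. e (v i) = 0 \<and> e (w i) = d (w i)" if d: "d \<in> Der K" for d
    proof -
      obtain e where e: "e \<in> Der K" "\<forall>i\<in>I. e (v i) = d (v i) \<and> e (w i) = 0" using Ind[OF d] by blast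
      have "(\<lambda>z. d z + (- 1) * e z) \<in> Der K" by (rule Der_lin_comb[OF d e(1)])
      then show ?thesis using e(2) by (intro bexI[of _ "\<lambda>z. d z + (- 1) * e z"]) auto
    qed
    have a1: "a \<notin> dcl (K \<union> ((A \<union> B) - {a}))" "a \<notin> B" if a: "a \<in> A" for a
    proof -
      obtain d where d: "d \<in> Der K" "d a = 1" "\<forall>c\<in>A. c \<noteq> a \<longrightarrow> d c = 0" using dindep_dual[OF A(3) a] .
      obtain e where e: "e \<in> Der K" "\<forall>i\<in>I. e (v i) = d (v i) \<and> e (w i) = 0" using Ind[OF d(1)] by blast
      have eA: "e c = d c" if "c \<in> A" for c using that A(1) e(2) by auto
      have eB: "e c = 0" if "c \<in> B" for c using that B(1) e(2) by auto
      show "a \<notin> B" using eB[of a] eA[OF a] d(2) by auto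
      have "e c = 0" if "c \<in> (A \<union> B) - {a}" for c using that eA[of c] eB[of c] d(3) by auto
      then have "e \<in> Der (K \<union> ((A \<union> B) - {a}))" using e(1) unfolding Der_def by auto
      then show "a \<notin> dcl (K \<union> ((A \<union> B) - {a}))"
        using eA[OF a] d(2) unfolding dcl_def by (auto intro!: bexI[of _ e])
    qed
    have b1: "b \<notin> dcl (K \<union> ((A \<union> B) - {b}))" if b: "b \<in> B" for b
    proof -
      obtain d where d: "d \<in> Der K" "d b = 1" "\<forall>c\<in>B. c \<noteq> b \<longrightarrow> d c = 0" using dindep_dual[OF B(3) b] .
      obtain e where e: "e \<in> Der K" "\<forall>i\<in>I. e (v i) = 0 \<and> e (w i) = d (w i)" using Ind2[OF d(1)] by blast
      have eA: "e c = 0" if "c \<in> A" for c using that A(1) e(2) by auto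
      have eB: "e c = d c" if "c \<in> B" for c using that B(1) e(2) by auto
      have "e c = 0" if "c \<in> (A \<union> B) - {b}" for c using that eA[of c] eB[of c] d(3) by auto
      then have "e \<in> Der (K \<union> ((A \<union> B) - {b}))" using e(1) unfolding Der_def by auto
      then show ?thesis using eB[OF b] d(2) unfolding dcl_def by (auto intro!: bexI[of _ e])
    qed
    have AB: "dindep K (A \<union> B)" unfolding dcl.indep_def using a1(1) b1 by blast
    have "A \<inter> B = {}" using a1(2) by blast
    then have "card (A \<union> B) = card A + card B" using A(2) B(2) by (simp add: card_Un_disjoint)
    \<comment> \<open>Each of the two tuples has rank at least half of \<open>card I\<close>, and
      the ranks add up because the tuples are free from each other. The products span both, hence
      are independent and distinct, and a derivation dual to \<open>x i0\<close> then violates the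
      relation.\<close>
    then have cAB: "card I \<le> card (A \<union> B)"
      using rotund_tuple_rank[OF fin Rv] rotund_tuple_rank[OF fin Rw] A(5) B(5) by linarith
    have ABS: "A \<union> B \<subseteq> dcl ?S" using A(1) B(1) sp by blast
    have cx: "card (x ` I) \<le> card I" using fin by (rule card_image_le)
    have dx: "dindep K (x ` I)"
      by (rule dcl.indep_if_spanning[OF fx AB ABS]) (use cAB cx in linarith)
    have "card (A \<union> B) \<le> card (x ` I)" using dcl.steinitz[OF fx AB ABS] by blast
    then have inj: "inj_on x I" using cAB cx fin by (intro eq_card_imp_inj_on) auto
    obtain d where d: "d \<in> Der K" "d (x i0) = 1" "\<forall>c\<in>x ` I. c \<noteq> x i0 \<longrightarrow> d c = 0"
      using dindep_dual[OF dx imageI[OF i0(1)]] .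
    have "(\<Sum>j\<in>I. c2 j * (d (x j) / x j)) = (\<Sum>j\<in>I. if j = i0 then c2 i0 / x i0 else 0)"
    proof (rule sum.cong[OF refl])
      fix j assume j: "j \<in> I"
      show "c2 j * (d (x j) / x j) = (if j = i0 then c2 i0 / x i0 else 0)"
      proof (cases "j = i0")
        case False
        then have "x j \<noteq> x i0" using inj j i0(1) by (auto simp: inj_on_def)
        then show ?thesis using d(3) j False by simp
      qed (simp add: d(2))
    qed
    also have "\<dots> = 1 / x i0" using fin i0(1) c2i by simp
    finally have "1 / x i0 = 0" using c2N d(1) unfolding N_def by simp
    then show False using xnz[OF i0(1)] by simp
  qed
  moreover have "c \<in> N" unfolding N_def x_def using less.prems(7) by blast
  ultimately show ?case using less.prems(8) by blast
qed

section \<open>Algebraically independent tuples\<close>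

text \<open>Independence of an indexed family: unlike \<open>dindep\<close> on the image it also
  excludes repetitions, so that index sets can be carried from one point to another.\<close>

definition tindep :: "'k::field set \<Rightarrow> (nat \<Rightarrow> 'k) \<Rightarrow> nat set \<Rightarrow> bool" where
  "tindep K z J \<longleftrightarrow> (\<forall>j\<in>J. z j \<notin> dcl (K \<union> z ` (J - {j})))"

lemma tindep_inj: "tindep K z J \<Longrightarrow> inj_on z J"
proof (rule inj_onI, rule ccontr)
  fix i j assume t: "tindep K z J" and ij: "i \<in> J" "j \<in> J" "z i = z j" "i \<noteq> j"
  then have "z i \<in> z ` (J - {i})" by auto
  then have "z i \<in> dcl (K \<union> z ` (J - {i}))" using dcl_ext[of "K \<union> z ` (J - {i})"] by blast
  then show False using t ij(1) unfolding tindep_def by blast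
qed

lemma tindep_iff: "tindep K z J \<longleftrightarrow> inj_on z J \<and> dindep K (z ` J)"
proof -
  have eq: "z ` J - {z j} = z ` (J - {j})" if "inj_on z J" "j \<in> J" for j
    using that by (auto simp: inj_on_def)
  show ?thesis
  proof
    assume t: "tindep K z J"
    have i: "inj_on z J" by (rule tindep_inj[OF t])
    show "inj_on z J \<and> dindep K (z ` J)"
      using t i eq unfolding tindep_def dcl.indep_def by auto
  next
    assume a: "inj_on z J \<and> dindep K (z ` J)"
    show "tindep K z J" unfolding tindep_def
    proof
      fix j assume j: "j \<in> J"
      then have "z j \<notin> dcl (K \<union> (z ` J - {z j}))" using a unfolding dcl.indep_def by blast
      then show "z j \<notin> dcl (K \<union> z ` (J - {j}))" using eq[OF _ j] a by simp
    qed
  qed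
qed

lemma tindep_polyfun_zero:
  fixes z :: "nat \<Rightarrow> 'k::field_char_0"
  assumes "finite J" "tindep K z J" "f \<in> polyfun K J" "f z = 0"
  shows "f x = 0"
  using assms
proof (induction J arbitrary: f x rule: finite_induct)
  case empty
  then show ?case using polyfun_cong[of f K "{}" x z] by auto
next
  case (insert s B)
  obtain p d where p: "poly_family K B d p" "\<And>x. f x = poly (p x) (x s)"
    using polyfun_decompose[OF insert.prems(2)] by blast
  have "insert s B - {s} = B" using insert.hyps by auto
  then have "z s \<notin> dcl (K \<union> z ` B)" using insert.prems(1) unfolding tindep_def by force
  then have pz: "p z = 0"
    by (rule poly_family_vanish[OF p(1)]) (use p(2)[of z] insert.prems(3) in simp)
  have tB: "tindep K z B" unfolding tindep_def
  proof
    fix j assume j: "j \<in> B"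
    have "K \<union> z ` (B - {j}) \<subseteq> K \<union> z ` (insert s B - {j})" by blast
    then show "z j \<notin> dcl (K \<union> z ` (B - {j}))"
      using dcl_mono insert.prems(1) j unfolding tindep_def by blast
  qed
  have "coeff (p x) i = 0" for i x
  proof (rule insert.IH[OF tB, of "\<lambda>x. coeff (p x) i"])
    show "(\<lambda>x. coeff (p x) i) \<in> polyfun K B" using p(1) unfolding poly_family_def by blast
    show "coeff (p z) i = 0" using pz by simp
  qed
  then have "p x = 0" for x by (simp add: poly_eqI)
  then show ?case unfolding p(2) by simp
qed

text \<open>Independence lifts from a specialisation \<open>z\<close> to \<open>y\<close>. A
  relation at \<open>y\<close> also holds at \<open>z\<close>; as \<open>z\<close> is independent
  there, all its coefficients vanish at \<open>z\<close>, hence identically, hence at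
  \<open>y\<close>.\<close>

lemma tindep_transfer:
  fixes y z :: "nat \<Rightarrow> 'k::field_char_0"
  assumes tr: "\<And>f. f \<in> polyfun K V \<Longrightarrow> f y = 0 \<Longrightarrow> f z = 0"
    and J: "finite J" "J \<subseteq> V" "tindep K z J"
  shows "tindep K y J"
  unfolding tindep_def
proof (intro ballI notI)
  fix j assume j: "j \<in> J" "y j \<in> dcl (K \<union> y ` (J - {j}))"
  then obtain p d where p: "poly_family K (J - {j}) d p" "p y \<noteq> 0" "poly (p y) (y j) = 0"
    using alg_over_poly_family[of K y "J - {j}" "y j"] by (auto simp: dcl_iff_alg_over)
  have e: "(\<lambda>x. poly (p x) (x j)) \<in> polyfun K J" by (rule poly_family_eval[OF p(1)]) (use j in auto)
  then have "(\<lambda>x. poly (p x) (x j)) \<in> polyfun K V" using polyfun_mono[OF _ order_refl J(2)] by blast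
  then have "poly (p z) (z j) = 0" using tr[of "\<lambda>x. poly (p x) (x j)"] p(3) by simp
  moreover have nz: "z j \<notin> dcl (K \<union> z ` (J - {j}))" using J(3) j(1) unfolding tindep_def by blast
  ultimately have "p z = 0" using poly_family_vanish[OF p(1), of z j] by blast
  have tJ: "tindep K z (J - {j})" unfolding tindep_def
  proof
    fix i assume i: "i \<in> J - {j}"
    have "K \<union> z ` (J - {j} - {i}) \<subseteq> K \<union> z ` (J - {i})" by blast
    then show "z i \<notin> dcl (K \<union> z ` (J - {j} - {i}))"
      using dcl_mono J(3) i unfolding tindep_def by blast
  qed
  have "coeff (p y) i = 0" for i
  proof (rule tindep_polyfun_zero[OF _ tJ, of "\<lambda>x. coeff (p x) i"])
    show "finite (J - {j})" using J(1) by simp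
    show "(\<lambda>x. coeff (p x) i) \<in> polyfun K (J - {j})" using p(1) unfolding poly_family_def by blast
    show "coeff (p z) i = 0" using \<open>p z = 0\<close> by simp
  qed
  then have "p y = 0" by (simp add: poly_eqI)
  then show False using p(2) by simp
qed

lemma tindep_basis:
  fixes z :: "nat \<Rightarrow> 'k::field"
  assumes "finite V"
  obtains J where "J \<subseteq> V" "tindep K z J" "z ` V \<subseteq> dcl (K \<union> z ` J)" "card J = drk K (z ` V)"
proof -
  have fz: "finite (z ` V)" using assms by simp
  have "z ` V \<subseteq> dcl (K \<union> z ` V)" using dcl_ext[of "K \<union> z ` V"] by blast
  then obtain B where B: "B \<subseteq> z ` V" "finite B" "dindep K B" "z ` V \<subseteq> dcl (K \<union> B)" "card B = drk K (z ` V)"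
    by (rule dcl.rk_basis[OF fz])
  obtain J where J: "J \<subseteq> V" "inj_on z J" "z ` J = B" using B(1) unfolding subset_image_inj by blast
  then show ?thesis using that[of J] B J card_image[OF J(2)] by (auto simp: tindep_iff)
qed

lemma tindep_card_le:
  assumes "finite V" "J \<subseteq> V" "tindep K z J"
  shows "card J \<le> drk K (z ` V)"
proof -
  have fz: "finite (z ` V)" using assms by simp
  have "z ` V \<subseteq> dcl (K \<union> z ` V)" using dcl_ext[of "K \<union> z ` V"] by blast
  from dcl.indep_le_rk[OF fz this, of "z ` J"] show ?thesis
    using assms card_image[of z J] by (auto simp: tindep_iff)
qed


section \<open>Zariski closed sets\<close>

abbreviation torus :: "nat \<Rightarrow> (nat \<Rightarrow> 'k::field) set" where
  "torus n \<equiv> tuples n mult_group"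

lemma zariski_closed_polyfun:
  assumes "zariski_closed n V"
  obtains P where "\<forall>p\<in>P. mpoly_vars p \<subseteq> {..<n}" "V = {x \<in> torus n. \<forall>p\<in>P. ev p x = 0}"
  using assms unfolding zariski_closed_def ev_def by (elim exE conjE) simp

lemma zariski_closed_inter:
  assumes V: "zariski_closed n V" and f: "f \<in> polyfun UNIV {..<n}"
  shows "zariski_closed n {x \<in> V. f x = 0}"
proof -
  obtain P where P: "\<forall>p\<in>P. mpoly_vars p \<subseteq> {..<n}" "V = {x \<in> torus n. \<forall>p\<in>P. ev p x = 0}"
    using zariski_closed_polyfun[OF V] .
  have "is_subring UNIV" by (simp add: is_subring_def)
  then obtain q where q: "mpoly_over UNIV {..<n} q" "f = ev q" using polyfun_imp_mpoly[OF f] by blast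
  have "{x \<in> V. f x = 0} = {x \<in> torus n. \<forall>p\<in>insert q P. ev p x = 0}" unfolding P(2) q(2) by auto
  moreover have "\<forall>p\<in>insert q P. mpoly_vars p \<subseteq> {..<n}" using P(1) q(1) by (auto simp: mpoly_over_def)
  ultimately show ?thesis unfolding zariski_closed_def ev_def by (intro exI[of _ "insert q P"] conjI)
qed

lemma zariski_closed_torus: "zariski_closed n (torus n)"
  unfolding zariski_closed_def by (intro exI[of _ "{}"]) auto

lemma irreducible_prime:
  assumes W: "irreducible_subvariety n W" and fg: "f \<in> polyfun UNIV {..<n}" "g \<in> polyfun UNIV {..<n}"
    and z: "\<forall>x\<in>W. f x * g x = 0"
  shows "(\<forall>x\<in>W. f x = 0) \<or> (\<forall>x\<in>W. g x = 0)"
proof -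
  have c: "zariski_closed n W" using W unfolding irreducible_subvariety_def by blast
  let ?A = "{x \<in> W. f x = 0}" and ?B = "{x \<in> W. g x = 0}"
  have "W = ?A \<union> ?B" using z by auto
  moreover have "zariski_closed n ?A" "zariski_closed n ?B" using zariski_closed_inter[OF c] fg by blast+
  ultimately have "W = ?A \<or> W = ?B" using W unfolding irreducible_subvariety_def by blast
  then show ?thesis by blast
qed

lemma zariski_closure_vanish:
  assumes "S \<subseteq> torus n" "f \<in> polyfun UNIV {..<n}" "\<And>x. x \<in> S \<Longrightarrow> f x = 0" "x \<in> zariski_closure n S"
  shows "f x = 0"
proof -
  have "zariski_closed n {x \<in> torus n. f x = 0}" by (rule zariski_closed_inter[OF zariski_closed_torus assms(2)])
  moreover have "S \<subseteq> {x \<in> torus n. f x = 0}" using assms(1,3) by blast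
  ultimately show ?thesis using assms(4) unfolding zariski_closure_def by blast
qed

definition mscale :: "'k \<Rightarrow> ('v, 'k::field) mpoly \<Rightarrow> ('v, 'k) mpoly" where
  "mscale c p = Poly_Mapping.single 0 c * p"

interpretation mvs: vector_space mscale
  by unfold_locales (simp_all add: mscale_def distrib_left distrib_right single_add mult_single mult.assoc[symmetric])

lemma ev_mscale: "ev (mscale c p) x = c * ev p x"
  by (simp add: mscale_def ev_mult ev_single monval_def)

lemma countable_monomials: "countable {m :: nat \<Rightarrow>\<^sub>0 nat. Poly_Mapping.keys m \<subseteq> {..<n}}"
proof -
  let ?f = "\<lambda>m :: nat \<Rightarrow>\<^sub>0 nat. map (Poly_Mapping.lookup m) [0..<n]"
  have "inj_on ?f {m. Poly_Mapping.keys m \<subseteq> {..<n}}"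
  proof (rule inj_onI)
    fix m m' :: "nat \<Rightarrow>\<^sub>0 nat"
    assume m: "m \<in> {m. Poly_Mapping.keys m \<subseteq> {..<n}}" "m' \<in> {m. Poly_Mapping.keys m \<subseteq> {..<n}}" "?f m = ?f m'"
    show "m = m'"
    proof (rule poly_mapping_eqI)
      fix i
      show "Poly_Mapping.lookup m i = Poly_Mapping.lookup m' i"
      proof (cases "i < n")
        case True
        then have "?f m ! i = ?f m' ! i" using m(3) by simp
        then show ?thesis using True by simp
      next
        case False
        then have "i \<notin> Poly_Mapping.keys m" "i \<notin> Poly_Mapping.keys m'" using m by auto
        then show ?thesis by (simp add: in_keys_iff)
      qed
    qed
  qed
  then show ?thesis by (rule countableI')
qed

text \<open>The polynomials in \<open>n\<close> variables have countable dimension, so countably many of the defining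
  equations suffice.\<close>

lemma zariski_closed_countable:
  fixes V :: "(nat \<Rightarrow> 'k::field) set"
  assumes "zariski_closed n V"
  obtains K F where "countable K" "F \<subseteq> polyfun K {..<n}" "V = {x \<in> torus n. \<forall>f\<in>F. f x = 0}"
proof -
  obtain P :: "(nat, 'k) mpoly set" where P: "\<forall>p\<in>P. mpoly_vars p \<subseteq> {..<n}" "V = {x \<in> torus n. \<forall>p\<in>P. ev p x = 0}"
    using zariski_closed_polyfun[OF assms] .
  obtain B where B: "B \<subseteq> P" "mvs.independent B" "P \<subseteq> mvs.span B"
    using mvs.maximal_independent_subset[of P] .
  let ?Mon = "{m :: nat \<Rightarrow>\<^sub>0 nat. Poly_Mapping.keys m \<subseteq> {..<n}}"
  let ?X = "{A. finite A \<and> A \<subseteq> ?Mon}"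
  let ?sp = "\<lambda>A. mvs.span ((\<lambda>m. Poly_Mapping.single m (1::'k)) ` A)"
  \<comment> \<open>There are countably many finite sets of monomials, and each spans a space that
    contains only finitely many members of the independent set \<open>B\<close>.\<close>
  have "B \<subseteq> (\<Union>A\<in>?X. B \<inter> ?sp A)"
  proof
    fix p assume p: "p \<in> B"
    then have "Poly_Mapping.keys p \<subseteq> ?Mon" using P(1) B(1) unfolding mpoly_vars_def by blast
    then have X: "Poly_Mapping.keys p \<in> ?X" by simp
    have "(\<Sum>m\<in>Poly_Mapping.keys p. mscale (Poly_Mapping.lookup p m) (Poly_Mapping.single m 1)) \<in> ?sp (Poly_Mapping.keys p)"
      by (intro mvs.span_sum mvs.span_scale mvs.span_base) auto
    then have "p \<in> ?sp (Poly_Mapping.keys p)"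
      using mpoly_expand[of p] by (simp add: mscale_def mult_single)
    then show "p \<in> (\<Union>A\<in>?X. B \<inter> ?sp A)" using X p by blast
  qed
  moreover have "countable (\<Union>A\<in>?X. B \<inter> ?sp A)"
  proof (rule countable_UN)
    show "countable ?X" by (rule countable_Collect_finite_subset[OF countable_monomials])
    fix A assume "A \<in> ?X"
    then have "finite ((\<lambda>m. Poly_Mapping.single m (1::'k)) ` A)" by simp
    moreover have "mvs.independent (B \<inter> ?sp A)" using B(2) by (rule mvs.independent_mono) blast
    ultimately have "finite (B \<inter> ?sp A)" using mvs.independent_span_bound by blast
    then show "countable (B \<inter> ?sp A)" by (rule countable_finite)
  qed
  ultimately have cB: "countable B" by (rule countable_subset)
  define K where "K = (\<Union>p\<in>B. insert 0 (Poly_Mapping.lookup p ` Poly_Mapping.keys p))"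
  have cK: "countable K" unfolding K_def using cB by (intro countable_UN) (auto intro: countable_finite)
  have "ev p \<in> polyfun K {..<n}" if p: "p \<in> B" for p
  proof (rule ev_polyfun)
    show "mpoly_vars p \<subseteq> {..<n}" using P(1) B(1) p by blast
    have "Poly_Mapping.lookup p m \<in> insert 0 (Poly_Mapping.lookup p ` Poly_Mapping.keys p)" for m
      by (cases "m \<in> Poly_Mapping.keys p") (auto simp: in_keys_iff)
    then show "range (Poly_Mapping.lookup p) \<subseteq> K" unfolding K_def using p by blast
  qed
  then have "ev ` B \<subseteq> polyfun K {..<n}" by blast
  moreover have "V = {x \<in> torus n. \<forall>f\<in>ev ` B. f x = 0}"
  proof -
    have "ev p x = 0" if x: "\<forall>p\<in>B. ev p x = 0" and p: "p \<in> P" for x p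
    proof -
      have "mvs.subspace {p. ev p x = 0}"
        by (rule mvs.subspaceI) (auto simp: ev_add ev_mscale)
      then have "mvs.span B \<subseteq> {p. ev p x = 0}" using x by (intro mvs.span_minimal) auto
      then show ?thesis using B(3) p by blast
    qed
    then show ?thesis unfolding P(2) using B(1) by blast
  qed
  ultimately show ?thesis using that cK by blast
qed

section \<open>Generic points\<close>

text \<open>As for \<open>alg_over_poly_family\<close>, but the common factor is kept as a
  polynomial function of its own: identities between polynomials at the point then become identities
  between families.\<close>

lemma poly_clear_denominators:
  fixes x :: "'v \<Rightarrow> 'k::field"
  assumes q: "coeffs_in q (gen_field (K \<union> x ` V))"
  shows "\<exists>p c. poly_family K V (degree q) p \<and> c \<in> polyfun K V \<and> c x \<noteq> 0 \<and> p x = Polynomial.smult (c x) q"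
proof -
  have "\<forall>i. \<exists>f g. f \<in> polyfun K V \<and> g \<in> polyfun K V \<and> g x \<noteq> 0 \<and> coeff q i = f x / g x"
    using q gen_field_fraction unfolding coeffs_in_def by blast
  then obtain f g where fg: "\<And>i. f i \<in> polyfun K V" "\<And>i. g i \<in> polyfun K V" "\<And>i. g i x \<noteq> 0"
    "\<And>i. coeff q i = f i x / g i x" by metis
  let ?d = "degree q"
  define p where "p y = (\<Sum>i\<le>?d. monom (f i y * (\<Prod>j\<in>{..?d} - {i}. g j y)) i)" for y
  have c: "coeff (p y) i = (if i \<le> ?d then f i y * (\<Prod>j\<in>{..?d} - {i}. g j y) else 0)" for y i
    unfolding p_def by (simp add: coeff_sum if_distrib cong: if_cong)
  have "poly_family K V ?d p" unfolding poly_family_def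
  proof (intro conjI allI)
    fix i show "(\<lambda>y. coeff (p y) i) \<in> polyfun K V"
      unfolding c by (cases "i \<le> ?d") (auto intro!: polyfun_0 polyfun_mult polyfun_prod fg)
  next
    fix y show "degree (p y) \<le> ?d" by (rule degree_le) (simp add: c)
  qed
  moreover have "p x = Polynomial.smult (\<Prod>j\<le>?d. g j x) q"
  proof (rule poly_eqI)
    fix i show "coeff (p x) i = coeff (Polynomial.smult (\<Prod>j\<le>?d. g j x) q) i"
    proof (cases "i \<le> ?d")
      case True
      then have "(\<Prod>j\<le>?d. g j x) = g i x * (\<Prod>j\<in>{..?d} - {i}. g j x)"
        by (simp add: prod.remove)
      then show ?thesis using True fg(3)[of i] by (simp add: c fg(4))
    qed (simp add: c coeff_eq_0)
  qed
  moreover have "(\<Prod>j\<le>?d. g j x) \<noteq> 0" using fg(3) by simp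
  moreover have "(\<lambda>y. \<Prod>j\<le>?d. g j y) \<in> polyfun K V" by (intro polyfun_prod fg)
  ultimately show ?thesis by (intro exI[of _ p] exI[of _ "\<lambda>y. \<Prod>j\<le>?d. g j y"]) simp
qed

lemma poly_family_diff:
  assumes "poly_family K V d p" "poly_family K V d q"
  shows "poly_family K V d (\<lambda>x. p x - q x)"
  using assms unfolding poly_family_def by (auto intro!: polyfun_diff degree_diff_le)

lemma poly_family_smult:
  assumes "c \<in> polyfun K V" "poly_family K V d p"
  shows "poly_family K V d (\<lambda>x. Polynomial.smult (c x) (p x))"
  using assms unfolding poly_family_def
  by (auto intro!: polyfun_mult)

lemma poly_family_mult:
  assumes "poly_family K V d p" "poly_family K V e q"
  shows "poly_family K V (d + e) (\<lambda>x. p x * q x)"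
  unfolding poly_family_def
proof (intro conjI allI)
  fix i show "(\<lambda>x. coeff (p x * q x) i) \<in> polyfun K V"
    unfolding coeff_mult using assms unfolding poly_family_def
    by (intro polyfun_sum polyfun_mult) auto
next
  fix x show "degree (p x * q x) \<le> d + e"
    using degree_mult_le[of "p x" "q x"] assms unfolding poly_family_def by (meson add_mono order_trans)
qed

lemma poly_family_mono: "poly_family K V d p \<Longrightarrow> d \<le> e \<Longrightarrow> poly_family K V e p"
  unfolding poly_family_def by (meson order_trans)

lemma poly_family_truncate:
  assumes "poly_family K V d p"
  shows "poly_family K V e (\<lambda>x. \<Sum>i\<le>e. monom (coeff (p x) i) i)"
proof -
  have c: "coeff (\<Sum>i\<le>e. monom (coeff (p x) i) i) k = (if k \<le> e then coeff (p x) k else 0)" for x k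
    by (simp add: coeff_sum if_distrib cong: if_cong)
  show ?thesis unfolding poly_family_def
  proof (intro conjI allI)
    fix k show "(\<lambda>x. coeff (\<Sum>i\<le>e. monom (coeff (p x) i) i) k) \<in> polyfun K V"
      unfolding c using assms polyfun_0[of K V] by (cases "k \<le> e") (auto simp: poly_family_def)
    fix x show "degree (\<Sum>i\<le>e. monom (coeff (p x) i) i) \<le> e"
      by (rule degree_le) (simp add: c)
  qed
qed

text \<open>\<open>Z\<close> stands for an ideal of polynomial functions, and \<open>p\<close> a polynomial of minimal degree in the
  variable \<open>m\<close>, over the functions of the earlier variables, that lies in \<open>Z\<close> without being trivial.\<close>

definition minimal_family ::
  "'k::field set \<Rightarrow> nat \<Rightarrow> (((nat \<Rightarrow> 'k) \<Rightarrow> 'k) \<Rightarrow> bool) \<Rightarrow> nat \<Rightarrow> ((nat \<Rightarrow> 'k) \<Rightarrow> 'k poly) \<Rightarrow> bool" where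
  "minimal_family K m Z e p \<longleftrightarrow> poly_family K {..<m} e p \<and> Z (\<lambda>x. poly (p x) (x m)) \<and>
     \<not> Z (\<lambda>x. coeff (p x) e) \<and>
     (\<forall>d q. d < e \<and> poly_family K {..<m} d q \<and> Z (\<lambda>x. poly (q x) (x m)) \<longrightarrow> (\<forall>i. Z (\<lambda>x. coeff (q x) i)))"

text \<open>Common to the functions vanishing on a variety and those vanishing at a single point;
  pseudo-division is used for both.\<close>

definition ideal_pred :: "'k::field set \<Rightarrow> (((nat \<Rightarrow> 'k) \<Rightarrow> 'k) \<Rightarrow> bool) \<Rightarrow> bool" where
  "ideal_pred K Z \<longleftrightarrow> Z (\<lambda>x. 0) \<and> (\<forall>f g. Z f \<longrightarrow> Z g \<longrightarrow> Z (\<lambda>x. f x - g x)) \<and> (\<forall>f g. Z f \<longrightarrow> Z (\<lambda>x. g x * f x))"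

lemma ideal_predD:
  assumes "ideal_pred K Z"
  shows "Z (\<lambda>x. 0)" "Z f \<Longrightarrow> Z g \<Longrightarrow> Z (\<lambda>x. f x - g x)" "Z f \<Longrightarrow> Z (\<lambda>x. g x * f x)"
    "Z f \<Longrightarrow> Z g \<Longrightarrow> Z (\<lambda>x. f x + g x)"
proof -
  show a: "Z (\<lambda>x. 0)" "Z f \<Longrightarrow> Z g \<Longrightarrow> Z (\<lambda>x. f x - g x)" "Z f \<Longrightarrow> Z (\<lambda>x. g x * f x)" for f g
    using assms unfolding ideal_pred_def by auto
  show "Z f \<Longrightarrow> Z g \<Longrightarrow> Z (\<lambda>x. f x + g x)"
    using a(2)[of f "\<lambda>x. (- 1) * g x"] a(3)[of g "\<lambda>x. - 1"] by simp
qed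

lemma ideal_pred_sum:
  assumes "ideal_pred K Z" "\<And>i. i \<in> A \<Longrightarrow> Z (f i)"
  shows "Z (\<lambda>x. \<Sum>i\<in>A. f i x)"
  using assms(2) by (induction A rule: infinite_finite_induct)
    (simp_all add: ideal_predD(1)[OF assms(1)] ideal_predD(4)[OF assms(1)])

lemma ideal_pred_poly:
  assumes "ideal_pred K Z" "poly_family K V d p" "\<And>i. Z (\<lambda>x. coeff (p x) i)"
  shows "Z (\<lambda>x. poly (p x) (x m))"
proof -
  have "poly (p x) (x m) = (\<Sum>i\<le>d. x m ^ i * coeff (p x) i)" for x
  proof -
    have "(\<Sum>i\<le>d. x m ^ i * coeff (p x) i) = (\<Sum>i\<le>degree (p x). x m ^ i * coeff (p x) i)"
      using assms(2) unfolding poly_family_def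
      by (intro sum.mono_neutral_right) (auto simp: coeff_eq_0)
    also have "\<dots> = poly (p x) (x m)" unfolding poly_altdef by (rule sum.cong) (simp_all only: mult.commute)
    finally show ?thesis by (rule sym)
  qed
  then have "(\<lambda>x. poly (p x) (x m)) = (\<lambda>x. \<Sum>i\<le>d. x m ^ i * coeff (p x) i)" by (rule ext)
  moreover have "Z (\<lambda>x. \<Sum>i\<le>d. x m ^ i * coeff (p x) i)"
  proof (rule ideal_pred_sum[OF assms(1), of "{..d}" "\<lambda>i x. x m ^ i * coeff (p x) i"])
    fix i show "Z (\<lambda>x. x m ^ i * coeff (p x) i)"
      using ideal_predD(3)[OF assms(1), of "\<lambda>x. coeff (p x) i" "\<lambda>x. x m ^ i"] assms(3) .
  qed
  ultimately show ?thesis by (simp only:)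
qed

text \<open>Pseudo-divide \<open>q\<close> by \<open>p\<close>; by minimality the coefficients of the remainder lie in \<open>Z\<close>.\<close>

lemma triangular_step:
  assumes Z: "ideal_pred K Z" and p: "minimal_family K m Z e p"
    and u: "coeff (p u) e \<noteq> 0" "poly (p u) (u m) = 0"
    and IH: "\<And>f. f \<in> polyfun K {..<m} \<Longrightarrow> Z f \<Longrightarrow> f u = 0"
    and q: "poly_family K {..<m} d q" "Z (\<lambda>x. poly (q x) (x m))"
  shows "poly (q u) (u m) = 0"
  using q
proof (induction d arbitrary: q rule: less_induct)
  case (less d)
  have pf: "poly_family K {..<m} e p" "Z (\<lambda>x. poly (p x) (x m))" "\<not> Z (\<lambda>x. coeff (p x) e)"
    using p by (simp_all add: minimal_family_def)
  have min: "Z (\<lambda>x. coeff (q x) i)"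
    if "d < e" "poly_family K {..<m} d q" "Z (\<lambda>x. poly (q x) (x m))" for d q i
    using p that by (simp add: minimal_family_def)
  show ?case
  proof (cases "d < e")
    case True
    have "coeff (q u) i = 0" for i
    proof (rule IH[of "\<lambda>x. coeff (q x) i"])
      show "(\<lambda>x. coeff (q x) i) \<in> polyfun K {..<m}" using less.prems(1) unfolding poly_family_def by blast
      show "Z (\<lambda>x. coeff (q x) i)" by (rule min[OF True less.prems])
    qed
    then have "q u = 0" by (simp add: poly_eqI)
    then show ?thesis by simp
  next
    case False
    \<comment> \<open>One step of pseudo-division: both leading terms become the product of the two
      leading coefficients and cancel.\<close>
    define r where "r x = Polynomial.smult (coeff (p x) e) (q x) - Polynomial.smult (coeff (q x) d) (monom 1 (d - e) * p x)" for x
    have cq: "(\<lambda>x. coeff (q x) d) \<in> polyfun K {..<m}" and cp: "(\<lambda>x. coeff (p x) e) \<in> polyfun K {..<m}"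
      using less.prems(1) pf(1) unfolding poly_family_def by blast+
    have mf: "poly_family K {..<m} (d - e) (\<lambda>x. monom 1 (d - e))"
      unfolding poly_family_def by (auto simp: polyfun_0 polyfun_1 degree_monom_eq)
    have "poly_family K {..<m} (d - e + e) (\<lambda>x. monom 1 (d - e) * p x)" by (rule poly_family_mult[OF mf pf(1)])
    then have r1: "poly_family K {..<m} d r" unfolding r_def using False
      by (intro poly_family_diff poly_family_smult cp cq less.prems(1)) simp
    have c0: "coeff (r x) d = 0" for x
      unfolding r_def using False by (simp add: coeff_monom_mult mult.commute[of "coeff (p x) e"])
    have Zr: "Z (\<lambda>x. poly (r x) (x m))"
    proof -
      have "Z (\<lambda>x. coeff (p x) e * poly (q x) (x m) - (coeff (q x) d * x m ^ (d - e)) * poly (p x) (x m))"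
        by (rule ideal_predD(2)[OF Z, of "\<lambda>x. coeff (p x) e * poly (q x) (x m)"
              "\<lambda>x. (coeff (q x) d * x m ^ (d - e)) * poly (p x) (x m)"],
            rule ideal_predD(3)[OF Z, of "\<lambda>x. poly (q x) (x m)" "\<lambda>x. coeff (p x) e"], fact,
            rule ideal_predD(3)[OF Z, of "\<lambda>x. poly (p x) (x m)" "\<lambda>x. coeff (q x) d * x m ^ (d - e)"], fact)
      then show ?thesis unfolding r_def by (simp add: poly_monom mult.assoc)
    qed
    have "poly (r u) (u m) = 0"
    \<comment> \<open>In degree 0 the truncated bound \<open>d - 1\<close> would not decrease, but
      there \<open>r u\<close> is constant and already 0.\<close>
    proof (cases "d = 0")
      case True
      have "degree (r u) = 0" using r1 True unfolding poly_family_def by simp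
      then have "r u = [:coeff (r u) 0:]" by (metis degree_0_id)
      then have "r u = 0" using c0[of u] True by simp
      then show ?thesis by simp
    next
      case False
      have "poly_family K {..<m} (d - 1) r" unfolding poly_family_def
      proof (intro conjI allI)
        fix i show "(\<lambda>x. coeff (r x) i) \<in> polyfun K {..<m}" using r1 unfolding poly_family_def by blast
        fix x show "degree (r x) \<le> d - 1"
        proof (rule degree_le, intro allI impI)
          fix i assume "d - 1 < i"
          then have "i = d \<or> d < i" using False by linarith
          then show "coeff (r x) i = 0"
            using c0 r1 coeff_eq_0[of "r x" i] unfolding poly_family_def by (meson le_less_trans)
        qed
      qed
      then show ?thesis using less.IH[of "d - 1" r] Zr False by simp
    qed
    then have "coeff (p u) e * poly (q u) (u m) = 0" unfolding r_def using u(2) by (simp add: poly_monom)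
    then show ?thesis using u(1) by simp
  qed
qed

section \<open>Conjugation, countability and transcendental numbers\<close>

lemma dclD: "a \<in> dcl S \<Longrightarrow> d \<in> Der S \<Longrightarrow> d a = 0"
  unfolding dcl_def by simp

text \<open>Conjugation is a field automorphism, so conjugating a derivation before and after gives
  a derivation; it kills what \<open>d\<close> kills after conjugation.\<close>

lemma cnj_dcl:
  assumes "cnj ` K \<subseteq> K" "a \<in> dcl (K \<union> A)"
  shows "cnj a \<in> dcl (K \<union> cnj ` A)"
  unfolding dcl_def
proof (intro CollectI ballI)
  fix d assume d: "d \<in> Der (K \<union> cnj ` A)"
  have "d (cnj a) = 0" if "a \<in> K \<union> A" for a
    using that assms(1) by (intro Der_zero[OF d]) auto
  then have "(\<lambda>z. cnj (d (cnj z))) \<in> Der (K \<union> A)"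
    by (simp add: Der_def Der_add[OF d] Der_mult[OF d])
  then have "cnj (d (cnj a)) = 0" by (rule dclD[OF assms(2)])
  then show "d (cnj a) = 0" by simp
qed

text \<open>Names for the elements of a generated field: its countability is inherited from the
  syntax.\<close>

datatype field_expr = Atom nat | Zero | One | Minus field_expr field_expr | Times field_expr field_expr | Inverse field_expr

primrec expr_value :: "(nat \<Rightarrow> 'k::field) \<Rightarrow> field_expr \<Rightarrow> 'k" where
  "expr_value f (Atom i) = f i"
| "expr_value f Zero = 0"
| "expr_value f One = 1"
| "expr_value f (Minus a b) = expr_value f a - expr_value f b"
| "expr_value f (Times a b) = expr_value f a * expr_value f b"
| "expr_value f (Inverse a) = inverse (expr_value f a)"

instance field_expr :: countable
  by countable_datatype

lemma countable_gen_field: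
  assumes "countable S"
  shows "countable (gen_field S)"
proof -
  define f where "f = from_nat_into S"
  have f: "S \<subseteq> range f" unfolding f_def using assms by (rule subset_range_from_nat_into)
  let ?F = "range (expr_value f)"
  have I: "expr_value f a \<in> ?F" for a by simp
  have "is_subfield ?F" unfolding is_subfield_def
  proof (intro conjI ballI)
    show "0 \<in> ?F" "1 \<in> ?F" using I[of Zero] I[of One] by simp_all
    fix x assume "x \<in> ?F"
    then obtain a where a: "x = expr_value f a" by blast
    show "inverse x \<in> ?F" using I[of "Inverse a"] by (simp add: a)
    fix y assume "y \<in> ?F"
    then obtain b where b: "y = expr_value f b" by blast
    show "x - y \<in> ?F" "x * y \<in> ?F" using I[of "Minus a b"] I[of "Times a b"] by (simp_all add: a b)
  qed
  moreover have "S \<subseteq> ?F"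
  proof
    fix x assume "x \<in> S"
    then obtain i where "x = f i" using f by blast
    then show "x \<in> ?F" using I[of "Atom i"] by simp
  qed
  ultimately have "gen_field S \<subseteq> ?F" by (rule gen_field_least)
  then show ?thesis by (rule countable_subset) simp
qed

lemma countable_dcl:
  fixes S :: "'k::field_char_0 set"
  assumes "countable S"
  shows "countable (dcl S)"
proof -
  let ?F = "gen_field S"
  have cF: "countable ?F" by (rule countable_gen_field[OF assms])
  let ?P = "Poly ` lists ?F"
  have "countable ?P" using cF by simp
  moreover have "dcl S \<subseteq> (\<Union>p\<in>?P - {0}. {a. poly p a = 0})"
  proof
    fix a assume "a \<in> dcl S"
    then obtain p where p: "p \<noteq> 0" "coeffs_in p ?F" "poly p a = 0"
      unfolding dcl_iff_alg_over alg_over_def by blast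
    have "coeffs p \<in> lists ?F" using p(2) unfolding coeffs_in_def coeffs_def by auto
    then have "p \<in> ?P" using Poly_coeffs[of p] by (metis imageI)
    then show "a \<in> (\<Union>p\<in>?P - {0}. {a. poly p a = 0})" using p by blast
  qed
  moreover have "countable (\<Union>p\<in>?P - {0}. {a. poly p a = 0})"
    using calculation(1) by (intro countable_UN) (auto intro: countable_finite poly_roots_finite)
  ultimately show ?thesis by (elim countable_subset)
qed

lemma real_transcendental:
  assumes "countable S"
  obtains a :: real where "complex_of_real a \<notin> dcl S"
proof -
  have "complex_of_real ` (complex_of_real -` dcl S) \<subseteq> dcl S" by auto
  then have "countable (complex_of_real ` (complex_of_real -` dcl S))"
    by (rule countable_subset) (rule countable_dcl[OF assms])
  then have "countable (complex_of_real -` dcl S)"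
    by (rule countable_image_inj_on) (auto simp: inj_on_def)
  then have "complex_of_real -` dcl S \<noteq> UNIV" using uncountable_UNIV_real by auto
  then obtain a where "a \<notin> complex_of_real -` dcl S" by blast
  then show ?thesis using that[of a] by simp
qed

lemma Der_ii: "d \<in> Der S \<Longrightarrow> d \<i> = 0"
proof -
  assume d: "d \<in> Der S"
  have "\<i> * d \<i> + d \<i> * \<i> = d (- 1)" using Der_mult[OF d, of "\<i>" "\<i>"] by simp
  also have "\<dots> = 0" using Der_minus[OF d, of 1] Der_1[OF d] by simp
  finally show ?thesis by simp
qed

text \<open>Two independent real numbers serve as real and imaginary parts. They are algebraic over
  \<open>y\<close> and its conjugate, as \<i> is algebraic, so these two must be independent as
  well.\<close>

lemma conjugate_independent:
  assumes "countable S"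
  obtains y where "y \<noteq> cnj y" "dindep S {y, cnj y}"
proof -
  obtain a :: real where a: "complex_of_real a \<notin> dcl S" using real_transcendental[OF assms] .
  have "countable (S \<union> {complex_of_real a})" using assms by simp
  then obtain b :: real where b: "complex_of_real b \<notin> dcl (S \<union> {complex_of_real a})"
    by (rule real_transcendental)
  have "dindep S {complex_of_real a}" unfolding dcl.indep_def using a by simp
  then have ab: "dindep S (insert (complex_of_real b) {complex_of_real a})" by (rule dcl.indep_insert) (rule b)
  have ne: "complex_of_real b \<noteq> complex_of_real a" using b dcl_ext[of "S \<union> {complex_of_real a}"] by auto
  define y where "y = complex_of_real a + \<i> * complex_of_real b"
  have cy: "cnj y = complex_of_real a - \<i> * complex_of_real b" by (simp add: y_def)
  let ?Y = "{y, cnj y}"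
  have sub: "is_subring (dcl (S \<union> ?Y))" by (rule is_subfield_subring[OF is_subfield_dcl])
  have fld: "is_subfield (dcl (S \<union> ?Y))" by (rule is_subfield_dcl)
  have yY: "y \<in> dcl (S \<union> ?Y)" "cnj y \<in> dcl (S \<union> ?Y)" using dcl_ext[of "S \<union> ?Y"] by auto
  have iY: "\<i> \<in> dcl (S \<union> ?Y)" unfolding dcl_def using Der_ii by blast
  have e: "complex_of_real a = (y + cnj y) / of_nat 2" "complex_of_real b = (y - cnj y) / (of_nat 2 * \<i>)"
    unfolding cy unfolding y_def by (simp_all add: field_simps)
  have "complex_of_real a \<in> dcl (S \<union> ?Y)"
    unfolding e(1) by (rule is_subfield_divide[OF fld is_subringD(5)[OF sub yY] is_subring_of_nat[OF sub]])
  moreover have "complex_of_real b \<in> dcl (S \<union> ?Y)" unfolding e(2)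
    by (rule is_subfield_divide[OF fld is_subringD(3)[OF sub yY] is_subringD(6)[OF sub is_subring_of_nat[OF sub] iY]])
  ultimately
  have sp: "insert (complex_of_real b) {complex_of_real a} \<subseteq> dcl (S \<union> ?Y)" by simp
  have c2: "card (insert (complex_of_real b) {complex_of_real a}) = 2" using ne by simp
  have fY: "finite ?Y" by simp
  have "card ?Y \<le> 2" by (simp add: card_insert_if)
  then have "dindep S ?Y" using dcl.indep_if_spanning[OF fY ab sp] c2 by linarith
  moreover have "card ?Y \<ge> 2" using dcl.steinitz[OF fY ab sp] c2 by linarith
  then have "y \<noteq> cnj y" by (auto simp: card_insert_if split: if_splits)
  ultimately show ?thesis by (rule that[rotated])
qed

text \<open>Membership in \<open>W\<close> is not part of the definition; the equations of
  \<open>W\<close> hold at \<open>w\<close> as soon as \<open>K\<close> contains their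
  coefficients.\<close>

definition generic_point :: "complex set \<Rightarrow> nat \<Rightarrow> (nat \<Rightarrow> complex) set \<Rightarrow> (nat \<Rightarrow> complex) \<Rightarrow> bool" where
  "generic_point K n W w \<longleftrightarrow> (\<forall>f\<in>polyfun K {..<n}. f w = 0 \<longleftrightarrow> (\<forall>x\<in>W. f x = 0))"

text \<open>Algebraic freeness of \<open>w\<close> from its conjugate over \<open>K\<close>, in the
  form used later: any derivation can be kept on \<open>w\<close> while being made zero on the
  conjugates.\<close>

definition conj_free :: "complex set \<Rightarrow> nat \<Rightarrow> (nat \<Rightarrow> complex) \<Rightarrow> bool" where
  "conj_free K n w \<longleftrightarrow> (\<forall>d\<in>Der K. \<exists>d'\<in>Der K. \<forall>i<n. d' (w i) = d (w i) \<and> d' (cnj (w i)) = 0)"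

lemma Der_zero_all: "d \<in> Der K \<Longrightarrow> (\<And>a. a \<in> A \<Longrightarrow> d a = 0) \<Longrightarrow> d \<in> Der (K \<union> A)"
  unfolding Der_def by auto

text \<open>If no nontrivial polynomial in the new variable vanishes on \<open>W\<close>, the new
  coordinate is taken transcendental over everything so far, together with its conjugate. Otherwise
  it is a root of a polynomial of least degree; that polynomial is irreducible at \<open>w\<close>
  because the ideal of \<open>W\<close> is prime, so the root satisfies no relation beyond those of
  \<open>W\<close>.\<close>

lemma generic_point_step:
  assumes W: "irreducible_subvariety n W" and m: "m < n" and K: "countable K" "cnj ` K \<subseteq> K"
    and w: "generic_point K m W w" "conj_free K m w"
  shows "\<exists>y. generic_point K (Suc m) W (w(m := y)) \<and> conj_free K (Suc m) (w(m := y))"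
proof -
  let ?Z = "\<lambda>f. \<forall>x\<in>W. f x = 0"
  have Z: "ideal_pred K ?Z" unfolding ideal_pred_def by simp
  have prime: "?Z f \<or> ?Z g" if "f \<in> polyfun K {..<Suc m}" "g \<in> polyfun K {..<Suc m}" "?Z (\<lambda>x. f x * g x)" for f g
  proof (rule irreducible_prime[OF W _ _ that(3)])
    show "f \<in> polyfun UNIV {..<n}" "g \<in> polyfun UNIV {..<n}"
      using polyfun_mono[OF that(1), of UNIV "{..<n}"] polyfun_mono[OF that(2), of UNIV "{..<n}"] m by auto
  qed
  have ins: "{..<Suc m} = insert m {..<m}" by auto
  have up: "f \<in> polyfun K {..<Suc m}" if "f \<in> polyfun K {..<m}" for f
    using polyfun_mono[OF that order_refl, of "{..<Suc m}"] by auto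
  have same: "f (w(m := y)) = f w" if "f \<in> polyfun K {..<m}" for f y
    using that by (rule polyfun_cong) auto
  have sameP: "p (w(m := y)) = p w" if "poly_family K {..<m} d p" for p d y
  proof (rule poly_eqI)
    fix i show "coeff (p (w(m := y))) i = coeff (p w) i"
      using same[of "\<lambda>x. coeff (p x) i"] that unfolding poly_family_def by simp
  qed
  have evP: "(\<lambda>x. poly (p x) (x m)) \<in> polyfun K {..<Suc m}" if "poly_family K {..<m} d p" for p d
    by (rule poly_family_eval[OF that]) auto
  have cP: "(\<lambda>x. coeff (p x) i) \<in> polyfun K {..<m}" if "poly_family K {..<m} d p" for p d i
    using that unfolding poly_family_def by blast
  have gp: "f w = 0 \<longleftrightarrow> ?Z f" if "f \<in> polyfun K {..<m}" for f using w(1) that unfolding generic_point_def by blast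
  have dec: "\<exists>q d. poly_family K {..<m} d q \<and> f = (\<lambda>x. poly (q x) (x m))"
    if f: "f \<in> polyfun K {..<Suc m}" for f
  proof -
    obtain q d where "poly_family K {..<m} d q" "\<forall>x. f x = poly (q x) (x m)"
      using polyfun_decompose[OF f[unfolded ins]] by blast
    then show ?thesis by (intro exI[of _ q] exI[of _ d]) auto
  qed
  let ?w = "\<lambda>y. w(m := y)"
  have im: "?w y ` {..<m} = w ` {..<m}" for y by auto
  show ?thesis
  proof (cases "\<exists>d q i. poly_family K {..<m} d q \<and> ?Z (\<lambda>x. poly (q x) (x m)) \<and> \<not> ?Z (\<lambda>x. coeff (q x) i)")
    case False
    then have noZ: "?Z (\<lambda>x. coeff (q x) i)" if "poly_family K {..<m} d q" "?Z (\<lambda>x. poly (q x) (x m))" for d q i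
      using that by blast
    let ?S = "K \<union> (w ` {..<m} \<union> cnj ` w ` {..<m})"
    have "countable ?S" using K(1) by (simp add: countable_finite)
    then obtain y where y: "y \<noteq> cnj y" "dindep ?S {y, cnj y}" by (rule conjugate_independent)
    have "{y, cnj y} - {y} = {cnj y}" using y(1) by auto
    then have "y \<notin> dcl (?S \<union> {cnj y})" using y(2) unfolding dcl.indep_def by force
    moreover have "dcl (K \<union> ?w y ` {..<m}) \<subseteq> dcl (?S \<union> {cnj y})" unfolding im by (rule dcl_mono) auto
    ultimately have yt: "?w y m \<notin> dcl (K \<union> ?w y ` {..<m})" by auto
    have "generic_point K (Suc m) W (?w y)" unfolding generic_point_def
    proof
      fix f assume f: "f \<in> polyfun K {..<Suc m}"
      obtain q d where q: "poly_family K {..<m} d q" "f = (\<lambda>x. poly (q x) (x m))" using dec[OF f] by blast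
      show "f (?w y) = 0 \<longleftrightarrow> ?Z f"
      proof
        assume "f (?w y) = 0"
        then have "poly (q (?w y)) (?w y m) = 0" unfolding q(2) .
        then have "q (?w y) = 0" by (rule poly_family_vanish[OF q(1) yt])
        then have "q w = 0" using sameP[OF q(1)] by simp
        then have "?Z (\<lambda>x. coeff (q x) i)" for i using gp[OF cP[OF q(1)], of i] by simp
        then show "?Z f" unfolding q(2) by (rule ideal_pred_poly[OF Z q(1)])
      next
        assume "?Z f"
        then have "?Z (\<lambda>x. coeff (q x) i)" for i using noZ[OF q(1)] q(2) by blast
        then have "coeff (q w) i = 0" for i using gp[OF cP[OF q(1)], of i] by blast
        then have "q w = 0" by (simp add: poly_eqI)
        then show "f (?w y) = 0" unfolding q(2) using sameP[OF q(1)] by simp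
      qed
    qed
    moreover have "conj_free K (Suc m) (?w y)" unfolding conj_free_def
    proof
      fix d assume d: "d \<in> Der K"
      then obtain d' where d': "d' \<in> Der K" "\<forall>i<m. d' (w i) = d (w i) \<and> d' (cnj (w i)) = 0"
        using w(2) unfolding conj_free_def by blast
      \<comment> \<open>A correction that leaves the earlier coordinates and their conjugates alone
        and adjusts \<open>d'\<close> at \<open>y\<close> and at \<open>cnj y\<close>, which are
        independent.\<close>
      obtain e where e: "e \<in> Der ?S" "\<forall>b\<in>{y, cnj y}. e b = (if b = y then d y - d' y else - d' (cnj y))"
        using dindep_prescribe[OF y(2), where f = "\<lambda>b. if b = y then d y - d' y else - d' (cnj y)"] by auto
      have eK: "e \<in> Der K" using e(1) Der_antimono[of K ?S] by blast
      have e0: "e (w i) = 0" "e (cnj (w i)) = 0" if "i < m" for i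
        using that by (auto intro!: Der_zero[OF e(1)])
      let ?e = "\<lambda>x. d' x + 1 * e x"
      have "?e \<in> Der K" by (rule Der_lin_comb[OF d'(1) eK])
      moreover have "?e (?w y i) = d (?w y i) \<and> ?e (cnj (?w y i)) = 0" if "i < Suc m" for i
      proof (cases "i = m")
        case True
        then show ?thesis using e(2) y(1) by auto
      next
        case False
        then have "i < m" using that by simp
        then show ?thesis using e0 d'(2) False by simp
      qed
      ultimately show "\<exists>d'\<in>Der K. \<forall>i<Suc m. d' (?w y i) = d (?w y i) \<and> d' (cnj (?w y i)) = 0"
        by (intro bexI[of _ ?e]) auto
    qed
    ultimately show ?thesis by blast
  next
    case True
    let ?Q = "\<lambda>e. \<exists>q. poly_family K {..<m} e q \<and> ?Z (\<lambda>x. poly (q x) (x m)) \<and> (\<exists>i. \<not> ?Z (\<lambda>x. coeff (q x) i))"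
    have exQ: "\<exists>e. ?Q e" using True by blast
    define e where "e = (LEAST e. ?Q e)"
    have Qe: "?Q e" unfolding e_def using exQ by (rule LeastI_ex)
    have lt: "\<not> ?Q d" if "d < e" for d using that unfolding e_def by (rule not_less_Least)
    obtain p i where p: "poly_family K {..<m} e p" "?Z (\<lambda>x. poly (p x) (x m))" "\<not> ?Z (\<lambda>x. coeff (p x) i)"
      using Qe by blast
    \<comment> \<open>Otherwise the leading term could be dropped on \<open>W\<close>, contradicting
      the choice of \<open>e\<close>.\<close>
    have lead: "\<not> ?Z (\<lambda>x. coeff (p x) e)"
    proof
      assume ze: "?Z (\<lambda>x. coeff (p x) e)"
      have ie: "i \<noteq> e" using ze p(3) by auto
      have "i < e"
      proof (rule ccontr)
        assume "\<not> i < e"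
        then have "e < i" using ie by simp
        then have "coeff (p x) i = 0" for x
          using p(1) unfolding poly_family_def by (meson coeff_eq_0 le_less_trans)
        then show False using p(3) by simp
      qed
      define r where "r x = (\<Sum>k\<le>e - 1. monom (coeff (p x) k) k)" for x
      have rf: "poly_family K {..<m} (e - 1) r" unfolding r_def by (rule poly_family_truncate[OF p(1)])
      have rc: "coeff (r x) k = (if k \<le> e - 1 then coeff (p x) k else 0)" for x k
        unfolding r_def by (simp add: coeff_sum if_distrib cong: if_cong)
      have "r x = p x" if x: "x \<in> W" for x
      proof (rule poly_eqI)
        fix k
        show "coeff (r x) k = coeff (p x) k"
        proof (cases "k \<le> e - 1")
          case False
          then have "k = e \<or> e < k" using \<open>i < e\<close> by linarith
          then have "coeff (p x) k = 0"
            using ze x p(1) unfolding poly_family_def by (meson coeff_eq_0 le_less_trans)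
          then show ?thesis using False by (simp add: rc)
        qed (simp add: rc)
      qed
      then have "?Q (e - 1)" using rf p(2,3) by (intro exI[of _ r]) auto
      then show False using lt[of "e - 1"] \<open>i < e\<close> by simp
    qed
    have mf: "minimal_family K m ?Z e p" unfolding minimal_family_def using p(1,2) lead lt by blast
    have lw: "coeff (p w) e \<noteq> 0" using gp[OF cP[OF p(1)], of e] lead by blast
    have dw: "degree (p w) = e"
      using p(1) lw unfolding poly_family_def by (meson antisym le_degree)
    have e0: "e \<noteq> 0"
    proof
      assume e: "e = 0"
      have "poly (p x) (x m) = coeff (p x) e" for x
      proof -
        have "degree (p x) = 0" using p(1) e unfolding poly_family_def by simp
        then have "p x = [:coeff (p x) 0:]" by (metis degree_0_id)
        then show ?thesis using e by (metis poly_0 poly_pCons mult_zero_right add_0_right)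
      qed
      then show False using p(2) lead by simp
    qed
    then obtain y where y: "poly (p w) y = 0"
      using fundamental_theorem_of_algebra_alt[of "p w"] dw
      by (metis constant_degree fundamental_theorem_of_algebra)
    let ?F = "gen_field (K \<union> w ` {..<m})"
    have F: "is_subfield ?F" by (rule is_subfield_gen)
    have cF: "coeffs_in (q w) ?F" if "poly_family K {..<m} d q" for q d
      unfolding coeffs_in_def using polyfun_value_gen_field[OF cP[OF that]] by blast
    have p0: "p w \<noteq> 0" using lw by auto
    have alg: "alg_over ?F y" unfolding alg_over_def using cF[OF p(1)] p0 y by blast
    obtain \<mu> where mu: "coeffs_in \<mu> ?F" "lead_coeff \<mu> = 1" "poly \<mu> y = 0"
      "\<And>p. coeffs_in p ?F \<Longrightarrow> poly p y = 0 \<Longrightarrow> p \<noteq> 0 \<Longrightarrow> degree \<mu> \<le> degree p"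
      using min_poly_exists[OF F alg] by metis
    have dvd: "\<exists>\<nu>. coeffs_in \<nu> ?F \<and> q = \<nu> * \<mu>" if q: "coeffs_in q ?F" "poly q y = 0" for q
    proof -
      obtain r \<nu> where r: "coeffs_in r ?F" "coeffs_in \<nu> ?F" "q = \<nu> * \<mu> + r" "r = 0 \<or> degree r < degree \<mu>"
        using monic_reduce[OF is_subfield_subring[OF F] mu(1,2) q(1)] by blast
      have "poly r y = 0" using q(2) r(3) mu(3) by simp
      then have "r = 0" using mu(4)[OF r(1)] r(4) by (meson leD)
      then show ?thesis using r by auto
    qed
    have famZ: "?Z (\<lambda>x. poly (q x) (x m))" if "poly_family K {..<m} d q" "q w = 0" for q d
      by (rule ideal_pred_poly[OF Z that(1)]) (use gp[OF cP[OF that(1)]] that(2) in simp)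
    \<comment> \<open>Gauss's lemma: a proper factor of \<open>p w\<close> over the generated field
      would, after clearing denominators, split a multiple of \<open>p\<close> into two families of
      smaller degree whose product vanishes on \<open>W\<close>. By primality one of them vanishes
      on \<open>W\<close>, against minimality of \<open>e\<close>.\<close>
    have degmu: "degree \<mu> = e"
    proof (rule ccontr)
      assume "degree \<mu> \<noteq> e"
      then have de: "degree \<mu> < e" using mu(4)[OF cF[OF p(1)] y p0] dw by simp
      have dm0: "degree \<mu> \<noteq> 0"
      proof
        assume "degree \<mu> = 0"
        then have "\<mu> = [:1:]" using mu(2) by (metis degree_0_id)
        then show False using mu(3) by simp
      qed
      obtain \<nu> where nu: "coeffs_in \<nu> ?F" "p w = \<nu> * \<mu>" using dvd[OF cF[OF p(1)] y] by blast
      have nz: "\<mu> \<noteq> 0" "\<nu> \<noteq> 0" using nu(2) p0 by auto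
      have dn: "degree \<nu> < e" "degree \<nu> + degree \<mu> = e"
        using degree_mult_eq[OF nz(2,1)] nu(2) dw dm0 by auto
      obtain a \<alpha> where a: "poly_family K {..<m} (degree \<mu>) a" "\<alpha> \<in> polyfun K {..<m}" "\<alpha> w \<noteq> 0"
        "a w = Polynomial.smult (\<alpha> w) \<mu>" using poly_clear_denominators[OF mu(1)] by blast
      obtain b \<beta> where b: "poly_family K {..<m} (degree \<nu>) b" "\<beta> \<in> polyfun K {..<m}" "\<beta> w \<noteq> 0"
        "b w = Polynomial.smult (\<beta> w) \<nu>" using poly_clear_denominators[OF nu(1)] by blast
      \<comment> \<open>It vanishes at the generic \<open>w\<close> coefficientwise, hence on
        \<open>W\<close>; since \<open>p\<close> vanishes on \<open>W\<close> too, so does the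
        product of the families \<open>b\<close> and \<open>a\<close>.\<close>
      let ?g = "\<lambda>x. Polynomial.smult (\<alpha> x * \<beta> x) (p x) - b x * a x"
      have "poly_family K {..<m} (degree \<nu> + degree \<mu>) ?g"
        by (intro poly_family_diff poly_family_smult poly_family_mult polyfun_mult a b)
           (use p(1) dn(2) in simp)
      moreover have "?g w = 0" unfolding a(4) b(4) nu(2) by (simp add: mult.commute)
      ultimately have zg: "?Z (\<lambda>x. poly (?g x) (x m))" by (rule famZ)
      have "poly (b x) (x m) * poly (a x) (x m) = 0" if x: "x \<in> W" for x
      proof -
        have "poly (?g x) (x m) = 0" using zg x by blast
        moreover have "poly (p x) (x m) = 0" using p(2) x by blast
        ultimately show ?thesis by simp
      qed
      then have "?Z (\<lambda>x. poly (b x) (x m)) \<or> ?Z (\<lambda>x. poly (a x) (x m))"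
        by (intro prime evP[OF b(1)] evP[OF a(1)]) blast
      then show False
      proof
        assume "?Z (\<lambda>x. poly (b x) (x m))"
        then have "\<forall>i. ?Z (\<lambda>x. coeff (b x) i)" using lt[OF dn(1)] b(1) by blast
        then have "coeff (b w) i = 0" for i using gp[OF cP[OF b(1)], of i] by blast
        then have "b w = 0" by (simp add: poly_eqI)
        then show False using b(3,4) nz(2) by simp
      next
        assume "?Z (\<lambda>x. poly (a x) (x m))"
        then have "\<forall>i. ?Z (\<lambda>x. coeff (a x) i)" using lt[OF de] a(1) by blast
        then have "coeff (a w) i = 0" for i using gp[OF cP[OF a(1)], of i] by blast
        then have "a w = 0" by (simp add: poly_eqI)
        then show False using a(3,4) nz(1) by simp
      qed
    qed
    have pmu: "\<exists>c. c \<in> ?F \<and> c \<noteq> 0 \<and> \<mu> = Polynomial.smult c (p w)"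
    proof -
      obtain \<nu> where nu: "coeffs_in \<nu> ?F" "p w = \<nu> * \<mu>" using dvd[OF cF[OF p(1)] y] by blast
      have nz: "\<mu> \<noteq> 0" "\<nu> \<noteq> 0" using nu(2) p0 by auto
      have "degree \<nu> = 0" using degree_mult_eq[OF nz(2,1)] nu(2) dw degmu by simp
      then have "\<nu> = [:coeff \<nu> 0:]" by (metis degree_0_id)
      then have "p w = [:coeff \<nu> 0:] * \<mu>" "coeff \<nu> 0 \<noteq> 0" using nu(2) nz(2) by (metis, metis pCons_0_0)
      then have "p w = Polynomial.smult (coeff \<nu> 0) \<mu>" "coeff \<nu> 0 \<noteq> 0" by simp_all
      moreover have "coeff \<nu> 0 \<in> ?F" using nu(1) unfolding coeffs_in_def by blast
      ultimately show ?thesis using is_subfield_inverse[OF F]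
        by (intro exI[of _ "inverse (coeff \<nu> 0)"]) simp
    qed
    have "generic_point K (Suc m) W (?w y)" unfolding generic_point_def
    proof
      fix f assume f: "f \<in> polyfun K {..<Suc m}"
      obtain q d where q: "poly_family K {..<m} d q" "f = (\<lambda>x. poly (q x) (x m))" using dec[OF f] by blast
      show "f (?w y) = 0 \<longleftrightarrow> ?Z f"
      proof
        assume zf: "?Z f"
        have "poly (q (?w y)) (?w y m) = 0"
        proof (rule triangular_step[OF Z mf, of "?w y"])
          show "coeff (p (?w y)) e \<noteq> 0" using lw sameP[OF p(1)] by simp
          show "poly (p (?w y)) (?w y m) = 0" using y sameP[OF p(1)] by simp
          show "g (?w y) = 0" if "g \<in> polyfun K {..<m}" "?Z g" for g using gp[OF that(1)] that same[OF that(1)] by simp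
          show "poly_family K {..<m} d q" by (rule q(1))
          show "?Z (\<lambda>x. poly (q x) (x m))" using zf q(2) by simp
        qed
        then show "f (?w y) = 0" unfolding q(2) .
      next
        assume "f (?w y) = 0"
        then have qy: "poly (q w) y = 0" unfolding q(2) using sameP[OF q(1)] by simp
        obtain \<nu> where nu: "coeffs_in \<nu> ?F" "q w = \<nu> * \<mu>" using dvd[OF cF[OF q(1)] qy] by blast
        obtain c where c: "c \<in> ?F" "\<mu> = Polynomial.smult c (p w)" using pmu by blast
        have "coeffs_in (Polynomial.smult c \<nu>) ?F" by (rule coeffs_in_ring(6)[OF is_subfield_subring[OF F] c(1) nu(1)])
        then obtain b \<beta> where b: "poly_family K {..<m} (degree (Polynomial.smult c \<nu>)) b" "\<beta> \<in> polyfun K {..<m}"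
          "\<beta> w \<noteq> 0" "b w = Polynomial.smult (\<beta> w) (Polynomial.smult c \<nu>)"
          using poly_clear_denominators by blast
        let ?D = "max d (degree (Polynomial.smult c \<nu>) + e)"
        let ?g = "\<lambda>x. Polynomial.smult (\<beta> x) (q x) - b x * p x"
        have "poly_family K {..<m} ?D ?g"
          using poly_family_mono[OF poly_family_smult[OF b(2) q(1)], of ?D]
            poly_family_mono[OF poly_family_mult[OF b(1) p(1)], of ?D] by (intro poly_family_diff) auto
        moreover have "?g w = 0" unfolding b(4) nu(2) c(2) by (simp add: mult_ac)
        ultimately have zg: "?Z (\<lambda>x. poly (?g x) (x m))" by (rule famZ)
        have "\<beta> x * f x = 0" if x: "x \<in> W" for x
        proof -
          have "poly (?g x) (x m) = 0" using zg x by blast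
          moreover have "poly (p x) (x m) = 0" using p(2) x by blast
          ultimately show ?thesis unfolding q(2) by simp
        qed
        then have "?Z \<beta> \<or> ?Z f" by (intro prime up[OF b(2)] f) blast
        moreover have "\<not> ?Z \<beta>" using gp[OF b(2)] b(3) by blast
        ultimately show "?Z f" by blast
      qed
    qed
    moreover have "conj_free K (Suc m) (?w y)" unfolding conj_free_def
    proof
      fix d assume d: "d \<in> Der K"
      then obtain d' where d': "d' \<in> Der K" "\<forall>i<m. d' (w i) = d (w i) \<and> d' (cnj (w i)) = 0"
        using w(2) unfolding conj_free_def by blast
      \<comment> \<open>As \<open>y\<close> is algebraic over the earlier coordinates, the
        derivation that works for them works for \<open>y\<close> without change; conjugation treats
        \<open>cnj y\<close> in the same way.\<close>
      have yd: "y \<in> dcl (K \<union> w ` {..<m})" using alg dcl_iff_alg_over by blast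
      have "(\<lambda>x. d x + (- 1) * d' x) \<in> Der (K \<union> w ` {..<m})"
        by (rule Der_zero_all[OF Der_lin_comb[OF d d'(1)]]) (use d'(2) in auto)
      then have "d y + (- 1) * d' y = 0" by (rule dclD[OF yd])
      moreover have "d' (cnj y) = 0"
      proof -
        have "d' \<in> Der (K \<union> cnj ` (w ` {..<m}))" by (rule Der_zero_all[OF d'(1)]) (use d'(2) in auto)
        then show ?thesis by (rule dclD[OF cnj_dcl[OF K(2) yd]])
      qed
      ultimately have "\<forall>i<Suc m. d' (?w y i) = d (?w y i) \<and> d' (cnj (?w y i)) = 0"
        using d'(2) by (auto simp: less_Suc_eq)
      then show "\<exists>d'\<in>Der K. \<forall>i<Suc m. d' (?w y i) = d (?w y i) \<and> d' (cnj (?w y i)) = 0"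
        using d'(1) by blast
    qed
    ultimately show ?thesis by blast
  qed
qed

theorem generic_point_exists:
  assumes W: "irreducible_subvariety n W" and K: "countable K" "cnj ` K \<subseteq> K"
  obtains w where "generic_point K n W w" "conj_free K n w"
proof -
  have "m \<le> n \<Longrightarrow> \<exists>w. generic_point K m W w \<and> conj_free K m w" for m
  proof (induction m)
    case 0
    have ne: "W \<noteq> {}" using W unfolding irreducible_subvariety_def by blast
    have "f x = f (\<lambda>_. 0)" if "f \<in> polyfun K {}" for f and x :: "nat \<Rightarrow> complex"
      using that by (rule polyfun_cong) auto
    then have "f (\<lambda>_. 0) = 0 \<longleftrightarrow> (\<forall>x\<in>W. f x = 0)" if "f \<in> polyfun K {}" for f
      using ne that by (metis all_not_in_conv)
    then have "generic_point K 0 W (\<lambda>_. 0)" unfolding generic_point_def by simp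
    moreover have "conj_free K 0 (\<lambda>_. 0)" unfolding conj_free_def by auto
    ultimately show ?case by blast
  next
    case (Suc m)
    then obtain w where "generic_point K m W w" "conj_free K m w" by auto
    then show ?case using generic_point_step[OF W _ K, of m w] Suc.prems by auto
  qed
  then show ?thesis using that by blast
qed

section \<open>Krull dimension and transcendence degree\<close>

lemma generic_pointD:
  "generic_point K n W w \<Longrightarrow> f \<in> polyfun K {..<n} \<Longrightarrow> f w = 0 \<longleftrightarrow> (\<forall>x\<in>W. f x = 0)"
  unfolding generic_point_def by simp

lemma generic_point_nonzero:
  assumes "generic_point K n W w" "W \<noteq> {}" "W \<subseteq> torus n" "i < n"
  shows "w i \<noteq> 0"
proof
  assume "w i = 0"
  moreover have "(\<lambda>x. x i) \<in> polyfun K {..<n}" using assms(4) by (intro polyfun_var) simp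
  ultimately have "\<forall>x\<in>W. x i = 0" using generic_pointD[OF assms(1), of "\<lambda>x. x i"] by simp
  moreover obtain x where "x \<in> W" using assms(2) by blast
  moreover have "x i \<noteq> 0" using \<open>x \<in> W\<close> assms(3,4) by (auto simp: tuples_def mult_group_def PiE_def Pi_def)
  ultimately show False by blast
qed

text \<open>A transcendence basis at \<open>z\<close> stays independent at \<open>z'\<close>. If the
  ranks agreed, an equation \<open>f\<close> of \<open>Z\<close> not vanishing on \<open>Z'\<close>
  would have a value at \<open>z'\<close> that is nonzero and algebraic over that basis; an equation
  for its inverse specialises at \<open>z\<close> to the vanishing of a single coefficient, which
  independence makes identically zero.\<close>

lemma generic_rank_strict:
  assumes Z: "Z = {x \<in> torus n. \<forall>f\<in>F. f x = 0}" "F \<subseteq> polyfun K {..<n}" and ZZ: "Z \<subset> Z'" "Z' \<subseteq> torus n"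
    and z: "generic_point K n Z z" and z': "generic_point K n Z' z'"
  shows "drk K (z ` {..<n}) < drk K (z' ` {..<n})"
proof -
  have tr: "f z = 0" if "f \<in> polyfun K {..<n}" "f z' = 0" for f
    using generic_pointD[OF z that(1)] generic_pointD[OF z' that(1)] that(2) ZZ(1) by auto
  have fin: "finite {..<n}" by simp
  obtain J where J: "J \<subseteq> {..<n}" "tindep K z J" "z ` {..<n} \<subseteq> dcl (K \<union> z ` J)" "card J = drk K (z ` {..<n})"
    using tindep_basis[OF fin] .
  have fJ: "finite J" using J(1) finite_subset by blast
  have J': "tindep K z' J" by (rule tindep_transfer[of K "{..<n}" z' z J]) (fact tr, fact fJ, fact J(1), fact J(2))
  have le: "card J \<le> drk K (z' ` {..<n})" by (rule tindep_card_le[OF fin J(1) J'])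
  show ?thesis
  proof (rule ccontr)
    assume "\<not> drk K (z ` {..<n}) < drk K (z' ` {..<n})"
    then have eq: "drk K (z' ` {..<n}) = card J" using le J(4) by simp
    have sp: "z' ` {..<n} \<subseteq> dcl (K \<union> z' ` J)"
    proof (rule ccontr)
      assume "\<not> z' ` {..<n} \<subseteq> dcl (K \<union> z' ` J)"
      then obtain a where a: "a \<in> z' ` {..<n}" "a \<notin> dcl (K \<union> z' ` J)" by blast
      have ij: "inj_on z' J" "dindep K (z' ` J)" using J' by (auto simp: tindep_iff)
      have "dindep K (insert a (z' ` J))" by (rule dcl.indep_insert[OF ij(2) a(2)])
      moreover have "insert a (z' ` J) \<subseteq> z' ` {..<n}" using a(1) J(1) by auto
      moreover have "z' ` {..<n} \<subseteq> dcl (K \<union> z' ` {..<n})" using dcl_ext[of "K \<union> z' ` {..<n}"] by blast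
      ultimately have "card (insert a (z' ` J)) \<le> drk K (z' ` {..<n})"
        using dcl.indep_le_rk[where Y = K and S = "z' ` {..<n}" and X = "z' ` {..<n}" and B = "insert a (z' ` J)"] by simp
      moreover have "a \<notin> z' ` J" using a(2) dcl_ext[of "K \<union> z' ` J"] by blast
      ultimately show False using eq fJ card_image[OF ij(1)] by simp
    qed
    obtain x f where xf: "x \<in> Z'" "f \<in> F" "f x \<noteq> 0" using ZZ unfolding Z(1) by blast
    have fp: "f \<in> polyfun K {..<n}" using xf(2) Z(2) by blast
    have fz': "f z' \<noteq> 0" using generic_pointD[OF z' fp] xf by auto
    have fz: "f z = 0" using generic_pointD[OF z fp] xf(2) unfolding Z(1) by auto
    have "f z' \<in> dcl (K \<union> z' ` J)"
      by (rule polyfun_value_in[OF fp is_subfield_subring[OF is_subfield_dcl]])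
         (use sp dcl_ext[of "K \<union> z' ` J"] in auto)
    then have "inverse (f z') \<in> dcl (K \<union> z' ` J)" by (rule is_subfield_inverse[OF is_subfield_dcl])
    then have "alg_over (gen_field (K \<union> z' ` J)) (inverse (f z'))" by (simp add: dcl_iff_alg_over)
    then obtain p d where p: "poly_family K J d p" "p z' \<noteq> 0" "poly (p z') (inverse (f z')) = 0"
      using alg_over_poly_family by blast
    define e where "e = degree (p z')"
    have cp: "(\<lambda>x. coeff (p x) i) \<in> polyfun K J" for i using p(1) unfolding poly_family_def by blast
    have cpn: "(\<lambda>x. coeff (p x) i) \<in> polyfun K {..<n}" for i by (rule polyfun_mono[OF cp order_refl J(1)])
    \<comment> \<open>The equation of the inverse of f, multiplied by f to the power
      \<open>e\<close>. Where f vanishes, only the term \<open>i = e\<close> remains.\<close>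
    let ?h = "\<lambda>x. \<Sum>i\<le>e. coeff (p x) i * f x ^ (e - i)"
    have "?h \<in> polyfun K {..<n}" by (intro polyfun_sum polyfun_mult cpn polyfun_power fp)
    moreover have "?h z' = 0"
    proof -
      have "?h z' = (\<Sum>i\<le>e. f z' ^ e * (coeff (p z') i * inverse (f z') ^ i))"
      proof (rule sum.cong[OF refl])
        fix i assume "i \<in> {..e}"
        then have "f z' ^ e = f z' ^ (e - i) * f z' ^ i" by (simp add: power_add[symmetric])
        then show "coeff (p z') i * f z' ^ (e - i) = f z' ^ e * (coeff (p z') i * inverse (f z') ^ i)"
          using fz' by (simp add: field_simps)
      qed
      also have "\<dots> = f z' ^ e * poly (p z') (inverse (f z'))"
        unfolding sum_distrib_left[symmetric] poly_altdef e_def ..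
      finally show ?thesis using p(3) by simp
    qed
    ultimately have "?h z = 0" using tr[of ?h] by blast
    moreover have "?h z = (\<Sum>i\<le>e. if i = e then coeff (p z) e else 0)"
      by (rule sum.cong[OF refl]) (auto simp: fz power_0_left)
    ultimately have "coeff (p z) e = 0" by simp
    then have "coeff (p z') e = 0" using tindep_polyfun_zero[OF fJ J(2) cp[of e]] by simp
    then show False using p(2) unfolding e_def by simp
  qed
qed

text \<open>In a chain of irreducible closed sets the rank of generic points grows with each member,
  so the top one has rank at least \<open>d\<close>. Its independent coordinates are then lifted to
  \<open>y\<close>, since every relation of \<open>y\<close> over \<open>K0\<close> holds on
  \<open>S\<close> and on the closure of \<open>S\<close>.\<close>

lemma variety_dim_le:
  assumes K0: "countable K0" "cnj ` K0 \<subseteq> K0" and S: "S \<subseteq> torus k"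
    and H: "\<And>f. f \<in> polyfun K0 {..<k} \<Longrightarrow> f y = 0 \<Longrightarrow> \<forall>x\<in>S. f x = 0"
  shows "variety_dim k S \<le> enat (drk K0 (y ` {..<k}))"
  unfolding variety_dim_def
proof (rule SUP_least)
  fix d assume "d \<in> {d :: nat. \<exists>Z :: nat \<Rightarrow> (nat \<Rightarrow> complex) set.
      (\<forall>i\<le>d. irreducible_subvariety k (Z i) \<and> Z i \<subseteq> zariski_closure k S) \<and> (\<forall>i<d. Z i \<subset> Z (Suc i))}"
  then obtain Z :: "nat \<Rightarrow> (nat \<Rightarrow> complex) set" where
    Z: "\<forall>i\<le>d. irreducible_subvariety k (Z i) \<and> Z i \<subseteq> zariski_closure k S" "\<forall>i<d. Z i \<subset> Z (Suc i)"
    by (elim CollectE exE conjE)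
  define Q where "Q i K F \<longleftrightarrow> countable K \<and> F \<subseteq> polyfun K {..<k} \<and> Z i = {x \<in> torus k. \<forall>f\<in>F. f x = 0}" for i K F
  have "\<exists>K F. Q i K F" if "i \<le> d" for i
  proof -
    have c: "zariski_closed k (Z i)" using Z(1) that unfolding irreducible_subvariety_def by blast
    obtain K F where "countable K" "F \<subseteq> polyfun K {..<k}" "Z i = {x \<in> torus k. \<forall>f\<in>F. f x = 0}"
      using zariski_closed_countable[OF c] .
    then show ?thesis unfolding Q_def by (intro exI conjI)
  qed
  then obtain KK F where "\<And>i. i \<le> d \<Longrightarrow> Q i (KK i) (F i)" by metis
  note KF = this[unfolded Q_def]
  \<comment> \<open>Large enough for the equations of the whole chain, yet countable and closed
    under conjugation, as generic points require. Independence over \<open>K\<close> implies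
    independence over \<open>K0\<close>.\<close>
  define K where "K = K0 \<union> (\<Union>i\<le>d. KK i \<union> cnj ` KK i)"
  have cK: "countable K" unfolding K_def using K0(1) KF by (intro countable_Un countable_UN) auto
  have conjK: "cnj ` K \<subseteq> K"
  proof
    fix x assume "x \<in> cnj ` K"
    then obtain a where a: "a \<in> K" "x = cnj a" by blast
    then consider "a \<in> K0" | i where "i \<le> d" "a \<in> KK i" | i b where "i \<le> d" "b \<in> KK i" "a = cnj b"
      unfolding K_def by auto
    then show "x \<in> K"
    proof cases
      case 1 then show ?thesis using a(2) K0(2) unfolding K_def by blast
    next
      case 2 then show ?thesis using a(2) unfolding K_def by blast
    next
      case 3 then show ?thesis using a(2) unfolding K_def by auto
    qed
  qed
  have FK: "F i \<subseteq> polyfun K {..<k}" if i: "i \<le> d" for i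
  proof
    fix f assume "f \<in> F i"
    then have "f \<in> polyfun (KK i) {..<k}" using KF[OF i] by blast
    moreover have "KK i \<subseteq> K" unfolding K_def using i by blast
    ultimately show "f \<in> polyfun K {..<k}" using polyfun_mono by blast
  qed
  have "\<exists>z. generic_point K k (Z i) z" if "i \<le> d" for i
    using generic_point_exists[OF _ cK conjK, of k "Z i"] Z(1) that by blast
  then obtain z where z: "\<And>i. i \<le> d \<Longrightarrow> generic_point K k (Z i) (z i)" by metis
  have "i \<le> d \<Longrightarrow> i \<le> drk K (z i ` {..<k})" for i
  proof (induction i)
    case (Suc i)
    have "Z (Suc i) \<subseteq> torus k" using KF[OF Suc.prems] by blast
    then have "drk K (z i ` {..<k}) < drk K (z (Suc i) ` {..<k})"
    proof (rule generic_rank_strict[of "Z i" k "F i" K "Z (Suc i)", rotated 3])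
      show "Z i = {x \<in> torus k. \<forall>f\<in>F i. f x = 0}" using KF[of i] Suc.prems by simp
      show "F i \<subseteq> polyfun K {..<k}" using FK[of i] Suc.prems by simp
      show "Z i \<subset> Z (Suc i)" using Z(2) Suc.prems by simp
      show "generic_point K k (Z i) (z i)" "generic_point K k (Z (Suc i)) (z (Suc i))"
        using z Suc.prems by simp_all
    qed
    then show ?case using Suc by simp
  qed simp
  then have d: "d \<le> drk K (z d ` {..<k})" by simp
  have fin: "finite {..<k}" by simp
  obtain J where J: "J \<subseteq> {..<k}" "tindep K (z d) J" "z d ` {..<k} \<subseteq> dcl (K \<union> z d ` J)" "card J = drk K (z d ` {..<k})"
    using tindep_basis[OF fin] .
  have KK0: "K0 \<subseteq> K" unfolding K_def by blast
  have "tindep K0 (z d) J" unfolding tindep_def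
  proof
    fix j assume j: "j \<in> J"
    have "dcl (K0 \<union> z d ` (J - {j})) \<subseteq> dcl (K \<union> z d ` (J - {j}))" by (rule dcl_mono) (use KK0 in blast)
    then show "z d j \<notin> dcl (K0 \<union> z d ` (J - {j}))" using J(2) j unfolding tindep_def by blast
  qed
  moreover have "f (z d) = 0" if f: "f \<in> polyfun K0 {..<k}" "f y = 0" for f
  proof -
    have "f \<in> polyfun UNIV {..<k}" using polyfun_mono[OF f(1)] by blast
    then have "\<forall>x\<in>zariski_closure k S. f x = 0"
      using zariski_closure_vanish[OF S, of f] H[OF f] by auto
    then have "\<forall>x\<in>Z d. f x = 0" using Z(1) by blast
    moreover have "f \<in> polyfun K {..<k}" using polyfun_mono[OF f(1) KK0] by blast
    ultimately show ?thesis using generic_pointD[OF z[of d], of f] by simp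
  qed
  ultimately have "tindep K0 y J"
    by (intro tindep_transfer[of K0 "{..<k}" y "z d" J] J(1) finite_subset[OF J(1) fin])
  then have "card J \<le> drk K0 (y ` {..<k})" by (rule tindep_card_le[OF fin J(1)])
  then show "enat d \<le> enat (drk K0 (y ` {..<k}))" using d J(4) by simp
qed

section \<open>Substituting Laurent monomials into polynomial functions\<close>

lemma monomial_times_power:
  assumes "finite I" "\<And>j. j \<in> I \<Longrightarrow> x j \<noteq> (0::'k::field)" "\<And>j. j \<in> I \<Longrightarrow> - e j \<le> int N"
  shows "monomial I x e * (\<Prod>j\<in>I. x j) ^ N = (\<Prod>j\<in>I. x j ^ nat (e j + int N))"
proof -
  have "monomial I x e * (\<Prod>j\<in>I. x j) ^ N = (\<Prod>j\<in>I. x j powi e j * x j ^ N)"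
    unfolding monomial_def by (simp add: prod.distrib prod_power_distrib)
  also have "\<dots> = (\<Prod>j\<in>I. x j ^ nat (e j + int N))"
  proof (rule prod.cong[OF refl])
    fix j assume j: "j \<in> I"
    have "x j powi e j * x j ^ N = x j powi (e j + int N)" using assms(2)[OF j] by (simp add: power_int_add)
    then show "x j powi e j * x j ^ N = x j ^ nat (e j + int N)"
      using assms(3)[OF j] by (simp add: power_int_def)
  qed
  finally show ?thesis .
qed

lemma polyfun_laurent:
  assumes "f \<in> polyfun K {..<k}"
  shows "\<exists>N g. g \<in> polyfun K {..<n} \<and> (\<forall>x. (\<forall>j<n. x j \<noteq> 0) \<longrightarrow>
    f (\<lambda>i. monomial {..<n} x (q i)) * (\<Prod>j<n. x j) ^ N = g x)"
  using assms
proof induction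
  case polyfun_1
  show ?case by (intro exI[of _ "0::nat"] exI[of _ "\<lambda>x. 1"]) (auto intro: polyfun.polyfun_1)
next
  case (polyfun_const c)
  then show ?case by (intro exI[of _ "0::nat"] exI[of _ "\<lambda>x. c"]) (auto intro: polyfun.polyfun_const)
next
  case (polyfun_var i)
  \<comment> \<open>The sum of absolute values bounds every negative exponent at once.\<close>
  define N where "N = nat (\<Sum>j<n. \<bar>q i j\<bar>)"
  have N: "- q i j \<le> int N" if "j < n" for j
  proof -
    have "\<bar>q i j\<bar> \<le> (\<Sum>j<n. \<bar>q i j\<bar>)" by (rule member_le_sum) (use that in auto)
    then show ?thesis unfolding N_def by linarith
  qed
  let ?g = "\<lambda>x. \<Prod>j<n. x j ^ nat (q i j + int N)"
  have "?g \<in> polyfun K {..<n}" by (intro polyfun_prod polyfun_power polyfun.polyfun_var)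
  moreover have "monomial {..<n} x (q i) * (\<Prod>j<n. x j) ^ N = ?g x" if "\<forall>j<n. x j \<noteq> 0" for x
    using monomial_times_power[of "{..<n}" x "q i" N] that N by simp
  ultimately show ?case by (intro exI[of _ N] exI[of _ ?g] conjI allI impI)
next
  case (polyfun_diff f1 f2)
  then obtain N1 g1 N2 g2 where g: "g1 \<in> polyfun K {..<n}" "g2 \<in> polyfun K {..<n}"
    "\<forall>x. (\<forall>j<n. x j \<noteq> 0) \<longrightarrow> f1 (\<lambda>i. monomial {..<n} x (q i)) * (\<Prod>j<n. x j) ^ N1 = g1 x"
    "\<forall>x. (\<forall>j<n. x j \<noteq> 0) \<longrightarrow> f2 (\<lambda>i. monomial {..<n} x (q i)) * (\<Prod>j<n. x j) ^ N2 = g2 x"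
    by blast
  let ?P = "\<lambda>x. \<Prod>j<n. x j"
  let ?g = "\<lambda>x. g1 x * ?P x ^ N2 - g2 x * ?P x ^ N1"
  have "?g \<in> polyfun K {..<n}"
    by (intro polyfun.polyfun_diff polyfun.polyfun_mult g polyfun_power polyfun_prod polyfun.polyfun_var)
  moreover have "(f1 (\<lambda>i. monomial {..<n} x (q i)) - f2 (\<lambda>i. monomial {..<n} x (q i))) * ?P x ^ (N1 + N2) = ?g x"
    if "\<forall>j<n. x j \<noteq> 0" for x
    using g(3,4)[THEN spec, of x, THEN mp, OF that, symmetric] by (simp add: power_add algebra_simps)
  ultimately show ?case by (intro exI[of _ "N1 + N2"] exI[of _ ?g] conjI allI impI)
next
  case (polyfun_mult f1 f2)
  then obtain N1 g1 N2 g2 where g: "g1 \<in> polyfun K {..<n}" "g2 \<in> polyfun K {..<n}"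
    "\<forall>x. (\<forall>j<n. x j \<noteq> 0) \<longrightarrow> f1 (\<lambda>i. monomial {..<n} x (q i)) * (\<Prod>j<n. x j) ^ N1 = g1 x"
    "\<forall>x. (\<forall>j<n. x j \<noteq> 0) \<longrightarrow> f2 (\<lambda>i. monomial {..<n} x (q i)) * (\<Prod>j<n. x j) ^ N2 = g2 x"
    by blast
  let ?P = "\<lambda>x. \<Prod>j<n. x j"
  have "(\<lambda>x. g1 x * g2 x) \<in> polyfun K {..<n}" by (intro polyfun.polyfun_mult g)
  moreover have "(f1 (\<lambda>i. monomial {..<n} x (q i)) * f2 (\<lambda>i. monomial {..<n} x (q i))) * ?P x ^ (N1 + N2) = g1 x * g2 x"
    if "\<forall>j<n. x j \<noteq> 0" for x
    using g(3,4)[THEN spec, of x, THEN mp, OF that, symmetric] by (simp add: power_add mult_ac)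
  ultimately show ?case by (intro exI[of _ "N1 + N2"] exI[of _ "\<lambda>x. g1 x * g2 x"] conjI allI impI)
qed

section \<open>Dual vectors\<close>

text \<open>Linearly independent vectors have a dual system, by elimination. Used over the rationals
  to compute a matrix rank and over the reals to solve the linearised equations.\<close>

lemma dual_vectors:
  fixes b :: "'x \<Rightarrow> nat \<Rightarrow> 'a::field"
  assumes "finite X" and "\<And>r. (\<And>i. i < n \<Longrightarrow> (\<Sum>x\<in>X. r x * b x i) = 0) \<Longrightarrow> \<forall>x\<in>X. r x = 0"
  shows "\<exists>\<rho>. \<forall>x\<in>X. \<forall>y\<in>X. (\<Sum>i<n. b x i * \<rho> y i) = (if x = y then 1 else 0)"
  using assms
proof (induction X rule: finite_induct)
  case (insert x0 X)
  have "\<forall>x\<in>X. r x = 0" if r: "\<And>i. i < n \<Longrightarrow> (\<Sum>x\<in>X. r x * b x i) = 0" for r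
  proof -
    let ?r = "r(x0 := 0)"
    have "(\<Sum>x\<in>insert x0 X. ?r x * b x i) = (\<Sum>x\<in>X. r x * b x i)" for i
      using insert.hyps by (simp, intro sum.cong) auto
    then have "\<forall>x\<in>insert x0 X. ?r x = 0" by (intro insert.prems) (simp only: r)
    then show ?thesis using insert.hyps(2) by (metis fun_upd_other insertI2)
  qed
  then obtain \<rho> where rho: "\<forall>x\<in>X. \<forall>y\<in>X. (\<Sum>i<n. b x i * \<rho> y i) = (if x = y then 1 else 0)"
    using insert.IH by blast
  define lam where "lam x = (\<Sum>i<n. b x0 i * \<rho> x i)" for x
  have "\<exists>i0<n. b x0 i0 - (\<Sum>x\<in>X. lam x * b x i0) \<noteq> 0"
  proof (rule ccontr)
    assume H: "\<not> ?thesis"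
    let ?r = "\<lambda>x. if x = x0 then 1 else - lam x"
    have "(\<Sum>x\<in>insert x0 X. ?r x * b x i) = b x0 i - (\<Sum>x\<in>X. lam x * b x i)" for i
    proof -
      have "(\<Sum>x\<in>X. ?r x * b x i) = - (\<Sum>x\<in>X. lam x * b x i)"
        unfolding sum_negf[symmetric] by (rule sum.cong) (use insert.hyps in auto)
      then show ?thesis using insert.hyps by simp
    qed
    then have "\<forall>x\<in>insert x0 X. ?r x = 0" using H by (intro insert.prems) auto
    then show False by auto
  qed
  then obtain i0 where i0: "i0 < n" "b x0 i0 - (\<Sum>x\<in>X. lam x * b x i0) \<noteq> 0" by blast
  define c where "c = b x0 i0 - (\<Sum>x\<in>X. lam x * b x i0)"
  \<comment> \<open>A coordinate vector made orthogonal to all earlier vectors and normalised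
    against \<open>b x0\<close>. The denominator \<open>c\<close> is the coordinate
    \<open>i0\<close> of what is left of \<open>b x0\<close> after removing its component along the
    earlier vectors.\<close>
  define \<tau> where "\<tau> i = ((if i = i0 then 1 else 0) - (\<Sum>x\<in>X. b x i0 * \<rho> x i)) / c" for i
  have c0: "c \<noteq> 0" using i0(2) unfolding c_def .
  have t: "(\<Sum>i<n. b x i * \<tau> i) = (b x i0 - (\<Sum>y\<in>X. b y i0 * (\<Sum>i<n. b x i * \<rho> y i))) / c" for x
  proof -
    have "(\<Sum>i<n. b x i * \<tau> i) = (\<Sum>i<n. b x i * (if i = i0 then 1 else 0) - (\<Sum>y\<in>X. b y i0 * (b x i * \<rho> y i))) / c"
      unfolding sum_divide_distrib
      by (rule sum.cong) (simp_all add: \<tau>_def right_diff_distrib sum_distrib_left mult.left_commute)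
    also have "\<dots> = ((\<Sum>i<n. b x i * (if i = i0 then 1 else 0)) - (\<Sum>i<n. \<Sum>y\<in>X. b y i0 * (b x i * \<rho> y i))) / c"
      by (simp add: sum_subtractf)
    also have "(\<Sum>i<n. b x i * (if i = i0 then 1 else 0)) = b x i0"
      using i0(1) by (simp add: if_distrib cong: if_cong)
    also have "(\<Sum>i<n. \<Sum>y\<in>X. b y i0 * (b x i * \<rho> y i)) = (\<Sum>y\<in>X. b y i0 * (\<Sum>i<n. b x i * \<rho> y i))"
      unfolding sum_distrib_left by (rule sum.swap)
    finally show ?thesis .
  qed
  have tX: "(\<Sum>i<n. b x i * \<tau> i) = 0" if x: "x \<in> X" for x
  proof -
    have "(\<Sum>y\<in>X. b y i0 * (\<Sum>i<n. b x i * \<rho> y i)) = (\<Sum>y\<in>X. if y = x then b x i0 else 0)"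
      by (rule sum.cong) (use rho x in auto)
    also have "\<dots> = b x i0" using x insert.hyps by simp
    finally show ?thesis unfolding t by simp
  qed
  have t0: "(\<Sum>i<n. b x0 i * \<tau> i) = 1"
  proof -
    have "(\<Sum>y\<in>X. b y i0 * (\<Sum>i<n. b x0 i * \<rho> y i)) = (\<Sum>y\<in>X. lam y * b y i0)"
      by (rule sum.cong) (simp_all add: lam_def)
    then show ?thesis unfolding t using c0 by (simp add: c_def)
  qed
  define \<rho>2 where "\<rho>2 y i = (if y = x0 then \<tau> i else \<rho> y i - lam y * \<tau> i)" for y i
  have s: "(\<Sum>i<n. b x i * (\<rho> y i - lam y * \<tau> i)) = (\<Sum>i<n. b x i * \<rho> y i) - lam y * (\<Sum>i<n. b x i * \<tau> i)" for x y
    by (simp add: right_diff_distrib sum_subtractf sum_distrib_left mult.left_commute)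
  have "(\<Sum>i<n. b x i * \<rho>2 y i) = (if x = y then 1 else 0)" if xy: "x \<in> insert x0 X" "y \<in> insert x0 X" for x y
  proof (cases "y = x0")
    case True
    then show ?thesis using xy(1) t0 tX insert.hyps(2) unfolding \<rho>2_def by auto
  next
    case False
    then have y: "y \<in> X" using xy(2) by simp
    have "(\<Sum>i<n. b x i * \<rho>2 y i) = (\<Sum>i<n. b x i * \<rho> y i) - lam y * (\<Sum>i<n. b x i * \<tau> i)"
      using False s[of x y] by (simp add: \<rho>2_def)
    then show ?thesis
      using xy(1) y False t0 tX rho by (auto simp: lam_def[symmetric])
  qed
  then show ?case by (intro exI[of _ \<rho>2]) blast
qed simp

section \<open>Newton iteration in finitely many real unknowns\<close>

lemma norm_null_sequence:
  fixes f :: "nat \<Rightarrow> complex"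
  assumes "\<And>k. norm (f k) \<le> b k" "b \<longlonglongrightarrow> 0"
  shows "f \<longlonglongrightarrow> 0"
proof (rule tendsto_norm_zero_cancel)
  show "(\<lambda>k. norm (f k)) \<longlonglongrightarrow> 0"
    by (rule tendsto_sandwich[OF _ _ tendsto_const assms(2)]) (simp_all add: assms(1))
qed

text \<open>Newton's method with the linear part frozen at \<open>B\<close>. The real vectors
  \<open>\<rho>\<close> and \<open>\<sigma>\<close> provide a right inverse of \<open>B\<close>, so
  each step cancels the linear part of the residual exactly; what is left is controlled by
  \<open>\<eta>\<close>, chosen so that the total residual at least halves.\<close>

lemma newton_solve:
  fixes g :: "nat \<Rightarrow> (nat \<Rightarrow> real) \<Rightarrow> complex" and B :: "nat \<Rightarrow> nat \<Rightarrow> complex"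
  assumes A: "finite A"
    and rho: "\<And>m m'. m \<in> A \<Longrightarrow> m' \<in> A \<Longrightarrow> (\<Sum>i<n. B m i * of_real (\<rho> m' i)) = (if m = m' then 1 else 0)"
    and sig: "\<And>m m'. m \<in> A \<Longrightarrow> m' \<in> A \<Longrightarrow> (\<Sum>i<n. B m i * of_real (\<sigma> m' i)) = (if m = m' then \<i> else 0)"
    and R: "0 < R" "\<And>m i. m \<in> A \<Longrightarrow> i < n \<Longrightarrow> \<bar>\<rho> m i\<bar> + \<bar>\<sigma> m i\<bar> \<le> R"
    and err: "\<And>m t t'. m \<in> A \<Longrightarrow> (\<And>i. i < n \<Longrightarrow> \<bar>t i - t0 i\<bar> \<le> \<delta>) \<Longrightarrow> (\<And>i. i < n \<Longrightarrow> \<bar>t' i - t0 i\<bar> \<le> \<delta>) \<Longrightarrow>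
        cmod (g m t - g m t' - (\<Sum>i<n. B m i * of_real (t i - t' i))) \<le> \<eta> * (\<Sum>i<n. \<bar>t i - t' i\<bar>)"
    and \<eta>: "0 \<le> \<eta>" "real (card A) * \<eta> * real n * R \<le> 1 / 2"
    and small: "2 * R * (\<Sum>m\<in>A. cmod (g m t0)) \<le> \<delta>"
  shows "\<exists>t. (\<forall>i<n. \<bar>t i - t0 i\<bar> \<le> \<delta>) \<and> (\<forall>m\<in>A. g m t = 0)"
proof -
  define G where "G t = (\<Sum>m\<in>A. cmod (g m t))" for t
  define stp where "stp t i = (\<Sum>m\<in>A. Re (g m t) * \<rho> m i + Im (g m t) * \<sigma> m i)" for t i
  define T where "T = rec_nat t0 (\<lambda>k t i. t i - stp t i)"
  have T0: "T 0 = t0" and TS: "T (Suc k) i = T k i - stp (T k) i" for k i by (simp_all add: T_def)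
  have G0: "0 \<le> G t" for t unfolding G_def by (simp add: sum_nonneg)
  have stpb: "\<bar>stp t i\<bar> \<le> R * G t" if i: "i < n" for t i
  proof -
    have "\<bar>stp t i\<bar> \<le> (\<Sum>m\<in>A. \<bar>Re (g m t) * \<rho> m i + Im (g m t) * \<sigma> m i\<bar>)" unfolding stp_def by (rule sum_abs)
    also have "\<dots> \<le> (\<Sum>m\<in>A. R * cmod (g m t))"
    proof (rule sum_mono)
      fix m assume m: "m \<in> A"
      have "\<bar>Re (g m t) * \<rho> m i + Im (g m t) * \<sigma> m i\<bar> \<le> \<bar>Re (g m t)\<bar> * \<bar>\<rho> m i\<bar> + \<bar>Im (g m t)\<bar> * \<bar>\<sigma> m i\<bar>"
        using abs_triangle_ineq[of "Re (g m t) * \<rho> m i" "Im (g m t) * \<sigma> m i"] by (simp add: abs_mult)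
      also have "\<dots> \<le> cmod (g m t) * \<bar>\<rho> m i\<bar> + cmod (g m t) * \<bar>\<sigma> m i\<bar>"
        by (intro add_mono mult_right_mono abs_Re_le_cmod abs_Im_le_cmod) auto
      also have "\<dots> = cmod (g m t) * (\<bar>\<rho> m i\<bar> + \<bar>\<sigma> m i\<bar>)" by (simp add: distrib_left)
      also have "\<dots> \<le> cmod (g m t) * R" by (intro mult_left_mono R(2)[OF m i]) simp
      finally show "\<bar>Re (g m t) * \<rho> m i + Im (g m t) * \<sigma> m i\<bar> \<le> R * cmod (g m t)" by (simp add: mult.commute)
    qed
    finally show ?thesis by (simp add: G_def sum_distrib_left)
  qed
  have Bs: "(\<Sum>i<n. B m i * of_real (stp t i)) = g m t" if m: "m \<in> A" for m t
  proof -
    have "(\<Sum>i<n. B m i * of_real (stp t i))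
        = (\<Sum>i<n. \<Sum>m'\<in>A. of_real (Re (g m' t)) * (B m i * of_real (\<rho> m' i)) + of_real (Im (g m' t)) * (B m i * of_real (\<sigma> m' i)))"
      by (rule sum.cong[OF refl]) (simp add: stp_def sum_distrib_left algebra_simps)
    also have "\<dots> = (\<Sum>m'\<in>A. \<Sum>i<n. of_real (Re (g m' t)) * (B m i * of_real (\<rho> m' i)) + of_real (Im (g m' t)) * (B m i * of_real (\<sigma> m' i)))"
      by (rule sum.swap)
    also have "\<dots> = (\<Sum>m'\<in>A. of_real (Re (g m' t)) * (\<Sum>i<n. B m i * of_real (\<rho> m' i)) + of_real (Im (g m' t)) * (\<Sum>i<n. B m i * of_real (\<sigma> m' i)))"
      by (simp add: sum.distrib sum_distrib_left)
    also have "\<dots> = (\<Sum>m'\<in>A. if m' = m then of_real (Re (g m t)) + of_real (Im (g m t)) * \<i> else 0)"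
      by (rule sum.cong[OF refl]) (use rho[OF m] sig[OF m] in auto)
    also have "\<dots> = of_real (Re (g m t)) + of_real (Im (g m t)) * \<i>" using A m by simp
    also have "\<dots> = g m t" by (simp add: complex_eq_iff)
    finally show ?thesis .
  qed
  let ?box = "\<lambda>t. \<forall>i<n. \<bar>t i - t0 i\<bar> \<le> \<delta>"
  \<comment> \<open>Steps of size at most R times the residual form a geometric series; its sum 2 R
    G(t0) is what \<open>small\<close> compares with \<open>\<delta>\<close>, so the iteration never
    leaves the box.\<close>
  have inv: "G (T k) \<le> G t0 / 2 ^ k \<and> (\<forall>i<n. \<bar>T k i - t0 i\<bar> \<le> 2 * R * G t0 * (1 - 1 / 2 ^ k))" for k
  proof (induction k)
    case (Suc k)
    have le: "2 * R * G t0 * (1 - 1 / 2 ^ j) \<le> \<delta>" for j :: nat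
    proof -
      have "2 * R * G t0 * (1 - 1 / 2 ^ j) \<le> 2 * R * G t0 * 1"
        using R(1) G0 by (intro mult_left_mono) auto
      then show ?thesis using small unfolding G_def by simp
    qed
    have bk: "\<bar>T k i - t0 i\<bar> \<le> \<delta>" if "i < n" for i using Suc le[of k] that by fastforce
    have st: "\<bar>stp (T k) i\<bar> \<le> R * (G t0 / 2 ^ k)" if "i < n" for i
    proof -
      have "R * G (T k) \<le> R * (G t0 / 2 ^ k)" using Suc R(1) by (intro mult_left_mono) auto
      then show ?thesis using stpb[OF that, of "T k"] by linarith
    qed
    have nb: "\<bar>T (Suc k) i - t0 i\<bar> \<le> 2 * R * G t0 * (1 - 1 / 2 ^ Suc k)" if "i < n" for i
    proof -
      have "\<bar>T (Suc k) i - t0 i\<bar> \<le> \<bar>T k i - t0 i\<bar> + \<bar>stp (T k) i\<bar>" unfolding TS by linarith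
      also have "\<dots> \<le> 2 * R * G t0 * (1 - 1 / 2 ^ k) + R * (G t0 / 2 ^ k)" using Suc st that by (simp add: add_mono)
      also have "\<dots> = 2 * R * G t0 * (1 - 1 / 2 ^ Suc k)" by (simp add: field_simps)
      finally show ?thesis .
    qed
    have "cmod (g m (T (Suc k))) \<le> \<eta> * (real n * (R * G (T k)))" if m: "m \<in> A" for m
    proof -
      have "cmod (g m (T (Suc k)) - g m (T k) - (\<Sum>i<n. B m i * of_real (T (Suc k) i - T k i)))
          \<le> \<eta> * (\<Sum>i<n. \<bar>T (Suc k) i - T k i\<bar>)"
        by (rule err[OF m]) (use bk nb le[of "Suc k"] in \<open>auto intro: order_trans\<close>)
      moreover have "(\<Sum>i<n. B m i * of_real (T (Suc k) i - T k i)) = - g m (T k)"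
        using Bs[OF m, of "T k"] by (simp add: TS sum_negf)
      moreover have "(\<Sum>i<n. \<bar>T (Suc k) i - T k i\<bar>) \<le> (\<Sum>i<n. R * G (T k))"
        by (rule sum_mono) (use stpb in \<open>simp add: TS\<close>)
      ultimately have "cmod (g m (T (Suc k))) \<le> \<eta> * (\<Sum>i<n. \<bar>T (Suc k) i - T k i\<bar>)"
        "(\<Sum>i<n. \<bar>T (Suc k) i - T k i\<bar>) \<le> real n * (R * G (T k))" by simp_all
      moreover from this(2) have "\<eta> * (\<Sum>i<n. \<bar>T (Suc k) i - T k i\<bar>) \<le> \<eta> * (real n * (R * G (T k)))"
        using \<eta>(1) by (rule mult_left_mono)
      ultimately show ?thesis by linarith
    qed
    then have "G (T (Suc k)) \<le> (\<Sum>m\<in>A. \<eta> * (real n * (R * G (T k))))" unfolding G_def[of "T (Suc k)"] by (rule sum_mono)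
    also have "\<dots> = (real (card A) * \<eta> * real n * R) * G (T k)" by simp
    also have "\<dots> \<le> 1 / 2 * G (T k)" by (rule mult_right_mono[OF \<eta>(2) G0])
    also have "\<dots> \<le> 1 / 2 * (G t0 / 2 ^ k)" using Suc by simp
    finally show ?case using nb by simp
  qed (simp add: T0)
  have le: "2 * R * G t0 * (1 - 1 / 2 ^ j) \<le> \<delta>" for j :: nat
  proof -
    have "2 * R * G t0 * (1 - 1 / 2 ^ j) \<le> 2 * R * G t0 * 1"
      using R(1) G0 by (intro mult_left_mono) auto
    then show ?thesis using small unfolding G_def by simp
  qed
  have bk: "\<bar>T k i - t0 i\<bar> \<le> \<delta>" if "i < n" for i k using inv[of k] le[of k] that by fastforce
  have "\<exists>l. (\<lambda>k. T k i) \<longlonglongrightarrow> l" if i: "i < n" for i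
  proof -
    have "summable (\<lambda>k. T (Suc k) i - T k i)"
    proof (rule summable_comparison_test)
      show "\<exists>N. \<forall>k\<ge>N. norm (T (Suc k) i - T k i) \<le> R * G t0 * (1 / 2) ^ k"
      proof (intro exI allI impI)
        fix k
        have "\<bar>stp (T k) i\<bar> \<le> R * G (T k)" by (rule stpb[OF i])
        also have "\<dots> \<le> R * (G t0 / 2 ^ k)" using inv[of k] R(1) by (intro mult_left_mono) auto
        finally show "norm (T (Suc k) i - T k i) \<le> R * G t0 * (1 / 2) ^ k" by (simp add: TS power_divide)
      qed
      show "summable (\<lambda>k. R * G t0 * (1 / 2) ^ k)" by (intro summable_mult summable_geometric) simp
    qed
    then have "(\<lambda>k. \<Sum>j<k. T (Suc j) i - T j i) \<longlonglongrightarrow> suminf (\<lambda>j. T (Suc j) i - T j i)" by (rule summable_LIMSEQ)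
    then have "(\<lambda>k. T k i - T 0 i) \<longlonglongrightarrow> suminf (\<lambda>j. T (Suc j) i - T j i)" by (simp only: sum_lessThan_telescope[of "\<lambda>j. T j i"])
    then have "(\<lambda>k. (T k i - T 0 i) + T 0 i) \<longlonglongrightarrow> suminf (\<lambda>j. T (Suc j) i - T j i) + T 0 i" by (intro tendsto_add tendsto_const)
    then show ?thesis by auto
  qed
  then obtain t where t: "\<And>i. i < n \<Longrightarrow> (\<lambda>k. T k i) \<longlonglongrightarrow> t i" by metis
  have bt: "\<bar>t i - t0 i\<bar> \<le> \<delta>" if i: "i < n" for i
  proof (rule LIMSEQ_le_const2)
    show "(\<lambda>k. \<bar>T k i - t0 i\<bar>) \<longlonglongrightarrow> \<bar>t i - t0 i\<bar>" by (intro tendsto_intros t[OF i])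
    show "\<exists>N. \<forall>k\<ge>N. \<bar>T k i - t0 i\<bar> \<le> \<delta>" using bk[OF i] by blast
  qed
  have "g m t = 0" if m: "m \<in> A" for m
  proof -
    have "(\<lambda>k. g m (T k) - g m t) \<longlonglongrightarrow> 0"
    proof (rule norm_null_sequence)
      let ?b = "\<lambda>k. \<eta> * (\<Sum>i<n. \<bar>T k i - t i\<bar>) + (\<Sum>i<n. cmod (B m i) * \<bar>T k i - t i\<bar>)"
      show "norm (g m (T k) - g m t) \<le> ?b k" for k
      proof -
        let ?s = "\<Sum>i<n. B m i * of_real (T k i - t i)"
        have "norm (g m (T k) - g m t) \<le> cmod (g m (T k) - g m t - ?s) + cmod ?s"
          using norm_triangle_ineq[of "g m (T k) - g m t - ?s" ?s] by simp
        moreover have "cmod (g m (T k) - g m t - ?s) \<le> \<eta> * (\<Sum>i<n. \<bar>T k i - t i\<bar>)"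
          by (rule err[OF m]) (use bk bt in auto)
        moreover have "cmod ?s \<le> (\<Sum>i<n. cmod (B m i) * \<bar>T k i - t i\<bar>)"
          by (rule order_trans[OF norm_sum]) (simp add: norm_mult flip: of_real_diff)
        ultimately show ?thesis by linarith
      qed
      have z: "(\<lambda>k. \<bar>T k i - t i\<bar>) \<longlonglongrightarrow> 0" if "i < n" for i
        using tendsto_rabs_zero[OF LIM_zero[OF t[OF that]]] .
      have "?b \<longlonglongrightarrow> \<eta> * (\<Sum>i<n. 0) + (\<Sum>i<n. cmod (B m i) * 0)"
        by (intro tendsto_add tendsto_mult tendsto_sum tendsto_const z) auto
      then show "?b \<longlonglongrightarrow> 0" by simp
    qed
    moreover have "(\<lambda>k. g m (T k)) \<longlonglongrightarrow> 0"
    proof (rule norm_null_sequence)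
      show "norm (g m (T k)) \<le> G t0 * (1 / 2) ^ k" for k
      proof -
        have "cmod (g m (T k)) \<le> G (T k)" unfolding G_def by (rule member_le_sum) (use A m in auto)
        then show ?thesis using inv[of k] by (simp add: power_divide)
      qed
      have "(\<lambda>k. G t0 * (1 / 2) ^ k) \<longlonglongrightarrow> G t0 * 0" by (intro tendsto_mult tendsto_const LIMSEQ_power_zero) simp
      then show "(\<lambda>k. G t0 * (1 / 2) ^ k) \<longlonglongrightarrow> 0" by simp
    qed
    ultimately have "(\<lambda>k. g m (T k) - (g m (T k) - g m t)) \<longlonglongrightarrow> 0 - 0" by (intro tendsto_diff)
    then have "(\<lambda>k::nat. g m t) \<longlonglongrightarrow> 0" by simp
    then show ?thesis by (simp add: LIMSEQ_const_iff)
  qed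
  then show ?thesis using bt by blast
qed

section \<open>Divided differences of polynomial functions\<close>

text \<open>Neighbourhoods of \<open>w\<close> in the first \<open>n\<close> coordinates; all others
  are unconstrained.\<close>

definition near :: "nat \<Rightarrow> (nat \<Rightarrow> complex) \<Rightarrow> (nat \<Rightarrow> complex) filter" where
  "near n w = (INF d\<in>{0<..}. principal {x. \<forall>i<n. dist (x i) (w i) < d})"

lemma eventually_near: "eventually P (near n w) \<longleftrightarrow> (\<exists>d>0. \<forall>x. (\<forall>i<n. dist (x i) (w i) < d) \<longrightarrow> P x)"
  unfolding near_def
proof (subst eventually_INF_base)
  show "{0::real<..} \<noteq> {}" by (simp add: gt_ex)
  fix a b :: real assume ab: "a \<in> {0<..}" "b \<in> {0<..}"
  show "\<exists>x\<in>{0<..}. principal {xa. \<forall>i<n. dist (xa i) (w i) < x}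
      \<le> inf (principal {x. \<forall>i<n. dist (x i) (w i) < a}) (principal {x. \<forall>i<n. dist (x i) (w i) < b})"
    by (rule bexI[of _ "min a b"]) (use ab in auto)
qed (auto simp: eventually_principal)

lemma tendsto_near: "i < n \<Longrightarrow> ((\<lambda>x. x i) \<longlongrightarrow> w i) (near n w)"
  unfolding tendsto_iff eventually_near by blast

lemma polyfun_tendsto:
  assumes "f \<in> polyfun K {..<n}"
  shows "(f \<longlongrightarrow> f w) (near n w)"
  using assms by induction (auto intro!: tendsto_intros tendsto_near)

text \<open>The values of \<open>h\<close> on the diagonal act as partial derivatives: the last
  clause is the chain rule for derivations over \<open>K\<close>. The difference formula at two
  nearby points gives the estimate that Newton's method needs, with no differentiability theory in
  several variables.\<close>

lemma divided_differences:
  assumes "f \<in> polyfun K V" "V \<subseteq> {..<n}"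
  shows "\<exists>h. (\<forall>x y. f x - f y = (\<Sum>i<n. h i x y * (x i - y i))) \<and>
     (\<forall>i<n. ((\<lambda>z. h i (fst z) (snd z)) \<longlongrightarrow> h i w w) (near n w \<times>\<^sub>F near n w)) \<and>
     (\<forall>i. i \<notin> V \<longrightarrow> (\<forall>x y. h i x y = 0)) \<and>
     (\<forall>d\<in>Der K. d (f w) = (\<Sum>i<n. h i w w * d (w i)))"
  using assms(1)
proof induction
  case polyfun_1
  show ?case by (intro exI[of _ "\<lambda>i x y. 0"]) (auto simp: Der_1)
next
  case (polyfun_const c)
  then show ?case by (intro exI[of _ "\<lambda>i x y. 0"]) (auto simp: Der_zero)
next
  case (polyfun_var j)
  have j: "j < n" using polyfun_var assms(2) by auto
  have s: "(\<Sum>i<n. (if i = j then 1 else 0) * c i) = c j" for c :: "nat \<Rightarrow> complex"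
    using j by (simp add: if_distrib[of "\<lambda>x. x * _"] cong: if_cong)
  show ?case by (intro exI[of _ "\<lambda>i x y. if i = j then 1 else 0"]) (use polyfun_var in \<open>auto simp: s\<close>)
next
  case (polyfun_diff f g)
  then obtain h k where h: "\<forall>x y. f x - f y = (\<Sum>i<n. h i x y * (x i - y i))"
      "\<forall>i<n. ((\<lambda>z. h i (fst z) (snd z)) \<longlongrightarrow> h i w w) (near n w \<times>\<^sub>F near n w)"
      "\<forall>i. i \<notin> V \<longrightarrow> (\<forall>x y. h i x y = 0)" "\<forall>d\<in>Der K. d (f w) = (\<Sum>i<n. h i w w * d (w i))"
    and k: "\<forall>x y. g x - g y = (\<Sum>i<n. k i x y * (x i - y i))"
      "\<forall>i<n. ((\<lambda>z. k i (fst z) (snd z)) \<longlongrightarrow> k i w w) (near n w \<times>\<^sub>F near n w)"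
      "\<forall>i. i \<notin> V \<longrightarrow> (\<forall>x y. k i x y = 0)" "\<forall>d\<in>Der K. d (g w) = (\<Sum>i<n. k i w w * d (w i))"
    by (elim exE conjE)
  show ?case
  proof (intro exI[of _ "\<lambda>i x y. h i x y - k i x y"] conjI allI impI ballI)
    fix x y
    have "f x - g x - (f y - g y) = (f x - f y) - (g x - g y)" by simp
    also have "\<dots> = (\<Sum>i<n. (h i x y - k i x y) * (x i - y i))"
      unfolding h(1)[THEN spec, THEN spec] k(1)[THEN spec, THEN spec] sum_subtractf[symmetric] left_diff_distrib ..
    finally show "f x - g x - (f y - g y) = (\<Sum>i<n. (h i x y - k i x y) * (x i - y i))" .
  next
    fix i assume "i < n"
    then show "((\<lambda>z. h i (fst z) (snd z) - k i (fst z) (snd z)) \<longlongrightarrow> h i w w - k i w w) (near n w \<times>\<^sub>F near n w)"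
      using h(2) k(2) by (intro tendsto_diff) auto
  next
    fix i x y assume "i \<notin> V" then show "h i x y - k i x y = 0" using h(3) k(3) by simp
  next
    fix d assume d: "d \<in> Der K"
    show "d (f w - g w) = (\<Sum>i<n. (h i w w - k i w w) * d (w i))"
      using h(4) k(4) d by (simp add: Der_diff[OF d] sum_subtractf left_diff_distrib)
  qed
next
  case (polyfun_mult f g)
  then obtain h k where h: "\<forall>x y. f x - f y = (\<Sum>i<n. h i x y * (x i - y i))"
      "\<forall>i<n. ((\<lambda>z. h i (fst z) (snd z)) \<longlongrightarrow> h i w w) (near n w \<times>\<^sub>F near n w)"
      "\<forall>i. i \<notin> V \<longrightarrow> (\<forall>x y. h i x y = 0)" "\<forall>d\<in>Der K. d (f w) = (\<Sum>i<n. h i w w * d (w i))"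
    and k: "\<forall>x y. g x - g y = (\<Sum>i<n. k i x y * (x i - y i))"
      "\<forall>i<n. ((\<lambda>z. k i (fst z) (snd z)) \<longlongrightarrow> k i w w) (near n w \<times>\<^sub>F near n w)"
      "\<forall>i. i \<notin> V \<longrightarrow> (\<forall>x y. k i x y = 0)" "\<forall>d\<in>Der K. d (g w) = (\<Sum>i<n. k i w w * d (w i))"
    by (elim exE conjE)
  have fV: "f \<in> polyfun K {..<n}" "g \<in> polyfun K {..<n}"
    using polyfun_mult.hyps polyfun_mono[OF _ order_refl assms(2)] by blast+
  show ?case
  \<comment> \<open>From f(x) g(x) - f(y) g(y) = f(x) (g(x) - g(y)) + g(y) (f(x) - f(y)).\<close>
  proof (intro exI[of _ "\<lambda>i x y. f x * k i x y + g y * h i x y"] conjI allI impI ballI)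
    fix x y
    have "f x * g x - f y * g y = f x * (g x - g y) + g y * (f x - f y)" by (simp add: algebra_simps)
    also have "\<dots> = (\<Sum>i<n. (f x * k i x y + g y * h i x y) * (x i - y i))"
      unfolding h(1)[THEN spec, THEN spec] k(1)[THEN spec, THEN spec]
      by (simp add: sum_distrib_left sum.distrib distrib_right mult.assoc)
    finally show "f x * g x - f y * g y = (\<Sum>i<n. (f x * k i x y + g y * h i x y) * (x i - y i))" .
  next
    fix i assume i: "i < n"
    have "((\<lambda>z. f (fst z)) \<longlongrightarrow> f w) (near n w \<times>\<^sub>F near n w)" "((\<lambda>z. g (snd z)) \<longlongrightarrow> g w) (near n w \<times>\<^sub>F near n w)"
      using filterlim_compose[OF polyfun_tendsto[OF fV(1), of w], of fst "near n w \<times>\<^sub>F near n w"]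
        filterlim_compose[OF polyfun_tendsto[OF fV(2), of w], of snd "near n w \<times>\<^sub>F near n w"]
      by (simp_all add: filterlim_def filtermap_fst_prod_filter filtermap_snd_prod_filter)
    then show "((\<lambda>z. f (fst z) * k i (fst z) (snd z) + g (snd z) * h i (fst z) (snd z)) \<longlongrightarrow>
        f w * k i w w + g w * h i w w) (near n w \<times>\<^sub>F near n w)"
      using h(2) k(2) i by (intro tendsto_add tendsto_mult) auto
  next
    fix i x y assume "i \<notin> V" then show "f x * k i x y + g y * h i x y = 0" using h(3) k(3) by simp
  next
    fix d assume d: "d \<in> Der K"
    show "d (f w * g w) = (\<Sum>i<n. (f w * k i w w + g w * h i w w) * d (w i))"
      unfolding Der_mult[OF d] h(4)[THEN bspec, OF d] k(4)[THEN bspec, OF d]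
      unfolding sum_distrib_left sum_distrib_right sum.distrib[symmetric]
      by (rule sum.cong) (simp_all add: algebra_simps)
  qed
qed

section \<open>Generic points of rotund varieties\<close>

text \<open>Integral independence of the rows gives rational independence by clearing denominators.
  A dual system of the rows then solves every equation A x = y, so the column space is
  everything.\<close>

lemma rank_eq_rows:
  assumes "int_indep_rows {..<k} {..<n} q"
  shows "vec_space.rank k (map_mat rat_of_int (mat k n (\<lambda>(i, j). q i j))) = k"
proof -
  let ?A = "map_mat rat_of_int (mat k n (\<lambda>(i, j). q i j))"
  have A: "?A \<in> carrier_mat k n" by simp
  have "\<forall>i\<in>{..<k}. r i = 0" if r: "\<And>j. j < n \<Longrightarrow> (\<Sum>i<k. r i * rat_of_int (q i j)) = 0" for r
  proof -
    have "\<exists>D e. D \<noteq> (0::int) \<and> (\<forall>i\<in>{..<k}. of_int D * r i = of_int (e i))"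
    proof -
      let ?D = "\<Prod>i<k. snd (quotient_of (r i))"
      have "\<exists>c :: int. of_int ?D * r i = of_int c" if "i < k" for i
      proof -
        have "snd (quotient_of (r i)) dvd ?D" using that by (intro dvd_prodI) auto
        then obtain c where c: "?D = snd (quotient_of (r i)) * c" ..
        have "r i = of_int (fst (quotient_of (r i))) / of_int (snd (quotient_of (r i)))"
          by (intro quotient_of_div) simp
        moreover have "snd (quotient_of (r i)) > 0" by (rule quotient_of_denom_pos') 
        ultimately have "of_int (snd (quotient_of (r i))) * r i = of_int (fst (quotient_of (r i)))"
          by (simp add: field_simps)
        then have "of_int ?D * r i = of_int (fst (quotient_of (r i)) * c)" unfolding c by (simp add: mult_ac)
        then show ?thesis by blast
      qed
      then have "\<forall>i\<in>{..<k}. \<exists>c :: int. of_int ?D * r i = of_int c" by simp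
      then obtain e where "\<forall>i\<in>{..<k}. of_int ?D * r i = of_int (e i)" by (rule bchoice[THEN exE])
      moreover have "snd (quotient_of (r i)) \<noteq> 0" for i using quotient_of_denom_pos'[of "r i"] by simp
      then have "?D \<noteq> 0" by simp
      ultimately show ?thesis by blast
    qed
    then obtain D e where D: "D \<noteq> 0" and e: "\<And>i. i < k \<Longrightarrow> rat_of_int D * r i = of_int (e i)" by auto
    have "(\<Sum>i<k. e i * q i j) = 0" if "j < n" for j
    proof -
      have "rat_of_int (\<Sum>i<k. e i * q i j) = (\<Sum>i<k. of_int D * (r i * of_int (q i j)))"
        unfolding of_int_sum by (rule sum.cong) (simp_all add: e[symmetric] mult.assoc)
      also have "\<dots> = 0" unfolding sum_distrib_left[symmetric] using r[OF that] by simp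
      finally show ?thesis unfolding of_int_eq_0_iff .
    qed
    then have "\<forall>i\<in>{..<k}. e i = 0" using assms unfolding int_indep_rows_def by simp
    then show ?thesis using e D by fastforce
  qed
  then have "\<exists>\<rho>. \<forall>x\<in>{..<k}. \<forall>y\<in>{..<k}. (\<Sum>i<n. rat_of_int (q x i) * \<rho> y i) = (if x = y then 1 else 0)"
    by (intro dual_vectors) auto
  then obtain \<rho> where \<rho>: "\<And>x y. x < k \<Longrightarrow> y < k \<Longrightarrow> (\<Sum>i<n. rat_of_int (q x i) * \<rho> y i) = (if x = y then 1 else 0)" by auto
  have "y \<in> vec_space.col_space k ?A" if y: "y \<in> carrier_vec k" for y
  proof -
    let ?x = "vec n (\<lambda>j. \<Sum>l<k. y $ l * \<rho> l j)"
    have "?A *\<^sub>v ?x = y"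
    proof (rule eq_vecI)
      fix i assume "i < dim_vec y"
      then have i: "i < k" using y by simp
      have "(?A *\<^sub>v ?x) $ i = (\<Sum>j<n. rat_of_int (q i j) * (\<Sum>l<k. y $ l * \<rho> l j))"
        using i by (simp add: scalar_prod_def atLeast0LessThan)
      also have "\<dots> = (\<Sum>l<k. y $ l * (\<Sum>j<n. rat_of_int (q i j) * \<rho> l j))"
        unfolding sum_distrib_left by (subst sum.swap) (simp add: mult_ac)
      also have "\<dots> = (\<Sum>l<k. y $ l * (if i = l then 1 else 0))" using i by (intro sum.cong) (simp_all add: \<rho>)
      also have "\<dots> = y $ i" using i by (simp add: if_distrib cong: if_cong)
      finally show "(?A *\<^sub>v ?x) $ i = y $ i" .
    qed (use y in simp)
    moreover have "?x \<in> carrier_vec n" by simp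
    ultimately show ?thesis unfolding vec_space.col_space_eq[OF A] using y A by auto
  qed
  moreover have "vec_space.col_space k ?A \<subseteq> carrier_vec k" unfolding vec_space.col_space_eq[OF A] by auto
  ultimately have "vec_space.col_space k ?A = carrier (module_vec TYPE(rat) k)" by (auto simp: module_vec_simps)
  then have sp: "LinearCombinations.module.span class_ring (module_vec TYPE(rat) k) (set (cols ?A)) = carrier (module_vec TYPE(rat) k)"
    unfolding vec_space.col_space_def .
  have "vec_space.rank k ?A = vectorspace.dim class_ring (module_vec TYPE(rat) k)"
    unfolding vec_space.rank_def sp by simp
  also have "\<dots> = k" by (rule vec_space.dim_is_n)
  finally show ?thesis .
qed

lemma int_indep_rows_reindex:
  assumes "bij_betw h L' L" "int_indep_rows L I q"
  shows "int_indep_rows L' I (\<lambda>i. q (h i))"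
  unfolding int_indep_rows_def
proof (intro allI impI ballI)
  fix r l assume r: "\<forall>j\<in>I. (\<Sum>l\<in>L'. r l * q (h l) j) = 0" and l: "l \<in> L'"
  let ?g = "the_inv_into L' h"
  have inj: "inj_on h L'" and L: "h ` L' = L" using assms(1) by (auto simp: bij_betw_def)
  have "(\<Sum>l\<in>L. r (?g l) * q l j) = 0" if "j \<in> I" for j
  proof -
    have "(\<Sum>l\<in>L. r (?g l) * q l j) = (\<Sum>l\<in>L'. r l * q (h l) j)"
      unfolding L[symmetric] sum.reindex[OF inj] by (rule sum.cong) (simp_all add: the_inv_into_f_f[OF inj])
    then show ?thesis using r that by simp
  qed
  then have "\<forall>j\<in>I. (\<Sum>l\<in>L. r (?g l) * q l j) = 0" by blast
  then have "\<forall>l\<in>L. r (?g l) = 0" using assms(2)[unfolded int_indep_rows_def, THEN spec[of _ "\<lambda>l. r (?g l)"]] by blast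
  then have "r (?g (h l)) = 0" using l L by auto
  then show "r l = 0" using l by (simp add: the_inv_into_f_f[OF inj])
qed

text \<open>A relation over \<open>K\<close> between monomials of \<open>w\<close> becomes, after
  multiplication by a power of the product of the coordinates, a polynomial vanishing at
  \<open>w\<close>, hence on \<open>W\<close>. The rank of the monomials thus bounds the dimension
  of the image of \<open>W\<close> from above, and rotundity bounds that dimension from
  below.\<close>

lemma rotund_generic_tuple:
  assumes W: "rotund n W" and K: "countable K" "cnj ` K \<subseteq> K" and w: "generic_point K n W w"
  shows "rotund_tuple K {..<n} w"
  unfolding rotund_tuple_def
proof (intro allI impI)
  fix L and q :: "nat \<Rightarrow> nat \<Rightarrow> int" assume Lq: "finite L \<and> int_indep_rows L {..<n} q"
  let ?k = "card L"
  have irr: "irreducible_subvariety n W" using W unfolding rotund_def by blast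
  have Wt: "W \<subseteq> torus n" "W \<noteq> {}"
    using irr unfolding irreducible_subvariety_def zariski_closed_def by auto
  have wnz: "w j \<noteq> 0" if "j < n" for j by (rule generic_point_nonzero[OF w Wt(2) Wt(1) that])
  obtain h where h: "bij_betw h {..<?k} L" using ex_bij_betw_nat_finite[of L] Lq by (auto simp: atLeast0LessThan)
  have ind: "int_indep_rows {..<?k} {..<n} (\<lambda>i. q (h i))" using int_indep_rows_reindex[OF h] Lq by blast
  let ?M = "mat ?k n (\<lambda>(i, j). q (h i) j)"
  have rk: "vec_space.rank ?k (map_mat rat_of_int ?M) = ?k" by (rule rank_eq_rows[OF ind])
  have M: "?M \<in> carrier_mat ?k n" by simp
  have dim: "enat ?k \<le> 2 * variety_dim ?k (matrix_power ?M ` W)"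
    using W M rk unfolding rotund_def by blast
  let ?y = "\<lambda>i. monomial {..<n} w (q (h i))"
  have mp: "matrix_power ?M x i = monomial {..<n} x (q (h i))" if "i < ?k" for x :: "nat \<Rightarrow> complex" and i
    using that by (simp add: matrix_power_def monomial_def)
  have xnz: "x j \<noteq> 0" if "x \<in> W" "j < n" for x j
    using that Wt(1) unfolding tuples_def mult_group_def by (fastforce dest: PiE_mem)
  have tor: "matrix_power ?M ` W \<subseteq> torus ?k"
  proof
    fix y assume "y \<in> matrix_power ?M ` W"
    then obtain x where x: "x \<in> W" "y = matrix_power ?M x" by blast
    have "y i \<noteq> 0" if "i < ?k" for i
      unfolding x(2) mp[OF that] monomial_def using xnz[OF x(1)] by simp
    moreover have "y i = undefined" if "\<not> i < ?k" for i
      using that unfolding x(2) matrix_power_def by simp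
    ultimately show "y \<in> torus ?k" unfolding tuples_def mult_group_def by (auto intro!: PiE_I)
  qed
  have "\<forall>x\<in>matrix_power ?M ` W. f x = 0" if f: "f \<in> polyfun K {..<?k}" "f ?y = 0" for f
  proof
    fix y assume "y \<in> matrix_power ?M ` W"
    then obtain x where x: "x \<in> W" "y = matrix_power ?M x" by blast
    obtain N g where g: "g \<in> polyfun K {..<n}" "\<forall>x. (\<forall>j<n. x j \<noteq> 0) \<longrightarrow>
        f (\<lambda>i. monomial {..<n} x (q (h i))) * (\<Prod>j<n. x j) ^ N = g x"
      using polyfun_laurent[OF f(1), of n "\<lambda>i. q (h i)"] by auto
    have "g w = 0" using g(2) wnz f(2) by (metis mult_zero_left)
    then have "g x = 0" using generic_pointD[OF w g(1)] x(1) by blast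
    moreover have "f (\<lambda>i. monomial {..<n} x (q (h i))) * (\<Prod>j<n. x j) ^ N = g x" using g(2) xnz[OF x(1)] by blast
    moreover have "(\<Prod>j<n. x j) ^ N \<noteq> 0" using xnz[OF x(1)] by simp
    ultimately have "f (\<lambda>i. monomial {..<n} x (q (h i))) = 0" by (metis mult_eq_0_iff)
    moreover have "f y = f (\<lambda>i. monomial {..<n} x (q (h i)))"
      by (rule polyfun_cong[OF f(1)]) (simp add: x(2) mp)
    ultimately show "f y = 0" by simp
  qed
  then have "variety_dim ?k (matrix_power ?M ` W) \<le> enat (drk K (?y ` {..<?k}))"
    by (intro variety_dim_le[OF K tor]) blast
  moreover have "?y ` {..<?k} = (\<lambda>l. monomial {..<n} w (q l)) ` L"
    using h unfolding bij_betw_def by (metis image_image)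
  ultimately have "variety_dim ?k (matrix_power ?M ` W) \<le> enat (drk K ((\<lambda>l. monomial {..<n} w (q l)) ` L))" by simp
  then have "2 * variety_dim ?k (matrix_power ?M ` W) \<le> 2 * enat (drk K ((\<lambda>l. monomial {..<n} w (q l)) ` L))"
    by (rule mult_left_mono) simp
  with dim have "enat ?k \<le> 2 * enat (drk K ((\<lambda>l. monomial {..<n} w (q l)) ` L))" by (rule order_trans)
  also have "\<dots> = enat (2 * drk K ((\<lambda>l. monomial {..<n} w (q l)) ` L))"
    by (simp add: numeral_eq_enat)
  finally show "?k \<le> 2 * drk K ((\<lambda>l. monomial {..<n} w (q l)) ` L)" by simp
qed

lemma drk_cnj_le:
  assumes K: "cnj ` K \<subseteq> K" and A: "finite A"
  shows "drk K A \<le> drk K (cnj ` A)"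
proof -
  have "A \<subseteq> dcl (K \<union> A)" using dcl_ext[of "K \<union> A"] by blast
  then obtain B where B: "B \<subseteq> A" "dindep K B" "card B = drk K A" using dcl.rk_basis[OF A, of A K] by metis
  have "dindep K (cnj ` B)" unfolding dcl.indep_def
  proof (intro ballI notI)
    fix b' assume "b' \<in> cnj ` B" and b': "b' \<in> dcl (K \<union> (cnj ` B - {b'}))"
    then obtain b where b: "b \<in> B" "b' = cnj b" by blast
    have "cnj b' \<in> dcl (K \<union> cnj ` (cnj ` B - {b'}))" by (rule cnj_dcl[OF K b'])
    moreover have "cnj ` (cnj ` B - {b'}) = B - {b}" unfolding b(2) by (force simp: image_iff)
    ultimately have "b \<in> dcl (K \<union> (B - {b}))" using b(2) by simp
    then show False using B(2) b(1) unfolding dcl.indep_def by blast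
  qed
  moreover have "cnj ` A \<subseteq> dcl (K \<union> cnj ` A)" using dcl_ext[of "K \<union> cnj ` A"] by blast
  ultimately have "card (cnj ` B) \<le> drk K (cnj ` A)"
    using dcl.indep_le_rk[of "cnj ` A" "cnj ` A" K "cnj ` B"] A B(1) by blast
  moreover have "card (cnj ` B) = card B" by (intro card_image inj_onI) simp
  ultimately show ?thesis using B(3) by simp
qed

lemma rotund_tuple_cnj:
  assumes K: "cnj ` K \<subseteq> K" and I: "rotund_tuple K I w"
  shows "rotund_tuple K I (\<lambda>i. cnj (w i))"
  unfolding rotund_tuple_def
proof (intro allI impI)
  fix L and q :: "nat \<Rightarrow> nat \<Rightarrow> int" assume L: "finite L \<and> int_indep_rows L I q"
  have c: "cnj (a powi k) = cnj a powi k" for a and k :: int by (simp add: power_int_def)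
  have m: "monomial I (\<lambda>i. cnj (w i)) e = cnj (monomial I w e)" for e by (simp add: monomial_def c)
  have "card L \<le> 2 * drk K ((\<lambda>l. monomial I w (q l)) ` L)" using I L unfolding rotund_tuple_def by blast
  also have "\<dots> \<le> 2 * drk K (cnj ` (\<lambda>l. monomial I w (q l)) ` L)" using L by (intro mult_left_mono drk_cnj_le[OF K]) auto
  also have "cnj ` (\<lambda>l. monomial I w (q l)) ` L = (\<lambda>l. monomial I (\<lambda>i. cnj (w i)) (q l)) ` L" unfolding m image_image ..
  finally show "card L \<le> 2 * drk K ((\<lambda>l. monomial I (\<lambda>i. cnj (w i)) (q l)) ` L)" .
qed

lemma Der_conjugate:
  assumes K: "cnj ` K \<subseteq> K" and d: "d \<in> Der K"
  shows "(\<lambda>z. cnj (d (cnj z))) \<in> Der K"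
proof -
  have "d (cnj s) = 0" if "s \<in> K" for s using Der_zero[OF d, of "cnj s"] K that by blast
  then show ?thesis unfolding Der_def by (simp add: Der_add[OF d] Der_mult[OF d])
qed

text \<open>
  With real coefficients a linear relation between the logarithmic derivatives of \<open>w\<close> can be added
  to its conjugate, which is a relation for the products of \<open>w\<close> with \<open>cnj \<circ> w\<close>.
\<close>

lemma no_real_log_relation:
  assumes W: "rotund n W" and K: "countable K" "cnj ` K \<subseteq> K" and w: "generic_point K n W w" "conj_free K n w"
    and r: "\<And>d. d \<in> Der K \<Longrightarrow> (\<Sum>i<n. complex_of_real (r i) * (d (w i) / w i)) = 0" and i: "i < n"
  shows "r i = 0"
proof -
  have irr: "irreducible_subvariety n W" using W unfolding rotund_def by blast
  have Wt: "W \<subseteq> torus n" "W \<noteq> {}"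
    using irr unfolding irreducible_subvariety_def zariski_closed_def by auto
  have wnz: "w j \<noteq> 0" if "j < n" for j by (rule generic_point_nonzero[OF w(1) Wt(2) Wt(1) that])
  have R: "rotund_tuple K {..<n} w" by (rule rotund_generic_tuple[OF W K w(1)])
  have R': "rotund_tuple K {..<n} (\<lambda>i. cnj (w i))" by (rule rotund_tuple_cnj[OF K(2) R])
  have D: "\<exists>d'\<in>Der K. \<forall>i\<in>{..<n}. d' (w i) = d (w i) \<and> d' (cnj (w i)) = 0" if "d \<in> Der K" for d
    using w(2) that unfolding conj_free_def by (simp add: Ball_def)
  have S: "(\<Sum>i<n. complex_of_real (r i) * (d (w i * cnj (w i)) / (w i * cnj (w i)))) = 0" if d: "d \<in> Der K" for d
  proof -
    have "(\<Sum>i<n. complex_of_real (r i) * (cnj (d (cnj (w i))) / w i)) = 0"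
      using r[OF Der_conjugate[OF K(2) d]] .
    then have "cnj (\<Sum>i<n. complex_of_real (r i) * (cnj (d (cnj (w i))) / w i)) = 0" by simp
    then have e: "(\<Sum>i<n. complex_of_real (r i) * (d (cnj (w i)) / cnj (w i))) = 0" by simp
    have "(\<Sum>i<n. complex_of_real (r i) * (d (w i * cnj (w i)) / (w i * cnj (w i)))) =
      (\<Sum>i<n. complex_of_real (r i) * (d (w i) / w i) + complex_of_real (r i) * (d (cnj (w i)) / cnj (w i)))"
      by (rule sum.cong) (simp_all add: Der_mult[OF d] wnz field_simps)
    also have "\<dots> = 0" unfolding sum.distrib r[OF d] e by simp
    finally show ?thesis .
  qed
  have "complex_of_real (r i) = 0"
    by (rule rotund_products_independent[of "{..<n}" w "\<lambda>i. cnj (w i)" K "\<lambda>i. complex_of_real (r i)" i])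
      (use wnz D R R' S i in auto)
  then show ?thesis by simp
qed

section \<open>Triangular equations at a generic point\<close>

text \<open>Least degree yields at once a nonzero leading coefficient and a simple root, since
  truncation and differentiation both lower the degree bound.\<close>

lemma leading_family:
  assumes wm: "w m \<in> dcl (K \<union> w ` {..<m})"
  obtains e p where "minimal_family K m (\<lambda>f. f w = (0::complex)) e p" "poly (pderiv (p w)) (w m) \<noteq> 0"
proof -
  let ?Z = "\<lambda>f. f w = (0::complex)"
  define Q where "Q e p \<longleftrightarrow> poly_family K {..<m} e p \<and> poly (p w) (w m) = 0 \<and> p w \<noteq> 0" for e p
  have "alg_over (gen_field (K \<union> w ` {..<m})) (w m)" using wm unfolding dcl_iff_alg_over .
  from alg_over_poly_family[OF this] obtain p0 d0 where "poly_family K {..<m} d0 p0" "p0 w \<noteq> 0" "poly (p0 w) (w m) = 0"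
    by (elim exE conjE)
  then have ex: "\<exists>e. \<exists>p. Q e p" unfolding Q_def by blast
  define e where "e = (LEAST e. \<exists>p. Q e p)"
  obtain p where p: "Q e p" using LeastI_ex[OF ex] unfolding e_def by blast
  have least: "q w = 0" if "d < e" "poly_family K {..<m} d q" "poly (q w) (w m) = 0" for d q
  proof (rule ccontr)
    assume "q w \<noteq> 0"
    then have "\<exists>p. Q d p" using that unfolding Q_def by blast
    then show False using not_less_Least that(1) unfolding e_def by blast
  qed
  have pf: "poly_family K {..<m} e p" and pz: "poly (p w) (w m) = 0" and pn: "p w \<noteq> 0" using p unfolding Q_def by blast+
  have deg: "degree (p w) \<le> e" using pf unfolding poly_family_def by blast
  have "e \<noteq> 0"
  proof
    assume "e = 0"
    then have "degree (p w) = 0" using deg by simp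
    then obtain a where "p w = [:a:]" by (rule degree_eq_zeroE)
    then show False using pz pn by simp
  qed
  have trunc: "(\<Sum>i\<le>d. monom (coeff q i) i) = q" if "degree q \<le> d" for q :: "complex poly" and d
    using that by (intro poly_as_sum_of_monoms')
  have dege: "degree (p w) = e"
  proof (rule ccontr)
    assume "degree (p w) \<noteq> e"
    then have l: "degree (p w) < e" using deg by simp
    let ?q = "\<lambda>x. \<Sum>i\<le>degree (p w). monom (coeff (p x) i) i"
    have "?q w = p w" by (rule trunc) simp
    moreover have "poly_family K {..<m} (degree (p w)) ?q" by (rule poly_family_truncate[OF pf])
    ultimately show False using least[OF l, of ?q] pz pn by simp
  qed
  have "coeff (p w) e \<noteq> 0" using dege pn leading_coeff_0_iff by blast
  moreover have "\<forall>d q. d < e \<and> poly_family K {..<m} d q \<and> poly (q w) (w m) = 0 \<longrightarrow> (\<forall>i. coeff (q w) i = 0)"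
  proof (intro allI impI)
    fix d q i assume "d < e \<and> poly_family K {..<m} d q \<and> poly (q w) (w m) = 0"
    then show "coeff (q w) i = 0" using least[of d q] by simp
  qed
  ultimately have mf: "minimal_family K m ?Z e p" unfolding minimal_family_def using pf pz by blast
  have "poly (pderiv (p w)) (w m) \<noteq> 0"
  proof
    assume z: "poly (pderiv (p w)) (w m) = 0"
    have "poly_family K {..<m} (e - 1) (\<lambda>x. pderiv (p x))"
      unfolding poly_family_def
    proof (intro conjI allI)
      fix i
      have "(\<lambda>x. of_nat (Suc i) * coeff (p x) (Suc i)) \<in> polyfun K {..<m}"
        using pf unfolding poly_family_def by (intro polyfun.intros polyfun_of_nat) blast
      then show "(\<lambda>x. coeff (pderiv (p x)) i) \<in> polyfun K {..<m}" by (simp add: coeff_pderiv)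
    next
      fix x
      have "degree (p x) \<le> e" using pf unfolding poly_family_def by blast
      then show "degree (pderiv (p x)) \<le> e - 1" by (simp add: degree_pderiv)
    qed
    then have "pderiv (p w) = 0" using least[of "e - 1" "\<lambda>x. pderiv (p x)"] z \<open>e \<noteq> 0\<close> by simp
    then show False using dege \<open>e \<noteq> 0\<close> pderiv_eq_0_iff[of "p w"] by simp
  qed
  with mf show ?thesis by (rule that)
qed

text \<open>One equation for each algebraic coordinate captures all relations of \<open>w\<close>,
  as long as the leading coefficients do not vanish: relations are reduced variable by variable, by
  pseudo-division at an algebraic coordinate and coefficientwise at a transcendental one.\<close>

lemma vanish_at_triangular_zero:
  assumes u: "\<And>m. m < n \<Longrightarrow> w m \<in> dcl (K \<union> w ` {..<m}) \<Longrightarrow>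
      \<exists>e p. minimal_family K m (\<lambda>f. f w = (0::complex)) e p \<and> coeff (p u) e \<noteq> 0 \<and> poly (p u) (u m) = 0"
  shows "m \<le> n \<Longrightarrow> f \<in> polyfun K {..<m} \<Longrightarrow> f w = 0 \<Longrightarrow> f u = 0"
proof (induction m arbitrary: f)
  case 0
  have "f u = f w" by (rule polyfun_cong[OF 0(2)]) simp
  then show ?case using 0 by simp
next
  case (Suc m)
  let ?Z = "\<lambda>f. f w = (0::complex)"
  have Z: "ideal_pred K ?Z" unfolding ideal_pred_def by simp
  have "f \<in> polyfun K (insert m {..<m})" using Suc.prems(2) by (simp add: lessThan_Suc)
  from polyfun_decompose[OF this] obtain q d where q: "poly_family K {..<m} d q" "\<forall>x. f x = poly (q x) (x m)" by (elim exE conjE)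
  have qw: "poly (q w) (w m) = 0" using q(2) Suc.prems(3) by simp
  have IH: "g u = 0" if "g \<in> polyfun K {..<m}" "g w = 0" for g
    using Suc.IH[OF _ that] Suc.prems(1) by simp
  show ?case
  proof (cases "w m \<in> dcl (K \<union> w ` {..<m})")
    case True
    obtain e p where p: "minimal_family K m ?Z e p" "coeff (p u) e \<noteq> 0" "poly (p u) (u m) = 0"
      using u[OF _ True] Suc.prems(1) by auto
    have "poly (q u) (u m) = 0"
      by (rule triangular_step[of K ?Z m e p u d q, OF Z p _ q(1) qw]) (rule IH)
    then show ?thesis using q(2) by simp
  next
    case False
    have "q w = 0" by (rule poly_family_vanish[OF q(1) False qw])
    then have "coeff (q u) i = 0" for i
      using IH[of "\<lambda>x. coeff (q x) i"] q(1) unfolding poly_family_def by simp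
    then have "q u = 0" by (simp add: poly_eq_iff)
    then show ?thesis using q(2) by simp
  qed
qed

text \<open>Variables beyond \<open>m\<close> do not occur, and the partial derivative in the
  variable \<open>m\<close> is that of the polynomial \<open>p w\<close> at a simple root. The
  gradients of the system are therefore triangular with nonzero diagonal.\<close>

lemma family_gradient:
  assumes p: "poly_family K {..<m} e p" and m: "m < n" and nz: "poly (pderiv (p w)) (w m) \<noteq> 0"
  obtains h where "\<forall>x y. poly (p x) (x m) - poly (p y) (y m) = (\<Sum>i<n. h i x y * (x i - y i))"
    "\<forall>i<n. ((\<lambda>z. h i (fst z) (snd z)) \<longlongrightarrow> h i w w) (near n w \<times>\<^sub>F near n w)"
    "\<forall>i. i > m \<longrightarrow> h i w w = 0" "h m w w \<noteq> 0"
    "\<forall>d\<in>Der K. d (poly (p w) (w m)) = (\<Sum>i<n. h i w w * d (w i))"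
proof -
  let ?f = "\<lambda>x. poly (p x) (x m)"
  have "?f \<in> polyfun K {..<Suc m}" by (rule poly_family_eval[OF p]) auto
  moreover have "{..<Suc m} \<subseteq> {..<n}" using m by auto
  ultimately have "\<exists>h. (\<forall>x y. ?f x - ?f y = (\<Sum>i<n. h i x y * (x i - y i))) \<and>
     (\<forall>i<n. ((\<lambda>z. h i (fst z) (snd z)) \<longlongrightarrow> h i w w) (near n w \<times>\<^sub>F near n w)) \<and>
     (\<forall>i. i \<notin> {..<Suc m} \<longrightarrow> (\<forall>x y. h i x y = 0)) \<and>
     (\<forall>d\<in>Der K. d (?f w) = (\<Sum>i<n. h i w w * d (w i)))" by (rule divided_differences)
  then obtain h where h: "\<forall>x y. ?f x - ?f y = (\<Sum>i<n. h i x y * (x i - y i))"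
    "\<forall>i<n. ((\<lambda>z. h i (fst z) (snd z)) \<longlongrightarrow> h i w w) (near n w \<times>\<^sub>F near n w)"
    "\<forall>i. i \<notin> {..<Suc m} \<longrightarrow> (\<forall>x y. h i x y = 0)" "\<forall>d\<in>Der K. d (?f w) = (\<Sum>i<n. h i w w * d (w i))"
    by (elim exE conjE)
  have "h m w w \<noteq> 0"
  proof -
    have pw: "p (w(m := t)) = p w" for t
    proof (rule poly_eqI)
      fix i
      have "(\<lambda>x. coeff (p x) i) \<in> polyfun K {..<m}" using p unfolding poly_family_def by blast
      from polyfun_cong[OF this, of "w(m := t)" w] show "coeff (p (w(m := t))) i = coeff (p w) i" by simp
    qed
    \<comment> \<open>Moving only the coordinate \<open>m\<close> turns the divided difference into
      an ordinary difference quotient, whose limit identifies \<open>h m w w\<close>.\<close>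
    have q: "poly (p w) t - poly (p w) (w m) = h m (w(m := t)) w * (t - w m)" for t
    proof -
      have "poly (p w) t - poly (p w) (w m) = ?f (w(m := t)) - ?f w" by (simp add: pw)
      also have "\<dots> = (\<Sum>i<n. h i (w(m := t)) w * ((w(m := t)) i - w i))" using h(1) by blast
      also have "\<dots> = (\<Sum>i<n. if i = m then h m (w(m := t)) w * (t - w m) else 0)" by (rule sum.cong) auto
      also have "\<dots> = h m (w(m := t)) w * (t - w m)" using m by simp
      finally show ?thesis .
    qed
    have "filterlim (\<lambda>t. (w(m := t), w)) (near n w \<times>\<^sub>F near n w) (at (w m))"
    proof (rule filterlim_Pair)
      show "filterlim (\<lambda>t. w(m := t)) (near n w) (at (w m))"
        unfolding filterlim_iff eventually_near
      proof (intro allI impI)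
        fix P assume "\<exists>d>0. \<forall>x. (\<forall>i<n. dist (x i) (w i) < d) \<longrightarrow> P x"
        then obtain d where d: "d > 0" "\<And>x. (\<forall>i<n. dist (x i) (w i) < d) \<Longrightarrow> P x" by blast
        show "\<forall>\<^sub>F t in at (w m). P (w(m := t))"
          unfolding eventually_at by (rule exI[of _ d]) (auto intro!: d)
      qed
      show "filterlim (\<lambda>t. w) (near n w) (at (w m))"
        unfolding filterlim_iff eventually_near by (auto intro!: always_eventually)
    qed
    moreover have "((\<lambda>z. h m (fst z) (snd z)) \<longlongrightarrow> h m w w) (near n w \<times>\<^sub>F near n w)" using h(2) m by blast
    ultimately have "((\<lambda>t. h m (fst (w(m := t), w)) (snd (w(m := t), w))) \<longlongrightarrow> h m w w) (at (w m))"
      by (rule filterlim_compose[rotated])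
    then have "((\<lambda>t. h m (w(m := t)) w) \<longlongrightarrow> h m w w) (at (w m))" by simp
    moreover have "\<forall>\<^sub>F t in at (w m). h m (w(m := t)) w = (poly (p w) t - poly (p w) (w m)) / (t - w m)"
      unfolding eventually_at q by (rule exI[of _ 1]) auto
    ultimately have "((\<lambda>t. (poly (p w) t - poly (p w) (w m)) / (t - w m)) \<longlongrightarrow> h m w w) (at (w m))"
      by (rule Lim_transform_eventually)
    moreover have "((\<lambda>t. (poly (p w) t - poly (p w) (w m)) / (t - w m)) \<longlongrightarrow> poly (pderiv (p w)) (w m)) (at (w m))"
      using poly_DERIV[of "p w" "w m"] unfolding has_field_derivative_iff .
    ultimately have "h m w w = poly (pderiv (p w)) (w m)" by (intro tendsto_unique[OF at_neq_bot]) auto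
    then show ?thesis using nz by simp
  qed
  then show ?thesis using h by (intro that[of h]) auto
qed

section \<open>Solutions of the form exp(\<epsilon> t + q)\<close>

text \<open>The divided difference of the exponential at 0, filled in to be continuous
  there.\<close>

definition exp_quot :: "complex \<Rightarrow> complex" where
  "exp_quot u = (if u = 0 then 1 else (exp u - 1) / u)"

lemma exp_quot_tendsto: "(exp_quot \<longlongrightarrow> 1) (nhds 0)"
proof -
  have "((\<lambda>u::complex. (exp u - exp 0) / (u - 0)) \<longlongrightarrow> exp 0) (at 0)"
    using DERIV_exp[of "0::complex"] unfolding has_field_derivative_iff .
  then have "((\<lambda>u::complex. (exp u - 1) / u) \<longlongrightarrow> 1) (at 0)" by simp
  moreover have "\<forall>\<^sub>F u in at 0. (exp u - 1) / u = exp_quot u"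
    unfolding eventually_at by (rule exI[of _ 1]) (simp add: exp_quot_def)
  ultimately have "(exp_quot \<longlongrightarrow> 1) (at 0)" by (rule Lim_transform_eventually)
  then have "(exp_quot \<longlongrightarrow> exp_quot 0) (at 0)" by (simp add: exp_quot_def)
  then have "isCont exp_quot 0" unfolding isCont_def .
  then have "(exp_quot \<longlongrightarrow> exp_quot 0) (nhds 0)" unfolding continuous_at tendsto_at_iff_tendsto_nhds .
  then show ?thesis by (simp add: exp_quot_def)
qed

lemma filterlim_prod_fst: "filterlim fst F (F \<times>\<^sub>F G)"
proof (unfold filterlim_iff eventually_prod_filter, intro allI impI)
  fix P assume "eventually P F"
  then show "\<exists>Pf Pg. eventually Pf F \<and> eventually Pg G \<and> (\<forall>x y. Pf x \<longrightarrow> Pg y \<longrightarrow> P (fst (x, y)))"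
    by (intro exI[of _ P] exI[of _ "\<lambda>_. True"]) simp
qed

lemma filterlim_prod_snd: "filterlim snd G (F \<times>\<^sub>F G)"
proof (unfold filterlim_iff eventually_prod_filter, intro allI impI)
  fix P assume "eventually P G"
  then show "\<exists>Pf Pg. eventually Pf F \<and> eventually Pg G \<and> (\<forall>x y. Pf x \<longrightarrow> Pg y \<longrightarrow> P (snd (x, y)))"
    by (intro exI[of _ "\<lambda>_. True"] exI[of _ P]) simp
qed

lemma exp_diff_quot: "exp a - exp b = exp b * exp_quot (a - b) * (a - b)"
  by (simp add: exp_quot_def field_simps exp_add[symmetric])

lemma filterlim_near_exp:
  assumes "\<And>i. i < n \<Longrightarrow> exp (z i) = w i"
  shows "filterlim (\<lambda>\<zeta> i. exp (\<zeta> i)) (near n w) (near n z)"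
  unfolding filterlim_iff
proof (intro allI impI)
  fix P assume "eventually P (near n w)"
  then obtain d where d: "d > 0" "\<And>x. (\<forall>i<n. dist (x i) (w i) < d) \<Longrightarrow> P x" unfolding eventually_near by blast
  have "\<forall>\<^sub>F \<zeta> in near n z. dist (exp (\<zeta> i)) (w i) < d" if "i \<in> {..<n}" for i
  proof -
    have "((\<lambda>\<zeta>. exp (\<zeta> i)) \<longlongrightarrow> exp (z i)) (near n z)" using that by (intro tendsto_exp tendsto_near) simp
    then show ?thesis using d(1) assms that unfolding tendsto_iff by simp
  qed
  then have "\<forall>\<^sub>F \<zeta> in near n z. \<forall>i\<in>{..<n}. dist (exp (\<zeta> i)) (w i) < d" by (intro eventually_ball_finite) auto
  then show "\<forall>\<^sub>F \<zeta> in near n z. P (\<lambda>i. exp (\<zeta> i))" by eventually_elim (rule d(2), simp)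
qed

text \<open>Logarithms of points near \<open>w\<close> are written in the real basis
  \<open>\<epsilon>\<close>, 1. The coefficient of 1 is fixed at elements of \<open>Q\<close> close
  to the required values, and the coefficients \<open>t\<close> of \<open>\<epsilon>\<close> are the
  unknowns. The estimates hold uniformly in the first choice, so the latter can be made after all
  radii are known.\<close>

lemma solve_near:
  fixes f :: "nat \<Rightarrow> (nat \<Rightarrow> complex) \<Rightarrow> complex" and h :: "nat \<Rightarrow> nat \<Rightarrow> (nat \<Rightarrow> complex) \<Rightarrow> (nat \<Rightarrow> complex) \<Rightarrow> complex"
  assumes A: "finite A" and wnz: "\<And>i. i < n \<Longrightarrow> w i \<noteq> 0"
    and \<beta>: "\<beta> \<noteq> 0" and \<epsilon>: "\<epsilon> = 1 + complex_of_real \<beta> * \<i>"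
    and diff: "\<And>m x y. m \<in> A \<Longrightarrow> f m x - f m y = (\<Sum>i<n. h m i x y * (x i - y i))"
    and lim: "\<And>m i. m \<in> A \<Longrightarrow> i < n \<Longrightarrow> ((\<lambda>z. h m i (fst z) (snd z)) \<longlongrightarrow> h m i w w) (near n w \<times>\<^sub>F near n w)"
    and zero: "\<And>m. m \<in> A \<Longrightarrow> f m w = 0"
    and cont: "\<And>m. m \<in> A \<Longrightarrow> (f m \<longlongrightarrow> f m w) (near n w)"
    and indep: "\<And>r s. (\<And>i. i < n \<Longrightarrow> (\<Sum>m\<in>A. r m * Re (h m i w w * w i * \<epsilon>) + s m * Im (h m i w w * w i * \<epsilon>)) = 0)
      \<Longrightarrow> \<forall>m\<in>A. r m = 0 \<and> s m = 0"
    and dense: "\<And>s e. 0 < e \<Longrightarrow> \<exists>q\<in>Q. \<bar>q - s\<bar> < (e :: real)"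
    and P: "eventually P (near n w)"
  shows "\<exists>(t :: nat \<Rightarrow> real) q. (\<forall>i. q i \<in> Q) \<and> P (\<lambda>i. exp (\<epsilon> * of_real (t i) + of_real (q i))) \<and>
    (\<forall>m\<in>A. f m (\<lambda>i. exp (\<epsilon> * of_real (t i) + of_real (q i))) = 0)"
proof -
  define B where "B m i = h m i w w * w i * \<epsilon>" for m i
  \<comment> \<open>A complex equation counts as two real ones, given by the real and the imaginary
    part of its gradient.\<close>
  define b where "b x i = (if snd x then Re (B (fst x) i) else Im (B (fst x) i))" for x :: "nat \<times> bool" and i
  have "\<exists>\<theta>. \<forall>x\<in>A \<times> UNIV. \<forall>y\<in>A \<times> UNIV. (\<Sum>i<n. b x i * \<theta> y i) = (if x = y then 1 else 0)"
  proof (rule dual_vectors)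
    show "finite (A \<times> (UNIV :: bool set))" using A by simp
    fix r :: "nat \<times> bool \<Rightarrow> real" assume r: "\<And>i. i < n \<Longrightarrow> (\<Sum>x\<in>A \<times> UNIV. r x * b x i) = 0"
    have "(\<Sum>m\<in>A. r (m, True) * Re (h m i w w * w i * \<epsilon>) + r (m, False) * Im (h m i w w * w i * \<epsilon>)) = 0" if "i < n" for i
    proof -
      have "(\<Sum>x\<in>A \<times> UNIV. r x * b x i) = (\<Sum>m\<in>A. \<Sum>c\<in>UNIV. r (m, c) * b (m, c) i)" by (simp add: sum.cartesian_product)
      also have "\<dots> = (\<Sum>m\<in>A. r (m, True) * Re (h m i w w * w i * \<epsilon>) + r (m, False) * Im (h m i w w * w i * \<epsilon>))"
        by (simp add: UNIV_bool b_def B_def add.commute)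
      finally show ?thesis using r[OF that] by simp
    qed
    then have "\<forall>m\<in>A. r (m, True) = 0 \<and> r (m, False) = 0" by (rule indep)
    then have "r (m, c) = 0" if "m \<in> A" for m c using that by (cases c) auto
    then show "\<forall>x\<in>A \<times> UNIV. r x = 0" by auto
  qed
  then obtain \<theta> where \<theta>: "\<forall>x\<in>A \<times> UNIV. \<forall>y\<in>A \<times> UNIV. (\<Sum>i<n. b x i * \<theta> y i) = (if x = y then 1 else 0)" ..
  define \<rho> where "\<rho> m = \<theta> (m, True)" for m
  define \<sigma> where "\<sigma> m = \<theta> (m, False)" for m
  have dual: "Re (\<Sum>i<n. B m i * of_real (\<theta> (m', c) i)) = (if m = m' \<and> c then 1 else 0)"
    "Im (\<Sum>i<n. B m i * of_real (\<theta> (m', c) i)) = (if m = m' \<and> \<not> c then 1 else 0)" if "m \<in> A" "m' \<in> A" for m m' c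
  proof -
    show "Re (\<Sum>i<n. B m i * of_real (\<theta> (m', c) i)) = (if m = m' \<and> c then 1 else 0)"
      using \<theta>[rule_format, of "(m, True)" "(m', c)"] that by (auto simp: b_def)
    show "Im (\<Sum>i<n. B m i * of_real (\<theta> (m', c) i)) = (if m = m' \<and> \<not> c then 1 else 0)"
      using \<theta>[rule_format, of "(m, False)" "(m', c)"] that by (auto simp: b_def)
  qed
  have rho: "(\<Sum>i<n. B m i * of_real (\<rho> m' i)) = (if m = m' then 1 else 0)" if "m \<in> A" "m' \<in> A" for m m'
    unfolding \<rho>_def by (rule complex_eqI) (simp_all only: dual[OF that], simp_all)
  have sig: "(\<Sum>i<n. B m i * of_real (\<sigma> m' i)) = (if m = m' then \<i> else 0)" if "m \<in> A" "m' \<in> A" for m m'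
    unfolding \<sigma>_def by (rule complex_eqI) (simp_all only: dual[OF that], simp_all)
  define R where "R = 1 + (\<Sum>m\<in>A. \<Sum>i<n. \<bar>\<rho> m i\<bar> + \<bar>\<sigma> m i\<bar>)"
  have R0: "0 < R" unfolding R_def by (intro add_pos_nonneg sum_nonneg) auto
  have R: "\<bar>\<rho> m i\<bar> + \<bar>\<sigma> m i\<bar> \<le> R" if "m \<in> A" "i < n" for m i
  proof -
    have "\<bar>\<rho> m i\<bar> + \<bar>\<sigma> m i\<bar> \<le> (\<Sum>i<n. \<bar>\<rho> m i\<bar> + \<bar>\<sigma> m i\<bar>)"
      by (rule member_le_sum[of i "{..<n}" "\<lambda>i. \<bar>\<rho> m i\<bar> + \<bar>\<sigma> m i\<bar>"]) (use that in auto)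
    also have "\<dots> \<le> (\<Sum>m\<in>A. \<Sum>i<n. \<bar>\<rho> m i\<bar> + \<bar>\<sigma> m i\<bar>)"
      by (rule member_le_sum[of m A "\<lambda>m. \<Sum>i<n. \<bar>\<rho> m i\<bar> + \<bar>\<sigma> m i\<bar>"]) (use that A in \<open>auto intro: sum_nonneg\<close>)
    finally show ?thesis unfolding R_def by simp
  qed
  define X where "X = real (card A) * real n * R"
  have X0: "0 \<le> X" unfolding X_def using R0 by simp
  \<comment> \<open>Half the reciprocal of the constant in the contraction condition; the added 1
    covers the case that the constant is 0.\<close>
  define \<eta> where "\<eta> = 1 / (2 * (1 + X))"
  have \<eta>0: "0 < \<eta>" unfolding \<eta>_def using X0 by simp
  have \<eta>1: "real (card A) * \<eta> * real n * R \<le> 1 / 2"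
  proof -
    have "real (card A) * \<eta> * real n * R = X / (2 * (1 + X))" unfolding \<eta>_def X_def by simp
    also have "\<dots> \<le> 1 / 2" using X0 by (simp add: field_simps)
    finally show ?thesis .
  qed
  define z where "z i = Complex (ln (cmod (w i))) (Arg (w i))" for i
  have ez: "exp (z i) = w i" if "i < n" for i
    using wnz[OF that] rcis_cmod_Arg[of "w i"] unfolding z_def exp_eq_polar rcis_def by simp
  \<comment> \<open>The imaginary part of \<open>\<epsilon>\<close> is \<open>\<beta>\<close>, so
    this coefficient accounts for the imaginary part of the logarithm and \<open>s0\<close> for the
    remaining real part.\<close>
  define t0 where "t0 i = Im (z i) / \<beta>" for i
  define s0 where "s0 i = Re (z i) - t0 i" for i
  have zts: "z i = \<epsilon> * of_real (t0 i) + of_real (s0 i)" for i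
    using \<beta> by (intro complex_eqI) (simp_all add: \<epsilon> t0_def s0_def)
  define E where "E \<zeta> = (\<lambda>i. exp (\<zeta> i :: complex))" for \<zeta> :: "nat \<Rightarrow> complex"
  have limE: "filterlim E (near n w) (near n z)" unfolding E_def by (rule filterlim_near_exp) (rule ez)
  \<comment> \<open>The divided difference of \<open>f m\<close> in the logarithmic coordinates; on
    the diagonal at \<open>z\<close> it equals \<open>B m i\<close>.\<close>
  define c where "c m i \<zeta> \<zeta>' = h m i (E \<zeta>) (E \<zeta>') * (exp (\<zeta>' i) * exp_quot (\<zeta> i - \<zeta>' i)) * \<epsilon>" for m i \<zeta> \<zeta>'
  have limc: "\<forall>\<^sub>F y in near n z \<times>\<^sub>F near n z. dist (c m i (fst y) (snd y)) (B m i) < \<eta>" if m: "m \<in> A" and i: "i < n" for m i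
  proof -
    let ?F = "near n z \<times>\<^sub>F near n z"
    have l1: "((\<lambda>y. fst y i) \<longlongrightarrow> z i) ?F"
      by (rule filterlim_compose[OF tendsto_near[OF i] filterlim_prod_fst])
    have l2: "((\<lambda>y. snd y i) \<longlongrightarrow> z i) ?F"
      by (rule filterlim_compose[OF tendsto_near[OF i] filterlim_prod_snd])
    have "((\<lambda>y. fst y i - snd y i) \<longlongrightarrow> z i - z i) ?F" by (rule tendsto_diff[OF l1 l2])
    then have "filterlim (\<lambda>y. fst y i - snd y i) (nhds 0) ?F" by simp
    then have l3: "((\<lambda>y. exp_quot (fst y i - snd y i)) \<longlongrightarrow> 1) ?F" by (rule filterlim_compose[OF exp_quot_tendsto])
    have "filterlim (\<lambda>y. (E (fst y), E (snd y))) (near n w \<times>\<^sub>F near n w) ?F"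
      by (intro filterlim_Pair filterlim_compose[OF limE] filterlim_prod_fst filterlim_prod_snd)
    from filterlim_compose[OF lim[OF m i] this]
    have l4: "((\<lambda>y. h m i (E (fst y)) (E (snd y))) \<longlongrightarrow> h m i w w) ?F" by simp
    have "((\<lambda>y. c m i (fst y) (snd y)) \<longlongrightarrow> h m i w w * (exp (z i) * 1) * \<epsilon>) ?F"
      unfolding c_def by (intro tendsto_mult tendsto_exp l1 l2 l3 l4 tendsto_const)
    then have "((\<lambda>y. c m i (fst y) (snd y)) \<longlongrightarrow> B m i) ?F" by (simp add: B_def ez[OF i])
    then show ?thesis using \<eta>0 unfolding tendsto_iff by blast
  qed
  have "\<forall>\<^sub>F y in near n z \<times>\<^sub>F near n z. \<forall>m\<in>A. \<forall>i\<in>{..<n}. dist (c m i (fst y) (snd y)) (B m i) < \<eta>"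
    using A limc by (intro eventually_ball_finite ballI) auto
  then obtain P1 P2 where P12: "eventually P1 (near n z)" "eventually P2 (near n z)"
    "\<And>\<zeta> \<zeta>'. P1 \<zeta> \<Longrightarrow> P2 \<zeta>' \<Longrightarrow> \<forall>m\<in>A. \<forall>i\<in>{..<n}. dist (c m i \<zeta> \<zeta>') (B m i) < \<eta>"
    unfolding eventually_prod_filter by auto
  have PE: "eventually (\<lambda>\<zeta>. P (E \<zeta>)) (near n z)" using limE P unfolding filterlim_iff by blast
  have "eventually (\<lambda>\<zeta>. P1 \<zeta> \<and> P2 \<zeta> \<and> P (E \<zeta>)) (near n z)" using P12(1,2) PE by (intro eventually_conj)
  then obtain D where D: "D > 0" "\<And>\<zeta>. \<forall>i<n. dist (\<zeta> i) (z i) < D \<Longrightarrow> P1 \<zeta> \<and> P2 \<zeta> \<and> P (E \<zeta>)"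
    unfolding eventually_near by blast
  \<comment> \<open>Half of the radius \<open>D\<close> is left for moving \<open>t\<close>, the
    other half for replacing \<open>s0\<close> by elements of \<open>Q\<close>.\<close>
  define \<delta> where "\<delta> = D / (2 * (1 + cmod \<epsilon>))"
  have e1: "0 < 1 + cmod \<epsilon>" by (simp add: add_pos_nonneg)
  have \<delta>: "0 < \<delta>" "cmod \<epsilon> * \<delta> < D / 2"
  proof -
    show "0 < \<delta>" unfolding \<delta>_def using D(1) e1 by simp
    have "(1 + cmod \<epsilon>) * \<delta> = D / 2" unfolding \<delta>_def using e1 by (simp add: field_simps)
    then show "cmod \<epsilon> * \<delta> < D / 2" using \<open>0 < \<delta>\<close> by (simp add: algebra_simps)
  qed
  have "((\<lambda>\<zeta>. 2 * R * (\<Sum>m\<in>A. cmod (f m (E \<zeta>)))) \<longlongrightarrow> 2 * R * (\<Sum>m\<in>A. cmod (f m w))) (near n z)"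
    by (intro tendsto_mult tendsto_const tendsto_sum tendsto_norm filterlim_compose[OF cont limE])
  then have "((\<lambda>\<zeta>. 2 * R * (\<Sum>m\<in>A. cmod (f m (E \<zeta>)))) \<longlongrightarrow> 0) (near n z)" by (simp add: zero)
  then have "\<forall>\<^sub>F \<zeta> in near n z. 2 * R * (\<Sum>m\<in>A. cmod (f m (E \<zeta>))) < \<delta>" by (rule order_tendstoD) (rule \<delta>(1))
  then obtain D2 where D2: "D2 > 0" "\<And>\<zeta>. \<forall>i<n. dist (\<zeta> i) (z i) < D2 \<Longrightarrow> 2 * R * (\<Sum>m\<in>A. cmod (f m (E \<zeta>))) < \<delta>"
    unfolding eventually_near by blast
  have "\<forall>i. \<exists>q\<in>Q. \<bar>q - s0 i\<bar> < min D2 (D / 2)" using D(1) D2(1) by (intro allI dense) simp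
  then obtain q where q: "\<And>i. q i \<in> Q" "\<And>i. \<bar>q i - s0 i\<bar> < min D2 (D / 2)" by metis
  define Z where "Z t = (\<lambda>i. \<epsilon> * complex_of_real (t i) + complex_of_real (q i))" for t :: "nat \<Rightarrow> real"
  have dZ: "dist (Z t i) (z i) \<le> cmod \<epsilon> * \<bar>t i - t0 i\<bar> + \<bar>q i - s0 i\<bar>" for t i
  proof -
    have "Z t i - z i = \<epsilon> * of_real (t i - t0 i) + of_real (q i - s0 i)" unfolding Z_def zts by (simp add: algebra_simps)
    then have "dist (Z t i) (z i) = cmod (\<epsilon> * of_real (t i - t0 i) + of_real (q i - s0 i))" by (simp add: dist_norm)
    also have "\<dots> \<le> cmod (\<epsilon> * of_real (t i - t0 i)) + cmod (of_real (q i - s0 i))" by (rule norm_triangle_ineq)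
    also have "\<dots> = cmod \<epsilon> * \<bar>t i - t0 i\<bar> + \<bar>q i - s0 i\<bar>" by (simp only: norm_mult norm_of_real)
    finally show ?thesis .
  qed
  have ZD: "P1 (Z t) \<and> P2 (Z t) \<and> P (E (Z t))" if t: "\<And>i. i < n \<Longrightarrow> \<bar>t i - t0 i\<bar> \<le> \<delta>" for t
  proof (rule D(2), intro allI impI)
    fix i assume "i < n"
    then have "cmod \<epsilon> * \<bar>t i - t0 i\<bar> \<le> cmod \<epsilon> * \<delta>" using t by (intro mult_left_mono) auto
    then show "dist (Z t i) (z i) < D" using dZ[of t i] \<delta>(2) q(2)[of i] by linarith
  qed
  have err: "cmod (f m (E (Z t)) - f m (E (Z t')) - (\<Sum>i<n. B m i * of_real (t i - t' i))) \<le> \<eta> * (\<Sum>i<n. \<bar>t i - t' i\<bar>)"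
    if m: "m \<in> A" and t: "\<And>i. i < n \<Longrightarrow> \<bar>t i - t0 i\<bar> \<le> \<delta>" and t': "\<And>i. i < n \<Longrightarrow> \<bar>t' i - t0 i\<bar> \<le> \<delta>" for m t t'
  proof -
    have P1: "P1 (Z t)" using ZD[of t] t by blast
    have P2: "P2 (Z t')" using ZD[of t'] t' by blast
    have "f m (E (Z t)) - f m (E (Z t')) = (\<Sum>i<n. c m i (Z t) (Z t') * of_real (t i - t' i))"
      unfolding diff[OF m]
    proof (rule sum.cong[OF refl])
      fix i
      have "E (Z t) i - E (Z t') i = exp (Z t' i) * exp_quot (Z t i - Z t' i) * (Z t i - Z t' i)"
        unfolding E_def by (rule exp_diff_quot)
      moreover have "Z t i - Z t' i = \<epsilon> * of_real (t i - t' i)" unfolding Z_def by (simp add: algebra_simps)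
      ultimately have "E (Z t) i - E (Z t') i = exp (Z t' i) * exp_quot (Z t i - Z t' i) * (\<epsilon> * of_real (t i - t' i))" by metis
      then show "h m i (E (Z t)) (E (Z t')) * (E (Z t) i - E (Z t') i) = c m i (Z t) (Z t') * of_real (t i - t' i)"
        unfolding c_def by (simp only: mult.assoc)
    qed
    then have "f m (E (Z t)) - f m (E (Z t')) - (\<Sum>i<n. B m i * of_real (t i - t' i)) =
       (\<Sum>i<n. (c m i (Z t) (Z t') - B m i) * of_real (t i - t' i))"
      by (simp only: sum_subtractf[symmetric] left_diff_distrib)
    also have "cmod \<dots> \<le> (\<Sum>i<n. \<eta> * \<bar>t i - t' i\<bar>)"
    proof (rule sum_norm_le)
      fix i assume i: "i \<in> {..<n}"
      have "cmod (c m i (Z t) (Z t') - B m i) < \<eta>" using P12(3)[OF P1 P2] m i by (simp add: dist_norm)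
      then have "cmod (c m i (Z t) (Z t') - B m i) * \<bar>t i - t' i\<bar> \<le> \<eta> * \<bar>t i - t' i\<bar>" by (intro mult_right_mono) auto
      then show "cmod ((c m i (Z t) (Z t') - B m i) * of_real (t i - t' i)) \<le> \<eta> * \<bar>t i - t' i\<bar>"
        by (simp only: norm_mult norm_of_real)
    qed
    finally show ?thesis by (simp only: sum_distrib_left)
  qed
  have "2 * R * (\<Sum>m\<in>A. cmod (f m (E (Z t0)))) < \<delta>"
  proof (rule D2(2), intro allI impI)
    fix i assume "i < n"
    show "dist (Z t0 i) (z i) < D2" using dZ[of t0 i] q(2)[of i] by simp
  qed
  then have small: "2 * R * (\<Sum>m\<in>A. cmod (f m (E (Z t0)))) \<le> \<delta>" by simp
  have "\<exists>t. (\<forall>i<n. \<bar>t i - t0 i\<bar> \<le> \<delta>) \<and> (\<forall>m\<in>A. f m (E (Z t)) = 0)"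
    by (rule newton_solve[where g = "\<lambda>m t. f m (E (Z t))" and B = B and \<rho> = \<rho> and \<sigma> = \<sigma> and \<eta> = \<eta>, OF A rho sig R0 R err less_imp_le[OF \<eta>0] \<eta>1 small])
  then obtain t where t: "\<forall>i<n. \<bar>t i - t0 i\<bar> \<le> \<delta>" "\<forall>m\<in>A. f m (E (Z t)) = 0" by blast
  have "P (E (Z t))" using ZD[of t] t(1) by blast
  then show ?thesis using t(2) q(1) unfolding E_def Z_def by (intro exI[of _ t] exI[of _ q]) blast
qed

section \<open>A lower bound for the predimension\<close>

lemma is_subfield_Rats: "is_subfield (\<rat> :: complex set)"
  unfolding is_subfield_def by (auto intro: Rats_diff Rats_mult Rats_inverse)

lemma common_denominator:
  assumes "finite A" "\<And>a. a \<in> A \<Longrightarrow> u a \<in> (\<rat> :: complex set)"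
  shows "\<exists>D e. D \<noteq> (0::int) \<and> (\<forall>a\<in>A. of_int D * u a = of_int (e a))"
  using assms
proof (induction A rule: finite_induct)
  case empty show ?case by (intro exI[of _ "1::int"]) auto
next
  case (insert x A)
  then obtain D e where D: "D \<noteq> 0" "\<forall>a\<in>A. of_int D * u a = of_int (e a)" by auto
  have "u x \<in> \<rat>" using insert.prems by simp
  then obtain p q :: int where pq: "q > 0" "u x = of_int p / of_int q" by (auto elim!: Rats_cases')
  then have q: "q \<noteq> 0" "of_int q * u x = of_int p" by auto
  let ?e = "\<lambda>a. if a = x then D * p else q * e a"
  have "of_int (D * q) * u a = of_int (?e a)" if a: "a \<in> insert x A" for a
  proof (cases "a = x")
    case True
    then show ?thesis using q(2) by (simp add: mult.assoc)
  next
    case False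
    then have "of_int D * u a = of_int (e a)" using D(2) a by simp
    moreover have "of_int (D * q) * u a = of_int q * (of_int D * u a)" by simp
    ultimately show ?thesis using False by simp
  qed
  then show ?case using D(1) q(1) by (intro exI[of _ "D * q"] exI[of _ ?e]) simp
qed

lemma rat_indep_family:
  fixes f :: "'i \<Rightarrow> complex"
  assumes I: "finite I" and F: "is_subfield F"
    and ind: "\<And>u. (\<And>i. i \<in> I \<Longrightarrow> u i \<in> F) \<Longrightarrow> (\<Sum>i\<in>I. u i * f i) = 0 \<Longrightarrow> \<forall>i\<in>I. u i = 0"
  shows "inj_on f I" "lin_indep F (f ` I)"
proof -
  note R = is_subfield_subring[OF F]
  show inj: "inj_on f I"
  proof (rule inj_onI, rule ccontr)
    fix i j assume ij: "i \<in> I" "j \<in> I" "f i = f j" "i \<noteq> j"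
    let ?u = "\<lambda>k. if k = i then 1 else if k = j then - 1 else (0::complex)"
    have "(\<Sum>k\<in>I. ?u k * f k) = (\<Sum>k\<in>{i, j}. ?u k * f k)" using I ij by (intro sum.mono_neutral_right) auto
    also have "\<dots> = 0" using ij by simp
    finally have "\<forall>k\<in>I. ?u k = 0" by (intro ind) (auto simp: is_subringD[OF R])
    then show False using ij(1) by auto
  qed
  show "lin_indep F (f ` I)" unfolding lin_indep_def
  proof (intro allI impI ballI)
    fix S u b assume H: "finite S \<and> S \<subseteq> f ` I \<and> (\<forall>b\<in>S. u b \<in> F) \<and> (\<Sum>b\<in>S. u b * b) = 0" and b: "b \<in> S"
    let ?u = "\<lambda>i. if f i \<in> S then u (f i) else 0"
    have "(\<Sum>i\<in>I. ?u i * f i) = (\<Sum>y\<in>f ` I. (if y \<in> S then u y else 0) * y)"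
      by (simp add: sum.reindex[OF inj])
    also have "\<dots> = (\<Sum>y\<in>S. u y * y)" using H I by (intro sum.mono_neutral_cong_right) auto
    finally have "\<forall>i\<in>I. ?u i = 0" using H by (intro ind) (auto simp: is_subringD(1)[OF R])
    moreover obtain i where "i \<in> I" "b = f i" using b H by blast
    ultimately show "u b = 0" using b by auto
  qed
qed

lemma lin_dim_eq_rk: "is_subfield F \<Longrightarrow> lin_dim F X = pregeometry.rk (fspan F) X"
proof -
  assume F: "is_subfield F"
  have "lin_indep F = pregeometry.indep (fspan F)" using lin_indep_iff[OF F] by (intro ext)
  then show ?thesis unfolding lin_dim_def pregeometry.rk_def[OF fspan_pregeometry[OF F]] by simp
qed

text \<open>An integrally independent subset of \<open>Q\<close> of greatest size; an integral
  relation involving \<open>q\<close> is solved for \<open>q\<close> over the rationals.\<close>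

lemma finite_rank_basis:
  assumes "finite_rank Q"
  obtains B where "finite B" "B \<subseteq> Q" "\<forall>q\<in>Q. complex_of_real q \<in> fspan \<rat> (complex_of_real ` B)"
proof -
  let ?P = "\<lambda>B. B \<subseteq> Q \<and> finite B \<and> lin_indep \<int> B"
  obtain N where N: "\<forall>B. ?P B \<longrightarrow> card B \<le> N" using assms unfolding finite_rank_def by blast
  have "?P {}" unfolding lin_indep_def by auto
  moreover have "\<forall>B. ?P B \<longrightarrow> card B < Suc N" using N by (simp add: less_Suc_eq_le)
  ultimately have "\<exists>B. ?P B \<and> (\<forall>C. ?P C \<longrightarrow> card C \<le> card B)"
    by (rule ex_has_greatest_nat[of ?P "{}" card "Suc N"])
  then obtain B where B: "?P B" "\<forall>C. ?P C \<longrightarrow> card C \<le> card B" by (elim exE conjE) simp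
  have "complex_of_real q \<in> fspan \<rat> (complex_of_real ` B)" if q: "q \<in> Q" for q
  proof (cases "q \<in> B")
    case True
    then show ?thesis using fspan_ext[OF is_subfield_Rats, of "complex_of_real ` B"] by auto
  next
    case False
    have "\<not> ?P (insert q B)"
    proof
      assume "?P (insert q B)"
      then have "card (insert q B) \<le> card B" using B(2) by simp
      then show False using False B(1) by simp
    qed
    then have "\<not> lin_indep \<int> (insert q B)" using B(1) q by simp
    then obtain S u b where S: "finite S" "S \<subseteq> insert q B" "\<forall>b\<in>S. u b \<in> \<int>" "(\<Sum>b\<in>S. u b * b) = 0" "b \<in> S" "u b \<noteq> 0"
      unfolding lin_indep_def by auto
    have qS: "q \<in> S \<and> u q \<noteq> 0"
    proof (rule ccontr)
      assume n: "\<not> (q \<in> S \<and> u q \<noteq> 0)"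
      have "(\<Sum>b\<in>S - {q}. u b * b) = 0"
      proof (cases "q \<in> S")
        case True
        then show ?thesis using n S(4) sum.remove[OF S(1) True, of "\<lambda>b. u b * b"] by simp
      qed (use S in simp)
      moreover have "finite (S - {q})" "S - {q} \<subseteq> B" "\<forall>b\<in>S - {q}. u b \<in> \<int>" using S by auto
      ultimately have H: "finite (S - {q}) \<and> S - {q} \<subseteq> B \<and> (\<forall>b\<in>S - {q}. u b \<in> \<int>) \<and> (\<Sum>b\<in>S - {q}. u b * b) = 0"
        by (intro conjI)
      have L: "lin_indep \<int> B" using B(1) by simp
      have "\<forall>b\<in>S - {q}. u b = 0"
        by (rule mp[OF L[unfolded lin_indep_def, THEN spec, of "S - {q}", THEN spec, of u] H])
      then show False using S(5,6) n by auto
    qed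
    have "u q * q + (\<Sum>b\<in>S - {q}. u b * b) = 0"
      using S(4) sum.remove[OF S(1) conjunct1[OF qS], of "\<lambda>b. u b * b"] by simp
    then have "q = (\<Sum>b\<in>S - {q}. u b * b) * (- inverse (u q))" using qS by (simp add: field_simps)
    then have "q = (\<Sum>b\<in>S - {q}. (- inverse (u q) * u b) * b)"
      by (simp add: sum_distrib_left mult.commute mult.left_commute)
    then have "complex_of_real q = of_real (\<Sum>b\<in>S - {q}. (- inverse (u q) * u b) * b)" by (rule arg_cong)
    then have e: "complex_of_real q = (\<Sum>b\<in>S - {q}. of_real (- inverse (u q) * u b) * of_real b)" by simp
    have S': "fsubspace \<rat> (fspan \<rat> (complex_of_real ` B))" by (rule fspan_fsubspace[OF is_subfield_Rats])
    have "(\<Sum>b\<in>S - {q}. complex_of_real (- inverse (u q) * u b) * of_real b) \<in> fspan \<rat> (complex_of_real ` B)"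
    proof (rule fsubspace_sum[OF S'])
      fix b assume b: "b \<in> S - {q}"
      have "u b \<in> \<int>" "u q \<in> \<int>" using b S(3) qS by auto
      then obtain i j where "u b = of_int i" "u q = of_int j" by (meson Ints_cases)
      then show "complex_of_real (- inverse (u q) * u b) \<in> \<rat>" by auto
      show "complex_of_real b \<in> fspan \<rat> (complex_of_real ` B)"
        using b S(2) fspan_ext[OF is_subfield_Rats, of "complex_of_real ` B"] by auto
    qed
    then show ?thesis unfolding e .
  qed
  then show ?thesis using that[of B] B(1) by blast
qed

lemma exp_of_int_sum: "finite A \<Longrightarrow> exp (\<Sum>x\<in>A. of_int (e x) * z x) = (\<Prod>x\<in>A. exp (z x :: complex) powi e x)"
  by (induction A rule: finite_induct) (simp_all add: exp_add exp_power_int[symmetric])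

lemma trdeg_conjugate_le:
  assumes "finite g" "J \<subseteq> g"
  shows "trdeg (J \<union> cnj ` J) \<le> 2 * drk {} g"
proof -
  have "g \<subseteq> dcl ({} \<union> g)" using dcl_ext[of g] by simp
  then obtain B where B: "B \<subseteq> g" "finite B" "dindep {} B" "g \<subseteq> dcl ({} \<union> B)" "card B = drk {} g"
    by (rule dcl.rk_basis[OF assms(1)])
  let ?S = "B \<union> cnj ` B"
  have "cnj a \<in> dcl ({} \<union> cnj ` B)" if "a \<in> g" for a by (rule cnj_dcl) (use B(4) that in auto)
  then have "J \<union> cnj ` J \<subseteq> dcl ({} \<union> B) \<union> dcl ({} \<union> cnj ` B)" using B(4) assms(2) by blast
  also have "\<dots> \<subseteq> dcl ({} \<union> ?S)" using dcl_mono[of "{} \<union> B" "{} \<union> ?S"] dcl_mono[of "{} \<union> cnj ` B" "{} \<union> ?S"] by blast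
  finally have sp: "J \<union> cnj ` J \<subseteq> dcl ({} \<union> ?S)" .
  have fS: "finite ?S" using B(2) by simp
  have "trdeg (J \<union> cnj ` J) = drk {} (J \<union> cnj ` J)" by (rule trdeg_over_eq_drk[OF fS sp])
  also have "\<dots> \<le> card ?S" by (rule dcl.rk_le_card[OF fS sp])
  also have "\<dots> \<le> 2 * card B" using card_Un_le[of B "cnj ` B"] card_image_le[OF B(2), of cnj] by linarith
  finally show ?thesis using B(5) by simp
qed

lemma fspan_times:
  assumes "is_subfield F" "x \<in> fspan F S"
  shows "a * x \<in> fspan F ((*) a ` S)"
proof -
  have "fsubspace F {y. a * y \<in> fspan F ((*) a ` S)}"
    using fspan_fsubspace[OF assms(1), of "(*) a ` S"] unfolding fsubspace_def
    by (auto simp: distrib_left mult.left_commute)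
  moreover have "S \<subseteq> {y. a * y \<in> fspan F ((*) a ` S)}" using fspan_ext[OF assms(1), of "(*) a ` S"] by auto
  ultimately have "fspan F S \<subseteq> {y. a * y \<in> fspan F ((*) a ` S)}" by (rule fspan_least)
  then show ?thesis using assms(2) by blast
qed

text \<open>Only indices whose real parameters are independent modulo the span of \<open>Q\<close>
  are used, so that logarithms and their conjugates are jointly independent over the rationals.
  Together with conjugates they number \<open>2 * card J\<close>, while over \<open>K\<close> they
  lie in a space of dimension at most \<open>card J + r\<close>.\<close>

lemma green_bound:
  fixes \<beta> :: real and Q :: "real set"
  assumes \<beta>: "\<beta> \<noteq> 0" and \<epsilon>: "\<epsilon> = 1 + complex_of_real \<beta> * \<i>" and Q: "finite_rank Q"
    and G: "G = exp ` {\<epsilon> * complex_of_real t + complex_of_real q | t q. q \<in> Q}"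
    and SC: "SC (gen_field {complex_of_real \<beta> * \<i>})"
  shows "\<exists>C. \<forall>g. finite g \<and> g \<subseteq> G \<and> (\<forall>e :: complex \<Rightarrow> int. (\<Prod>x\<in>g. x powi e x) = 1 \<longrightarrow> (\<forall>x\<in>g. e x = 0))
    \<longrightarrow> card g \<le> 2 * drk {} g + C"
proof -
  obtain Bq where Bq: "finite Bq" "Bq \<subseteq> Q" "\<forall>q\<in>Q. complex_of_real q \<in> fspan \<rat> (complex_of_real ` Bq)"
    using finite_rank_basis[OF Q] .
  note FQ = is_subfield_Rats and RQ = is_subfield_subring[OF is_subfield_Rats]
  interpret P: pregeometry "fspan (\<rat> :: complex set)" by (rule fspan_pregeometry[OF FQ])
  let ?K = "gen_field {complex_of_real \<beta> * \<i>}"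
  have FK: "is_subfield ?K" by (rule is_subfield_gen)
  note RK = is_subfield_subring[OF FK]
  interpret PK: pregeometry "fspan ?K" by (rule fspan_pregeometry[OF FK])
  let ?b = "complex_of_real ` Bq"
  define r where "r = card ?b"
  have fb: "finite ?b" using Bq(1) by simp
  have bb: "?b \<subseteq> fspan \<rat> ?b" by (rule fspan_ext[OF FQ])
  obtain b0 where b0: "b0 \<subseteq> ?b" "finite b0" "P.indep b0" "?b \<subseteq> fspan \<rat> b0" "card b0 = P.rk ?b"
    using P.rk_basis[OF fb bb] .
  have r0: "card b0 \<le> r" unfolding r_def by (rule card_mono[OF fb b0(1)])
  have qb: "complex_of_real q \<in> fspan \<rat> b0" if "q \<in> Q" for q
    using Bq(3) that P.cl_leI[OF b0(4)] by blast
  \<comment> \<open>The constant: \<open>r\<close> for the part of \<open>Q\<close> in the span over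
    \<open>K\<close>, 1 for the transcendence degree of \<open>K\<close>, and \<open>2 * r\<close>
    for passing from \<open>g\<close> to the subset \<open>J\<close>.\<close>
  have "card g \<le> 2 * drk {} g + (3 * r + 1)"
    if g: "finite g" "g \<subseteq> G" "\<forall>e :: complex \<Rightarrow> int. (\<Prod>x\<in>g. x powi e x) = 1 \<longrightarrow> (\<forall>x\<in>g. e x = 0)" for g
  proof -
    have "\<forall>x\<in>g. \<exists>t q. q \<in> Q \<and> x = exp (\<epsilon> * complex_of_real t + complex_of_real q)" using g(2) unfolding G by blast
    then obtain t q where tq: "\<And>x. x \<in> g \<Longrightarrow> q x \<in> Q \<and> x = exp (\<epsilon> * complex_of_real (t x) + complex_of_real (q x))" by metis
    define \<tau> where "\<tau> x = complex_of_real (t x)" for x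
    define \<kappa> where "\<kappa> x = complex_of_real (q x)" for x
    define z where "z x = \<epsilon> * \<tau> x + \<kappa> x" for x
    have ez: "exp (z x) = x" if "x \<in> g" for x using tq[OF that] by (simp add: z_def \<tau>_def \<kappa>_def)
    have \<kappa>b: "\<kappa> x \<in> fspan \<rat> b0" if "x \<in> g" for x using qb tq[OF that] by (simp add: \<kappa>_def)
    have zind: "inj_on z g" "lin_indep \<rat> (z ` g)"
    proof -
      have "\<forall>x\<in>g. u x = 0" if u: "\<And>x. x \<in> g \<Longrightarrow> u x \<in> \<rat>" "(\<Sum>x\<in>g. u x * z x) = 0" for u
      proof -
        obtain D e where D: "D \<noteq> 0" "\<forall>x\<in>g. of_int D * u x = of_int (e x)" using common_denominator[OF g(1), of u] u(1) by blast
        have "(\<Sum>x\<in>g. of_int (e x) * z x) = of_int D * (\<Sum>x\<in>g. u x * z x)"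
          unfolding sum_distrib_left
        proof (rule sum.cong[OF refl])
          fix x assume "x \<in> g"
          then have "of_int D * u x = of_int (e x)" using D(2) by blast
          then show "of_int (e x) * z x = of_int D * (u x * z x)" by (simp only: mult.assoc[symmetric])
        qed
        then have "exp (\<Sum>x\<in>g. of_int (e x) * z x) = 1" using u(2) by simp
        moreover have "exp (\<Sum>x\<in>g. of_int (e x) * z x) = (\<Prod>x\<in>g. x powi e x)"
          unfolding exp_of_int_sum[OF g(1)] by (rule prod.cong) (simp_all add: ez)
        ultimately have e0: "\<forall>x\<in>g. e x = 0" using g(3) by simp
        show ?thesis
        proof
          fix x assume x: "x \<in> g"
          then have "of_int D * u x = of_int (e x)" using D(2) by blast
          then show "u x = 0" using e0 x D(1) by simp
        qed
      qed
      from rat_indep_family[OF g(1) FQ this] show "inj_on z g" "lin_indep \<rat> (z ` g)" by blast+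
    qed
    have fX: "finite (b0 \<union> \<tau> ` g)" using b0(2) g(1) by simp
    \<comment> \<open>A rational basis of all real parameters that begins with the basis
      \<open>b0\<close> for \<open>Q\<close>; \<open>J\<close> indexes the part that is
      added.\<close>
    obtain B where B: "b0 \<subseteq> B" "B \<subseteq> b0 \<union> \<tau> ` g" "finite B" "P.indep B" "b0 \<union> \<tau> ` g \<subseteq> fspan \<rat> B"
      using P.extend_to_basis[OF fX fspan_ext[OF FQ] Un_upper1 b0(3)] .
    have "B - b0 \<subseteq> \<tau> ` g" using B(2) by blast
    then obtain J where J: "J \<subseteq> g" "inj_on \<tau> J" "\<tau> ` J = B - b0" unfolding subset_image_inj by blast
    have fJ: "finite J" using J(1) g(1) finite_subset by blast
    have Beq: "B = b0 \<union> \<tau> ` J" using J(3) B(1) by blast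
    have key: "\<forall>x\<in>J. a x = 0" if a: "\<And>x. x \<in> J \<Longrightarrow> a x \<in> \<rat>" "(\<Sum>x\<in>J. a x * \<tau> x) \<in> fspan \<rat> b0" for a
    proof (rule ccontr)
      assume "\<not> (\<forall>x\<in>J. a x = 0)"
      then obtain x0 where x0: "x0 \<in> J" "a x0 \<noteq> 0" by blast
      let ?S = "fspan \<rat> (B - {\<tau> x0})"
      have S: "fsubspace \<rat> ?S" by (rule fspan_fsubspace[OF FQ])
      have nb: "\<tau> x0 \<notin> b0" using J(3) x0(1) by blast
      have "b0 \<subseteq> B - {\<tau> x0}" using B(1) nb by blast
      then have s1: "(\<Sum>x\<in>J. a x * \<tau> x) \<in> ?S" using a(2) fspan_mono[of b0 "B - {\<tau> x0}" \<rat>] by blast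
      have s2: "(\<Sum>x\<in>J - {x0}. a x * \<tau> x) \<in> ?S"
      proof (rule fsubspace_sum[OF S])
        fix x assume x: "x \<in> J - {x0}"
        then show "a x \<in> \<rat>" using a(1) by simp
        have "\<tau> x \<noteq> \<tau> x0" using J(2) x x0(1) by (auto simp: inj_on_def)
        then have "\<tau> x \<in> B - {\<tau> x0}" using x J(3) by blast
        then show "\<tau> x \<in> ?S" using fspan_ext[OF FQ, of "B - {\<tau> x0}"] by blast
      qed
      have "\<tau> x0 = inverse (a x0) * ((\<Sum>x\<in>J. a x * \<tau> x) + (- 1) * (\<Sum>x\<in>J - {x0}. a x * \<tau> x))"
        using x0 sum.remove[OF fJ x0(1), of "\<lambda>x. a x * \<tau> x"] by simp
      moreover have "(\<Sum>x\<in>J. a x * \<tau> x) + (- 1) * (\<Sum>x\<in>J - {x0}. a x * \<tau> x) \<in> ?S"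
        using S s1 s2 is_subringD(2,4)[OF RQ] unfolding fsubspace_def by blast
      moreover have "inverse (a x0) \<in> \<rat>" using a(1)[OF x0(1)] by simp
      ultimately have "\<tau> x0 \<in> ?S" using S unfolding fsubspace_def by metis
      moreover have "\<tau> x0 \<in> B" using J(3) x0(1) by blast
      ultimately show False using B(4) unfolding P.indep_def by blast
    qed
    \<comment> \<open>The logarithms lie in the rational span of \<open>\<epsilon>\<close> times
      \<open>B\<close> together with \<open>b0\<close>, and \<open>b0\<close> is counted in
      both.\<close>
    have mJ: "card g \<le> card J + 2 * r"
    proof -
      let ?T = "(*) \<epsilon> ` B \<union> b0"
      have S: "fsubspace \<rat> (fspan \<rat> ?T)" by (rule fspan_fsubspace[OF FQ])
      have "z ` g \<subseteq> fspan \<rat> ?T"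
      proof
        fix y assume "y \<in> z ` g"
        then obtain x where x: "x \<in> g" "y = z x" by blast
        have "\<tau> x \<in> fspan \<rat> B" using B(5) x(1) by blast
        then have "\<epsilon> * \<tau> x \<in> fspan \<rat> ((*) \<epsilon> ` B)" by (rule fspan_times[OF FQ])
        then have "\<epsilon> * \<tau> x \<in> fspan \<rat> ?T" using fspan_mono[of "(*) \<epsilon> ` B" ?T \<rat>] by blast
        moreover have "\<kappa> x \<in> fspan \<rat> ?T" using \<kappa>b[OF x(1)] fspan_mono[of b0 ?T \<rat>] by blast
        ultimately show "y \<in> fspan \<rat> ?T" unfolding x(2) z_def using S unfolding fsubspace_def by blast
      qed
      moreover have "P.indep (z ` g)" using zind(2) lin_indep_iff[OF FQ] by blast
      moreover have fT: "finite ?T" using B(3) b0(2) by simp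
      ultimately have "card (z ` g) \<le> card ?T" using P.steinitz by blast
      also have "\<dots> \<le> card B + card b0"
        using card_Un_le[of "(*) \<epsilon> ` B" b0] card_image_le[OF B(3), of "(*) \<epsilon>"] by linarith
      also have "card B \<le> card b0 + card J"
        unfolding Beq using card_Un_le[of b0 "\<tau> ` J"] card_image_le[OF fJ, of \<tau>] by linarith
      finally show ?thesis using card_image[OF zind(1)] r0 by linarith
    qed
    define f where "f = (\<lambda>(x, s). if s then z x else cnj (z x))"
    let ?I = "J \<times> (UNIV :: bool set)"
    have fI: "finite ?I" using fJ by simp
    have cz: "cnj (z x) = cnj \<epsilon> * \<tau> x + \<kappa> x" for x by (simp add: z_def \<tau>_def \<kappa>_def)
    have f_ind: "inj_on f ?I" "lin_indep \<rat> (f ` ?I)"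
    proof -
      have "\<forall>i\<in>?I. u i = 0" if u: "\<And>i. i \<in> ?I \<Longrightarrow> u i \<in> \<rat>" "(\<Sum>i\<in>?I. u i * f i) = 0" for u
      proof -
        let ?p = "\<lambda>x. u (x, True)" and ?m = "\<lambda>x. u (x, False)"
        have S0: "(\<Sum>x\<in>J. ?p x * z x + ?m x * cnj (z x)) = 0"
        proof -
          have "(\<Sum>i\<in>?I. u i * f i) = (\<Sum>x\<in>J. \<Sum>s\<in>UNIV. u (x, s) * f (x, s))"
            by (simp add: sum.cartesian_product)
          also have "\<dots> = (\<Sum>x\<in>J. ?p x * z x + ?m x * cnj (z x))" by (simp add: UNIV_bool f_def add.commute)
          finally show ?thesis using u(2) by simp
        qed
        have cu: "cnj (u (x, s)) = u (x, s)" if "x \<in> J" for x s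
        proof -
          have "u (x, s) \<in> \<rat>" using u(1) that by simp
          then obtain a b where "u (x, s) = of_int a / of_int b" by (auto elim: Rats_cases')
          then show ?thesis by simp
        qed
        have "cnj (\<Sum>x\<in>J. ?p x * z x + ?m x * cnj (z x)) = (\<Sum>x\<in>J. ?p x * cnj (z x) + ?m x * z x)"
          unfolding cnj_sum by (rule sum.cong[OF refl]) (simp add: cu)
        then have S1: "(\<Sum>x\<in>J. ?p x * cnj (z x) + ?m x * z x) = 0" using S0 by simp
        \<comment> \<open>Subtracting the conjugate relation isolates the imaginary parts, where
          \<open>Q\<close> does not contribute; this forces equal coefficients at \<open>z x\<close>
          and its conjugate, after which only real parts are left.\<close>
        have e1: "(?p x * z x + ?m x * cnj (z x)) - (?p x * cnj (z x) + ?m x * z x) = (2 * complex_of_real \<beta> * \<i>) * ((?p x - ?m x) * \<tau> x)" for x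
          unfolding cz unfolding z_def \<epsilon> by (simp add: algebra_simps)
        have "(\<Sum>x\<in>J. (2 * complex_of_real \<beta> * \<i>) * ((?p x - ?m x) * \<tau> x)) = 0 - 0"
          unfolding e1[symmetric] sum_subtractf S0 S1 ..
        then have "(2 * complex_of_real \<beta> * \<i>) * (\<Sum>x\<in>J. (?p x - ?m x) * \<tau> x) = 0" unfolding sum_distrib_left by simp
        then have "(\<Sum>x\<in>J. (?p x - ?m x) * \<tau> x) = 0" using \<beta> by simp
        moreover have "0 \<in> fspan \<rat> b0" using fspan_fsubspace[OF FQ, of b0] unfolding fsubspace_def by blast
        ultimately have "\<forall>x\<in>J. ?p x - ?m x = 0" using u(1) by (intro key) auto
        then have pm: "?m x = ?p x" if "x \<in> J" for x using that by simp
        have e2: "?p x * z x + ?m x * cnj (z x) = 2 * (?p x * \<tau> x + ?p x * \<kappa> x)" if "x \<in> J" for x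
          unfolding pm[OF that] cz unfolding z_def \<epsilon> by (simp add: algebra_simps)
        have "(\<Sum>x\<in>J. 2 * (?p x * \<tau> x + ?p x * \<kappa> x)) = 0" using S0 e2 by simp
        then have "2 * ((\<Sum>x\<in>J. ?p x * \<tau> x) + (\<Sum>x\<in>J. ?p x * \<kappa> x)) = 0"
          unfolding sum_distrib_left[symmetric] sum.distrib .
        then have "(\<Sum>x\<in>J. ?p x * \<tau> x) + (\<Sum>x\<in>J. ?p x * \<kappa> x) = 0"
          by (metis mult_eq_0_iff zero_neq_numeral)
        then have "(\<Sum>x\<in>J. ?p x * \<tau> x) = (\<Sum>x\<in>J. (- ?p x) * \<kappa> x)" by (simp add: sum_negf eq_neg_iff_add_eq_0)
        moreover have "(\<Sum>x\<in>J. (- ?p x) * \<kappa> x) \<in> fspan \<rat> b0"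
          by (rule fsubspace_sum[OF fspan_fsubspace[OF FQ]]) (use u(1) \<kappa>b J(1) in auto)
        ultimately have "\<forall>x\<in>J. ?p x = 0" using u(1) by (intro key) auto
        then have "u (x, s) = 0" if "x \<in> J" for x s using pm[OF that] that by (cases s) auto
        then show ?thesis by auto
      qed
      from rat_indep_family[OF fI FQ this] show "inj_on f ?I" "lin_indep \<rat> (f ` ?I)" by blast+
    qed
    let ?X = "f ` ?I"
    have finX: "finite ?X" using fI by simp
    have cX: "card ?X = 2 * card J" using card_image[OF f_ind(1)] by (simp add: card_cartesian_product)
    have lQ: "lin_dim \<rat> ?X = 2 * card J"
    proof -
      have "P.indep ?X" using f_ind(2) lin_indep_iff[OF FQ] by blast
      then have "P.rk ?X = card ?X" by (intro P.rk_eq order_refl finX fspan_ext[OF FQ])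
      then show ?thesis unfolding lin_dim_eq_rk[OF FQ] cX .
    qed
    have lK: "lin_dim ?K ?X \<le> card J + r"
    proof -
      let ?T = "\<tau> ` J \<union> b0"
      have S: "fsubspace ?K (fspan ?K ?T)" by (rule fspan_fsubspace[OF FK])
      have iK: "complex_of_real \<beta> * \<i> \<in> ?K" using gen_field_ext[of "{complex_of_real \<beta> * \<i>}"] by blast
      have eK: "\<epsilon> \<in> ?K" "cnj \<epsilon> \<in> ?K"
        using is_subringD(5)[OF RK is_subringD(2)[OF RK] iK] is_subringD(3)[OF RK is_subringD(2)[OF RK] iK]
        unfolding \<epsilon> by simp_all
      have QK: "\<rat> \<subseteq> ?K"
      proof
        fix x :: complex assume "x \<in> \<rat>"
        then obtain a b :: int where "x = of_int a / of_int b" by (auto elim!: Rats_cases' )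
        then show "x \<in> ?K" using is_subfield_divide[OF FK is_subring_of_int[OF RK] is_subring_of_int[OF RK]] by simp
      qed
      have "fspan \<rat> b0 \<subseteq> fspan ?K b0" unfolding fspan_def using QK by blast
      also have "\<dots> \<subseteq> fspan ?K ?T" by (rule fspan_mono) blast
      finally have bT: "fspan \<rat> b0 \<subseteq> fspan ?K ?T" .
      have "?X \<subseteq> fspan ?K ?T"
      proof
        fix y assume "y \<in> ?X"
        then obtain x s where x: "x \<in> J" "y = f (x, s)" by auto
        have k: "\<kappa> x \<in> fspan ?K ?T" using bT \<kappa>b x(1) J(1) by blast
        have tt: "\<tau> x \<in> fspan ?K ?T" using fspan_ext[OF FK, of ?T] x(1) by blast
        have "z x \<in> fspan ?K ?T" "cnj (z x) \<in> fspan ?K ?T"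
          unfolding cz unfolding z_def using S k tt eK unfolding fsubspace_def by blast+
        then show "y \<in> fspan ?K ?T" unfolding x(2) f_def by simp
      qed
      then have "PK.rk ?X \<le> card ?T" using b0(2) fJ by (intro PK.rk_le_card) auto
      also have "\<dots> \<le> card J + r"
        using card_Un_le[of "\<tau> ` J" b0] card_image_le[OF fJ, of \<tau>] r0 by linarith
      finally show ?thesis unfolding lin_dim_eq_rk[OF FK] .
    qed
    have eX: "exp ` ?X = J \<union> cnj ` J"
    proof -
      have "exp ` ?X = (\<lambda>x. exp (z x)) ` J \<union> (\<lambda>x. exp (cnj (z x))) ` J"
        by (force simp: f_def image_iff Bex_def split: if_splits)
      also have "(\<lambda>x. exp (z x)) ` J = (\<lambda>x. x) ` J" using ez J(1) by (intro image_cong refl) (simp add: subset_eq)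
      also have "\<dots> = J" by simp
      also have "(\<lambda>x. exp (cnj (z x))) ` J = cnj ` J"
      proof (rule image_cong[OF refl])
        fix x assume "x \<in> J"
        then have "exp (z x) = x" using ez J(1) by blast
        moreover have "exp (cnj (z x)) = cnj (exp (z x))" by (simp add: complex_eq_iff Re_exp Im_exp)
        ultimately show "exp (cnj (z x)) = cnj x" by simp
      qed
      finally show ?thesis .
    qed
    have tK: "trdeg ?K \<le> 1"
    proof -
      let ?s = "{complex_of_real \<beta> * \<i>}"
      have sp: "?K \<subseteq> dcl ({} \<union> ?s)" using gen_field_subset_dcl[of ?s] by simp
      have "trdeg ?K = drk {} ?K" by (rule trdeg_over_eq_drk[OF _ sp]) simp
      also have "\<dots> \<le> card ?s" by (rule dcl.rk_le_card[OF _ sp]) simp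
      finally show ?thesis by simp
    qed
    obtain xs where xs: "set xs = ?X" using finite_list[OF finX] by blast
    have "int (lin_dim ?K ?X) + int (trdeg (exp ` ?X)) - int (lin_dim \<rat> ?X) \<ge> - int (trdeg ?K)"
      using SC unfolding SC_def xs[symmetric] by blast
    then have "2 * card J \<le> card J + r + 2 * drk {} g + 1"
      using lQ lK tK trdeg_conjugate_le[OF g(1) J(1)] unfolding eX by linarith
    then show ?thesis using mJ by linarith
  qed
  then show ?thesis by (intro exI[of _ "3 * r + 1"]) blast
qed

section \<open>Strong extensions\<close>

lemma mgen_mono: "A \<subseteq> B \<Longrightarrow> mgen A \<subseteq> mgen B"
  unfolding mgen_def by blast

lemma mspan_mono: "A \<subseteq> B \<Longrightarrow> mspan A \<subseteq> mspan B"
  unfolding mspan_def using mgen_mono[of A B] by blast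

lemma mgenI: "finite S \<Longrightarrow> S \<subseteq> Y \<Longrightarrow> (\<Prod>y\<in>S. y powi e y) \<in> mgen Y"
  unfolding mgen_def by blast

lemma mgen_base: "x \<in> Y \<Longrightarrow> x \<in> mgen Y"
  using mgenI[of "{x}" Y "\<lambda>_. 1"] by simp

lemma mgen_1: "1 \<in> mgen Y"
  using mgenI[of "{}" Y] by simp

lemma mgen_mult:
  assumes Y: "Y \<subseteq> mult_group" and ab: "a \<in> mgen Y" "b \<in> mgen Y"
  shows "a * b \<in> mgen Y"
proof -
  obtain S e where S: "finite S" "S \<subseteq> Y" "a = (\<Prod>y\<in>S. y powi e y)" using ab(1) unfolding mgen_def by blast
  obtain T f where T: "finite T" "T \<subseteq> Y" "b = (\<Prod>y\<in>T. y powi f y)" using ab(2) unfolding mgen_def by blast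
  let ?e = "\<lambda>y. if y \<in> S then e y else 0" and ?f = "\<lambda>y. if y \<in> T then f y else 0"
  have "a = (\<Prod>y\<in>S \<union> T. y powi ?e y)" unfolding S(3) using S(1) T(1) by (intro prod.mono_neutral_cong_left) auto
  moreover have "b = (\<Prod>y\<in>S \<union> T. y powi ?f y)" unfolding T(3) using S(1) T(1) by (intro prod.mono_neutral_cong_left) auto
  ultimately have "a * b = (\<Prod>y\<in>S \<union> T. y powi ?e y * y powi ?f y)" by (simp add: prod.distrib)
  also have "\<dots> = (\<Prod>y\<in>S \<union> T. y powi (?e y + ?f y))"
  proof (rule prod.cong[OF refl])
    fix y assume "y \<in> S \<union> T"
    then have "y \<noteq> 0" using S(2) T(2) Y unfolding mult_group_def by auto
    then show "y powi ?e y * y powi ?f y = y powi (?e y + ?f y)" by (simp add: power_int_add)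
  qed
  finally show ?thesis using mgenI[of "S \<union> T" Y "\<lambda>y. ?e y + ?f y"] S T by simp
qed

lemma mgen_powi:
  assumes "a \<in> mgen Y"
  shows "a powi k \<in> mgen Y"
proof -
  obtain S e where S: "finite S" "S \<subseteq> Y" "a = (\<Prod>y\<in>S. y powi e y)" using assms unfolding mgen_def by blast
  have "a powi k = (\<Prod>y\<in>S. y powi (e y * k))"
    unfolding S(3) using S(1) by (induction S rule: finite_induct) (simp_all add: power_int_mult_distrib power_int_mult)
  then show ?thesis using mgenI[OF S(1,2), of "\<lambda>y. e y * k"] by simp
qed

lemma mspan_base: "Y \<subseteq> mult_group \<Longrightarrow> Y \<subseteq> mspan Y"
proof
  fix x assume "Y \<subseteq> mult_group" "x \<in> Y"
  then show "x \<in> mspan Y" unfolding mspan_def using mgen_base[of x Y] by (auto intro!: exI[of _ "1::int"])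
qed

lemma mspan_1: "1 \<in> mspan Y"
  unfolding mspan_def mult_group_def using mgen_1[of Y] by (auto intro!: exI[of _ "1::int"])

lemma mspan_mult:
  assumes Y: "Y \<subseteq> mult_group" and ab: "a \<in> mspan Y" "b \<in> mspan Y"
  shows "a * b \<in> mspan Y"
proof -
  obtain m k where m: "a \<noteq> 0" "m \<noteq> 0" "a powi m \<in> mgen Y" and k: "b \<noteq> 0" "k \<noteq> 0" "b powi k \<in> mgen Y"
    using ab unfolding mspan_def mult_group_def by blast
  have "(a * b) powi (m * k) = (a powi m) powi k * (b powi k) powi m"
    by (simp add: power_int_mult_distrib power_int_mult[symmetric] mult.commute)
  then have "(a * b) powi (m * k) \<in> mgen Y" using mgen_mult[OF Y mgen_powi[OF m(3)] mgen_powi[OF k(3)]] by simp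
  moreover have "m * k \<noteq> 0" "a * b \<in> mult_group" using m k by (auto simp: mult_group_def)
  ultimately show ?thesis unfolding mspan_def by blast
qed

lemma mspan_powi:
  assumes "a \<in> mspan Y"
  shows "a powi j \<in> mspan Y"
proof -
  obtain m where m: "a \<noteq> 0" "m \<noteq> 0" "a powi m \<in> mgen Y" using assms unfolding mspan_def mult_group_def by blast
  have "(a powi j) powi m = (a powi m) powi j" by (simp add: power_int_mult[symmetric] mult.commute)
  then have "(a powi j) powi m \<in> mgen Y" using mgen_powi[OF m(3)] by simp
  moreover have "a powi j \<in> mult_group" using m(1) by (simp add: mult_group_def)
  ultimately show ?thesis unfolding mspan_def using m(2) by blast
qed

lemma mspan_prod:
  assumes "Y \<subseteq> mult_group" "\<And>i. i \<in> A \<Longrightarrow> f i \<in> mspan Y"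
  shows "prod f A \<in> mspan Y"
  using assms(2) by (induction A rule: infinite_finite_induct) (auto simp: mspan_1 mspan_mult[OF assms(1)])

text \<open>Logarithmic derivatives turn a multiplicative relation into a linear one, and
  \<open>x powi m\<close> with \<open>m\<close> nonzero has vanishing derivative only if
  \<open>x\<close> has.\<close>

lemma mspan_subset_dcl:
  fixes S :: "'k::field_char_0 set"
  assumes "S \<subseteq> mult_group"
  shows "mspan S \<subseteq> dcl S"
proof
  fix x assume "x \<in> mspan S"
  then obtain m where m: "x \<noteq> 0" "m \<noteq> 0" "x powi m \<in> mgen S" unfolding mspan_def mult_group_def by blast
  then obtain T e where T: "finite T" "T \<subseteq> S" "x powi m = (\<Prod>y\<in>T. y powi e y)" unfolding mgen_def by blast
  show "x \<in> dcl S" unfolding dcl_def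
  proof (intro CollectI ballI)
    fix d assume d: "d \<in> Der S"
    have "of_int m * (d x / x) = d (x powi m) / x powi m" by (rule Der_powi[OF d m(1), symmetric])
    also have "\<dots> = (\<Sum>y\<in>T. of_int (e y) * (d y / y))"
      unfolding T(3) by (rule Der_ln_prod_powi[OF d T(1)]) (use T(2) assms in \<open>auto simp: mult_group_def\<close>)
    also have "\<dots> = 0" using T(2) Der_zero[OF d] by (intro sum.neutral) auto
    finally show "d x = 0" using m by simp
  qed
qed

section \<open>Multiplicative independence and rank\<close>

lemma mult_indep_maximal:
  obtains B where "B \<subseteq> X" "mult_indep Y B" "\<forall>x\<in>X - B. \<not> mult_indep Y (insert x B)"
proof -
  let ?A = "{B. B \<subseteq> X \<and> mult_indep Y B}"
  have "\<exists>M\<in>?A. \<forall>B\<in>?A. M \<subseteq> B \<longrightarrow> B = M"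
  proof (rule subset_Zorn_nonempty)
    have "{} \<in> ?A" unfolding mult_indep_def by auto
    then show "?A \<noteq> {}" by (rule ex_in_conv[THEN iffD1, OF exI])
    fix C assume C: "C \<noteq> {}" "subset.chain ?A C"
    have "mult_indep Y (\<Union>C)" unfolding mult_indep_def
    proof (intro allI impI)
      fix S and e :: "'a \<Rightarrow> int"
      assume H: "finite S \<and> S \<subseteq> \<Union>C \<and> (\<Prod>b\<in>S. b powi e b) \<in> mspan Y"
      obtain B where B: "B \<in> C" "S \<subseteq> B"
        using finite_subset_Union_chain[OF conjunct1[OF H] _ C] H by blast
      then have "mult_indep Y B" using C(2) unfolding subset.chain_def by blast
      then show "\<forall>b\<in>S. e b = 0"
        using mp[OF spec[OF spec[OF \<open>mult_indep Y B\<close>[unfolded mult_indep_def], of S], of e]] H B(2) by simp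
    qed
    moreover have "\<Union>C \<subseteq> X" using C(2) unfolding subset.chain_def by blast
    ultimately show "\<Union>C \<in> ?A" by simp
  qed
  then obtain M where M: "M \<in> ?A" "\<forall>B\<in>?A. M \<subseteq> B \<longrightarrow> B = M" by (rule bexE)
  have "\<not> mult_indep Y (insert x M)" if x: "x \<in> X - M" for x
  proof
    assume "mult_indep Y (insert x M)"
    then have "insert x M \<in> ?A" using M(1) x by simp
    then have "insert x M = M" using M(2) by blast
    then show False using x by blast
  qed
  then show ?thesis using that[of M] M(1) by simp
qed

text \<open>Maximal independent sets exist by Zorn's lemma, so the choice in
  \<open>indep_rank\<close> does return an independent set, possibly an infinite one.\<close>

lemma mult_rank_over_indep:
  obtains B where "B \<subseteq> X" "mult_indep Y B" "mult_rank_over X Y = card B"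
proof -
  let ?P = "\<lambda>B. B \<subseteq> X \<and> mult_indep Y B \<and> (\<forall>x\<in>X - B. \<not> mult_indep Y (insert x B))"
  obtain B0 where "B0 \<subseteq> X" "mult_indep Y B0" "\<forall>x\<in>X - B0. \<not> mult_indep Y (insert x B0)"
    using mult_indep_maximal[of X Y] .
  then have "?P B0" by simp
  then have "?P (SOME B. ?P B)" by (rule someI)
  then show ?thesis using that[of "SOME B. ?P B"] unfolding mult_rank_over_def indep_rank_def by simp
qed

text \<open>In a relation over \<open>Y\<close>, the factors from \<open>A\<close> lie in the span
  of \<open>Y'\<close>, so the exponents on \<open>B\<close> vanish first and then those on
  \<open>A\<close>.\<close>

lemma mult_indep_Un:
  assumes Y: "Y \<subseteq> Y'" "Y' \<subseteq> mult_group" and A: "A \<subseteq> Y'" "mult_indep Y A" and B: "mult_indep Y' B"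
  shows "A \<inter> B = {}" "mult_indep Y (A \<union> B)"
proof -
  have bY: "Y' \<subseteq> mspan Y'" by (rule mspan_base[OF Y(2)])
  have MB: "\<forall>b\<in>S. e b = 0" if "finite S" "S \<subseteq> B" "(\<Prod>b\<in>S. b powi e b) \<in> mspan Y'" for S e
    using B that unfolding mult_indep_def by simp
  have MA: "\<forall>b\<in>S. e b = 0" if "finite S" "S \<subseteq> A" "(\<Prod>b\<in>S. b powi e b) \<in> mspan Y" for S e
    using A(2) that unfolding mult_indep_def by simp
  show dis: "A \<inter> B = {}"
  proof (rule ccontr)
    assume "A \<inter> B \<noteq> {}"
    then obtain x where x: "x \<in> A" "x \<in> B" by blast
    then have "x \<in> mspan Y'" using A(1) bY by blast
    then have "\<forall>b\<in>{x}. (1::int) = 0" using x(2) by (intro MB) auto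
    then show False by simp
  qed
  show "mult_indep Y (A \<union> B)" unfolding mult_indep_def
  proof (intro allI impI)
    fix S and e :: "'a \<Rightarrow> int"
    assume H: "finite S \<and> S \<subseteq> A \<union> B \<and> (\<Prod>b\<in>S. b powi e b) \<in> mspan Y"
    let ?p = "\<lambda>S. \<Prod>b\<in>S. b powi e b"
    have SU: "S = (S \<inter> A) \<union> (S \<inter> B)" "(S \<inter> A) \<inter> (S \<inter> B) = {}" using H dis by auto
    have "?p S = ?p (S \<inter> A) * ?p (S \<inter> B)"
      using SU H prod.union_disjoint[of "S \<inter> A" "S \<inter> B" "\<lambda>b. b powi e b"] by simp
    moreover have nz: "?p (S \<inter> A) \<noteq> 0" using A(1) Y(2) H by (auto simp: mult_group_def)
    ultimately have "?p (S \<inter> B) = ?p S * (?p (S \<inter> A)) powi (- 1)" by (simp add: power_int_minus field_simps)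
    moreover have "?p (S \<inter> A) \<in> mspan Y'" using A(1) bY by (intro mspan_prod[OF Y(2)] mspan_powi) auto
    moreover have "?p S \<in> mspan Y'" using H mspan_mono[OF Y(1)] by blast
    ultimately have "?p (S \<inter> B) \<in> mspan Y'" using mspan_mult[OF Y(2)] mspan_powi by metis
    then have eB: "\<forall>b\<in>S \<inter> B. e b = 0" using H by (intro MB) auto
    then have "?p (S \<inter> B) = 1" by (intro prod.neutral) simp
    then have "?p (S \<inter> A) \<in> mspan Y" using H \<open>?p S = ?p (S \<inter> A) * ?p (S \<inter> B)\<close> by simp
    then have "\<forall>b\<in>S \<inter> A. e b = 0" using H by (intro MA) auto
    then show "\<forall>b\<in>S. e b = 0" using eB SU(1) by blast
  qed
qed

lemma drk_Un_le:
  assumes "finite A" "finite B"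
  shows "drk Y (A \<union> B) \<le> drk Y A + drk (Y \<union> A) B"
proof -
  have "A \<subseteq> dcl (Y \<union> A)" using dcl_ext[of "Y \<union> A"] by blast
  then obtain A' where A': "A' \<subseteq> A" "finite A'" "dindep Y A'" "A \<subseteq> dcl (Y \<union> A')" "card A' = drk Y A"
    by (rule dcl.rk_basis[OF assms(1)])
  have "B \<subseteq> dcl ((Y \<union> A) \<union> B)" using dcl_ext[of "(Y \<union> A) \<union> B"] by blast
  then obtain B' where B': "B' \<subseteq> B" "finite B'" "dindep (Y \<union> A) B'" "B \<subseteq> dcl ((Y \<union> A) \<union> B')" "card B' = drk (Y \<union> A) B"
    by (rule dcl.rk_basis[OF assms(2)])
  let ?S = "A' \<union> B'"
  have AS: "A \<subseteq> dcl (Y \<union> ?S)" using A'(4) dcl_mono[of "Y \<union> A'" "Y \<union> ?S"] by blast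
  then have "(Y \<union> A) \<union> B' \<union> (Y \<union> ?S) \<subseteq> dcl (Y \<union> ?S)" using dcl_ext[of "Y \<union> ?S"] by blast
  then have "dcl ((Y \<union> A) \<union> B' \<union> (Y \<union> ?S)) = dcl (Y \<union> ?S)" by (intro dcl_between) blast+
  moreover have "dcl ((Y \<union> A) \<union> B') \<subseteq> dcl ((Y \<union> A) \<union> B' \<union> (Y \<union> ?S))" by (rule dcl_mono) blast
  ultimately have "A \<union> B \<subseteq> dcl (Y \<union> ?S)" using AS B'(4) by blast
  then have "drk Y (A \<union> B) \<le> card ?S" using A'(2) B'(2) by (intro dcl.rk_le_card) auto
  then show ?thesis using card_Un_le[of A' B'] A'(5) B'(5) by linarith
qed

text \<open>The defect is bounded below, so some independent green set \<open>g\<close> minimises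
  it. A finite-dimensional extension of negative predimension over \<open>c\<close> and
  \<open>g\<close> would contain green elements that lower the defect further.\<close>

lemma strong_extension:
  fixes G :: "complex set" and c :: "complex list"
  assumes G: "G \<subseteq> mult_group" and c: "set c \<subseteq> mult_group"
    and bound: "\<exists>C. \<forall>g. finite g \<and> g \<subseteq> G \<and> (\<forall>e :: complex \<Rightarrow> int. (\<Prod>x\<in>g. x powi e x) = 1 \<longrightarrow> (\<forall>x\<in>g. e x = 0))
      \<longrightarrow> card g \<le> 2 * drk {} g + C"
  shows "\<exists>g. set g \<subseteq> G \<and> strong (localise (delta G) (set (c @ g))) (set (c @ g))"
proof -
  define Y where "Y = mspan (set c)"
  obtain C where C0: "\<forall>g. finite g \<and> g \<subseteq> G \<and> (\<forall>e :: complex \<Rightarrow> int. (\<Prod>x\<in>g. x powi e x) = 1 \<longrightarrow> (\<forall>x\<in>g. e x = 0))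
      \<longrightarrow> card g \<le> 2 * drk {} g + C" using bound ..
  have C: "card g \<le> 2 * drk {} g + C" if "finite g" "g \<subseteq> G"
    "\<forall>e :: complex \<Rightarrow> int. (\<Prod>x\<in>g. x powi e x) = 1 \<longrightarrow> (\<forall>x\<in>g. e x = 0)" for g
    by (rule C0[THEN spec[of _ g], THEN mp]) (intro conjI that)
  let ?P = "\<lambda>g. finite g \<and> g \<subseteq> G \<and> mult_indep (Y \<inter> G) g"
  \<comment> \<open>Passing from rank over the prime field to rank over \<open>c\<close> costs at
    most the length of \<open>c\<close>, and the rank is counted twice.\<close>
  define C' where "C' = C + 2 * card (set c)"
  have bd: "card g \<le> 2 * drk (set c) g + C'" if g: "?P g" for g
  proof -
    have "\<forall>x\<in>g. e x = 0" if "(\<Prod>x\<in>g. x powi e x) = 1" for e :: "complex \<Rightarrow> int"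
    proof -
      have "finite g \<and> g \<subseteq> g \<and> (\<Prod>x\<in>g. x powi e x) \<in> mspan (Y \<inter> G)" using g that mspan_1[of "Y \<inter> G"] by simp
      then show ?thesis
        using mp[OF spec[OF spec[OF conjunct2[OF conjunct2[OF g], unfolded mult_indep_def], of g], of e]] by blast
    qed
    then have "card g \<le> 2 * drk {} g + C" using C g by simp
    moreover have "drk {} g \<le> drk (set c) g + card (set c)"
    proof -
      have fg: "finite g" using g by simp
      have "g \<subseteq> dcl (set c \<union> g)" using dcl_ext[of "set c \<union> g"] by blast
      then obtain B where B: "B \<subseteq> g" "finite B" "dindep (set c) B" "g \<subseteq> dcl (set c \<union> B)" "card B = drk (set c) g"
        by (rule dcl.rk_basis[OF fg])
      have "drk {} g \<le> card (set c \<union> B)" using B by (intro dcl.rk_le_card) auto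
      then show ?thesis using card_Un_le[of "set c" B] B(5) by linarith
    qed
    ultimately show ?thesis unfolding C'_def by linarith
  qed
  \<comment> \<open>The defect, shifted by \<open>C'\<close> so that the truncated subtraction of
    natural numbers is exact, by \<open>bd\<close>.\<close>
  let ?m = "\<lambda>g. 2 * drk (set c) g + C' - card g"
  have "?P {}" unfolding mult_indep_def by simp
  then have "\<exists>g. ?P g \<and> (\<forall>h. ?P h \<longrightarrow> ?m g \<le> ?m h)" by (rule ex_has_least_nat)
  then obtain g where g: "?P g" "\<forall>h. ?P h \<longrightarrow> ?m g \<le> ?m h" by (elim exE conjE) simp
  obtain gl where gl: "set gl = g" using finite_list g(1) by blast
  define c' where "c' = set c \<union> g"
  have c'm: "c' \<subseteq> mult_group" using c g(1) G unfolding c'_def by blast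
  have fc: "finite c'" unfolding c'_def using g(1) by simp
  have sc: "set (c @ gl) = c'" using gl unfolding c'_def by simp
  have "strong (localise (delta G) c') c'" unfolding strong_def localise_def
  proof (intro allI impI)
    fix X :: "complex set" assume X: "mspan_closed X \<and> mfinite_dim X"
    \<comment> \<open>Localising at \<open>c'\<close> and then testing over the span of
      \<open>c'\<close> adjoins \<open>c'\<close> twice; the closure \<open>Y'\<close> still adds
      nothing algebraically to \<open>c'\<close>.\<close>
    define T where "T = mspan c' \<union> c'"
    define Y' where "Y' = mspan T"
    have Tm: "T \<subseteq> mult_group" using c'm unfolding T_def mspan_def by blast
    have cT: "c' \<subseteq> T" unfolding T_def by blast
    have TY: "T \<subseteq> Y'" unfolding Y'_def by (rule mspan_base[OF Tm])
    have "T \<subseteq> dcl c'" unfolding T_def using mspan_subset_dcl[OF c'm] dcl_ext[of c'] by blast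
    then have "dcl T = dcl c'" by (rule dcl_between[OF cT])
    then have Yd: "Y' \<subseteq> dcl c'" unfolding Y'_def using mspan_subset_dcl[OF Tm] by blast
    have Ym: "Y' \<subseteq> mult_group" unfolding Y'_def mspan_def by blast
    have cY: "c' \<subseteq> Y'" using cT TY by blast
    have eqcl: "dcl (Y' \<union> A) = dcl (c' \<union> A)" for A
    proof (rule dcl_between)
      show "c' \<union> A \<subseteq> Y' \<union> A" using cY by blast
      show "Y' \<union> A \<subseteq> dcl (c' \<union> A)" using Yd dcl_mono[of c' "c' \<union> A"] dcl_ext[of "c' \<union> A"] by blast
    qed
    have eqrk: "drk Y' A = drk c' A" for A unfolding eqcl ..
    obtain S where S: "finite S" "S \<subseteq> X" "X \<subseteq> mspan S" using X unfolding mfinite_dim_def by blast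
    have Xm: "X \<subseteq> mult_group" using X unfolding mspan_closed_def by blast
    have "mspan S \<subseteq> dcl S" using S(2) Xm by (intro mspan_subset_dcl) blast
    also have "\<dots> \<subseteq> dcl (Y' \<union> S)" by (rule dcl_mono) blast
    finally have XS: "X \<subseteq> dcl (Y' \<union> S)" using S(3) by blast
    have tr: "trdeg_over X Y' = drk Y' X" by (rule trdeg_over_eq_drk[OF S(1) XS])
    let ?XY = "{x * y | x y. x \<in> X \<and> y \<in> Y'} \<inter> G"
    obtain B where B: "B \<subseteq> ?XY" "mult_indep (Y' \<inter> G) B" "mult_rank_over ?XY (Y' \<inter> G) = card B"
      using mult_rank_over_indep[of ?XY "Y' \<inter> G"] .
    have "card B \<le> 2 * drk Y' X"
    \<comment> \<open>For an infinite \<open>B\<close> the value \<open>card B\<close> is 0 and the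
      bound is trivial.\<close>
    proof (cases "finite B")
      case True
      have YY: "Y \<inter> G \<subseteq> Y' \<inter> G" unfolding Y_def Y'_def using mspan_mono[of "set c" T] cT unfolding c'_def by blast
      have Y'm: "Y' \<inter> G \<subseteq> mult_group" using Ym by blast
      have gY: "g \<subseteq> Y' \<inter> G" using g(1) cY unfolding c'_def by blast
      have "g \<inter> B = {}" "mult_indep (Y \<inter> G) (g \<union> B)"
        using mult_indep_Un[OF YY Y'm gY _ B(2)] g(1) by blast+
      then have P: "?P (g \<union> B)" using g(1) True B(1) by blast
      have "?m g \<le> ?m (g \<union> B)" using g(2) P by blast
      then have "card (g \<union> B) \<le> card g + 2 * (drk (set c) (g \<union> B) - drk (set c) g)"
        using bd[OF P] bd[OF g(1)] by linarith
      moreover have "card (g \<union> B) = card g + card B" using g(1) True \<open>g \<inter> B = {}\<close> by (simp add: card_Un_disjoint)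
      moreover have "drk (set c) (g \<union> B) \<le> drk (set c) g + drk c' B"
        unfolding c'_def using g(1) True by (intro drk_Un_le) auto
      ultimately have "card B \<le> 2 * drk c' B" by linarith
      moreover have "drk Y' B \<le> drk Y' X"
      proof (rule dcl.rk_mono[OF S(1) XS])
        show "B \<subseteq> dcl (Y' \<union> X)"
        proof
          fix b assume "b \<in> B"
          then obtain x y where xy: "b = x * y" "x \<in> X" "y \<in> Y'" using B(1) by blast
          then have "x \<in> dcl (Y' \<union> X)" "y \<in> dcl (Y' \<union> X)" using dcl_ext[of "Y' \<union> X"] by auto
          then show "b \<in> dcl (Y' \<union> X)"
            unfolding xy(1) by (rule is_subringD(6)[OF is_subfield_subring[OF is_subfield_dcl]])
        qed
      qed
      ultimately show ?thesis unfolding eqrk by linarith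
    qed simp
    then show "delta G X (mspan (mspan c' \<union> c')) \<ge> 0"
      unfolding delta_def T_def[symmetric] Y'_def[symmetric] tr B(3) by linarith
  qed
  then show ?thesis using gl g(1) sc by (intro exI[of _ gl]) simp
qed

section \<open>Density of green points\<close>

lemma add_subgroup_of_int_mult:
  assumes Q: "add_subgroup Q" and x: "x \<in> Q"
  shows "of_int k * x \<in> Q"
proof -
  have m: "- y \<in> Q" if "y \<in> Q" for y
    using Q that unfolding add_subgroup_def by (metis diff_0)
  have a: "y + z \<in> Q" if "y \<in> Q" "z \<in> Q" for y z
    using Q that m[of z] unfolding add_subgroup_def by (metis diff_minus_eq_add)
  have n: "of_nat j * x \<in> Q" for j
  proof (induction j)
    case 0
    show ?case using Q unfolding add_subgroup_def by simp
  next
    case (Suc j)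
    then show ?case using a[OF x Suc.IH] by (simp add: algebra_simps)
  qed
  show ?thesis
  proof (cases k rule: int_cases2)
    case (nonneg j)
    then show ?thesis using n[of j] by simp
  next
    case (nonpos j)
    then show ?thesis using m[OF n[of j]] by simp
  qed
qed

text \<open>Dividing one nonzero element produces arbitrarily small ones, whose integral multiples
  come close to every real number.\<close>

lemma add_divisible_dense:
  assumes Q: "add_subgroup Q" "add_divisible Q" "Q \<noteq> {0}" and e: "0 < e"
  shows "\<exists>q\<in>Q. \<bar>q - s\<bar> < e"
proof -
  have "0 \<in> Q" using Q(1) unfolding add_subgroup_def by blast
  then obtain x where x: "x \<in> Q" "x \<noteq> 0" using Q(3) by blast
  obtain m :: nat where m: "\<bar>x\<bar> / e < real m" using reals_Archimedean2 by blast
  have "0 \<le> \<bar>x\<bar> / e" using e by simp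
  then have m0: "m > 0" using m by (cases m) auto
  then obtain y where y: "y \<in> Q" "real m * y = x" using Q(2) x(1) unfolding add_divisible_def by blast
  have y0: "y \<noteq> 0" using y(2) x(2) by auto
  have "\<bar>x\<bar> = real m * \<bar>y\<bar>" using y(2) by (metis abs_mult abs_of_nat)
  then have "real m * \<bar>y\<bar> < real m * e" using m e by (simp add: field_simps)
  then have ye: "\<bar>y\<bar> < e" using m0 by simp
  let ?k = "\<lfloor>s / y\<rfloor>"
  have "of_int ?k * y - s = (of_int ?k - s / y) * y" using y0 by (simp add: field_simps)
  then have "\<bar>of_int ?k * y - s\<bar> = \<bar>of_int ?k - s / y\<bar> * \<bar>y\<bar>" by (simp add: abs_mult)
  also have "\<dots> \<le> 1 * \<bar>y\<bar>" by (rule mult_right_mono) (linarith, simp)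
  finally have "\<bar>of_int ?k * y - s\<bar> < e" using ye by simp
  then show ?thesis using add_subgroup_of_int_mult[OF Q(1) y(1)] by blast
qed

text \<open>A real relation between the real and imaginary parts makes a complex combination
  \<open>S\<close> of the gradients purely imaginary. Divided by \<i> it is a real linear relation
  between logarithmic derivatives of \<open>w\<close>, hence trivial; the triangular shape does the
  rest.\<close>

lemma gradient_independent:
  assumes W: "rotund n W" and K: "countable K" "cnj ` K \<subseteq> K" and w: "generic_point K n W w" "conj_free K n w"
    and wnz: "\<And>i. i < n \<Longrightarrow> w i \<noteq> 0" and \<epsilon>: "\<epsilon> \<noteq> 0" and A: "finite A" "A \<subseteq> {..<n}"
    and tri: "\<And>m i. m \<in> A \<Longrightarrow> m < i \<Longrightarrow> a m i = 0" "\<And>m. m \<in> A \<Longrightarrow> a m m \<noteq> 0"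
    and der: "\<And>m d. m \<in> A \<Longrightarrow> d \<in> Der K \<Longrightarrow> (\<Sum>i<n. a m i * d (w i)) = 0"
    and rs: "\<And>i. i < n \<Longrightarrow> (\<Sum>m\<in>A. r m * Re (a m i * w i * \<epsilon>) + s m * Im (a m i * w i * \<epsilon>)) = 0"
  shows "\<forall>m\<in>A. r m = 0 \<and> s m = 0"
proof -
  \<comment> \<open>Chosen so that Re (\<gamma> z) = r Re z + s Im z.\<close>
  define \<gamma> where "\<gamma> m = Complex (r m) (- s m)" for m
  define S where "S i = (\<Sum>m\<in>A. \<gamma> m * (a m i * w i * \<epsilon>))" for i
  have "Re (S i) = (\<Sum>m\<in>A. r m * Re (a m i * w i * \<epsilon>) + s m * Im (a m i * w i * \<epsilon>))" for i
    unfolding S_def Re_sum by (rule sum.cong) (simp_all add: \<gamma>_def)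
  then have S: "S i = \<i> * complex_of_real (Im (S i))" if "i < n" for i
    using rs[OF that] by (intro complex_eqI) simp_all
  have "(\<Sum>i<n. complex_of_real (Im (S i)) * (d (w i) / w i)) = 0" if d: "d \<in> Der K" for d
  proof -
    have "\<i> * (\<Sum>i<n. complex_of_real (Im (S i)) * (d (w i) / w i)) = (\<Sum>i<n. S i * (d (w i) / w i))"
      unfolding sum_distrib_left by (rule sum.cong) (simp_all add: S[symmetric] mult.assoc[symmetric])
    also have "\<dots> = (\<Sum>i<n. \<Sum>m\<in>A. \<gamma> m * \<epsilon> * (a m i * d (w i)))"
      unfolding S_def sum_distrib_right by (intro sum.cong) (simp_all add: wnz)
    also have "\<dots> = (\<Sum>m\<in>A. \<gamma> m * \<epsilon> * (\<Sum>i<n. a m i * d (w i)))"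
      unfolding sum_distrib_left by (rule sum.swap)
    also have "\<dots> = 0" using der d by simp
    finally show ?thesis by simp
  qed
  then have "Im (S i) = 0" if "i < n" for i by (rule no_real_log_relation[OF W K w _ that])
  then have S0: "S i = 0" if "i < n" for i using S[OF that] that by simp
  have lin: "(\<Sum>m\<in>A. \<gamma> m * a m i) = 0" if i: "i < n" for i
  proof -
    have "(\<Sum>m\<in>A. \<gamma> m * a m i) * (w i * \<epsilon>) = S i" unfolding S_def sum_distrib_right by (rule sum.cong) (simp_all add: mult_ac)
    then show ?thesis using S0[OF i] wnz[OF i] \<epsilon> by simp
  qed
  have "\<gamma> m = 0" if "m \<in> A" for m
  proof (rule ccontr)
    assume "\<gamma> m \<noteq> 0"
    let ?N = "{m \<in> A. \<gamma> m \<noteq> 0}"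
    have N: "finite ?N" "?N \<noteq> {}" using A(1) that \<open>\<gamma> m \<noteq> 0\<close> by auto
    define M where "M = Max ?N"
    have M: "M \<in> A" "\<gamma> M \<noteq> 0" using Max_in[OF N] unfolding M_def by auto
    have big: "\<gamma> m' = 0" if "m' \<in> A" "M < m'" for m' using Max_ge[OF N(1), of m'] that unfolding M_def by auto
    have "(\<Sum>m\<in>A. \<gamma> m * a m M) = (\<Sum>m\<in>A. if m = M then \<gamma> M * a M M else 0)"
    proof (rule sum.cong[OF refl])
      fix m' assume "m' \<in> A"
      then show "\<gamma> m' * a m' M = (if m' = M then \<gamma> M * a M M else 0)"
        using big[of m'] tri(1)[of m' M] by (cases m' M rule: linorder_cases) auto
    qed
    also have "\<dots> = \<gamma> M * a M M" using A(1) M(1) by simp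
    finally have "\<gamma> M * a M M = 0" using lin[of M] M(1) A(2) by auto
    then show False using M tri(2) by simp
  qed
  then show ?thesis unfolding \<gamma>_def by (auto simp: complex_eq_iff)
qed

text \<open>Were \<open>x\<close> outside a closed \<open>V\<close> containing the green points of
  \<open>W\<close>, some equation \<open>p0\<close> of \<open>V\<close> would fail at
  \<open>x\<close> and so at a point \<open>w\<close> generic over its coefficients. It still fails
  near \<open>w\<close>, but green points of \<open>W\<close> occur there.\<close>

theorem green_EC_property:
  assumes \<beta>: "\<beta> \<noteq> 0" and \<epsilon>: "\<epsilon> = 1 + complex_of_real \<beta> * \<i>"
    and Q: "add_subgroup Q" "add_divisible Q" "Q \<noteq> {0}"
    and G: "G = exp ` {\<epsilon> * complex_of_real t + complex_of_real q | t q. q \<in> Q}"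
  shows "EC_property G"
  unfolding EC_property_def
proof (intro allI impI subsetI)
  fix n and W :: "(nat \<Rightarrow> complex) set" and x
  assume "n \<ge> 1 \<and> even n \<and> rotund n W \<and> 2 * variety_dim n W = enat n" and x: "x \<in> W"
  then have W: "rotund n W" by blast
  have irr: "irreducible_subvariety n W" using W unfolding rotund_def by blast
  have closed: "zariski_closed n W" and ne: "W \<noteq> {}" using irr unfolding irreducible_subvariety_def by blast+
  have Wt: "W \<subseteq> torus n" using closed unfolding zariski_closed_def by auto
  have "x \<in> V" if V: "zariski_closed n V" and sub: "W \<inter> tuples n G \<subseteq> V" for V
  proof (rule ccontr)
    assume xV: "x \<notin> V"
    obtain P where P: "\<forall>p\<in>P. mpoly_vars p \<subseteq> {..<n}" "V = {x \<in> torus n. \<forall>p\<in>P. ev p x = 0}"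
      using zariski_closed_polyfun[OF V] .
    obtain p0 where p0: "p0 \<in> P" "ev p0 x \<noteq> 0" using xV x Wt unfolding P(2) by blast
    obtain K1 F where K1: "countable K1" and F: "F \<subseteq> polyfun K1 {..<n}" and WF: "W = {x \<in> torus n. \<forall>f\<in>F. f x = 0}"
      using zariski_closed_countable[OF closed] .
    define K0 where "K0 = K1 \<union> range (Poly_Mapping.lookup p0)"
    define K where "K = K0 \<union> cnj ` K0"
    have "range (Poly_Mapping.lookup p0) \<subseteq> insert 0 (Poly_Mapping.lookup p0 ` Poly_Mapping.keys p0)"
      by (auto simp: in_keys_iff)
    then have "finite (range (Poly_Mapping.lookup p0))" by (rule finite_subset) simp
    then have "countable K0" unfolding K0_def using K1 by (simp add: countable_finite)
    then have K: "countable K" "cnj ` K \<subseteq> K" unfolding K_def by (auto simp: image_Un image_image)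
    have FK: "f \<in> polyfun K {..<n}" if "f \<in> F" for f
      by (rule polyfun_mono[of f K1 "{..<n}"]) (use F that in \<open>auto simp: K_def K0_def\<close>)
    have f0: "ev p0 \<in> polyfun K {..<n}"
      by (rule ev_polyfun) (use P(1) p0(1) in \<open>auto simp: K_def K0_def\<close>)
    obtain w where w: "generic_point K n W w" "conj_free K n w" using generic_point_exists[OF irr K] .
    have wnz: "w i \<noteq> 0" if "i < n" for i by (rule generic_point_nonzero[OF w(1) ne Wt that])
    have f0w: "ev p0 w \<noteq> 0" using generic_pointD[OF w(1) f0] p0(2) x by blast
    \<comment> \<open>The coordinates algebraic over the preceding ones, each contributing one
      equation of the triangular system.\<close>
    define A where "A = {m. m < n \<and> w m \<in> dcl (K \<union> w ` {..<m})}"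
    have A: "finite A" "A \<subseteq> {..<n}" unfolding A_def by auto
    define Z where "Z = (\<lambda>f :: (nat \<Rightarrow> complex) \<Rightarrow> complex. f w = 0)"
    have "\<forall>m\<in>A. \<exists>ep. minimal_family K m Z (fst ep) (snd ep) \<and> poly (pderiv (snd ep w)) (w m) \<noteq> 0"
    proof
      fix m assume "m \<in> A"
      then have "w m \<in> dcl (K \<union> w ` {..<m})" unfolding A_def by blast
      then obtain e p where "minimal_family K m Z e p" "poly (pderiv (p w)) (w m) \<noteq> 0"
        unfolding Z_def by (rule leading_family)
      then show "\<exists>ep. minimal_family K m Z (fst ep) (snd ep) \<and> poly (pderiv (snd ep w)) (w m) \<noteq> 0"
        by (intro exI[of _ "(e, p)"]) simp
    qed
    then obtain ep where ep: "\<forall>m\<in>A. minimal_family K m Z (fst (ep m)) (snd (ep m)) \<and> poly (pderiv (snd (ep m) w)) (w m) \<noteq> 0"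
      by (rule bchoice[THEN exE])
    define e where "e m = fst (ep m)" for m
    define p where "p m = snd (ep m)" for m
    have p: "minimal_family K m Z (e m) (p m)" "poly (pderiv (p m w)) (w m) \<noteq> 0" if "m \<in> A" for m
      using ep that unfolding e_def p_def by auto
    have pf: "poly_family K {..<m} (e m) (p m)" and pz: "poly (p m w) (w m) = 0" and pc: "coeff (p m w) (e m) \<noteq> 0"
      if "m \<in> A" for m using p(1)[OF that] unfolding minimal_family_def Z_def by blast+
    define f where "f m y = poly (p m y) (y m)" for m and y :: "nat \<Rightarrow> complex"
    define good where "good m h \<longleftrightarrow> (\<forall>x y. f m x - f m y = (\<Sum>i<n. h i x y * (x i - y i))) \<and>
        (\<forall>i<n. ((\<lambda>z. h i (fst z) (snd z)) \<longlongrightarrow> h i w w) (near n w \<times>\<^sub>F near n w)) \<and>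
        (\<forall>i. i > m \<longrightarrow> h i w w = 0) \<and> h m w w \<noteq> 0 \<and>
        (\<forall>d\<in>Der K. d (f m w) = (\<Sum>i<n. h i w w * d (w i)))"
      for m and h :: "nat \<Rightarrow> (nat \<Rightarrow> complex) \<Rightarrow> (nat \<Rightarrow> complex) \<Rightarrow> complex"
    have "\<forall>m\<in>A. Ex (good m)"
    proof
      fix m assume m: "m \<in> A"
      then have "m < n" using A(2) by auto
      obtain h where h: "\<forall>x y. poly (p m x) (x m) - poly (p m y) (y m) = (\<Sum>i<n. h i x y * (x i - y i))"
        "\<forall>i<n. ((\<lambda>z. h i (fst z) (snd z)) \<longlongrightarrow> h i w w) (near n w \<times>\<^sub>F near n w)"
        "\<forall>i. i > m \<longrightarrow> h i w w = 0" "h m w w \<noteq> 0"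
        "\<forall>d\<in>Der K. d (poly (p m w) (w m)) = (\<Sum>i<n. h i w w * d (w i))"
        using family_gradient[OF pf[OF m] \<open>m < n\<close> p(2)[OF m]] .
      have "good m h" unfolding good_def f_def by (intro conjI h)
      then show "Ex (good m)" by (rule exI[of "good m" h])
    qed
    from bchoice[OF this] obtain h where h: "\<forall>m\<in>A. good m (h m)" by (rule exE)
    have h1: "f m x - f m y = (\<Sum>i<n. h m i x y * (x i - y i))" if "m \<in> A" for m x y
      using bspec[OF h that] unfolding good_def by (elim conjE) (drule spec[of _ x], erule spec[of _ y])
    have h2: "((\<lambda>z. h m i (fst z) (snd z)) \<longlongrightarrow> h m i w w) (near n w \<times>\<^sub>F near n w)" if "m \<in> A" "i < n" for m i
      using bspec[OF h that(1)] that(2) unfolding good_def by (elim conjE) blast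
    have h3: "h m i w w = 0" if "m \<in> A" "m < i" for m i
      using bspec[OF h that(1)] that(2) unfolding good_def by (elim conjE) blast
    have h4: "h m m w w \<noteq> 0" if "m \<in> A" for m using bspec[OF h that] unfolding good_def by (elim conjE)
    have fw: "f m w = 0" if "m \<in> A" for m using pz[OF that] unfolding f_def .
    have h5: "(\<Sum>i<n. h m i w w * d (w i)) = 0" if "m \<in> A" "d \<in> Der K" for m d
    proof -
      have "\<forall>d\<in>Der K. d (f m w) = (\<Sum>i<n. h m i w w * d (w i))"
        using bspec[OF h that(1)] unfolding good_def by (elim conjE)
      then have "d (f m w) = (\<Sum>i<n. h m i w w * d (w i))" using that(2) by (rule bspec)
      then show ?thesis using fw[OF that(1)] Der_0[OF that(2)] by simp
    qed
    have fc: "(f m \<longlongrightarrow> f m w) (near n w)" if "m \<in> A" for m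
    proof (rule polyfun_tendsto)
      show "f m \<in> polyfun K {..<n}" unfolding f_def
        by (rule poly_family_eval[OF pf[OF that]]) (use that A(2) in auto)
    qed
    have e0: "\<epsilon> \<noteq> 0" unfolding \<epsilon> by (simp add: complex_eq_iff)
    \<comment> \<open>The open condition to preserve: \<open>p0\<close> excludes \<open>V\<close>,
      and the leading coefficients make zeros of the triangular system satisfy all equations of
      \<open>W\<close>.\<close>
    have nonvan: "\<forall>\<^sub>F y in near n w. ev p0 y \<noteq> 0 \<and> (\<forall>m\<in>A. coeff (p m y) (e m) \<noteq> 0)"
    proof (intro eventually_conj eventually_ball_finite ballI)
      show "\<forall>\<^sub>F y in near n w. ev p0 y \<noteq> 0"
        by (rule tendsto_imp_eventually_ne[OF polyfun_tendsto[OF f0] f0w])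
      show "finite A" by (rule A(1))
      fix m assume m: "m \<in> A"
      have "(\<lambda>y. coeff (p m y) (e m)) \<in> polyfun K {..<m}" using pf[OF m] unfolding poly_family_def by blast
      then have "(\<lambda>y. coeff (p m y) (e m)) \<in> polyfun K {..<n}" by (rule polyfun_mono) (use m A(2) in auto)
      from polyfun_tendsto[OF this] show "\<forall>\<^sub>F y in near n w. coeff (p m y) (e m) \<noteq> 0"
        by (rule tendsto_imp_eventually_ne) (rule pc[OF m])
    qed
    have "\<exists>(t :: nat \<Rightarrow> real) q. (\<forall>i. q i \<in> Q) \<and>
      (ev p0 (\<lambda>i. exp (\<epsilon> * of_real (t i) + of_real (q i))) \<noteq> 0 \<and>
       (\<forall>m\<in>A. coeff (p m (\<lambda>i. exp (\<epsilon> * of_real (t i) + of_real (q i)))) (e m) \<noteq> 0)) \<and>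
      (\<forall>m\<in>A. f m (\<lambda>i. exp (\<epsilon> * of_real (t i) + of_real (q i))) = 0)"
    proof (rule solve_near[OF A(1) wnz \<beta> \<epsilon> h1 h2 fw fc _ _ nonvan])
      fix r s :: "nat \<Rightarrow> real"
      assume rs: "\<And>i. i < n \<Longrightarrow> (\<Sum>m\<in>A. r m * Re (h m i w w * w i * \<epsilon>) + s m * Im (h m i w w * w i * \<epsilon>)) = 0"
      show "\<forall>m\<in>A. r m = 0 \<and> s m = 0"
        by (rule gradient_independent[of n W K w \<epsilon> A "\<lambda>m i. h m i w w" r s, OF W K w wnz e0 A h3 h4 h5 rs])
    next
      fix s d :: real assume "0 < d"
      then show "\<exists>q\<in>Q. \<bar>q - s\<bar> < d" by (rule add_divisible_dense[OF Q])
    qed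
    then obtain t q where q: "\<forall>i. q i \<in> Q" and tq:
      "ev p0 (\<lambda>i. exp (\<epsilon> * of_real (t i) + of_real (q i))) \<noteq> 0"
      "\<forall>m\<in>A. coeff (p m (\<lambda>i. exp (\<epsilon> * of_real (t i) + of_real (q i)))) (e m) \<noteq> 0"
      "\<forall>m\<in>A. f m (\<lambda>i. exp (\<epsilon> * of_real (t i) + of_real (q i))) = 0" by (elim exE conjE)
    define u where "u = (\<lambda>i. exp (\<epsilon> * complex_of_real (t i) + complex_of_real (q i)))"
    have van: "g u = 0" if g: "g \<in> polyfun K {..<n}" "g w = 0" for g
    proof (rule vanish_at_triangular_zero[of n w K u n g, OF _ order_refl g])
      fix m assume "m < n" "w m \<in> dcl (K \<union> w ` {..<m})"
      then have m: "m \<in> A" unfolding A_def by blast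
      have "minimal_family K m (\<lambda>f. f w = 0) (e m) (p m)" using p(1)[OF m] unfolding Z_def .
      moreover have "coeff (p m u) (e m) \<noteq> 0" "poly (p m u) (u m) = 0" using tq(2,3) m unfolding u_def f_def by blast+
      ultimately show "\<exists>e p. minimal_family K m (\<lambda>f. f w = 0) e p \<and> coeff (p u) e \<noteq> 0 \<and> poly (p u) (u m) = 0"
        by (intro exI[of _ "e m"] exI[of _ "p m"] conjI)
    qed
    \<comment> \<open>Points of the torus are extensional, whereas the solution has a value at every
      index.\<close>
    define u' where "u' = restrict u {..<n}"
    have cong: "g u' = g u" if "g \<in> polyfun K {..<n}" for g
      by (rule polyfun_cong[OF that]) (simp add: u'_def)
    have uG: "u' \<in> tuples n G" unfolding tuples_def u'_def u_def G using q by auto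
    have ut: "u' \<in> torus n" unfolding tuples_def u'_def u_def mult_group_def by auto
    have "g u' = 0" if g: "g \<in> F" for g
    proof -
      have "g w = 0" using generic_pointD[OF w(1) FK[OF g]] g unfolding WF by blast
      then show ?thesis using van[OF FK[OF g]] cong[OF FK[OF g]] by simp
    qed
    then have "u' \<in> W" unfolding WF using ut by blast
    then have "u' \<in> V" using sub uG by blast
    then have "ev p0 u' = 0" using p0(1) unfolding P(2) by blast
    then show False using cong[OF f0] tq(1) unfolding u_def by simp
  qed
  then show "x \<in> zariski_closure n (W \<inter> tuples n G)" unfolding zariski_closure_def by blast
qed

lemma green_subgroup:
  assumes Q: "add_subgroup Q" "add_divisible Q"
    and G: "G = exp ` {\<epsilon> * complex_of_real t + complex_of_real q | t q. q \<in> Q}"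
  shows "mult_subgroup G" "mult_divisible G"
proof -
  have I: "exp (\<epsilon> * complex_of_real t + complex_of_real q) \<in> G" if "q \<in> Q" for t q
    unfolding G using that by blast
  have "x / y \<in> G" if "x \<in> G" "y \<in> G" for x y
  proof -
    from that obtain t q t' q' where x: "x = exp (\<epsilon> * complex_of_real t + complex_of_real q)" "q \<in> Q"
      and y: "y = exp (\<epsilon> * complex_of_real t' + complex_of_real q')" "q' \<in> Q" unfolding G by blast
    have "x / y = exp (\<epsilon> * complex_of_real (t - t') + complex_of_real (q - q'))"
      unfolding x(1) y(1) exp_diff[symmetric] by (simp add: algebra_simps)
    moreover have "q - q' \<in> Q" using Q(1) x(2) y(2) unfolding add_subgroup_def by blast
    ultimately show ?thesis using I[of "q - q'" "t - t'"] by simp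
  qed
  moreover have "1 \<in> G" using I[of 0 0] Q(1) unfolding add_subgroup_def by simp
  moreover have "G \<subseteq> mult_group" unfolding G mult_group_def by auto
  ultimately show "mult_subgroup G" unfolding mult_subgroup_def by blast
  show "mult_divisible G" unfolding mult_divisible_def
  proof (intro ballI allI impI)
    fix x and m :: nat assume "x \<in> G" and m: "m > 0"
    then obtain t q where x: "x = exp (\<epsilon> * complex_of_real t + complex_of_real q)" "q \<in> Q" unfolding G by blast
    obtain q' where q': "q' \<in> Q" "of_nat m * q' = q" using Q(2) x(2) m unfolding add_divisible_def by blast
    have "exp (\<epsilon> * complex_of_real (t / m) + complex_of_real q') ^ m
        = exp (of_nat m * (\<epsilon> * complex_of_real (t / m) + complex_of_real q'))" by (rule exp_of_nat_mult[symmetric])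
    also have "of_nat m * (\<epsilon> * complex_of_real (t / m) + complex_of_real q') = \<epsilon> * complex_of_real t + complex_of_real q"
      unfolding q'(2)[symmetric] using m by (simp add: field_simps)
    finally show "\<exists>y\<in>G. y ^ m = x" unfolding x(1) using I[OF q'(1)] by blast
  qed
qed

theorem theorem4p1:
  fixes \<beta> :: real and \<epsilon> :: complex and Q :: "real set" and G :: "complex set"
  assumes "\<beta> \<noteq> 0"
    and "\<epsilon> = 1 + complex_of_real \<beta> * \<i>"
    and "add_subgroup Q" and "add_divisible Q" and "finite_rank Q" and "Q \<noteq> {0}"
    and "G = exp ` {\<epsilon> * complex_of_real t + complex_of_real q | t q. q \<in> Q}"
    and "SC (gen_field {complex_of_real \<beta> * \<i>})"
  shows
    "(\<forall>c :: complex list. set c \<subseteq> mult_group \<longrightarrow>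
        (\<exists>c'. prefix c c' \<and> set c' \<subseteq> mult_group \<and>
           strong (localise (delta G) (set c')) (set c')) \<and>
        (set c \<subseteq> G \<longrightarrow>
           (\<exists>c'. prefix c c' \<and> set c' \<subseteq> G \<and>
              strong (localise (delta G) (set c')) (set c')))) \<and>
     EC_property G \<and>
     (\<forall>c :: complex list. set c \<subseteq> G \<and> strong (localise (delta G) (set c)) (set c) \<longrightarrow>
        (let X0 = mspan (set c) in
           green_model X0 (X0 \<inter> G) G id \<and>
           satisfies_theory G id (green_theory X0 (X0 \<inter> G))))"
proof (intro conjI allI impI)
  note bound = green_bound[OF assms(1,2,5,7,8)]
  have sg: "mult_subgroup G" and dv: "mult_divisible G" using green_subgroup[OF assms(3,4,7)] .
  have Gm: "G \<subseteq> mult_group" using sg unfolding mult_subgroup_def by blast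
  show EC: "EC_property G" by (rule green_EC_property[OF assms(1-4,6,7)])
  {
    fix c :: "complex list" assume "set c \<subseteq> mult_group"
    then obtain g where g: "set g \<subseteq> G" "strong (localise (delta G) (set (c @ g))) (set (c @ g))"
      using strong_extension[OF Gm _ bound] by blast
    have pre: "prefix c (c @ g)" by simp
    show "\<exists>c'. prefix c c' \<and> set c' \<subseteq> mult_group \<and> strong (localise (delta G) (set c')) (set c')"
      using pre g \<open>set c \<subseteq> mult_group\<close> Gm by (intro exI[of _ "c @ g"] conjI) auto
    assume "set c \<subseteq> G"
    then show "\<exists>c'. prefix c c' \<and> set c' \<subseteq> G \<and> strong (localise (delta G) (set c')) (set c')"
      using pre g by (intro exI[of _ "c @ g"] conjI) auto
  }
  fix c :: "complex list" assume c: "set c \<subseteq> G \<and> strong (localise (delta G) (set c)) (set c)"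
  define X0 where "X0 = mspan (set c)"
  have cm: "set c \<subseteq> mult_group" using c Gm by blast
  have "set c \<subseteq> X0" unfolding X0_def by (rule mspan_base[OF cm])
  \<comment> \<open>The localisation at \<open>c\<close>, tested over its span, is the plain
    predimension tested over the span of \<open>X0\<close>.\<close>
  then have "mspan X0 = mspan (mspan (set c) \<union> set c)" unfolding X0_def by (simp add: Un_absorb2)
  then have "strong (delta G) X0"
    using c unfolding strong_def localise_def by simp
  moreover have "L_embedding X0 (X0 \<inter> G) G id"
    unfolding L_embedding_def X0_def mspan_def by auto
  ultimately have model: "green_model X0 (X0 \<inter> G) G id"
    unfolding green_model_def using sg dv EC by simp
  then have "satisfies_theory G id (green_theory X0 (X0 \<inter> G))"
    unfolding satisfies_theory_def green_theory_def by simp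
  with model show "let X0 = mspan (set c) in green_model X0 (X0 \<inter> G) G id \<and>
      satisfies_theory G id (green_theory X0 (X0 \<inter> G))" unfolding X0_def by (simp add: Let_def)
qed

end
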